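(* Let $\beta\in(0,1/2)$, let $(L_t)_{t\in\mathbb{R}}$ be a two-sided Lévy process with $\mathbb{E}[L_1]=0$ and $\mathbb{E}[L_1^2]=1$, and let $\eta$ be a finite signed measure on $[0,\infty)$ with $\int_{[0,\infty)}u\,|\eta|(du)<\infty$. Set $h(z)=(-z)^{1-\beta}-\int_{[0,\infty)}e^{zu}\,\eta(du)$ for $z\in\mathbb{C}$ with $\mathrm{Re}(z)\le 0$, and suppose that $h(z)\neq 0$ for every $z\in\mathbb{C}$ with $\mathrm{Re}(z)\leq 0$. Let $g:\mathbb{R}\to\mathbb{R}$ be the function in $L^2$, vanishing on $(-\infty,0)$, with $\mathcal{F}[g](y)=(-iy)^{-\beta}/h(iy)$ for $y\in\mathbb{R}$. Then the process $$X_t=\int_{-\infty}^t g(t-u)\,dL_u,\quad t\in\mathbb{R},$$ is well-defined, centered and square integrable, and it is the unique purely non-deterministic solution to the stochastic fractional delay differential equation $$X_t-X_s=\int_{-\infty}^t\big(D^\beta_-\mathds{1}_{(s,t]}\big)(u)\int_{[0,\infty)}X_{u-v}\,\eta(dv)\,du+L_t-L_s\quad\text{almost surely, for each } s<t.$$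
   Context: Complex powers: $z^\gamma=r^\gamma e^{i\gamma\theta}$ for $z=re^{i\theta}$, $r>0$, $\theta\in(-\pi,\pi]$ (principal branch). Write $x_+=\max\{x,0\}$. The Fourier transform is $\mathcal{F}[f](y)=\int_{\mathbb{R}}e^{iyu}f(u)\,du$ for $f\in L^1$ and is extended to $L^2$ by Plancherel's theorem. Under the stated non-vanishing condition on $h$, a real-valued $g$ as described exists and is unique as an element of $L^2$. For $s<t$, $\big(D^\beta_-\mathds{1}_{(s,t]}\big)(u)=\frac{1}{\Gamma(1-\beta)}\big[(t-u)_+^{-\beta}-(s-u)_+^{-\beta}\big]$, $u\in\mathbb{R}$; this function belongs to $L^1$. A two-sided Lévy process is $L_t=L^1_t$ for $t\ge0$ and $L_t=-L^2_{(-t)-}$ for $t<0$, where $(L^1_t)_{t\ge0}$ is a one-sided Lévy process and $L^2$ is an independent copy of it. For $f\in L^2$, $\int_{\mathbb{R}}f\,dL$ is the $L^2(\mathbb{P})$-limit of integrals of step functions, with $\mathbb{E}[(\int f\,dL)^2]=\mathbb{E}[L_1^2]\int f(u)^2\,du$. A process $(X_t)_{t\in\mathbb{R}}$ with $\mathbb{E}[|X_0|]<\infty$ is called a solution to the equation if it is stationary and satisfies it almost surely for each $s<t$. A stationary process with $\mathbb{E}[X_0^2]<\infty$ and $\mathbb{E}[X_0]=0$ is purely non-deterministic if $\bigcap_{t\in\mathbb{R}}\overline{\mathrm{sp}}\{X_s: s\le t\}=\{0\}$, where $\overline{\mathrm{sp}}$ denotes the $L^2(\mathbb{P})$-closure of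 the linear span. Uniqueness is up to almost sure equality for each $t$. *)

theory Defs
  imports "HOL-Probability.Probability"
begin

section \<open>Finite signed measures\<close>

definition finite_signed_measure :: "'a measure \<Rightarrow> ('a set \<Rightarrow> real) \<Rightarrow> bool" where
  "finite_signed_measure M \<eta> \<longleftrightarrow>
     \<eta> {} = 0 \<and>
     (\<forall>A :: nat \<Rightarrow> 'a set. range A \<subseteq> sets M \<longrightarrow> disjoint_family A \<longrightarrow>
        (\<lambda>n. \<eta> (A n)) sums \<eta> (\<Union>n. A n))"

text \<open>
  Positive part of the Jordan decomposition: the measure sending \<open>A\<close> to the supremum of \<open>\<eta> B\<close>
  over measurable \<open>B \<subseteq> A\<close>. The function \<open>ennreal\<close> sends negative numbers to \<open>0\<close>, which does
  not affect the supremum since \<open>\<eta> {} = 0\<close>.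
\<close>

definition upper_variation :: "'a measure \<Rightarrow> ('a set \<Rightarrow> real) \<Rightarrow> 'a measure" where
  "upper_variation M \<eta> =
     measure_of (space M) (sets M) (\<lambda>A. SUP B\<in>{B \<in> sets M. B \<subseteq> A}. ennreal (\<eta> B))"

definition lower_variation :: "'a measure \<Rightarrow> ('a set \<Rightarrow> real) \<Rightarrow> 'a measure" where
  "lower_variation M \<eta> = upper_variation M (\<lambda>A. - \<eta> A)"

definition total_variation :: "'a measure \<Rightarrow> ('a set \<Rightarrow> real) \<Rightarrow> 'a measure" where
  "total_variation M \<eta> =
     measure_of (space M) (sets M)
       (\<lambda>A. emeasure (upper_variation M \<eta>) A + emeasure (lower_variation M \<eta>) A)"

definition signed_integrable ::
    "'a measure \<Rightarrow> ('a set \<Rightarrow> real) \<Rightarrow> ('a \<Rightarrow> 'b::{banach, second_countable_topology}) \<Rightarrow> bool" where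
  "signed_integrable M \<eta> f \<longleftrightarrow> integrable (total_variation M \<eta>) f"

definition signed_integral ::
    "'a measure \<Rightarrow> ('a set \<Rightarrow> real) \<Rightarrow> ('a \<Rightarrow> 'b::{banach, second_countable_topology}) \<Rightarrow> 'b" where
  "signed_integral M \<eta> f =
     integral\<^sup>L (upper_variation M \<eta>) f - integral\<^sup>L (lower_variation M \<eta>) f"

abbreviation halfline :: "real measure" where
  "halfline \<equiv> restrict_space borel {0..}"


section \<open>Square integrable functions and the Fourier transform\<close>

definition square_integrable ::
    "'a measure \<Rightarrow> ('a \<Rightarrow> 'b::{banach, second_countable_topology}) \<Rightarrow> bool" where
  "square_integrable M f \<longleftrightarrow> f \<in> borel_measurable M \<and> integrable M (\<lambda>x. (norm (f x))\<^sup>2)"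

definition L2_tendsto ::
    "'a measure \<Rightarrow> (nat \<Rightarrow> 'a \<Rightarrow> 'b::{banach, second_countable_topology}) \<Rightarrow> ('a \<Rightarrow> 'b) \<Rightarrow> bool" where
  "L2_tendsto M F f \<longleftrightarrow>
     (\<forall>n. square_integrable M (F n)) \<and> square_integrable M f \<and>
     (\<lambda>n. LINT x|M. (norm (F n x - f x))\<^sup>2) \<longlonglongrightarrow> 0"

definition fourier_L1 :: "(real \<Rightarrow> complex) \<Rightarrow> real \<Rightarrow> complex" where
  "fourier_L1 f y = (LINT u|lborel. exp (\<i> * complex_of_real (y * u)) * f u)"

text \<open>
  The Plancherel extension of \<open>fourier_L1\<close>: \<open>G\<close> is the transform of the square integrable \<open>f\<close>,
  as an element of \<open>L\<^sup>2\<close>, so \<open>G\<close> is only determined almost everywhere.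
\<close>

definition has_fourier_L2 :: "(real \<Rightarrow> complex) \<Rightarrow> (real \<Rightarrow> complex) \<Rightarrow> bool" where
  "has_fourier_L2 f G \<longleftrightarrow>
     (\<exists>F :: nat \<Rightarrow> real \<Rightarrow> complex. (\<forall>n. integrable lborel (F n)) \<and>
        L2_tendsto lborel F f \<and> L2_tendsto lborel (\<lambda>n. fourier_L1 (F n)) G)"


section \<open>Levy processes\<close>

text \<open>Processes have type \<open>real \<Rightarrow> 'w \<Rightarrow> real\<close>; a one-sided process is only considered at times
  \<open>t \<ge> 0\<close>.\<close>

definition levy_process :: "'w measure \<Rightarrow> (real \<Rightarrow> 'w \<Rightarrow> real) \<Rightarrow> bool" where
  "levy_process M L \<longleftrightarrow>
     (\<forall>t\<ge>0. L t \<in> borel_measurable M) \<and>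
     (AE \<omega> in M. L 0 \<omega> = 0) \<and>
     (\<forall>(n::nat) (\<tau> :: nat \<Rightarrow> real). 0 \<le> \<tau> 0 \<longrightarrow> (\<forall>i<n. \<tau> i \<le> \<tau> (Suc i)) \<longrightarrow>
        prob_space.indep_vars M (\<lambda>_. borel) (\<lambda>i \<omega>. L (\<tau> (Suc i)) \<omega> - L (\<tau> i) \<omega>) {..<n}) \<and>
     (\<forall>s\<ge>0. \<forall>t\<ge>s. distr M borel (\<lambda>\<omega>. L t \<omega> - L s \<omega>) = distr M borel (L (t - s))) \<and>
     (AE \<omega> in M. \<forall>t\<ge>0. ((\<lambda>s. L s \<omega>) \<longlongrightarrow> L t \<omega>) (at_right t) \<and>
        (t > 0 \<longrightarrow> (\<exists>l. ((\<lambda>s. L s \<omega>) \<longlongrightarrow> l) (at_left t))))"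

definition path_space :: "(real \<Rightarrow> real) measure" where
  "path_space = (\<Pi>\<^sub>M t\<in>{0..}. borel)"

definition sample_path :: "(real \<Rightarrow> 'w \<Rightarrow> real) \<Rightarrow> 'w \<Rightarrow> real \<Rightarrow> real" where
  "sample_path L \<omega> = (\<lambda>t\<in>{0..}. L t \<omega>)"

text \<open>The last clause says \<open>L t = - L2 ((-t)-)\<close> for \<open>t < 0\<close>, with the left limit of \<open>L2\<close>.\<close>

definition two_sided_levy_process :: "'w measure \<Rightarrow> (real \<Rightarrow> 'w \<Rightarrow> real) \<Rightarrow> bool" where
  "two_sided_levy_process M L \<longleftrightarrow>
     (\<forall>t. L t \<in> borel_measurable M) \<and>
     (\<exists>L1 L2. levy_process M L1 \<and> levy_process M L2 \<and>
        prob_space.indep_var M path_space (sample_path L1) path_space (sample_path L2) \<and>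
        distr M path_space (sample_path L1) = distr M path_space (sample_path L2) \<and>
        (AE \<omega> in M. (\<forall>t\<ge>0. L t \<omega> = L1 t \<omega>) \<and>
           (\<forall>t<0. ((\<lambda>s. L2 s \<omega>) \<longlongrightarrow> - L t \<omega>) (at_left (- t)))))"


section \<open>The stochastic integral of a deterministic function\<close>

text \<open>A list of triples \<open>(c, a, b)\<close> with \<open>a < b\<close> encodes a step function, the sum of the
  \<open>c * indicator {a<..b}\<close>.\<close>

definition step_fun :: "(real \<times> real \<times> real) list \<Rightarrow> real \<Rightarrow> real" where
  "step_fun S u = (\<Sum>(c, a, b)\<leftarrow>S. c * indicator {a<..b} u)"

definition step_integral ::
    "(real \<Rightarrow> 'w \<Rightarrow> real) \<Rightarrow> (real \<times> real \<times> real) list \<Rightarrow> 'w \<Rightarrow> real" where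
  "step_integral L S \<omega> = (\<Sum>(c, a, b)\<leftarrow>S. c * (L b \<omega> - L a \<omega>))"

text \<open>\<open>has_levy_integral M L f Y\<close>: the random variable \<open>Y\<close> is a version of the integral of \<open>f\<close>
  over the real line with respect to \<open>L\<close>.\<close>

definition has_levy_integral ::
    "'w measure \<Rightarrow> (real \<Rightarrow> 'w \<Rightarrow> real) \<Rightarrow> (real \<Rightarrow> real) \<Rightarrow> ('w \<Rightarrow> real) \<Rightarrow> bool" where
  "has_levy_integral M L f Y \<longleftrightarrow>
     (\<exists>S :: nat \<Rightarrow> (real \<times> real \<times> real) list.
        (\<forall>n. \<forall>(c, a, b)\<in>set (S n). a < b) \<and>
        L2_tendsto lborel (\<lambda>n. step_fun (S n)) f \<and>
        L2_tendsto M (\<lambda>n. step_integral L (S n)) Y)"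


section \<open>Stationary and purely non-deterministic processes\<close>

definition measurable_process :: "'w measure \<Rightarrow> (real \<Rightarrow> 'w \<Rightarrow> real) \<Rightarrow> bool" where
  "measurable_process M X \<longleftrightarrow> (\<lambda>(t, \<omega>). X t \<omega>) \<in> borel_measurable (borel \<Otimes>\<^sub>M M)"

definition stationary_process :: "'w measure \<Rightarrow> (real \<Rightarrow> 'w \<Rightarrow> real) \<Rightarrow> bool" where
  "stationary_process M X \<longleftrightarrow>
     (\<forall>t. X t \<in> borel_measurable M) \<and>
     (\<forall>h J. finite J \<longrightarrow>
        distr M (\<Pi>\<^sub>M t\<in>J. borel) (\<lambda>\<omega>. \<lambda>t\<in>J. X (t + h) \<omega>) =
        distr M (\<Pi>\<^sub>M t\<in>J. borel) (\<lambda>\<omega>. \<lambda>t\<in>J. X t \<omega>))"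

text \<open>The \<open>L\<^sup>2\<close>-closure of the linear span of the \<open>X s\<close>, \<open>s \<le> t\<close>, consisting of functions rather
  than of almost sure equivalence classes.\<close>

definition past_closed_span ::
    "'w measure \<Rightarrow> (real \<Rightarrow> 'w \<Rightarrow> real) \<Rightarrow> real \<Rightarrow> ('w \<Rightarrow> real) set" where
  "past_closed_span M X t =
     {Z. \<exists>(J :: nat \<Rightarrow> real set) (c :: nat \<Rightarrow> real \<Rightarrow> real).
        (\<forall>n. finite (J n) \<and> J n \<subseteq> {..t}) \<and>
        L2_tendsto M (\<lambda>n \<omega>. \<Sum>s\<in>J n. c n s * X s \<omega>) Z}"

definition purely_nondeterministic :: "'w measure \<Rightarrow> (real \<Rightarrow> 'w \<Rightarrow> real) \<Rightarrow> bool" where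
  "purely_nondeterministic M X \<longleftrightarrow>
     stationary_process M X \<and>
     square_integrable M (X 0) \<and> (LINT \<omega>|M. X 0 \<omega>) = 0 \<and>
     (\<forall>Z \<in> (\<Inter>t. past_closed_span M X t). AE \<omega> in M. Z \<omega> = 0)"


section \<open>The stochastic fractional delay differential equation\<close>

text \<open>Complex \<open>powr\<close> is the principal branch, with arguments in \<open>(-\<pi>, \<pi>]\<close>, and
  \<open>0 powr (1 - \<beta>) = 0\<close>.\<close>

definition sfdde_h :: "real \<Rightarrow> (real set \<Rightarrow> real) \<Rightarrow> complex \<Rightarrow> complex" where
  "sfdde_h \<beta> \<eta> z =
     (- z) powr complex_of_real (1 - \<beta>) -
     signed_integral halfline \<eta> (\<lambda>u. exp (z * complex_of_real u))"

text \<open>The right-sided fractional derivative of the indicator of \<open>{s<..t}\<close>; note that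
  \<open>0 powr (- \<beta>) = 0\<close>, the intended value of a positive part to the power \<open>- \<beta>\<close> when the positive
  part vanishes.\<close>

definition frac_deriv_indicator :: "real \<Rightarrow> real \<Rightarrow> real \<Rightarrow> real \<Rightarrow> real" where
  "frac_deriv_indicator \<beta> s t u =
     1 / Gamma (1 - \<beta>) * ((max (t - u) 0) powr (- \<beta>) - (max (s - u) 0) powr (- \<beta>))"

text \<open>
  The integrals in the equation are pathwise, so a solution is a (jointly) measurable process. Given
  measurability, stationarity and integrability of \<open>X 0\<close>, the two integrability clauses hold
  automatically by Tonelli's theorem; they only make explicit that the integrals exist.
\<close>

definition sfdde_solution ::
    "'w measure \<Rightarrow> (real \<Rightarrow> 'w \<Rightarrow> real) \<Rightarrow> real \<Rightarrow> (real set \<Rightarrow> real) \<Rightarrow> (real \<Rightarrow> 'w \<Rightarrow> real) \<Rightarrow> bool" where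
  "sfdde_solution M L \<beta> \<eta> X \<longleftrightarrow>
     measurable_process M X \<and> stationary_process M X \<and> integrable M (X 0) \<and>
     (\<forall>s t. s < t \<longrightarrow> (AE \<omega> in M.
        (AE u in lborel. u \<le> t \<longrightarrow> signed_integrable halfline \<eta> (\<lambda>v. X (u - v) \<omega>)) \<and>
        set_integrable lborel {..t}
          (\<lambda>u. frac_deriv_indicator \<beta> s t u * signed_integral halfline \<eta> (\<lambda>v. X (u - v) \<omega>)) \<and>
        X t \<omega> - X s \<omega> =
          (LINT u:{..t}|lborel.
             frac_deriv_indicator \<beta> s t u * signed_integral halfline \<eta> (\<lambda>v. X (u - v) \<omega>)) +
          L t \<omega> - L s \<omega>))"

end

theory Submission
  imports Defs "HOL-Real_Asymp.Real_Asymp"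
begin

text \<open>
  On the Fourier side, \<open>D\<^sup>\<beta>\<^sub>- 1\<^sub>(\<^sub>s\<^sub>,\<^sub>t\<^sub>]\<close> is the multiplier \<open>(e\<^sup>i\<^sup>y\<^sup>t - e\<^sup>i\<^sup>y\<^sup>s) (-iy)\<^sup>\<beta>\<^sup>-\<^sup>1\<close>, up to the sign
  convention for \<open>y\<close>. Hence the formula for \<open>\<F>[g]\<close> says that, for almost every \<open>x\<close>,
  \<open>g(t - x) - g(s - x) - 1\<^sub>(\<^sub>s\<^sub>,\<^sub>t\<^sub>](x) = \<integral> D(u) \<integral> g(u - v - x) \<eta>(dv) du\<close>. This holds first after smoothing by
  Gaussians, where all Fourier inversions converge absolutely. By the isometry, both sides of the
  delay equation for \<open>X\<close> then have the same inner products with all integrals against \<open>L\<close>, and with the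
  superpositions of the \<open>X u\<close>, so they agree almost surely.

  For uniqueness let \<open>Z = Y - X\<close> be the difference of two solutions and \<open>W\<close> an increment of \<open>Z\<close>. Then
  \<open>z(u) = E[W Z u]\<close> is a bounded solution of the homogeneous equation. Convolving this equation with
  the integrable function whose transform is \<open>(e\<^sup>-\<^sup>i\<^sup>y\<^sup>b - 1) e\<^sup>-\<^sup>(\<^sup>\<epsilon>\<^sup>y\<^sup>)\<^sup>2\<^sup>/\<^sup>2 (-iy)\<^sup>1\<^sup>-\<^sup>\<beta> / h(iy)\<close> shows that a Gaussian
  smoothing of \<open>z\<close> has increments over lag \<open>b\<close> that do not depend on time; being bounded, it is constant,
  and so is \<open>z\<close>. Thus \<open>E[W\<^sup>2] = 0\<close> and \<open>Z\<close> is a single random variable. Averages of \<open>X\<close> over sparse remote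
  times tend to \<open>0\<close>, so that variable lies in the remote past of \<open>Y\<close> and vanishes.
\<close>

section \<open>Square integrable functions\<close>

text \<open>The transform of \<open>g\<close> decays at infinity only like 1/|y|: it is square
  integrable but not integrable, so no pointwise inversion formula can be inserted into the
  equation. Gaussian factors give absolute convergence, and letting their width shrink recovers the
  identity almost everywhere. The unknown of the homogeneous equation is merely bounded and has no
  transform as a function, so its equation is convolved with an integrable function instead of being
  divided by its symbol. The reciprocal symbol \<open>q / h\<close> tends to 1 at infinity and is
  not smooth at 0: the Gaussian supplies decay and the factor vanishing at 0 a bounded derivative,
  which together make the inverse transform integrable. The signed measure enters through its total
  variation \<open>Q\<close> and a density \<open>\<sigma>\<close>, so the double integral of the
  equation is a single one over \<open>\<nu>\<close>, Lebesgue measure times \<open>Q\<close>, with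
  integrable weight \<open>D s t\<close>. Of the law of \<open>L\<close>, the equation sees only
  means and covariances; the joint laws of increments serve stationarity.\<close>

lemma square_integrable_real:
  fixes f :: "'a \<Rightarrow> real"
  shows "square_integrable M f \<longleftrightarrow> f \<in> borel_measurable M \<and> integrable M (\<lambda>x. (f x)\<^sup>2)"
  by (simp add: square_integrable_def)

lemma square_integrable_measurable [measurable_dest]:
  "square_integrable M f \<Longrightarrow> f \<in> borel_measurable M"
  by (simp add: square_integrable_def)

lemma square_integrable_mult:
  fixes f g :: "'a \<Rightarrow> real"
  assumes f: "square_integrable M f" and g: "square_integrable M g"
  shows "integrable M (\<lambda>x. f x * g x)"
proof (rule Bochner_Integration.integrable_bound)
  show "integrable M (\<lambda>x. (f x)\<^sup>2 + (g x)\<^sup>2)"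
    using f g by (simp add: square_integrable_real)
  show "(\<lambda>x. f x * g x) \<in> borel_measurable M"
    using f g by measurable
  have "norm (a * b) \<le> norm (a\<^sup>2 + b\<^sup>2)" for a b :: real
  proof -
    have "2 * \<bar>a * b\<bar> \<le> a\<^sup>2 + b\<^sup>2"
      using sum_squares_bound[of "\<bar>a\<bar>" "\<bar>b\<bar>"] by (simp add: abs_mult)
    then show ?thesis by simp
  qed
  then show "AE x in M. norm (f x * g x) \<le> norm ((f x)\<^sup>2 + (g x)\<^sup>2)" by auto
qed

lemma square_integrable_add:
  fixes f g :: "'a \<Rightarrow> real"
  assumes f: "square_integrable M f" and g: "square_integrable M g"
  shows "square_integrable M (\<lambda>x. f x + g x)"
proof -
  have "integrable M (\<lambda>x. (f x)\<^sup>2 + (g x)\<^sup>2 + 2 * (f x * g x))"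
    using f g square_integrable_mult[OF f g] by (auto simp: square_integrable_real)
  moreover have "(\<lambda>x. f x + g x) \<in> borel_measurable M" using f g by measurable
  ultimately show ?thesis by (simp add: square_integrable_real power2_sum mult.assoc)
qed

lemma square_integrable_cmult:
  fixes f :: "'a \<Rightarrow> real"
  assumes f: "square_integrable M f"
  shows "square_integrable M (\<lambda>x. c * f x)"
  using f by (auto simp: square_integrable_real power_mult_distrib)

lemma square_integrable_diff:
  fixes f g :: "'a \<Rightarrow> real"
  assumes f: "square_integrable M f" and g: "square_integrable M g"
  shows "square_integrable M (\<lambda>x. f x - g x)"
  using square_integrable_add[OF f square_integrable_cmult[OF g, of "-1"]] by simp

lemma square_integrable_zero [simp]: "square_integrable M (\<lambda>x. 0 :: real)"
  by (simp add: square_integrable_real)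

lemma square_integrable_sum:
  fixes f :: "'i \<Rightarrow> 'a \<Rightarrow> real"
  assumes "\<And>i. i \<in> I \<Longrightarrow> square_integrable M (f i)"
  shows "square_integrable M (\<lambda>x. \<Sum>i\<in>I. f i x)"
  using assms
proof (induction I rule: infinite_finite_induct)
  case (insert i I)
  then have "square_integrable M (f i)" "square_integrable M (\<lambda>x. \<Sum>i\<in>I. f i x)" by simp_all
  from square_integrable_add[OF this] show ?case using insert(1,2) by simp
qed simp_all

lemma square_integrable_bound:
  fixes f g :: "'a \<Rightarrow> real"
  assumes g: "square_integrable M g" and f: "f \<in> borel_measurable M"
    and le: "\<And>x. \<bar>f x\<bar> \<le> \<bar>g x\<bar>"
  shows "square_integrable M f"
  unfolding square_integrable_real
proof (rule conjI[OF f Bochner_Integration.integrable_bound[of M "\<lambda>x. (g x)\<^sup>2"]])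
  show "integrable M (\<lambda>x. (g x)\<^sup>2)" using g by (simp add: square_integrable_real)
  show "(\<lambda>x. (f x)\<^sup>2) \<in> borel_measurable M" using f by measurable
  show "AE x in M. norm ((f x)\<^sup>2) \<le> norm ((g x)\<^sup>2)"
    using le by (auto simp: abs_le_square_iff)
qed

lemma square_integrable_cong_AE:
  fixes f g :: "'a \<Rightarrow> real"
  assumes f: "square_integrable M f" and g: "g \<in> borel_measurable M" and e: "AE x in M. f x = g x"
  shows "square_integrable M g"
proof -
  have "integrable M (\<lambda>x. (f x)\<^sup>2) \<longleftrightarrow> integrable M (\<lambda>x. (g x)\<^sup>2)"
    using f g e by (intro integrable_cong_AE) auto
  with f g show ?thesis by (simp add: square_integrable_real)
qed

lemma Cauchy_Schwarz_integral:
  fixes f g :: "'a \<Rightarrow> real"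
  assumes f: "square_integrable M f" and g: "square_integrable M g"
  shows "(LINT x|M. f x * g x)\<^sup>2 \<le> (LINT x|M. (f x)\<^sup>2) * (LINT x|M. (g x)\<^sup>2)"
proof -
  define A B C where "A = (LINT x|M. (f x)\<^sup>2)" and "B = (LINT x|M. f x * g x)"
    and "C = (LINT x|M. (g x)\<^sup>2)"
  have i: "integrable M (\<lambda>x. (f x)\<^sup>2)" "integrable M (\<lambda>x. (g x)\<^sup>2)" "integrable M (\<lambda>x. f x * g x)"
    using f g square_integrable_mult[OF f g] by (auto simp: square_integrable_real)
  have q: "0 \<le> A - 2 * t * B + t\<^sup>2 * C" for t
  proof -
    have "0 \<le> (LINT x|M. (f x - t * g x)\<^sup>2)" by simp
    also have "(LINT x|M. (f x - t * g x)\<^sup>2) =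
        (LINT x|M. (f x)\<^sup>2 - 2 * t * (f x * g x) + t\<^sup>2 * (g x)\<^sup>2)"
      by (intro Bochner_Integration.integral_cong) (auto simp: power2_eq_square algebra_simps)
    also have "\<dots> = A - 2 * t * B + t\<^sup>2 * C"
      using i by (simp add: A_def B_def C_def)
    finally show ?thesis .
  qed
  have "0 \<le> C" by (simp add: C_def)
  show ?thesis
  proof (cases "C = 0")
    case True
    have "B = 0"
    proof (rule ccontr)
      assume "B \<noteq> 0"
      \<comment> \<open>This \<open>t\<close> turns the quadratic into \<open>A - (A + 1)\<close>,
        which is negative.\<close>
      then show False using q[of "(A + 1) / (2 * B)"] True by simp
    qed
    then show ?thesis using True by (simp add: A_def B_def C_def)
  next
    case False
    with \<open>0 \<le> C\<close> have "0 < C" by simp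
    have "0 \<le> A - 2 * (B / C) * B + (B / C)\<^sup>2 * C" by (rule q)
    also have "\<dots> = A - B\<^sup>2 / C" using False by (simp add: power2_eq_square field_simps)
    finally have "B\<^sup>2 / C \<le> A" by simp
    then have "B\<^sup>2 \<le> A * C" using \<open>0 < C\<close> by (simp add: field_simps)
    then show ?thesis by (simp add: A_def B_def C_def)
  qed
qed

lemma Cauchy_Schwarz_abs:
  fixes f g :: "'a \<Rightarrow> real"
  assumes f: "square_integrable M f" and g: "square_integrable M g"
  shows "\<bar>LINT x|M. f x * g x\<bar> \<le> sqrt (LINT x|M. (f x)\<^sup>2) * sqrt (LINT x|M. (g x)\<^sup>2)"
proof -
  have "\<bar>LINT x|M. f x * g x\<bar> = sqrt ((LINT x|M. f x * g x)\<^sup>2)" by simp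
  also have "\<dots> \<le> sqrt ((LINT x|M. (f x)\<^sup>2) * (LINT x|M. (g x)\<^sup>2))"
    using Cauchy_Schwarz_integral[OF f g] by (rule real_sqrt_le_mono)
  finally show ?thesis by (simp add: real_sqrt_mult)
qed

text \<open>Replaces Minkowski's inequality: squared norms avoid square roots, at the price of a
  factor 2 that is harmless in limits. Pointwise it comes from the parallelogram identity.\<close>

lemma integral_power2_diff_triangle:
  fixes f g h :: "'a \<Rightarrow> real"
  assumes f: "square_integrable M f" and g: "square_integrable M g" and h: "square_integrable M h"
  shows "(LINT x|M. (f x - h x)\<^sup>2) \<le> 2 * (LINT x|M. (f x - g x)\<^sup>2) + 2 * (LINT x|M. (g x - h x)\<^sup>2)"
proof -
  have i: "integrable M (\<lambda>x. (f x - h x)\<^sup>2)" "integrable M (\<lambda>x. (f x - g x)\<^sup>2)"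
    "integrable M (\<lambda>x. (g x - h x)\<^sup>2)"
    using square_integrable_diff[OF f h] square_integrable_diff[OF f g] square_integrable_diff[OF g h]
    by (auto simp: square_integrable_real)
  have "(LINT x|M. (f x - h x)\<^sup>2) \<le> (LINT x|M. 2 * (f x - g x)\<^sup>2 + 2 * (g x - h x)\<^sup>2)"
  proof (rule integral_mono)
    fix x
    have "0 \<le> ((f x - g x) - (g x - h x))\<^sup>2" by simp
    then show "(f x - h x)\<^sup>2 \<le> 2 * (f x - g x)\<^sup>2 + 2 * (g x - h x)\<^sup>2"
      by (simp add: power2_eq_square algebra_simps)
  qed (use i in auto)
  also have "\<dots> = 2 * (LINT x|M. (f x - g x)\<^sup>2) + 2 * (LINT x|M. (g x - h x)\<^sup>2)"
    using i by simp
  finally show ?thesis .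
qed

section \<open>Convergence in L^2\<close>

lemma L2_tendsto_real:
  fixes F :: "nat \<Rightarrow> 'a \<Rightarrow> real"
  shows "L2_tendsto M F f \<longleftrightarrow> (\<forall>n. square_integrable M (F n)) \<and> square_integrable M f \<and>
     (\<lambda>n. LINT x|M. (F n x - f x)\<^sup>2) \<longlonglongrightarrow> 0"
  by (simp add: L2_tendsto_def)

lemma L2_tendsto_integral_mult:
  fixes F G :: "nat \<Rightarrow> 'a \<Rightarrow> real"
  assumes F: "L2_tendsto M F f" and G: "L2_tendsto M G g"
  shows "(\<lambda>n. LINT x|M. F n x * G n x) \<longlonglongrightarrow> (LINT x|M. f x * g x)"
proof -
  note F' = F[unfolded L2_tendsto_real] and G' = G[unfolded L2_tendsto_real]
  have sf: "square_integrable M (F n)" "square_integrable M (G n)" "square_integrable M f"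
    "square_integrable M g" for n using F' G' by auto
  note sd = square_integrable_diff[OF sf(1,3)] square_integrable_diff[OF sf(2,4)]
  let ?a = "\<lambda>n. sqrt (LINT x|M. (F n x - f x)\<^sup>2)" and ?b = "\<lambda>n. sqrt (LINT x|M. (G n x - g x)\<^sup>2)"
  have a: "?a \<longlonglongrightarrow> 0" and b: "?b \<longlonglongrightarrow> 0"
    using F' G' by (auto intro!: tendsto_eq_intros)
  have "(\<lambda>n. (LINT x|M. F n x * G n x) - (LINT x|M. f x * g x)) \<longlonglongrightarrow> 0"
  proof (rule Lim_null_comparison)
    let ?r = "\<lambda>n. ?a n * ?b n + ?a n * sqrt (LINT x|M. (g x)\<^sup>2) + sqrt (LINT x|M. (f x)\<^sup>2) * ?b n"
    have "?r \<longlonglongrightarrow> 0 * 0 + 0 * sqrt (LINT x|M. (g x)\<^sup>2) + sqrt (LINT x|M. (f x)\<^sup>2) * 0"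
      by (intro tendsto_add tendsto_mult a b tendsto_const)
    then show "?r \<longlonglongrightarrow> 0" by simp
    show "\<forall>\<^sub>F n in sequentially. norm ((LINT x|M. F n x * G n x) - (LINT x|M. f x * g x)) \<le> ?r n"
    proof (intro always_eventually allI)
      fix n
      have "(LINT x|M. F n x * G n x) = (LINT x|M. (F n x - f x) * (G n x - g x) + (F n x - f x) * g x
          + f x * (G n x - g x) + f x * g x)"
        by (intro Bochner_Integration.integral_cong) (auto simp: algebra_simps)
      also have "\<dots> = (LINT x|M. (F n x - f x) * (G n x - g x)) + (LINT x|M. (F n x - f x) * g x)
          + (LINT x|M. f x * (G n x - g x)) + (LINT x|M. f x * g x)"
        using square_integrable_mult[OF sd(1,2), of n n] square_integrable_mult[OF sd(1) sf(4), of n]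
          square_integrable_mult[OF sf(3) sd(2), of n] square_integrable_mult[OF sf(3,4)] by simp
      finally show "norm ((LINT x|M. F n x * G n x) - (LINT x|M. f x * g x)) \<le> ?r n"
        using Cauchy_Schwarz_abs[OF sd(1,2), of n n] Cauchy_Schwarz_abs[OF sd(1) sf(4), of n]
          Cauchy_Schwarz_abs[OF sf(3) sd(2), of n] unfolding real_norm_def by linarith
    qed
  qed
  then show ?thesis by (simp add: LIM_zero_iff)
qed

lemma L2_tendsto_const:
  "square_integrable M f \<Longrightarrow> L2_tendsto M (\<lambda>_. f) f"
  by (simp add: L2_tendsto_def)

lemma L2_tendsto_diff:
  fixes F G :: "nat \<Rightarrow> 'a \<Rightarrow> real"
  assumes F: "L2_tendsto M F f" and G: "L2_tendsto M G g"
  shows "L2_tendsto M (\<lambda>n x. F n x - G n x) (\<lambda>x. f x - g x)"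
proof -
  note F' = F[unfolded L2_tendsto_real] and G' = G[unfolded L2_tendsto_real]
  have s: "\<And>n. square_integrable M (\<lambda>x. F n x - G n x)" "square_integrable M (\<lambda>x. f x - g x)"
    using F' G' by (auto intro: square_integrable_diff)
  have "(\<lambda>n. LINT x|M. ((F n x - G n x) - (f x - g x))\<^sup>2) \<longlonglongrightarrow> 0"
  proof (rule Lim_null_comparison)
    show "(\<lambda>n. 2 * (LINT x|M. (F n x - f x)\<^sup>2) + 2 * (LINT x|M. (G n x - g x)\<^sup>2)) \<longlonglongrightarrow> 0"
      using F' G' by (auto intro!: tendsto_eq_intros)
    show "\<forall>\<^sub>F n in sequentially. norm (LINT x|M. ((F n x - G n x) - (f x - g x))\<^sup>2)
        \<le> 2 * (LINT x|M. (F n x - f x)\<^sup>2) + 2 * (LINT x|M. (G n x - g x)\<^sup>2)"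
    proof (intro always_eventually allI)
      fix n
      have d: "square_integrable M (\<lambda>x. F n x - f x)" "square_integrable M (\<lambda>x. G n x - g x)"
        using F' G' by (auto intro: square_integrable_diff)
      have eq: "((F n x - G n x) - (f x - g x))\<^sup>2 = ((F n x - f x) - (G n x - g x))\<^sup>2" for x
        by (simp add: algebra_simps)
      have "(0 - (G n x - g x))\<^sup>2 = (G n x - g x)\<^sup>2" for x by (simp add: power2_commute)
      with integral_power2_diff_triangle[OF d(1) square_integrable_zero d(2)]
      have "(LINT x|M. ((F n x - f x) - (G n x - g x))\<^sup>2)
          \<le> 2 * (LINT x|M. (F n x - f x)\<^sup>2) + 2 * (LINT x|M. (G n x - g x)\<^sup>2)" by simp
      then
      show "norm (LINT x|M. ((F n x - G n x) - (f x - g x))\<^sup>2)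
        \<le> 2 * (LINT x|M. (F n x - f x)\<^sup>2) + 2 * (LINT x|M. (G n x - g x)\<^sup>2)"
        unfolding eq by simp
    qed
  qed
  with s show ?thesis by (simp add: L2_tendsto_real)
qed

lemma integral_power2_eq_0_AE:
  fixes f :: "'a \<Rightarrow> real"
  assumes "square_integrable M f" "(LINT x|M. (f x)\<^sup>2) = 0"
  shows "AE x in M. f x = 0"
  using assms integral_nonneg_eq_0_iff_AE[where f = "\<lambda>x. (f x)\<^sup>2" and M = M] by (auto simp: square_integrable_real)

lemma L2_tendsto_unique:
  fixes F :: "nat \<Rightarrow> 'a \<Rightarrow> real"
  assumes f: "L2_tendsto M F f" and g: "L2_tendsto M F g"
  shows "AE x in M. f x = g x"
proof -
  \<comment> \<open>Subtracting the sequence from itself leaves the zero sequence; its L^2 distance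
    to the difference of the limits is constant and tends to 0.\<close>
  have "L2_tendsto M (\<lambda>n x. F n x - F n x) (\<lambda>x. f x - g x)"
    by (rule L2_tendsto_diff[OF f g])
  then have "square_integrable M (\<lambda>x. f x - g x)" "(LINT x|M. (f x - g x)\<^sup>2) = 0"
    by (auto simp: L2_tendsto_real LIMSEQ_const_iff power2_commute)
  from integral_power2_eq_0_AE[OF this] show ?thesis by auto
qed

section \<open>Almost sure limits and completeness of L^2\<close>

lemma square_integrable_nn_integral:
  fixes f :: "'a \<Rightarrow> real"
  assumes "square_integrable M f"
  shows "(\<integral>\<^sup>+x. ennreal ((f x)\<^sup>2) \<partial>M) = ennreal (LINT x|M. (f x)\<^sup>2)"
  using assms by (intro nn_integral_eq_integral) (auto simp: square_integrable_real)

lemma square_integrableI_nn_integral: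
  fixes f :: "'a \<Rightarrow> real"
  assumes f: "f \<in> borel_measurable M" and le: "(\<integral>\<^sup>+x. ennreal ((f x)\<^sup>2) \<partial>M) \<le> ennreal C" and C: "0 \<le> C"
  shows "square_integrable M f" "(LINT x|M. (f x)\<^sup>2) \<le> C"
proof -
  have "integrable M (\<lambda>x. (f x)\<^sup>2)"
    using f le by (intro integrableI_bounded) (auto intro: le_less_trans)
  with f show s: "square_integrable M f" by (simp add: square_integrable_real)
  show "(LINT x|M. (f x)\<^sup>2) \<le> C"
    using le C unfolding square_integrable_nn_integral[OF s] by (simp add: ennreal_le_iff)
qed

text \<open>The weights 4^k turn the bounds 8^-k into 2^-k, so the series of the 4^k V_k^2 has a
  finite integral and is almost everywhere finite; every term then lies below one constant depending
  on the point. This replaces Chebyshev plus Borel-Cantelli.\<close>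

lemma AE_bounded_of_summable_L2:
  fixes V :: "nat \<Rightarrow> 'a \<Rightarrow> real"
  assumes V: "\<And>k. square_integrable M (V k)" and le: "\<And>k. (LINT x|M. (V k x)\<^sup>2) \<le> (1/8) ^ k"
  shows "AE x in M. \<exists>C. \<forall>k. \<bar>V k x\<bar> \<le> C * (1/2) ^ k"
proof -
  have [measurable]: "V k \<in> borel_measurable M" for k using V by measurable
  have "(\<integral>\<^sup>+x. (\<Sum>k. ennreal (4 ^ k * (V k x)\<^sup>2)) \<partial>M) = (\<Sum>k. \<integral>\<^sup>+x. ennreal (4 ^ k * (V k x)\<^sup>2) \<partial>M)"
    by (rule nn_integral_suminf) auto
  also have "\<dots> \<le> (\<Sum>k. ennreal ((1/2) ^ k))"
  proof (rule suminf_le)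
    fix k
    have "(\<integral>\<^sup>+x. ennreal (4 ^ k * (V k x)\<^sup>2) \<partial>M) = ennreal (4 ^ k) * ennreal (LINT x|M. (V k x)\<^sup>2)"
      by (simp add: ennreal_mult nn_integral_cmult square_integrable_nn_integral[OF V])
    also have "\<dots> \<le> ennreal (4 ^ k) * ennreal ((1/8) ^ k)"
      by (intro mult_left_mono ennreal_leI le) auto
    also have "\<dots> = ennreal ((1/2) ^ k)"
      by (simp add: ennreal_mult[symmetric] power_mult_distrib[symmetric])
    finally show "(\<integral>\<^sup>+x. ennreal (4 ^ k * (V k x)\<^sup>2) \<partial>M) \<le> ennreal ((1/2) ^ k)" .
  qed auto
  also have "\<dots> = ennreal (\<Sum>k. (1/2) ^ k)"
    by (intro suminf_ennreal2) (auto intro: summable_geometric)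
  also have "\<dots> < \<infinity>" by simp
  finally have "AE x in M. (\<Sum>k. ennreal (4 ^ k * (V k x)\<^sup>2)) \<noteq> \<infinity>"
    by (intro nn_integral_noteq_infinite) auto
  then show ?thesis
  proof eventually_elim
    case (elim x)
    define S where "S = (\<Sum>k. ennreal (4 ^ k * (V k x)\<^sup>2))"
    have "S \<noteq> \<infinity>" using elim unfolding S_def .
    then obtain C where C: "0 \<le> C" "S = ennreal C"
      by (cases S) auto
    have "\<bar>V k x\<bar> \<le> sqrt C * (1/2) ^ k" for k
    proof -
      have "ennreal (4 ^ k * (V k x)\<^sup>2) = (\<Sum>i\<in>{k}. ennreal (4 ^ i * (V i x)\<^sup>2))" by simp
      also have "\<dots> \<le> S" unfolding S_def by (rule sum_le_suminf) auto
      finally have "4 ^ k * (V k x)\<^sup>2 \<le> C" using C by simp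
      then have "(2 ^ k * \<bar>V k x\<bar>)\<^sup>2 \<le> C"
        by (simp add: power_mult_distrib power_mult[symmetric] mult.commute[of k])
           (simp add: power_mult)
      then have "2 ^ k * \<bar>V k x\<bar> \<le> sqrt C" by (rule real_le_rsqrt)
      then show ?thesis by (simp add: field_simps power_divide)
    qed
    then show ?case by blast
  qed
qed

lemma AE_tendsto_of_summable_L2:
  fixes V :: "nat \<Rightarrow> 'a \<Rightarrow> real"
  assumes V: "\<And>k. square_integrable M (V k)" "square_integrable M f"
    and le: "\<And>k. (LINT x|M. (V k x - f x)\<^sup>2) \<le> (1/8) ^ k"
  shows "AE x in M. (\<lambda>k. V k x) \<longlonglongrightarrow> f x"
proof -
  have "AE x in M. \<exists>C. \<forall>k. \<bar>V k x - f x\<bar> \<le> C * (1/2) ^ k"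
    by (intro AE_bounded_of_summable_L2 square_integrable_diff V le)
  then show ?thesis
  proof eventually_elim
    case (elim x)
    then obtain C where C: "\<And>k. \<bar>V k x - f x\<bar> \<le> C * (1/2) ^ k" by auto
    have "(\<lambda>k. V k x - f x) \<longlonglongrightarrow> 0"
    proof (rule Lim_null_comparison)
      show "(\<lambda>k. C * (1/2) ^ k) \<longlonglongrightarrow> 0"
        by (intro tendsto_mult_right_zero LIMSEQ_power_zero) auto
    qed (use C in auto)
    then show ?case by (simp add: LIM_zero_iff)
  qed
qed

text \<open>The rate 8^-k is the one that \<open>AE_bounded_of_summable_L2\<close> converts into
  geometric bounds almost everywhere.\<close>

lemma fast_subseq:
  fixes a :: "nat \<Rightarrow> real"
  assumes "a \<longlonglongrightarrow> 0"
  obtains r where "strict_mono r" "\<And>k. a (r k) \<le> (1/8) ^ k"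
proof -
  have "\<exists>r. \<forall>k. a (r k) \<le> (1/8) ^ k \<and> r k < r (Suc k)"
  proof (rule dependent_nat_choice)
    show "\<exists>x. a x \<le> (1/8) ^ 0"
      using order_tendstoD(2)[OF assms, of 1] by (auto simp: eventually_sequentially intro: less_imp_le)
    fix x n
    have "eventually (\<lambda>m. a m < (1/8) ^ Suc n) sequentially"
      by (rule order_tendstoD(2)[OF assms]) simp
    moreover have "eventually (\<lambda>m. x < m) sequentially" by (rule eventually_gt_at_top)
    ultimately have "eventually (\<lambda>m. a m < (1/8) ^ Suc n \<and> x < m) sequentially"
      by eventually_elim auto
    then show "\<exists>y. a y \<le> (1/8) ^ Suc n \<and> x < y"
      by (auto simp: eventually_sequentially intro: less_imp_le)
  qed
  then show ?thesis using that by (auto simp: strict_mono_Suc_iff)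
qed

lemma L2_tendsto_AE_subseq:
  fixes F :: "nat \<Rightarrow> 'a \<Rightarrow> real"
  assumes "L2_tendsto M F f"
  obtains r where "strict_mono r" "AE x in M. (\<lambda>k. F (r k) x) \<longlonglongrightarrow> f x"
proof -
  note F = assms[unfolded L2_tendsto_real]
  obtain r where r: "strict_mono r" "\<And>k. (LINT x|M. (F (r k) x - f x)\<^sup>2) \<le> (1/8) ^ k"
    using F fast_subseq by blast
  show ?thesis
    by (rule that[OF r(1)]) (use F r(2) in \<open>auto intro!: AE_tendsto_of_summable_L2\<close>)
qed

text \<open>Riesz-Fischer. Along a fast subsequence the increments are almost everywhere bounded by
  a geometric sequence, so a pointwise limit exists; Fatou's lemma along that subsequence then
  carries the Cauchy estimate over to the limit.\<close>

lemma L2_complete: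
  fixes F :: "nat \<Rightarrow> 'a \<Rightarrow> real"
  assumes F: "\<And>n. square_integrable M (F n)"
    and Cauchy: "\<And>e. 0 < e \<Longrightarrow> \<exists>N. \<forall>m\<ge>N. \<forall>n\<ge>N. (LINT x|M. (F m x - F n x)\<^sup>2) < e"
  obtains f where "L2_tendsto M F f"
proof -
  have [measurable]: "F n \<in> borel_measurable M" for n using F by measurable
  have "\<forall>k. \<exists>N. \<forall>m\<ge>N. \<forall>n\<ge>N. (LINT x|M. (F m x - F n x)\<^sup>2) < (1/8) ^ k"
    using Cauchy by simp
  then obtain N where N: "\<And>k m n. N k \<le> m \<Longrightarrow> N k \<le> n \<Longrightarrow> (LINT x|M. (F m x - F n x)\<^sup>2) < (1/8) ^ k"
    by metis
  \<comment> \<open>The sum dominates every single \<open>N k\<close> and is monotone in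
    \<open>k\<close>; the added \<open>k\<close> makes \<open>r k\<close> tend to infinity.\<close>
  define r where "r k = (\<Sum>i\<le>k. N i) + k" for k
  have rN: "N k \<le> r k" for k unfolding r_def by (simp add: trans_le_add1 member_le_sum)
  have rmono: "r k \<le> r (Suc k)" for k unfolding r_def by simp
  have rk: "k \<le> r k" for k unfolding r_def by simp
  have "AE x in M. \<exists>C. \<forall>k. \<bar>F (r (Suc k)) x - F (r k) x\<bar> \<le> C * (1/2) ^ k"
  proof (intro AE_bounded_of_summable_L2 square_integrable_diff F)
    fix k
    have "(LINT x|M. (F (r (Suc k)) x - F (r k) x)\<^sup>2) < (1/8) ^ k"
      using rN[of k] rmono[of k] by (intro N) auto
    then show "(LINT x|M. (F (r (Suc k)) x - F (r k) x)\<^sup>2) \<le> (1/8) ^ k" by simp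
  qed
  then have conv: "AE x in M. convergent (\<lambda>k. F (r k) x)"
  proof eventually_elim
    case (elim x)
    then obtain C where C: "\<And>k. \<bar>F (r (Suc k)) x - F (r k) x\<bar> \<le> C * (1/2) ^ k" by auto
    have "summable (\<lambda>k. F (r (Suc k)) x - F (r k) x)"
      by (rule summable_comparison_test'[of "\<lambda>k. C * (1/2) ^ k" 0])
         (use C in \<open>auto intro!: summable_mult summable_geometric\<close>)
    then have "convergent (\<lambda>n. \<Sum>k<n. F (r (Suc k)) x - F (r k) x)" by (simp add: summable_iff_convergent)
    then have "convergent (\<lambda>n. F (r n) x - F (r 0) x)"
      by (simp add: sum_lessThan_telescope[where f = "\<lambda>k. F (r k) x"])
    then show ?case
      by (subst (asm) convergent_diff_const_right_iff)
  qed
  define f where "f x = lim (\<lambda>k. F (r k) x)" for x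
  have [measurable]: "f \<in> borel_measurable M" unfolding f_def[abs_def] by measurable
  have lim: "AE x in M. (\<lambda>k. F (r k) x) \<longlonglongrightarrow> f x"
    using conv by eventually_elim (simp add: f_def convergent_LIMSEQ_iff)
  have bd: "(\<integral>\<^sup>+x. ennreal ((F n x - f x)\<^sup>2) \<partial>M) \<le> ennreal e"
    if n: "\<And>m. m \<ge> K \<Longrightarrow> (LINT x|M. (F n x - F m x)\<^sup>2) \<le> e" for n K e
  proof -
    have "(\<integral>\<^sup>+x. ennreal ((F n x - f x)\<^sup>2) \<partial>M) = (\<integral>\<^sup>+x. liminf (\<lambda>k. ennreal ((F n x - F (r k) x)\<^sup>2)) \<partial>M)"
    proof (rule nn_integral_cong_AE, use lim in eventually_elim)
      case (elim x)
      then have "(\<lambda>k. ennreal ((F n x - F (r k) x)\<^sup>2)) \<longlonglongrightarrow> ennreal ((F n x - f x)\<^sup>2)"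
        by (intro tendsto_intros)
      from lim_imp_Liminf[OF trivial_limit_sequentially this] show ?case by (rule sym)
    qed
    also have "\<dots> \<le> liminf (\<lambda>k. \<integral>\<^sup>+x. ennreal ((F n x - F (r k) x)\<^sup>2) \<partial>M)"
      by (rule nn_integral_liminf) auto
    also have "\<dots> \<le> ennreal e"
    proof (rule Liminf_le)
      show "\<forall>\<^sub>F k in sequentially. (\<integral>\<^sup>+x. ennreal ((F n x - F (r k) x)\<^sup>2) \<partial>M) \<le> ennreal e"
        using eventually_ge_at_top[of K]
      proof eventually_elim
        case (elim k)
        then show ?case using n[of "r k"] rk[of k]
          by (simp add: square_integrable_nn_integral square_integrable_diff F ennreal_leI)
      qed
    qed simp
    finally show ?thesis .
  qed
  have dsq: "square_integrable M (\<lambda>x. F n x - f x) \<and> (LINT x|M. (F n x - f x)\<^sup>2) \<le> e"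
    if "0 < e" "\<And>m. m \<ge> K \<Longrightarrow> (LINT x|M. (F n x - F m x)\<^sup>2) \<le> e" for n K e
    using square_integrableI_nn_integral[OF _ bd[of K n e]] that by auto
  obtain N1 where N1: "\<forall>m\<ge>N1. \<forall>n\<ge>N1. (LINT x|M. (F m x - F n x)\<^sup>2) < 1" using Cauchy[of 1] by auto
  have "square_integrable M (\<lambda>x. F N1 x - f x)"
    using dsq[of 1 N1 N1] N1 by (meson less_imp_le order_refl zero_less_one)
  from square_integrable_diff[OF F[of N1] this] have f: "square_integrable M f" by simp
  have "(\<lambda>n. LINT x|M. (F n x - f x)\<^sup>2) \<longlonglongrightarrow> 0"
  proof (rule LIMSEQ_I)
    fix e :: real assume "0 < e"
    then obtain K where K: "\<forall>m\<ge>K. \<forall>n\<ge>K. (LINT x|M. (F m x - F n x)\<^sup>2) < e / 2"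
      using Cauchy[of "e / 2"] by auto
    have "norm ((LINT x|M. (F n x - f x)\<^sup>2) - 0) < e" if "n \<ge> K" for n
      using dsq[of "e / 2" K n] K that \<open>0 < e\<close> by (force intro: less_imp_le)
    then show "\<exists>no. \<forall>n\<ge>no. norm ((LINT x|M. (F n x - f x)\<^sup>2) - 0) < e" by auto
  qed
  with f F show ?thesis by (intro that) (auto simp: L2_tendsto_real)
qed

text \<open>The form of Fubini's theorem used for Fourier integrals: each variable carries its own
  integrable weight, and the kernel coupling them is an exponential of modulus 1 or another bounded
  function.\<close>

lemma Fubini_bounded_kernel:
  fixes f :: "'a \<Rightarrow> complex" and g :: "'b \<Rightarrow> complex" and k :: "'a \<Rightarrow> 'b \<Rightarrow> complex"
  assumes M: "sigma_finite_measure M" and N: "sigma_finite_measure N"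
    and f: "integrable M f" and g: "integrable N g"
    and k: "case_prod k \<in> borel_measurable (M \<Otimes>\<^sub>M N)"
    and B: "\<And>x y. x \<in> space M \<Longrightarrow> y \<in> space N \<Longrightarrow> norm (k x y) \<le> B"
  shows "(LINT x|M. f x * (LINT y|N. g y * k x y)) = (LINT y|N. g y * (LINT x|M. f x * k x y))"
proof -
  interpret M: sigma_finite_measure M by fact
  interpret N: sigma_finite_measure N by fact
  interpret pair_sigma_finite M N ..
  have [measurable]: "f \<in> borel_measurable M" "g \<in> borel_measurable N" using f g by auto
  note k[measurable]
  have fg: "integrable (M \<Otimes>\<^sub>M N) (\<lambda>(x, y). f x * g y)"
    by (intro Fubini_integrable) (use f g in \<open>auto simp: norm_mult\<close>)
  have "integrable (M \<Otimes>\<^sub>M N) (\<lambda>(x, y). f x * g y * k x y)"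
  proof (rule Bochner_Integration.integrable_bound)
    show "integrable (M \<Otimes>\<^sub>M N) (\<lambda>z. complex_of_real B * (case z of (x, y) \<Rightarrow> f x * g y))"
      using fg by auto
    show "(\<lambda>(x, y). f x * g y * k x y) \<in> borel_measurable (M \<Otimes>\<^sub>M N)" by measurable
    show "AE z in M \<Otimes>\<^sub>M N. norm (case z of (x, y) \<Rightarrow> f x * g y * k x y)
        \<le> norm (complex_of_real B * (case z of (x, y) \<Rightarrow> f x * g y))"
    proof (rule AE_I2)
      fix z assume "z \<in> space (M \<Otimes>\<^sub>M N)"
      then have z: "norm (k (fst z) (snd z)) \<le> B" by (auto simp: space_pair_measure intro: B)
      then have "norm (k (fst z) (snd z)) \<le> \<bar>B\<bar>" by linarith
      then show "norm (case z of (x, y) \<Rightarrow> f x * g y * k x y)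
        \<le> norm (complex_of_real B * (case z of (x, y) \<Rightarrow> f x * g y))"
        by (auto simp: norm_mult split_beta mult.commute intro: mult_left_mono mult_right_mono)
    qed
  qed
  from Fubini_integral[OF this]
  have "(LINT y|N. LINT x|M. f x * g y * k x y) = (LINT x|M. LINT y|N. f x * g y * k x y)" .
  moreover have "(LINT x|M. f x * g y * k x y) = g y * (LINT x|M. f x * k x y)" for y
    by (subst integral_mult_right_zero[symmetric]) (simp add: mult_ac)
  moreover have "(LINT y|N. f x * g y * k x y) = f x * (LINT y|N. g y * k x y)" for x
    by (subst integral_mult_right_zero[symmetric]) (simp add: mult_ac)
  ultimately show ?thesis by simp
qed

text \<open>Cauchy-Schwarz for the measure with density |d| bounds the squared superposition by the
  total mass of |d| times the superposition of the squares, whose expectation is controlled by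
  \<open>C\<close>. It is applied with a process on the probability space, and also with Lebesgue
  measure as \<open>M\<close> and translates of a fixed function as \<open>X\<close>.\<close>

lemma weighted_superposition:
  fixes X :: "real \<Rightarrow> 'w \<Rightarrow> real" and d \<theta> :: "'c \<Rightarrow> real"
  assumes M: "sigma_finite_measure M" and nu: "sigma_finite_measure \<nu>"
    and d: "integrable \<nu> d" and \<theta>[measurable]: "\<theta> \<in> borel_measurable \<nu>"
    and X[measurable]: "(\<lambda>(t, \<omega>). X t \<omega>) \<in> borel_measurable (borel \<Otimes>\<^sub>M M)"
    and sq: "\<And>t. square_integrable M (X t)" and C: "\<And>t. (LINT \<omega>|M. (X t \<omega>)\<^sup>2) \<le> C"
  defines "I \<equiv> (\<lambda>\<omega>. LINT c|\<nu>. d c * X (\<theta> c) \<omega>)"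
  shows "AE \<omega> in M. integrable \<nu> (\<lambda>c. d c * X (\<theta> c) \<omega>)"
    and "square_integrable M I"
    and "\<And>W. square_integrable M W \<Longrightarrow>
           (LINT \<omega>|M. W \<omega> * I \<omega>) = (LINT c|\<nu>. d c * (LINT \<omega>|M. W \<omega> * X (\<theta> c) \<omega>))"
proof -
  interpret M: sigma_finite_measure M by fact
  interpret N: sigma_finite_measure \<nu> by fact
  interpret pair_sigma_finite \<nu> M ..
  have d_m[measurable]: "d \<in> borel_measurable \<nu>" using d by auto
  have C0: "0 \<le> C" using C[of 0] by (meson Bochner_Integration.integral_nonneg order_trans zero_le_power2)
  have Xm[measurable]: "(\<lambda>(c, \<omega>). X (\<theta> c) \<omega>) \<in> borel_measurable (\<nu> \<Otimes>\<^sub>M M)"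
    using measurable_compose[of "\<lambda>(c, \<omega>). (\<theta> c, \<omega>)" "\<nu> \<Otimes>\<^sub>M M" "borel \<Otimes>\<^sub>M M", OF _ X] by (simp add: split_beta')
  have [measurable]: "(\<lambda>c. X (\<theta> c) \<omega>) \<in> borel_measurable \<nu>" if "\<omega> \<in> space M" for \<omega>
    using measurable_compose[OF measurable_Pair2'[OF that] Xm] by simp
  define D where "D = (\<integral>\<^sup>+c. ennreal \<bar>d c\<bar> \<partial>\<nu>)"
  have Dfin: "D < \<infinity>" using d unfolding D_def integrable_iff_bounded by simp
  define q where "q \<omega> = (\<integral>\<^sup>+c. ennreal (\<bar>d c\<bar> * (X (\<theta> c) \<omega>)\<^sup>2) \<partial>\<nu>)" for \<omega>
  have qm[measurable]: "q \<in> borel_measurable M" unfolding q_def[abs_def] by measurable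
  have "(\<integral>\<^sup>+\<omega>. q \<omega> \<partial>M) = (\<integral>\<^sup>+c. (\<integral>\<^sup>+\<omega>. ennreal (\<bar>d c\<bar> * (X (\<theta> c) \<omega>)\<^sup>2) \<partial>M) \<partial>\<nu>)"
    unfolding q_def by (rule Fubini') measurable
  also have "\<dots> \<le> (\<integral>\<^sup>+c. ennreal \<bar>d c\<bar> * ennreal C \<partial>\<nu>)"
  proof (rule nn_integral_mono)
    fix c assume "c \<in> space \<nu>"
    have "(\<integral>\<^sup>+\<omega>. ennreal (\<bar>d c\<bar> * (X (\<theta> c) \<omega>)\<^sup>2) \<partial>M) = ennreal \<bar>d c\<bar> * ennreal (LINT \<omega>|M. (X (\<theta> c) \<omega>)\<^sup>2)"
      using sq[of "\<theta> c"]
      by (simp add: ennreal_mult nn_integral_cmult square_integrable_nn_integral[OF sq])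
    also have "\<dots> \<le> ennreal \<bar>d c\<bar> * ennreal C" by (intro mult_left_mono ennreal_leI C) auto
    finally show "(\<integral>\<^sup>+\<omega>. ennreal (\<bar>d c\<bar> * (X (\<theta> c) \<omega>)\<^sup>2) \<partial>M) \<le> ennreal \<bar>d c\<bar> * ennreal C" .
  qed
  also have "\<dots> = D * ennreal C" unfolding D_def by (simp add: nn_integral_multc)
  finally have qint: "(\<integral>\<^sup>+\<omega>. q \<omega> \<partial>M) \<le> D * ennreal C" .
  have sq_le: "(\<integral>\<^sup>+c. ennreal \<bar>d c * X (\<theta> c) \<omega>\<bar> \<partial>\<nu>)\<^sup>2 \<le> D * q \<omega>" if [measurable]: "\<omega> \<in> space M" for \<omega>
  proof -
    have "(\<integral>\<^sup>+c. ennreal \<bar>d c * X (\<theta> c) \<omega>\<bar> \<partial>\<nu>)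
        = (\<integral>\<^sup>+c. ennreal (sqrt \<bar>d c\<bar>) * ennreal (sqrt \<bar>d c\<bar> * \<bar>X (\<theta> c) \<omega>\<bar>) \<partial>\<nu>)"
      by (intro nn_integral_cong) (simp add: ennreal_mult[symmetric] abs_mult mult.assoc[symmetric])
    also have "\<dots>\<^sup>2 \<le> (\<integral>\<^sup>+c. (ennreal (sqrt \<bar>d c\<bar>))\<^sup>2 \<partial>\<nu>) * (\<integral>\<^sup>+c. (ennreal (sqrt \<bar>d c\<bar> * \<bar>X (\<theta> c) \<omega>\<bar>))\<^sup>2 \<partial>\<nu>)"
      by (rule Cauchy_Schwarz_nn_integral) auto
    also have "\<dots> = D * q \<omega>"
      by (simp add: D_def q_def ennreal_power power_mult_distrib)
    finally show ?thesis .
  qed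
  have "AE \<omega> in M. q \<omega> \<noteq> \<infinity>"
    using qint Dfin by (intro nn_integral_noteq_infinite) (auto simp: ennreal_mult_eq_top_iff top_unique)
  then show ae: "AE \<omega> in M. integrable \<nu> (\<lambda>c. d c * X (\<theta> c) \<omega>)"
  proof (rule AE_mp, intro AE_I2 impI)
    fix \<omega> assume w[measurable]: "\<omega> \<in> space M" and "q \<omega> \<noteq> \<infinity>"
    then have "D * q \<omega> < \<infinity>" using Dfin by (auto simp: ennreal_mult_less_top less_top)
    with sq_le[OF w] have "(\<integral>\<^sup>+c. ennreal \<bar>d c * X (\<theta> c) \<omega>\<bar> \<partial>\<nu>)\<^sup>2 < \<infinity>" by (rule le_less_trans)
    then have "(\<integral>\<^sup>+c. ennreal \<bar>d c * X (\<theta> c) \<omega>\<bar> \<partial>\<nu>) < \<infinity>"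
      by (auto simp: power_less_top_ennreal)
    then show "integrable \<nu> (\<lambda>c. d c * X (\<theta> c) \<omega>)" by (intro integrableI_bounded) auto
  qed
  have Im[measurable]: "I \<in> borel_measurable M" unfolding I_def by measurable
  have Ile: "ennreal ((I \<omega>)\<^sup>2) \<le> D * q \<omega>" if "\<omega> \<in> space M" for \<omega>
  proof -
    have "ennreal \<bar>I \<omega>\<bar> \<le> (\<integral>\<^sup>+c. ennreal \<bar>d c * X (\<theta> c) \<omega>\<bar> \<partial>\<nu>)"
      unfolding I_def using integral_norm_bound_ennreal[of \<nu> "\<lambda>c. d c * X (\<theta> c) \<omega>"]
      by (cases "integrable \<nu> (\<lambda>c. d c * X (\<theta> c) \<omega>)") (auto simp: not_integrable_integral_eq)
    then have "(ennreal \<bar>I \<omega>\<bar>)\<^sup>2 \<le> (\<integral>\<^sup>+c. ennreal \<bar>d c * X (\<theta> c) \<omega>\<bar> \<partial>\<nu>)\<^sup>2" by (rule power_mono) simp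
    with sq_le[OF that] show ?thesis by (simp add: ennreal_power)
  qed
  have "(\<integral>\<^sup>+\<omega>. ennreal ((I \<omega>)\<^sup>2) \<partial>M) \<le> (\<integral>\<^sup>+\<omega>. D * q \<omega> \<partial>M)"
    by (intro nn_integral_mono Ile)
  also have "\<dots> \<le> D * (D * ennreal C)"
    using qint by (simp add: nn_integral_cmult mult_left_mono)
  also have "\<dots> = ennreal (enn2real D * (enn2real D * C))"
    using Dfin C0 by (simp add: ennreal_mult)
  finally show Isq: "square_integrable M I"
    using C0 by (intro square_integrableI_nn_integral(1)[of I M "enn2real D * (enn2real D * C)"]) auto
  fix W :: "'w \<Rightarrow> real" assume W: "square_integrable M W"
  then have [measurable]: "W \<in> borel_measurable M" by measurable
  let ?K = "sqrt (LINT \<omega>|M. (W \<omega>)\<^sup>2) * sqrt C"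
  have abs: "square_integrable M (\<lambda>\<omega>. \<bar>f \<omega>\<bar>)" if "square_integrable M f" for f :: "'w \<Rightarrow> real"
    using that by (auto simp: square_integrable_real)
  have "integrable (\<nu> \<Otimes>\<^sub>M M) (\<lambda>(c, \<omega>). d c * (W \<omega> * X (\<theta> c) \<omega>))"
  proof (rule Fubini_integrable)
    show "integrable \<nu> (\<lambda>c. LINT \<omega>|M. norm (case (c, \<omega>) of (c, \<omega>) \<Rightarrow> d c * (W \<omega> * X (\<theta> c) \<omega>)))"
    proof (rule Bochner_Integration.integrable_bound)
      show "integrable \<nu> (\<lambda>c. d c * ?K)" using d by simp
      show "AE c in \<nu>. norm (LINT \<omega>|M. norm (case (c, \<omega>) of (c, \<omega>) \<Rightarrow> d c * (W \<omega> * X (\<theta> c) \<omega>))) \<le> norm (d c * ?K)"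
      proof (rule AE_I2)
        fix c
        have "(LINT \<omega>|M. norm (case (c, \<omega>) of (c, \<omega>) \<Rightarrow> d c * (W \<omega> * X (\<theta> c) \<omega>)))
            = \<bar>d c\<bar> * (LINT \<omega>|M. \<bar>W \<omega>\<bar> * \<bar>X (\<theta> c) \<omega>\<bar>)"
          by (subst integral_mult_right_zero[symmetric]) (simp add: abs_mult)
        moreover have "\<bar>LINT \<omega>|M. \<bar>W \<omega>\<bar> * \<bar>X (\<theta> c) \<omega>\<bar>\<bar> \<le> ?K"
          using Cauchy_Schwarz_abs[OF abs[OF W] abs[OF sq[of "\<theta> c"]]]
            mult_left_mono[OF real_sqrt_le_mono[OF C[of "\<theta> c"]], of "sqrt (LINT \<omega>|M. (W \<omega>)\<^sup>2)"] by simp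
        ultimately show "norm (LINT \<omega>|M. norm (case (c, \<omega>) of (c, \<omega>) \<Rightarrow> d c * (W \<omega> * X (\<theta> c) \<omega>))) \<le> norm (d c * ?K)"
          by (auto simp: abs_mult C0 intro!: mult_left_mono)
      qed
    qed measurable
    show "AE c in \<nu>. integrable M (\<lambda>\<omega>. case (c, \<omega>) of (c, \<omega>) \<Rightarrow> d c * (W \<omega> * X (\<theta> c) \<omega>))"
      using square_integrable_mult[OF W sq] by auto
  qed measurable
  from Fubini_integral[OF this]
  have "(LINT \<omega>|M. LINT c|\<nu>. d c * (W \<omega> * X (\<theta> c) \<omega>)) = (LINT c|\<nu>. LINT \<omega>|M. d c * (W \<omega> * X (\<theta> c) \<omega>))" .
  moreover have "(LINT c|\<nu>. d c * (W \<omega> * X (\<theta> c) \<omega>)) = W \<omega> * I \<omega>" for \<omega>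
    unfolding I_def by (subst integral_mult_right_zero[symmetric]) (simp add: mult_ac)
  ultimately show "(LINT \<omega>|M. W \<omega> * I \<omega>) = (LINT c|\<nu>. d c * (LINT \<omega>|M. W \<omega> * X (\<theta> c) \<omega>))"
    by simp
qed

section \<open>Densities of signed measures\<close>

lemma finite_signed_measure_Un:
  assumes "finite_signed_measure M \<eta>" "A \<in> sets M" "B \<in> sets M" "A \<inter> B = {}"
  shows "\<eta> (A \<union> B) = \<eta> A + \<eta> B"
proof -
  have "(\<lambda>n. \<eta> (binaryset A B n)) sums \<eta> (\<Union>n. binaryset A B n)"
  proof -
    have "disjoint_family (binaryset A B)"
      using assms(4) by (auto simp: disjoint_family_on_def binaryset_def)
    moreover have "range (binaryset A B) \<subseteq> sets M"
      using assms(2,3) by (simp add: range_binaryset_eq)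
    ultimately show ?thesis using assms(1) unfolding finite_signed_measure_def by blast
  qed
  moreover have "(\<lambda>n. \<eta> (binaryset A B n)) sums (\<eta> A + \<eta> B)"
    by (rule binaryset_sums) (use assms(1) in \<open>simp add: finite_signed_measure_def\<close>)
  ultimately show ?thesis unfolding UN_binaryset_eq by (rule sums_unique2)
qed

lemma finite_signed_measure_Diff:
  assumes "finite_signed_measure M \<eta>" "A \<in> sets M" "B \<in> sets M" "B \<subseteq> A"
  shows "\<eta> (A - B) = \<eta> A - \<eta> B"
proof -
  have "(A - B) \<inter> B = {}" "A - B \<union> B = A" "A - B \<in> sets M" using assms by auto
  with finite_signed_measure_Un[OF assms(1), of "A - B" B] assms(3) show ?thesis by simp
qed

lemma finite_signed_measure_uminus:
  "finite_signed_measure M \<eta> \<Longrightarrow> finite_signed_measure M (\<lambda>A. - \<eta> A)"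
  unfolding finite_signed_measure_def by (auto intro: sums_minus)

text \<open>The successive differences are disjoint, so by countable additivity their values form a
  convergent series, and its partial sums telescope.\<close>

lemma decseq_finite_signed_measure_bounded:
  assumes \<eta>: "finite_signed_measure M \<eta>" and A: "\<And>n. A n \<in> sets M" "\<And>n. A (Suc n) \<subseteq> A n"
  shows "Bseq (\<lambda>n. \<eta> (A n))"
proof -
  have dec: "decseq A" by (rule decseq_SucI) (rule A(2))
  have disj: "disjoint_family (\<lambda>n. A n - A (Suc n))"
  proof (clarsimp simp: disjoint_family_on_def, goal_cases)
    case (1 m n)
    then show ?case
    proof (induction m n rule: linorder_less_wlog)
      case (less a b)
      then have "A b \<subseteq> A (Suc a)" using decseqD[OF dec, of "Suc a" b] by simp
      then show ?case by auto
    qed auto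
  qed
  have "(\<lambda>n. \<eta> (A n - A (Suc n))) sums \<eta> (\<Union>n. A n - A (Suc n))"
    using \<eta> A(1) disj unfolding finite_signed_measure_def by (auto simp: image_subset_iff)
  then have "(\<lambda>n. \<Sum>k<n. \<eta> (A k - A (Suc k))) \<longlonglongrightarrow> \<eta> (\<Union>n. A n - A (Suc n))"
    by (simp add: sums_def)
  moreover have "(\<Sum>k<n. \<eta> (A k - A (Suc k))) = \<eta> (A 0) - \<eta> (A n)" for n
    by (induction n) (auto simp: finite_signed_measure_Diff[OF \<eta> A(1) A(1) A(2)])
  ultimately have "(\<lambda>n. \<eta> (A 0) - \<eta> (A n)) \<longlonglongrightarrow> \<eta> (\<Union>n. A n - A (Suc n))" by simp
  from tendsto_diff[OF tendsto_const[of "\<eta> (A 0)"] this]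
  have "convergent (\<lambda>n. \<eta> (A n))" by (auto simp: convergent_def)
  then show ?thesis by (rule convergent_imp_Bseq)
qed

section \<open>Finiteness of the variations, and a density for the signed measure\<close>

lemma space_upper_variation [simp]: "space (upper_variation M \<eta>) = space M"
  and sets_upper_variation [simp, measurable_cong]: "sets (upper_variation M \<eta>) = sets M"
  by (simp_all add: upper_variation_def sets.space_closed space_measure_of sets_measure_of sets.sigma_sets_eq)

lemma space_lower_variation [simp]: "space (lower_variation M \<eta>) = space M"
  and sets_lower_variation [simp, measurable_cong]: "sets (lower_variation M \<eta>) = sets M"
  by (simp_all add: lower_variation_def)

lemma space_total_variation [simp]: "space (total_variation M \<eta>) = space M"
  and sets_total_variation [simp, measurable_cong]: "sets (total_variation M \<eta>) = sets M"
  by (simp_all add: total_variation_def sets.space_closed space_measure_of sets_measure_of sets.sigma_sets_eq)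

lemma emeasure_total_variation:
  "emeasure (total_variation M \<eta>) A = emeasure (upper_variation M \<eta>) A + emeasure (lower_variation M \<eta>) A"
proof (cases "A \<in> sets M")
  case True
  show ?thesis
  proof (rule emeasure_measure_of[OF total_variation_def])
    show "countably_additive (sets (total_variation M \<eta>))
        (\<lambda>A. emeasure (upper_variation M \<eta>) A + emeasure (lower_variation M \<eta>) A)"
      by (auto simp: countably_additive_def suminf_add[symmetric] suminf_emeasure image_subset_iff)
  qed (use True sets.space_closed in \<open>auto simp: positive_def\<close>)
qed (simp add: emeasure_notin_sets)

text \<open>If the variation were infinite, one could repeatedly split a set of infinite variation into two
  pieces of large \<open>\<eta>\<close>-value and keep one of infinite variation, which contradicts convergence of
  \<open>\<eta>\<close> along decreasing sequences.\<close>

lemma finite_measure_upper_variation: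
  assumes \<eta>: "finite_signed_measure M \<eta>"
  shows "finite_measure (upper_variation M \<eta>)"
proof (rule finite_measureI, rule notI)
  let ?U = "upper_variation M \<eta>" and ?S = "\<lambda>A. SUP B\<in>{B \<in> sets M. B \<subseteq> A}. ennreal (\<eta> B)"
  assume inf: "emeasure ?U (space ?U) = \<infinity>"
  \<comment> \<open>\<open>measure_of\<close> gives the zero measure whenever the supremum fails to
    be a measure. Infinite total mass excludes that default, so \<open>U\<close> identifies
    \<open>?U\<close> with the supremum.\<close>
  have conv: "emeasure ?U A = (if A \<in> sets M \<and> measure_space (space M) (sets M) ?S then ?S A else 0)" for A
    unfolding upper_variation_def
    by (subst emeasure_measure_of_conv) (simp add: sets.sigma_sets_eq)
  with inf have U: "emeasure ?U A = ?S A" if "A \<in> sets M" for A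
    using that conv[of A] conv[of "space ?U"] by (auto split: if_splits)
  have step: "\<exists>B. (B \<in> sets M \<and> emeasure ?U B = \<infinity> \<and> real n \<le> \<bar>\<eta> B\<bar>) \<and> B \<subseteq> A"
    if A: "A \<in> sets M" "emeasure ?U A = \<infinity>" for A n
  proof -
    \<comment> \<open>The margin |eta A| makes both pieces large: \<open>\<eta> B\<close> exceeds
      \<open>n\<close>, and \<open>\<eta> (A - B)\<close> lies below \<open>- n\<close>.\<close>
    have "ennreal (real n + \<bar>\<eta> A\<bar>) < ?S A"
      unfolding U[OF A(1), symmetric] A(2) infinity_ennreal_def by (rule ennreal_less_top)
    then obtain B where B: "B \<in> sets M" "B \<subseteq> A" "ennreal (real n + \<bar>\<eta> A\<bar>) < ennreal (\<eta> B)"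
      by (auto simp: less_SUP_iff)
    from B(3) have large: "real n + \<bar>\<eta> A\<bar> < \<eta> B" by (subst (asm) ennreal_less_iff) auto
    have d: "\<eta> (A - B) = \<eta> A - \<eta> B" by (rule finite_signed_measure_Diff[OF \<eta> A(1) B(1,2)])
    have "emeasure ?U A = emeasure ?U B + emeasure ?U (A - B)"
      using A B by (subst plus_emeasure) (auto simp: Un_absorb1)
    then have "emeasure ?U B = \<infinity> \<or> emeasure ?U (A - B) = \<infinity>" using A by (metis ennreal_add_eq_top infinity_ennreal_def)
    then show ?thesis
    proof
      assume "emeasure ?U B = \<infinity>"
      then show ?thesis using B large by (intro exI[of _ B]) auto
    next
      assume "emeasure ?U (A - B) = \<infinity>"
      then show ?thesis using A B large d by (intro exI[of _ "A - B"]) auto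
    qed
  qed
  have "\<exists>A. \<forall>n. (A n \<in> sets M \<and> emeasure ?U (A n) = \<infinity> \<and> real n \<le> \<bar>\<eta> (A n)\<bar>) \<and> A (Suc n) \<subseteq> A n"
  proof (rule dependent_nat_choice)
    show "\<exists>A. A \<in> sets M \<and> emeasure ?U A = \<infinity> \<and> real 0 \<le> \<bar>\<eta> A\<bar>"
      using inf by (intro exI[of _ "space M"]) auto
  qed (use step in blast)
  then obtain A where A: "\<And>n. A n \<in> sets M" "\<And>n. A (Suc n) \<subseteq> A n" "\<And>n. real n \<le> \<bar>\<eta> (A n)\<bar>"
    by blast
  obtain K where "\<And>n. \<bar>\<eta> (A n)\<bar> \<le> K"
    using decseq_finite_signed_measure_bounded[where A = A, OF \<eta> A(1) A(2)] by (auto simp: Bseq_def)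
  moreover obtain n where "K < real n" using reals_Archimedean2 by blast
  ultimately show False using A(3)[of n] by (meson leD le_less_trans order_trans)
qed

lemma finite_measure_lower_variation:
  "finite_signed_measure M \<eta> \<Longrightarrow> finite_measure (lower_variation M \<eta>)"
  unfolding lower_variation_def
  by (intro finite_measure_upper_variation finite_signed_measure_uminus)

lemma finite_measure_total_variation:
  assumes "finite_signed_measure M \<eta>"
  shows "finite_measure (total_variation M \<eta>)"
proof -
  interpret P: finite_measure "upper_variation M \<eta>" by (rule finite_measure_upper_variation[OF assms])
  interpret N: finite_measure "lower_variation M \<eta>" by (rule finite_measure_lower_variation[OF assms])
  show ?thesis
    using P.emeasure_finite N.emeasure_finite by (intro finite_measureI) (simp add: emeasure_total_variation)
qed

lemma nn_integral_mono_emeasure: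
  assumes s: "sets N = sets M" and le: "\<And>A. A \<in> sets M \<Longrightarrow> emeasure N A \<le> emeasure M A"
  shows "(\<integral>\<^sup>+x. f x \<partial>N) \<le> (\<integral>\<^sup>+x. f x \<partial>M)"
proof -
  have sp: "space N = space M" by (rule sets_eq_imp_space_eq[OF s])
  have sf: "simple_function N g \<longleftrightarrow> simple_function M g" for g :: "'a \<Rightarrow> ennreal"
    unfolding simple_function_def s sp ..
  have "integral\<^sup>S N g \<le> integral\<^sup>S M g" if "simple_function M g" for g
    unfolding simple_integral_def sp
    using that by (intro sum_mono mult_left_mono le) (auto simp: simple_function_def)
  then show ?thesis
    unfolding nn_integral_def by (intro SUP_subset_mono) (auto simp: sf le_fun_def)
qed

text \<open>Both variations are dominated by their sum, so Radon-Nikodym gives densities, and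
  \<open>\<sigma>\<close> is their difference. The same \<open>\<sigma>\<close> serves real
  integrands, for the paths of a process, and complex ones, for the transform of
  \<open>\<eta>\<close>.\<close>

lemma signed_integral_density:
  assumes \<eta>: "finite_signed_measure M \<eta>"
  obtains \<sigma> where "\<sigma> \<in> borel_measurable M"
    "\<And>f :: 'a \<Rightarrow> real. integrable (total_variation M \<eta>) f \<Longrightarrow>
       integrable (total_variation M \<eta>) (\<lambda>x. \<sigma> x * f x) \<and>
       signed_integral M \<eta> f = (LINT x|total_variation M \<eta>. \<sigma> x * f x)"
    "\<And>f :: 'a \<Rightarrow> complex. integrable (total_variation M \<eta>) f \<Longrightarrow>
       integrable (total_variation M \<eta>) (\<lambda>x. of_real (\<sigma> x) * f x) \<and>
       signed_integral M \<eta> f = (LINT x|total_variation M \<eta>. of_real (\<sigma> x) * f x)"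
proof -
  let ?T = "total_variation M \<eta>" and ?P = "upper_variation M \<eta>" and ?N = "lower_variation M \<eta>"
  interpret T: finite_measure ?T by (rule finite_measure_total_variation[OF \<eta>])
  have dens: "\<exists>p. p \<in> borel_measurable M \<and> (\<forall>x. 0 \<le> p x) \<and> Q = density ?T (\<lambda>x. ennreal (p x))"
    if Q: "finite_measure Q" "sets Q = sets ?T" and le: "\<And>A. emeasure Q A \<le> emeasure ?T A" for Q
  proof -
    have ac: "absolutely_continuous ?T Q"
    proof (unfold absolutely_continuous_def, rule subsetI)
      fix A assume "A \<in> null_sets ?T"
      then show "A \<in> null_sets Q" using le[of A] Q(2) by (auto simp: null_sets_def)
    qed
    obtain D where D: "D \<in> borel_measurable ?T" "AE x in ?T. RN_deriv ?T Q x = ennreal (D x)" "\<And>x. 0 \<le> D x"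
      using T.real_RN_deriv[OF Q(1) ac Q(2)] by blast
    have "Q = density ?T (RN_deriv ?T Q)" using T.density_RN_deriv[OF ac Q(2)] by simp
    also have "\<dots> = density ?T (\<lambda>x. ennreal (D x))"
      using D by (intro density_cong) auto
    finally show ?thesis using D by (auto simp: measurable_cong_sets[OF sets_total_variation refl])
  qed
  obtain p where p: "p \<in> borel_measurable M" "\<And>x. 0 \<le> p x" "?P = density ?T (\<lambda>x. ennreal (p x))"
    using dens[OF finite_measure_upper_variation[OF \<eta>]] by (auto simp: emeasure_total_variation)
  obtain n where n: "n \<in> borel_measurable M" "\<And>x. 0 \<le> n x" "?N = density ?T (\<lambda>x. ennreal (n x))"
    using dens[OF finite_measure_lower_variation[OF \<eta>]] by (auto simp: emeasure_total_variation)
  have [measurable]: "p \<in> borel_measurable ?T" "n \<in> borel_measurable ?T" using p n by simp_all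
  have P: "integrable ?T (\<lambda>x. p x *\<^sub>R f x) \<and> integral\<^sup>L ?P f = (LINT x|?T. p x *\<^sub>R f x)"
    if f: "integrable ?T f" for f :: "'a \<Rightarrow> 'b :: {banach, second_countable_topology}"
  proof -
    have [measurable]: "f \<in> borel_measurable ?T" using f by auto
    have "(\<integral>\<^sup>+x. norm (f x) \<partial>?P) \<le> (\<integral>\<^sup>+x. norm (f x) \<partial>?T)"
      by (rule nn_integral_mono_emeasure) (auto simp: emeasure_total_variation)
    also have "\<dots> < \<infinity>" using f by (simp add: integrable_iff_bounded)
    finally have "integrable ?P f" by (intro integrableI_bounded) auto
    then have "integrable (density ?T (\<lambda>x. ennreal (p x))) f" by (simp only: p(3))
    moreover have "integral\<^sup>L ?P f = integral\<^sup>L (density ?T (\<lambda>x. ennreal (p x))) f" by (simp only: p(3))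
    ultimately show ?thesis using p(2) by (simp add: integrable_density integral_density)
  qed
  have N: "integrable ?T (\<lambda>x. n x *\<^sub>R f x) \<and> integral\<^sup>L ?N f = (LINT x|?T. n x *\<^sub>R f x)"
    if f: "integrable ?T f" for f :: "'a \<Rightarrow> 'b :: {banach, second_countable_topology}"
  proof -
    have [measurable]: "f \<in> borel_measurable ?T" using f by auto
    have "(\<integral>\<^sup>+x. norm (f x) \<partial>?N) \<le> (\<integral>\<^sup>+x. norm (f x) \<partial>?T)"
      by (rule nn_integral_mono_emeasure) (auto simp: emeasure_total_variation)
    also have "\<dots> < \<infinity>" using f by (simp add: integrable_iff_bounded)
    finally have "integrable ?N f" by (intro integrableI_bounded) auto
    then have "integrable (density ?T (\<lambda>x. ennreal (n x))) f" by (simp only: n(3))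
    moreover have "integral\<^sup>L ?N f = integral\<^sup>L (density ?T (\<lambda>x. ennreal (n x))) f" by (simp only: n(3))
    ultimately show ?thesis using n(2) by (simp add: integrable_density integral_density)
  qed
  show ?thesis
  proof (rule that[of "\<lambda>x. p x - n x"])
    show "(\<lambda>x. p x - n x) \<in> borel_measurable M" using p n by measurable
    fix f :: "'a \<Rightarrow> real" assume f: "integrable ?T f"
    show "integrable ?T (\<lambda>x. (p x - n x) * f x) \<and> signed_integral M \<eta> f = (LINT x|?T. (p x - n x) * f x)"
      using P[OF f] N[OF f] by (simp add: signed_integral_def left_diff_distrib)
  next
    fix f :: "'a \<Rightarrow> complex" assume f: "integrable ?T f"
    show "integrable ?T (\<lambda>x. of_real (p x - n x) * f x) \<and> signed_integral M \<eta> f = (LINT x|?T. of_real (p x - n x) * f x)"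
      using P[OF f] N[OF f] by (simp add: signed_integral_def left_diff_distrib scaleR_conv_of_real)
  qed
qed

section \<open>Second moments of Levy processes\<close>

lemma distr_eq_moments:
  fixes X Y :: "'a \<Rightarrow> real"
  assumes [measurable]: "X \<in> borel_measurable M" "Y \<in> borel_measurable N"
    and e: "distr M borel X = distr N borel Y"
  shows "square_integrable M X \<longleftrightarrow> square_integrable N Y"
    and "integrable M X \<longleftrightarrow> integrable N Y"
    and "(LINT x|M. X x) = (LINT x|N. Y x)"
    and "(LINT x|M. (X x)\<^sup>2) = (LINT x|N. (Y x)\<^sup>2)"
proof -
  have i: "integrable M (\<lambda>x. f (X x)) \<longleftrightarrow> integrable N (\<lambda>x. f (Y x))" and
    l: "(LINT x|M. f (X x)) = (LINT x|N. f (Y x))" if [measurable]: "f \<in> borel_measurable borel" for f :: "real \<Rightarrow> real"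
  proof -
    have "integrable M (\<lambda>x. f (X x)) \<longleftrightarrow> integrable (distr M borel X) f"
      by (rule integrable_distr_eq[symmetric]) auto
    also have "\<dots> \<longleftrightarrow> integrable N (\<lambda>x. f (Y x))"
      unfolding e by (rule integrable_distr_eq) auto
    finally show "integrable M (\<lambda>x. f (X x)) \<longleftrightarrow> integrable N (\<lambda>x. f (Y x))" .
    have "(LINT x|M. f (X x)) = integral\<^sup>L (distr M borel X) f"
      by (rule integral_distr[symmetric]) auto
    also have "\<dots> = (LINT x|N. f (Y x))"
      unfolding e by (rule integral_distr) auto
    finally show "(LINT x|M. f (X x)) = (LINT x|N. f (Y x))" .
  qed
  show "square_integrable M X \<longleftrightarrow> square_integrable N Y"
    using i[of "\<lambda>x. x\<^sup>2"] by (simp add: square_integrable_real)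
  show "integrable M X \<longleftrightarrow> integrable N Y" using i[of "\<lambda>x. x"] by simp
  show "(LINT x|M. X x) = (LINT x|N. Y x)" using l[of "\<lambda>x. x"] by simp
  show "(LINT x|M. (X x)\<^sup>2) = (LINT x|N. (Y x)\<^sup>2)" using l[of "\<lambda>x. x\<^sup>2"] by simp
qed

section \<open>Independence and square integrability\<close>

context prob_space
begin

lemma square_integrable_integrable:
  fixes f :: "'a \<Rightarrow> real"
  assumes "square_integrable M f"
  shows "integrable M f"
proof (rule square_integrable_imp_integrable)
  show "f \<in> borel_measurable M" "integrable M (\<lambda>x. (f x)\<^sup>2)" using assms by (auto simp: square_integrable_real)
qed

lemma square_integrable_const: "square_integrable M (\<lambda>_. c :: real)"
  by (simp add: square_integrable_real)

text \<open>By independence and Fubini, X + y is square integrable for almost every value y of Y,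
  and one such y is enough. This carries second moments from integer times to the times in
  between.\<close>

lemma indep_sum_square_integrable:
  fixes X Y :: "'a \<Rightarrow> real"
  assumes ind: "indep_var borel X borel Y" and s: "square_integrable M (\<lambda>\<omega>. X \<omega> + Y \<omega>)"
  shows "square_integrable M X"
proof -
  have m[measurable]: "X \<in> borel_measurable M" "Y \<in> borel_measurable M"
    and d: "distr M borel X \<Otimes>\<^sub>M distr M borel Y = distr M (borel \<Otimes>\<^sub>M borel) (\<lambda>x. (X x, Y x))"
    using ind by (auto simp: indep_var_distribution_eq)
  interpret PX: prob_space "distr M borel X" by (rule prob_space_distr) measurable
  interpret PY: prob_space "distr M borel Y" by (rule prob_space_distr) measurable
  interpret pair_sigma_finite "distr M borel X" "distr M borel Y" ..
  have "(\<integral>\<^sup>+y. \<integral>\<^sup>+x. ennreal ((x + y)\<^sup>2) \<partial>distr M borel X \<partial>distr M borel Y)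
      = (\<integral>\<^sup>+z. ennreal ((fst z + snd z)\<^sup>2) \<partial>(distr M borel X \<Otimes>\<^sub>M distr M borel Y))"
    by (subst nn_integral_snd[symmetric]) auto
  also have "\<dots> = (\<integral>\<^sup>+\<omega>. ennreal ((X \<omega> + Y \<omega>)\<^sup>2) \<partial>M)"
    unfolding d by (subst nn_integral_distr) auto
  also have "\<dots> \<noteq> \<infinity>" unfolding square_integrable_nn_integral[OF s] by simp
  finally have "AE y in distr M borel Y. (\<integral>\<^sup>+x. ennreal ((x + y)\<^sup>2) \<partial>distr M borel X) \<noteq> \<infinity>"
    by (intro nn_integral_noteq_infinite) auto
  then obtain y where y: "(\<integral>\<^sup>+x. ennreal ((x + y)\<^sup>2) \<partial>distr M borel X) \<noteq> \<infinity>"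
    using eventually_happens'[OF PY.ae_filter_bot] by blast
  have "(\<integral>\<^sup>+x. ennreal ((x + y)\<^sup>2) \<partial>distr M borel X) = (\<integral>\<^sup>+\<omega>. ennreal ((X \<omega> + y)\<^sup>2) \<partial>M)"
    by (subst nn_integral_distr) auto
  with y have "(\<integral>\<^sup>+\<omega>. ennreal ((X \<omega> + y)\<^sup>2) \<partial>M) < \<infinity>" by (simp add: less_top)
  then have "integrable M (\<lambda>\<omega>. (X \<omega> + y)\<^sup>2)" by (intro integrableI_bounded) auto
  then have "square_integrable M (\<lambda>\<omega>. X \<omega> + y)" by (simp add: square_integrable_real)
  from square_integrable_diff[OF this square_integrable_const[of y]] show ?thesis by simp
qed

lemma indep_vars_pair:
  fixes X :: "'i \<Rightarrow> 'a \<Rightarrow> 'b :: topological_space"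
  assumes "indep_vars (\<lambda>_. borel) X I" "i \<in> I" "j \<in> I" "i \<noteq> j"
  shows "indep_var borel (X i) borel (X j)"
proof -
  have "indep_vars (\<lambda>k. borel) (\<lambda>k. case_bool (X i) (X j) k) UNIV"
    unfolding indep_vars_def
  proof (intro conjI ballI)
    show "random_variable borel (case k of True \<Rightarrow> X i | False \<Rightarrow> X j)" for k
      using assms by (auto simp: indep_vars_def split: bool.split)
    let ?F = "\<lambda>i. sigma_sets (space M) {X i -` A \<inter> space M |A. A \<in> sets borel}"
    have F: "indep_sets ?F I" using assms by (auto simp: indep_vars_def)
    have "indep_sets (\<lambda>k. ?F (if k then i else j)) UNIV"
      unfolding indep_sets_def
    proof (intro conjI ballI allI impI)
      show "?F (if k then i else j) \<subseteq> events" for k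
        using F assms by (auto simp: indep_sets_def)
      fix J :: "bool set" and A assume J: "J \<subseteq> UNIV" "J \<noteq> {}" "finite J"
        and A: "A \<in> (\<Pi> k\<in>J. ?F (if k then i else j))"
      define r where "r k = (if k then i else j)" for k
      have inj: "inj_on r J" using assms(4) by (auto simp: inj_on_def r_def split: if_splits)
      \<comment> \<open>As \<open>i\<close> and \<open>j\<close> differ, \<open>n = i\<close>
        recovers the label \<open>k\<close> from the index \<open>r k\<close>.\<close>
      let ?A = "\<lambda>n. A (n = i)"
      have r: "(r k = i) = k" for k using assms(4) by (auto simp: r_def)
      have "\<forall>n\<in>r ` J. ?A n \<in> ?F n"
      proof
        fix n assume "n \<in> r ` J"
        then obtain k where "k \<in> J" "n = r k" by auto
        then show "?A n \<in> ?F n" using A r[of k] by (auto simp: Pi_iff r_def)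
      qed
      moreover have "r ` J \<subseteq> I" using assms by (auto simp: r_def)
      ultimately have "prob (\<Inter>n\<in>r ` J. ?A n) = (\<Prod>n\<in>r ` J. prob (?A n))"
        using J by (intro indep_setsD[OF F]) auto
      also have "\<dots> = (\<Prod>k\<in>J. prob (A k))"
        by (subst prod.reindex[OF inj]) (simp add: r)
      finally show "prob (\<Inter>k\<in>J. A k) = (\<Prod>k\<in>J. prob (A k))" by (simp add: r image_image)
    qed
    then show "indep_sets (\<lambda>k. sigma_sets (space M)
        {(case k of True \<Rightarrow> X i | False \<Rightarrow> X j) -` A \<inter> space M |A. A \<in> sets borel}) UNIV"
      by (rule iffD1[OF indep_sets_cong, rotated 2]) (auto split: bool.split)
  qed
  moreover have "case_bool borel borel = (\<lambda>_. borel :: 'b measure)" by (auto simp: fun_eq_iff split: bool.split)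
  ultimately show ?thesis unfolding indep_var_def by simp
qed

end

text \<open>Cauchy's functional equation with nonnegativity as the regularity condition:
  \<open>V\<close> is monotone, so comparing n t with the neighbouring integers gives n |V t - t| <=
  1 for all n.\<close>

lemma additive_nonneg_linear:
  fixes V :: "real \<Rightarrow> real"
  assumes add: "\<And>s t. 0 \<le> s \<Longrightarrow> 0 \<le> t \<Longrightarrow> V (s + t) = V s + V t"
    and nonneg: "\<And>t. 0 \<le> t \<Longrightarrow> 0 \<le> V t" and one: "V 1 = 1" and t: "0 \<le> t"
  shows "V t = t"
proof (rule ccontr)
  have mult: "V (real n * t) = real n * V t" if "0 \<le> t" for n t
  proof (induction n)
    case 0
    then show ?case using add[of 0 0] by simp
  next
    case (Suc n)
    then show ?case using add[of "real n * t" t] that by (simp add: algebra_simps)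
  qed
  have mono: "V s \<le> V t" if "0 \<le> s" "s \<le> t" for s t
    using add[of s "t - s"] nonneg[of "t - s"] that by simp
  have bound: "real n * \<bar>V t - t\<bar> \<le> 1" for n
  proof -
    define k where "k = nat \<lfloor>real n * t\<rfloor>"
    have k: "real k \<le> real n * t" "real n * t \<le> real (Suc k)"
      using t unfolding k_def by auto linarith+
    have "real k \<le> real n * V t" using mono[of "real k" "real n * t"] k mult[of 1 k] mult[OF t, of n] one by simp
    moreover have "real n * V t \<le> real (Suc k)"
      using mono[of "real n * t" "real (Suc k)"] k t mult[of 1 "Suc k"] mult[OF t, of n] one by simp
    ultimately have "\<bar>real n * V t - real n * t\<bar> \<le> 1" using k by simp
    then show ?thesis by (simp add: abs_mult right_diff_distrib[symmetric])
  qed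
  assume "V t \<noteq> t"
  then obtain n where "1 < real n * \<bar>V t - t\<bar>" using reals_Archimedean3[of "\<bar>V t - t\<bar>"] by auto
  with bound[of n] show False by simp
qed

section \<open>One-sided Levy processes\<close>

locale levy = prob_space M for M :: "'w measure" +
  fixes L :: "real \<Rightarrow> 'w \<Rightarrow> real"
  assumes levy: "levy_process M L"
begin

lemma measurable_levy [measurable]: "0 \<le> t \<Longrightarrow> L t \<in> borel_measurable M"
  using levy by (simp add: levy_process_def)

lemma levy_0: "AE \<omega> in M. L 0 \<omega> = 0"
  using levy by (simp add: levy_process_def)

lemma indep_vars_levy:
  assumes "0 \<le> \<tau> 0" "\<And>i. i < n \<Longrightarrow> \<tau> i \<le> \<tau> (Suc i)"
  shows "indep_vars (\<lambda>_. borel) (\<lambda>i \<omega>. L (\<tau> (Suc i)) \<omega> - L (\<tau> i) \<omega>) {..<n::nat}"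
  using levy assms by (simp add: levy_process_def)

lemma distr_levy:
  "0 \<le> s \<Longrightarrow> s \<le> t \<Longrightarrow> distr M borel (\<lambda>\<omega>. L t \<omega> - L s \<omega>) = distr M borel (L (t - s))"
  using levy by (simp add: levy_process_def)

lemma indep_levy:
  assumes "0 \<le> s" "s \<le> t"
  shows "indep_var borel (\<lambda>\<omega>. L s \<omega> - L 0 \<omega>) borel (\<lambda>\<omega>. L t \<omega> - L s \<omega>)"
proof -
  define \<tau> where "\<tau> i = (if i = 0 then 0 else if i = 1 then s else t)" for i :: nat
  have "indep_vars (\<lambda>_. borel) (\<lambda>i \<omega>. L (\<tau> (Suc i)) \<omega> - L (\<tau> i) \<omega>) {..<2}"
    by (rule indep_vars_levy) (use assms in \<open>auto simp: \<tau>_def\<close>)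
  from indep_vars_pair[OF this, of 0 1] show ?thesis by (simp add: \<tau>_def)
qed

lemma levy_prob:
  assumes \<tau>: "0 \<le> \<tau> 0" "\<And>i. i < n \<Longrightarrow> \<tau> i \<le> \<tau> (Suc i)" and A: "\<And>i. i < n \<Longrightarrow> A i \<in> sets borel"
  shows "prob {\<omega> \<in> space M. \<forall>i<n. L (\<tau> (Suc i)) \<omega> - L (\<tau> i) \<omega> \<in> A i}
       = (\<Prod>i<n. measure (distr M borel (L (\<tau> (Suc i) - \<tau> i))) (A i))"
proof (cases "n = 0")
  case True
  then show ?thesis by (simp add: prob_space)
next
  case False
  have pos: "0 \<le> \<tau> i" if "i \<le> n" for i
    using that by (induction i) (use \<tau> in \<open>auto intro: order_trans simp: Suc_le_eq\<close>)
  let ?D = "\<lambda>i \<omega>. L (\<tau> (Suc i)) \<omega> - L (\<tau> i) \<omega>"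
  have "{\<omega> \<in> space M. \<forall>i<n. ?D i \<omega> \<in> A i} = (\<Inter>i\<in>{..<n}. ?D i -` A i \<inter> space M)"
    using False by auto
  also have "prob \<dots> = (\<Prod>i<n. prob (?D i -` A i \<inter> space M))"
    by (rule indep_varsD[OF indep_vars_levy[of \<tau> n]]) (use False \<tau> A in auto)
  also have "\<dots> = (\<Prod>i<n. measure (distr M borel (L (\<tau> (Suc i) - \<tau> i))) (A i))"
  proof (rule prod.cong[OF refl])
    fix i assume i: "i \<in> {..<n}"
    then have [measurable]: "L (\<tau> (Suc i)) \<in> borel_measurable M" "L (\<tau> i) \<in> borel_measurable M"
      using pos[of i] pos[of "Suc i"] by auto
    have "prob (?D i -` A i \<inter> space M) = measure (distr M borel (?D i)) (A i)"
      using A i by (subst measure_distr) auto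
    then show "prob (?D i -` A i \<inter> space M) = measure (distr M borel (L (\<tau> (Suc i) - \<tau> i))) (A i)"
      using distr_levy[of "\<tau> i" "\<tau> (Suc i)"] pos[of i] \<tau>(2)[of i] i by simp
  qed
  finally show ?thesis .
qed

end

locale standard_levy = levy +
  assumes sq1: "square_integrable M (L 1)" and mean1: "(LINT \<omega>|M. L 1 \<omega>) = 0"
    and var1: "(LINT \<omega>|M. (L 1 \<omega>)\<^sup>2) = 1"
begin

lemma sq_levy_incr_iff:
  assumes "0 \<le> s" "s \<le> t"
  shows "square_integrable M (\<lambda>\<omega>. L t \<omega> - L s \<omega>) \<longleftrightarrow> square_integrable M (L (t - s))"
  using assms by (intro distr_eq_moments(1) distr_levy) auto

lemma sq_levy_0: "square_integrable M (L 0)"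
  by (rule square_integrable_cong_AE[OF square_integrable_zero]) (use levy_0 in auto)

lemma sq_levy:
  assumes "0 \<le> t" shows "square_integrable M (L t)"
proof -
  have n: "square_integrable M (L (real n))" for n
  proof (induction n)
    case 0
    then show ?case using sq_levy_0 by simp
  next
    case (Suc n)
    have "square_integrable M (\<lambda>\<omega>. L (real (Suc n)) \<omega> - L (real n) \<omega>)"
      using sq1 by (subst sq_levy_incr_iff) auto
    from square_integrable_add[OF this Suc] show ?case by simp
  qed
  obtain n where n_t: "t \<le> real n" using real_arch_simple by blast
  have "square_integrable M (\<lambda>\<omega>. (L t \<omega> - L 0 \<omega>) + (L (real n) \<omega> - L t \<omega>))"
    using square_integrable_diff[OF n[of n] sq_levy_0] by simp
  from indep_sum_square_integrable[OF indep_levy this] have "square_integrable M (\<lambda>\<omega>. L t \<omega> - L 0 \<omega>)"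
    using assms n_t by simp
  from square_integrable_add[OF this sq_levy_0] show ?thesis by simp
qed

lemma integrable_levy: "0 \<le> t \<Longrightarrow> integrable M (L t)"
  by (intro square_integrable_integrable sq_levy)

text \<open>The variance is additive and nonnegative, hence linear. The mean is additive too, but of
  no known sign, so additivity settles only rational times. For the others the mean is pushed onto
  increments of vanishing length: their variance tends to 0, so they converge to their common mean,
  whereas right continuity at 0 sends them to 0.\<close>

lemma levy_moments:
  assumes t: "0 \<le> t"
  shows "(LINT \<omega>|M. L t \<omega>) = 0" and "(LINT \<omega>|M. (L t \<omega>)\<^sup>2) = t"
    and levy_cov': "0 \<le> s \<Longrightarrow> s \<le> t \<Longrightarrow> (LINT \<omega>|M. L s \<omega> * L t \<omega>) = s"
proof -
  define m v where "m t = (LINT \<omega>|M. L t \<omega>)" and "v t = (LINT \<omega>|M. (L t \<omega>)\<^sup>2)" for t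
  have incr: "(LINT \<omega>|M. L t \<omega> - L s \<omega>) = m (t - s)" "(LINT \<omega>|M. (L t \<omega> - L s \<omega>)\<^sup>2) = v (t - s)"
    if "0 \<le> s" "s \<le> t" for s t
    unfolding m_def v_def using that by (auto intro!: distr_eq_moments(3,4) distr_levy)
  have m_add: "m (s + t) = m s + m t" if "0 \<le> s" "0 \<le> t" for s t
    using incr(1)[of s "s + t"] that by (simp add: m_def integrable_levy)
  have cross: "(LINT \<omega>|M. L s \<omega> * (L t \<omega> - L s \<omega>)) = m s * m (t - s)" if "0 \<le> s" "s \<le> t" for s t
  proof -
    have "(LINT \<omega>|M. L s \<omega> * (L t \<omega> - L s \<omega>)) = (LINT \<omega>|M. (L s \<omega> - L 0 \<omega>) * (L t \<omega> - L s \<omega>))"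
      using levy_0 that by (intro integral_cong_AE) auto
    also have "\<dots> = (LINT \<omega>|M. L s \<omega> - L 0 \<omega>) * (LINT \<omega>|M. L t \<omega> - L s \<omega>)"
      using that by (intro indep_var_lebesgue_integral indep_levy Bochner_Integration.integrable_diff integrable_levy) auto
    finally show ?thesis using that by (simp add: incr)
  qed
  have v_add: "v (s + t) = v s + v t + 2 * (m s * m t)" if "0 \<le> s" "0 \<le> t" for s t
  proof -
    have sq: "square_integrable M (L s)" "square_integrable M (\<lambda>\<omega>. L (s + t) \<omega> - L s \<omega>)"
      using that by (auto intro!: square_integrable_diff sq_levy)
    have "v (s + t) = (LINT \<omega>|M. (L s \<omega>)\<^sup>2 + (L (s + t) \<omega> - L s \<omega>)\<^sup>2 + 2 * (L s \<omega> * (L (s + t) \<omega> - L s \<omega>)))"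
      unfolding v_def by (intro Bochner_Integration.integral_cong) (auto simp: power2_eq_square algebra_simps)
    also have "\<dots> = v s + v t + 2 * (m s * m t)"
      using square_integrable_mult[OF sq] sq that incr(2)[of s "s + t"] cross[of s "s + t"]
      by (simp add: square_integrable_real v_def)
    finally show ?thesis .
  qed
  \<comment> \<open>The second moment is additive only up to a product of means; passing to the
    variance removes it.\<close>
  define V where "V t = v t - (m t)\<^sup>2" for t
  have "V (s + t) = V s + V t" if "0 \<le> s" "0 \<le> t" for s t
    unfolding V_def v_add[OF that] m_add[OF that] by (simp add: power2_eq_square algebra_simps)
  moreover have "0 \<le> V t" if "0 \<le> t" for t
  proof -
    have "variance (L t) = V t"
      using variance_eq[of "L t"] sq_levy[OF that] integrable_levy[OF that]
      by (simp add: V_def v_def m_def square_integrable_real)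
    moreover have "0 \<le> variance (L t)" by (rule Bochner_Integration.integral_nonneg) simp
    ultimately show ?thesis by linarith
  qed
  moreover have "V 1 = 1" by (simp add: V_def v_def m_def mean1 var1)
  ultimately have V: "V t = t" if "0 \<le> t" for t using additive_nonneg_linear[of V t] that by blast
  have m_mult: "m (real n * t) = real n * m t" if "0 \<le> t" for n t
  proof (induction n)
    case 0
    then show ?case using m_add[of 0 0] by simp
  next
    case (Suc n)
    then show ?case using m_add[of "real n * t" t] that by (simp add: algebra_simps)
  qed
  have m_rat: "m (real k / real n) = 0" if "0 < n" for k n
  proof -
    have "real n * m (real k / real n) = m (real k)" using m_mult[of "real k / real n" n] that by simp
    also have "\<dots> = 0" using m_mult[of 1 k] by (simp add: m_def mean1)
    finally show ?thesis using that by simp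
  qed
  have m0: "m t = 0" if "0 \<le> t" for t
  proof (cases "t = 0")
    case True
    then show ?thesis using m_add[of 0 0] by simp
  next
    case False
    with that have t: "0 < t" by simp
    \<comment> \<open>The largest integer strictly below (n + 1) t, so that the remainder
      \<open>\<delta> n\<close> is strictly positive and tends to 0 from the right.\<close>
    define k where "k n = nat (\<lceil>real (Suc n) * t\<rceil> - 1)" for n
    define \<delta> where "\<delta> n = t - real (k n) / real (Suc n)" for n
    have kn: "real (k n) < real (Suc n) * t" "real (Suc n) * t \<le> real (k n) + 1" for n
    proof -
      have "0 < real (Suc n) * t" using t by simp
      then have "1 \<le> \<lceil>real (Suc n) * t\<rceil>" by (simp del: of_nat_Suc)
      then have "real (k n) = real_of_int \<lceil>real (Suc n) * t\<rceil> - 1" unfolding k_def by simp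
      then show "real (k n) < real (Suc n) * t" "real (Suc n) * t \<le> real (k n) + 1" by linarith+
    qed
    have \<delta>: "0 < \<delta> n" "\<delta> n \<le> inverse (real (Suc n))" for n
    proof -
      define N where "N = real (Suc n)"
      have N: "0 < N" by (simp add: N_def)
      have "N * \<delta> n = N * t - real (k n)" using N by (simp add: \<delta>_def N_def[symmetric] right_diff_distrib del: of_nat_Suc)
      then have "0 < N * \<delta> n" "\<delta> n * N \<le> 1" using kn[of n] by (simp_all add: N_def[symmetric] mult.commute del: of_nat_Suc)
      then show "0 < \<delta> n" "\<delta> n \<le> inverse (real (Suc n))"
        using N by (simp_all add: zero_less_mult_iff N_def[symmetric] inverse_eq_divide pos_le_divide_eq del: of_nat_Suc)
    qed
    have m\<delta>': "m t = m (\<delta> n) + m (real (k n) / real (Suc n))" for n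
      using m_add[of "\<delta> n" "real (k n) / real (Suc n)"] \<delta>[of n] by (simp add: \<delta>_def)
    \<comment> \<open>The rational part of \<open>t\<close> has mean 0, so every remainder carries
      the whole mean of \<open>L t\<close>.\<close>
    have m\<delta>: "m (\<delta> n) = m t" for n using m\<delta>'[of n] m_rat[of "Suc n" "k n"] by linarith
    have lim\<delta>: "\<delta> \<longlonglongrightarrow> 0"
      by (rule tendsto_sandwich[OF _ _ tendsto_const LIMSEQ_inverse_real_of_nat]) (use \<delta> in \<open>auto intro!: always_eventually less_imp_le simp del: of_nat_Suc\<close>)
    then have fl: "filterlim \<delta> (at_right 0) sequentially"
      unfolding filterlim_at using \<delta> lim\<delta> by (auto intro!: always_eventually simp: less_imp_neq[symmetric])
    have sq\<delta>: "square_integrable M (L (\<delta> n))" for n using \<delta>[of n] by (intro sq_levy) simp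
    have "L2_tendsto M (\<lambda>n. L (\<delta> n)) (\<lambda>_. m t)"
      unfolding L2_tendsto_real
    proof (intro conjI allI sq\<delta> square_integrable_const)
      have "(LINT \<omega>|M. (L (\<delta> n) \<omega> - m t)\<^sup>2) = \<delta> n" for n
      proof -
        have "(LINT \<omega>|M. (L (\<delta> n) \<omega> - m t)\<^sup>2) = variance (L (\<delta> n))"
          using m\<delta>[of n] by (simp add: m_def)
        also have "\<dots> = V (\<delta> n)" using sq\<delta>[of n] square_integrable_integrable[OF sq\<delta>[of n]]
          by (subst variance_eq) (auto simp: V_def v_def m_def square_integrable_real)
        finally show ?thesis using V \<delta>[of n] by simp
      qed
      then show "(\<lambda>n. LINT \<omega>|M. (L (\<delta> n) \<omega> - m t)\<^sup>2) \<longlonglongrightarrow> 0" using lim\<delta> by simp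
    qed
    then obtain r where r: "strict_mono r" "AE \<omega> in M. (\<lambda>k. L (\<delta> (r k)) \<omega>) \<longlonglongrightarrow> m t"
      by (rule L2_tendsto_AE_subseq)
    have "AE \<omega> in M. ((\<lambda>s. L s \<omega>) \<longlongrightarrow> L 0 \<omega>) (at_right 0)"
      using levy by (auto simp: levy_process_def)
    with r(2) levy_0 have "AE \<omega> in M. m t = 0"
    proof eventually_elim
      case (elim \<omega>)
      have "filterlim (\<lambda>k. \<delta> (r k)) (at_right 0) sequentially"
        by (rule filterlim_compose[OF fl filterlim_subseq[OF r(1)]])
      from filterlim_compose[OF elim(3) this] have "(\<lambda>k. L (\<delta> (r k)) \<omega>) \<longlonglongrightarrow> L 0 \<omega>" .
      with elim(1,2) show ?case using LIMSEQ_unique by fastforce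
    qed
    then show ?thesis by simp
  qed
  show "(LINT \<omega>|M. L t \<omega>) = 0" using m0[OF t] by (simp add: m_def)
  have v: "v t = t" if "0 \<le> t" for t using V[OF that] m0[OF that] by (simp add: V_def)
  then show "(LINT \<omega>|M. (L t \<omega>)\<^sup>2) = t" using t by (simp add: v_def)
  assume s: "0 \<le> s" "s \<le> t"
  have "(LINT \<omega>|M. L s \<omega> * L t \<omega>) = (LINT \<omega>|M. (L s \<omega>)\<^sup>2 + L s \<omega> * (L t \<omega> - L s \<omega>))"
    by (intro Bochner_Integration.integral_cong) (auto simp: power2_eq_square algebra_simps)
  also have "\<dots> = v s + m s * m (t - s)"
    unfolding cross[OF s, symmetric] v_def
    using sq_levy[OF s(1)] sq_levy[OF t] square_integrable_mult[OF sq_levy[OF s(1)] square_integrable_diff[OF sq_levy[OF t] sq_levy[OF s(1)]]]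
    by (intro Bochner_Integration.integral_add) (auto simp: square_integrable_real)
  finally show "(LINT \<omega>|M. L s \<omega> * L t \<omega>) = s" using v m0 s by simp
qed

lemma levy_cov:
  assumes "0 \<le> s" "0 \<le> t" shows "(LINT \<omega>|M. L s \<omega> * L t \<omega>) = min s t"
  using levy_cov'[of t s] levy_cov'[of s t] assms by (cases "s \<le> t") (auto simp: mult.commute min_def)

text \<open>The variance of L t - L s is t - s, so L s tends to L t in L^2 and, along a subsequence,
  almost surely. Hence at a fixed time a left limit almost surely equals the value there, which
  removes the left limits from the definition of the two-sided process.\<close>

lemma levy_left_limit:
  assumes t: "0 < t"
  shows "AE \<omega> in M. \<forall>l. ((\<lambda>s. L s \<omega>) \<longlongrightarrow> l) (at_left t) \<longrightarrow> l = L t \<omega>"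
proof -
  define s where "s n = t - t * inverse (real (Suc n))" for n
  have lims: "s \<longlonglongrightarrow> t"
    unfolding s_def using tendsto_diff[OF tendsto_const tendsto_mult[OF tendsto_const LIMSEQ_inverse_real_of_nat], of t t] by simp
  have s: "0 \<le> s n" "s n < t" for n using t by (simp_all add: s_def field_simps)
  have fl: "filterlim s (at_left t) sequentially"
    unfolding filterlim_at using lims s by (auto intro!: always_eventually simp: less_imp_neq)
  have "L2_tendsto M (\<lambda>n. L (s n)) (L t)"
    unfolding L2_tendsto_real
  proof (intro conjI allI sq_levy)
    have "(LINT \<omega>|M. (L (s n) \<omega> - L t \<omega>)\<^sup>2) = t - s n" for n
      using levy_moments(2)[of "t - s n"] s[of n] t
      by (subst power2_commute, subst distr_eq_moments(4)[OF _ _ distr_levy]) auto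
    then show "(\<lambda>n. LINT \<omega>|M. (L (s n) \<omega> - L t \<omega>)\<^sup>2) \<longlonglongrightarrow> 0"
      using tendsto_diff[OF tendsto_const lims, of t] by simp
  qed (use s t in auto)
  then obtain r where r: "strict_mono r" "AE \<omega> in M. (\<lambda>k. L (s (r k)) \<omega>) \<longlonglongrightarrow> L t \<omega>"
    by (rule L2_tendsto_AE_subseq)
  from r(2) show ?thesis
  proof eventually_elim
    case (elim \<omega>)
    have fl': "filterlim (\<lambda>k. s (r k)) (at_left t) sequentially"
      by (rule filterlim_compose[OF fl filterlim_subseq[OF r(1)]])
    show ?case
    proof (intro allI impI)
      fix l assume "((\<lambda>s. L s \<omega>) \<longlongrightarrow> l) (at_left t)"
      from filterlim_compose[OF this fl'] elim show "l = L t \<omega>" using LIMSEQ_unique by blast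
    qed
  qed
qed

end

text \<open>The integrand that represents \<open>L t\<close> for either sign of \<open>t\<close>:
  below 0 the minus sign appears because \<open>L\<close> vanishes at 0 and increments are taken
  forward in time.\<close>

definition oriented_indicator :: "real \<Rightarrow> real \<Rightarrow> real" where
  "oriented_indicator t u = indicator {0<..t} u - indicator {t<..0} u"

lemma indicator_eq_oriented_diff: "a \<le> b \<Longrightarrow> indicator {a<..b} u = oriented_indicator b u - oriented_indicator a u"
  by (auto simp: oriented_indicator_def indicator_def)

lemma integral_oriented_indicator_mult:
  "(LINT u|lborel. oriented_indicator s u * oriented_indicator t u) =
    (if 0 \<le> s \<and> 0 \<le> t then min s t else if s \<le> 0 \<and> t \<le> 0 then min (- s) (- t) else 0)"
proof -
  have 1: "(LINT u|lborel. oriented_indicator s u * oriented_indicator t u) = (LINT u|lborel. indicator {0<..min s t} u)" if "0 \<le> s" "0 \<le> t"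
    using that by (intro Bochner_Integration.integral_cong) (auto simp: oriented_indicator_def indicator_def)
  have 2: "(LINT u|lborel. oriented_indicator s u * oriented_indicator t u) = (LINT u|lborel. indicator {max s t<..0} u)" if "s \<le> 0" "t \<le> 0"
    using that by (intro Bochner_Integration.integral_cong) (auto simp: oriented_indicator_def indicator_def)
  have 3: "oriented_indicator s u * oriented_indicator t u = 0" if "(s < 0 \<and> 0 < t) \<or> (t < 0 \<and> 0 < s)" for u
    using that by (auto simp: oriented_indicator_def indicator_def)
  have 3: "(LINT u|lborel. oriented_indicator s u * oriented_indicator t u) = 0"
    if "(s < 0 \<and> 0 < t) \<or> (t < 0 \<and> 0 < s)"
    by (simp only: 3[OF that]) simp
  show ?thesis
    using 1 2 3 by (auto simp: not_le)
qed

section \<open>Two-sided Levy processes\<close>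

locale standard_two_sided_levy = prob_space M for M :: "'w measure" +
  fixes L :: "real \<Rightarrow> 'w \<Rightarrow> real"
  assumes two_sided: "two_sided_levy_process M L"
    and sq1: "square_integrable M (L 1)" and mean1: "(LINT \<omega>|M. L 1 \<omega>) = 0"
    and var1: "(LINT \<omega>|M. (L 1 \<omega>)\<^sup>2) = 1"
begin

lemma measurable_L [measurable]: "L t \<in> borel_measurable M"
  using two_sided by (simp add: two_sided_levy_process_def)

lemma measurable_path_component [measurable]: "0 \<le> t \<Longrightarrow> (\<lambda>x. x t) \<in> borel_measurable path_space"
  unfolding path_space_def by (rule measurable_component_singleton) simp

lemma two_sided_decomposition:
  obtains L1 L2 where "standard_levy M L1" "standard_levy M L2"
    "indep_var path_space (sample_path L1) path_space (sample_path L2)"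
    "\<And>t. 0 \<le> t \<Longrightarrow> AE \<omega> in M. L t \<omega> = L1 t \<omega>"
    "\<And>t. t \<le> 0 \<Longrightarrow> AE \<omega> in M. L t \<omega> = - L2 (- t) \<omega>"
    "\<And>t. 0 \<le> t \<Longrightarrow> distr M borel (L1 t) = distr M borel (L t)"
    "\<And>t. 0 \<le> t \<Longrightarrow> distr M borel (L2 t) = distr M borel (L t)"
proof -
  obtain L1 L2 where L: "levy_process M L1" "levy_process M L2"
    and ind: "indep_var path_space (sample_path L1) path_space (sample_path L2)"
    and dist: "distr M path_space (sample_path L1) = distr M path_space (sample_path L2)"
    and ae: "AE \<omega> in M. (\<forall>t\<ge>0. L t \<omega> = L1 t \<omega>) \<and>
           (\<forall>t<0. ((\<lambda>s. L2 s \<omega>) \<longlongrightarrow> - L t \<omega>) (at_left (- t)))"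
    using two_sided unfolding two_sided_levy_process_def by blast
  interpret L1: levy M L1 by standard (rule L)
  interpret L2: levy M L2 by standard (rule L)
  have ae1: "AE \<omega> in M. L t \<omega> = L1 t \<omega>" if "0 \<le> t" for t
    using ae by eventually_elim (use that in auto)
  have [measurable]: "sample_path L1 \<in> M \<rightarrow>\<^sub>M path_space" "sample_path L2 \<in> M \<rightarrow>\<^sub>M path_space"
    using ind indep_var_rv1 indep_var_rv2 by blast+
  have d1: "distr M borel (L1 t) = distr M borel (L t)" if "0 \<le> t" for t
    using ae1[OF that] that by (intro distr_cong_AE) auto
  \<comment> \<open>The two one-sided processes agree only in law on path space; evaluating paths at
    \<open>t\<close> gives equal marginals.\<close>
  have dd: "distr M borel (L' t) = distr (distr M path_space (sample_path L')) borel (\<lambda>x. x t)"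
    if "0 \<le> t" "sample_path L' \<in> M \<rightarrow>\<^sub>M path_space" for t L'
    using that by (subst distr_distr) (auto simp: o_def sample_path_def)
  have d2: "distr M borel (L2 t) = distr M borel (L t)" if "0 \<le> t" for t
    unfolding d1[OF that, symmetric] using that by (simp add: dd dist)
  note m = distr_eq_moments[OF _ _ d1[of 1]] distr_eq_moments[OF _ _ d2[of 1]]
  interpret L1: standard_levy M L1
    by standard (use m sq1 mean1 var1 in auto)
  interpret L2: standard_levy M L2
    by standard (use m sq1 mean1 var1 in auto)
  have ae2: "AE \<omega> in M. L t \<omega> = - L2 (- t) \<omega>" if "t \<le> 0" for t
  proof (cases "t = 0")
    case True
    show ?thesis using ae1[of 0] L1.levy_0 L2.levy_0 by (auto simp: True)
  next
    case False
    with that have "AE \<omega> in M. \<forall>l. ((\<lambda>s. L2 s \<omega>) \<longlongrightarrow> l) (at_left (- t)) \<longrightarrow> l = L2 (- t) \<omega>"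
      by (intro L2.levy_left_limit) simp
    with ae show ?thesis by eventually_elim (use that False in force)
  qed
  show ?thesis
    by (rule that[of L1 L2]) (use L1.standard_levy_axioms L2.standard_levy_axioms ind ae1 ae2 d1 d2 in blast)+
qed

text \<open>Times of opposite sign involve the independent halves \<open>L1\<close> and
  \<open>L2\<close>, whose means vanish, so their covariance is 0; times of equal sign reduce to one
  half.\<close>

lemma L_moments:
  shows sq_L: "square_integrable M (L t)" and mean_L: "(LINT \<omega>|M. L t \<omega>) = 0"
    and cov_L: "(LINT \<omega>|M. L s \<omega> * L t \<omega>) = (LINT u|lborel. oriented_indicator s u * oriented_indicator t u)"
proof -
  obtain L1 L2 where L1: "standard_levy M L1" and L2: "standard_levy M L2"
    and ind: "indep_var path_space (sample_path L1) path_space (sample_path L2)"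
    and ae1: "\<And>t. 0 \<le> t \<Longrightarrow> AE \<omega> in M. L t \<omega> = L1 t \<omega>"
    and ae2: "\<And>t. t \<le> 0 \<Longrightarrow> AE \<omega> in M. L t \<omega> = - L2 (- t) \<omega>"
    and "\<And>t. 0 \<le> t \<Longrightarrow> distr M borel (L1 t) = distr M borel (L t)"
    and "\<And>t. 0 \<le> t \<Longrightarrow> distr M borel (L2 t) = distr M borel (L t)"
    by (rule two_sided_decomposition) blast
  interpret L1: standard_levy M L1 by fact
  interpret L2: standard_levy M L2 by fact
  have sq2: "square_integrable M (\<lambda>\<omega>. - L2 (- t) \<omega>)" if "t \<le> 0" for t
    using square_integrable_cmult[OF L2.sq_levy[of "- t"], of "-1"] that by simp
  show "square_integrable M (L t)" for t
  proof (cases "0 \<le> t")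
    case True
    with ae1[OF True] show ?thesis
      by (intro square_integrable_cong_AE[OF L1.sq_levy[OF True]]) auto
  next
    case False
    with ae2[of t] show ?thesis
      by (intro square_integrable_cong_AE[OF sq2[of t]]) auto
  qed
  show "(LINT \<omega>|M. L t \<omega>) = 0" for t
  proof (cases "0 \<le> t")
    case True
    then have "(LINT \<omega>|M. L t \<omega>) = (LINT \<omega>|M. L1 t \<omega>)" using ae1[OF True] by (intro integral_cong_AE) auto
    then show ?thesis using L1.levy_moments(1) True by simp
  next
    case False
    then have "(LINT \<omega>|M. L t \<omega>) = (LINT \<omega>|M. - L2 (- t) \<omega>)" using ae2[of t] by (intro integral_cong_AE) auto
    then show ?thesis using L2.levy_moments(1)[of "- t"] False by simp
  qed
  have mixed: "(LINT \<omega>|M. L s \<omega> * L t \<omega>) = 0" if "0 \<le> s" "t \<le> 0" for s t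
  proof -
    have "indep_var borel ((\<lambda>x. x s) \<circ> sample_path L1) borel ((\<lambda>x. x (- t)) \<circ> sample_path L2)"
      by (rule indep_var_compose[OF ind]) (use that in auto)
    then have "indep_var borel (L1 s) borel (L2 (- t))" using that by (simp add: o_def sample_path_def)
    then have "(LINT \<omega>|M. L1 s \<omega> * L2 (- t) \<omega>) = (LINT \<omega>|M. L1 s \<omega>) * (LINT \<omega>|M. L2 (- t) \<omega>)"
      using that by (intro indep_var_lebesgue_integral L1.integrable_levy L2.integrable_levy) auto
    also have "\<dots> = 0" using L1.levy_moments(1) that by simp
    moreover have "AE \<omega> in M. L s \<omega> * L t \<omega> = - (L1 s \<omega> * L2 (- t) \<omega>)"
      using ae1[OF that(1)] ae2[OF that(2)] by eventually_elim simp
    then have "(LINT \<omega>|M. L s \<omega> * L t \<omega>) = (LINT \<omega>|M. - (L1 s \<omega> * L2 (- t) \<omega>))"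
      using that by (intro integral_cong_AE) auto
    ultimately show ?thesis by simp
  qed
  show "(LINT \<omega>|M. L s \<omega> * L t \<omega>) = (LINT u|lborel. oriented_indicator s u * oriented_indicator t u)"
  proof -
    consider "0 \<le> s" "0 \<le> t" | "s \<le> 0" "t \<le> 0" "\<not> (0 \<le> s \<and> 0 \<le> t)" | "0 < s" "t < 0" | "s < 0" "0 < t" by linarith
    then show ?thesis
    proof cases
      case 1
      have "AE \<omega> in M. L s \<omega> * L t \<omega> = L1 s \<omega> * L1 t \<omega>"
        using ae1[OF 1(1)] ae1[OF 1(2)] by eventually_elim simp
      then have "(LINT \<omega>|M. L s \<omega> * L t \<omega>) = (LINT \<omega>|M. L1 s \<omega> * L1 t \<omega>)"
        using 1 by (intro integral_cong_AE) auto
      then show ?thesis using 1 by (simp add: integral_oriented_indicator_mult L1.levy_cov)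
    next
      case 2
      have "AE \<omega> in M. L s \<omega> * L t \<omega> = L2 (- s) \<omega> * L2 (- t) \<omega>"
        using ae2[OF 2(1)] ae2[OF 2(2)] by eventually_elim simp
      then have "(LINT \<omega>|M. L s \<omega> * L t \<omega>) = (LINT \<omega>|M. L2 (- s) \<omega> * L2 (- t) \<omega>)"
        using 2 by (intro integral_cong_AE) auto
      then show ?thesis using 2 by (simp add: integral_oriented_indicator_mult L2.levy_cov)
    next
      case 3
      then show ?thesis using mixed[of s t] by (simp add: integral_oriented_indicator_mult)
    next
      case 4
      then show ?thesis using mixed[of t s] by (simp add: integral_oriented_indicator_mult mult.commute)
    qed
  qed
qed

text \<open>Because 0 is a node of the grid, each increment lies on one side of 0 and comes from
  \<open>L1\<close> or \<open>L2\<close> alone. The right-hand side depends on the grid only through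
  its mesh lengths, and this is the source of stationarity.\<close>

lemma distr_increments:
  assumes \<tau>: "\<And>i. i < n \<Longrightarrow> \<tau> i \<le> \<tau> (Suc i)" and m: "m \<le> n" "\<tau> m = 0"
  shows "distr M (\<Pi>\<^sub>M i\<in>{..<n}. borel) (\<lambda>\<omega>. \<lambda>i\<in>{..<n}. L (\<tau> (Suc i)) \<omega> - L (\<tau> i) \<omega>)
       = (\<Pi>\<^sub>M i\<in>{..<n}. distr M borel (L (\<tau> (Suc i) - \<tau> i)))"
proof -
  obtain L1 L2 where L1: "standard_levy M L1" and L2: "standard_levy M L2"
    and ind: "indep_var path_space (sample_path L1) path_space (sample_path L2)"
    and ae1: "\<And>t. 0 \<le> t \<Longrightarrow> AE \<omega> in M. L t \<omega> = L1 t \<omega>"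
    and ae2: "\<And>t. t \<le> 0 \<Longrightarrow> AE \<omega> in M. L t \<omega> = - L2 (- t) \<omega>"
    and d1: "\<And>t. 0 \<le> t \<Longrightarrow> distr M borel (L1 t) = distr M borel (L t)"
    and d2: "\<And>t. 0 \<le> t \<Longrightarrow> distr M borel (L2 t) = distr M borel (L t)"
    by (rule two_sided_decomposition) blast
  interpret L1: standard_levy M L1 by fact
  interpret L2: standard_levy M L2 by fact
  have pm: "sample_path L1 \<in> M \<rightarrow>\<^sub>M path_space" "sample_path L2 \<in> M \<rightarrow>\<^sub>M path_space"
    using ind indep_var_rv1 indep_var_rv2 by blast+
  note pm[measurable]
  have mono: "\<tau> i \<le> \<tau> j" if "i \<le> j" "j \<le> n" for i j
    using that by (induction j rule: dec_induct) (use \<tau> in \<open>auto intro: order_trans simp: Suc_le_eq\<close>)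
  have nonneg: "0 \<le> \<tau> i" if "m \<le> i" "i \<le> n" for i using mono[of m i] that m by simp
  have nonpos: "\<tau> i \<le> 0" if "i \<le> m" for i using mono[of i m] that m by simp
  let ?P = "\<lambda>i. distr M borel (L (\<tau> (Suc i) - \<tau> i))"
  interpret P: product_sigma_finite ?P
    by (simp add: product_sigma_finite_def prob_space_imp_sigma_finite prob_space_distr)
  show ?thesis
  proof (rule P.PiM_eqI)
    fix A :: "nat \<Rightarrow> real set"
    assume "\<And>i. i \<in> {..<n} \<Longrightarrow> A i \<in> sets (?P i)"
    then have A[measurable]: "A i \<in> sets borel" if "i < n" for i using that by simp
    define \<tau>1 where "\<tau>1 i = \<tau> (m + i)" for i
    \<comment> \<open>The nodes left of 0 are reflected and read in reverse, which makes them an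
      increasing sequence of times for \<open>L2\<close>; the j-th reflected increment therefore
      belongs to the set \<open>A (m - Suc j)\<close>.\<close>
    define \<tau>2 where "\<tau>2 j = - \<tau> (m - j)" for j
    define B1 where "B1 = {x \<in> space path_space. \<forall>i<n - m. x (\<tau>1 (Suc i)) - x (\<tau>1 i) \<in> A (m + i)}"
    define B2 where "B2 = {x \<in> space path_space. \<forall>j<m. x (\<tau>2 (Suc j)) - x (\<tau>2 j) \<in> A (m - Suc j)}"
    have \<tau>1: "0 \<le> \<tau>1 i" if "i \<le> n - m" for i using nonneg[of "m + i"] that m by (simp add: \<tau>1_def)
    have \<tau>2: "0 \<le> \<tau>2 j" for j using nonpos[of "m - j"] by (simp add: \<tau>2_def)
    have B1_sets: "B1 \<in> sets path_space"
      unfolding B1_def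
    proof (rule sets.sets_Collect_countable_All, goal_cases)
      case (1 i)
      show ?case
      proof (cases "i < n - m")
        case True
        then have [measurable]: "(\<lambda>x. x (\<tau>1 (Suc i))) \<in> borel_measurable path_space"
          "(\<lambda>x. x (\<tau>1 i)) \<in> borel_measurable path_space" "A (m + i) \<in> sets borel"
          using \<tau>1[of i] \<tau>1[of "Suc i"] m by auto
        show ?thesis by measurable
      qed simp
    qed
    have B2_sets: "B2 \<in> sets path_space"
      unfolding B2_def
    proof (rule sets.sets_Collect_countable_All, goal_cases)
      case (1 j)
      show ?case
      proof (cases "j < m")
        case True
        then have [measurable]: "(\<lambda>x. x (\<tau>2 (Suc j))) \<in> borel_measurable path_space"
          "(\<lambda>x. x (\<tau>2 j)) \<in> borel_measurable path_space" "A (m - Suc j) \<in> sets borel"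
          using \<tau>2 m by auto
        show ?thesis by measurable
      qed simp
    qed
    let ?E = "{\<omega> \<in> space M. \<forall>i<n. L (\<tau> (Suc i)) \<omega> - L (\<tau> i) \<omega> \<in> A i}"
    let ?F = "(\<lambda>\<omega>. (sample_path L1 \<omega>, sample_path L2 \<omega>)) -` (B1 \<times> B2) \<inter> space M"
    have E_sets: "?E \<in> sets M"
    proof (rule sets.sets_Collect_countable_All, goal_cases)
      case (1 i)
      show ?case
      proof (cases "i < n")
        case True
        note A[OF True, measurable]
        show ?thesis by measurable
      qed simp
    qed
    have F_sets: "?F \<in> sets M"
    proof -
      have "?F = (sample_path L1 -` B1 \<inter> space M) \<inter> (sample_path L2 -` B2 \<inter> space M)" by auto
      then show ?thesis using measurable_sets[OF pm(1) B1_sets] measurable_sets[OF pm(2) B2_sets] by auto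
    qed
    have "AE \<omega> in M. \<forall>i\<in>{..n}. (m \<le> i \<longrightarrow> L (\<tau> i) \<omega> = L1 (\<tau> i) \<omega>) \<and> (i \<le> m \<longrightarrow> L (\<tau> i) \<omega> = - L2 (- \<tau> i) \<omega>)"
    proof (subst AE_finite_all, simp, intro ballI)
      fix i assume i: "i \<in> {..n}"
      have a: "AE \<omega> in M. m \<le> i \<longrightarrow> L (\<tau> i) \<omega> = L1 (\<tau> i) \<omega>"
        using ae1[OF nonneg[of i]] i by (cases "m \<le> i") auto
      have b: "AE \<omega> in M. i \<le> m \<longrightarrow> L (\<tau> i) \<omega> = - L2 (- \<tau> i) \<omega>"
        using ae2[OF nonpos[of i]] i by (cases "i \<le> m") auto
      from a b show "AE \<omega> in M. (m \<le> i \<longrightarrow> L (\<tau> i) \<omega> = L1 (\<tau> i) \<omega>) \<and> (i \<le> m \<longrightarrow> L (\<tau> i) \<omega> = - L2 (- \<tau> i) \<omega>)"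
        by eventually_elim auto
    qed
    then have "AE \<omega> in M. \<omega> \<in> ?E \<longleftrightarrow> \<omega> \<in> ?F"
    proof (rule AE_mp, intro AE_I2 impI)
      fix \<omega> assume w: "\<omega> \<in> space M"
        and H: "\<forall>i\<in>{..n}. (m \<le> i \<longrightarrow> L (\<tau> i) \<omega> = L1 (\<tau> i) \<omega>) \<and> (i \<le> m \<longrightarrow> L (\<tau> i) \<omega> = - L2 (- \<tau> i) \<omega>)"
      have sp: "sample_path L1 \<omega> \<in> space path_space" "sample_path L2 \<omega> \<in> space path_space"
        using measurable_space[OF pm(1) w] measurable_space[OF pm(2) w] by auto
      have e1: "sample_path L1 \<omega> (\<tau>1 (Suc i)) - sample_path L1 \<omega> (\<tau>1 i) = L (\<tau> (Suc (m + i))) \<omega> - L (\<tau> (m + i)) \<omega>"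
        if "i < n - m" for i
        using H[rule_format, of "m + i"] H[rule_format, of "Suc (m + i)"] that \<tau>1[of i] \<tau>1[of "Suc i"]
        by (simp add: sample_path_def \<tau>1_def)
      have e2: "sample_path L2 \<omega> (\<tau>2 (Suc j)) - sample_path L2 \<omega> (\<tau>2 j) = L (\<tau> (Suc (m - Suc j))) \<omega> - L (\<tau> (m - Suc j)) \<omega>"
        if "j < m" for j
        using H[rule_format, of "m - Suc j"] H[rule_format, of "m - j"] that m(1) \<tau>2[of j] \<tau>2[of "Suc j"]
        by (simp add: sample_path_def \<tau>2_def Suc_diff_Suc)
      have "(\<forall>i<n. L (\<tau> (Suc i)) \<omega> - L (\<tau> i) \<omega> \<in> A i) \<longleftrightarrow>
          (\<forall>i<n - m. L (\<tau> (Suc (m + i))) \<omega> - L (\<tau> (m + i)) \<omega> \<in> A (m + i)) \<and>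
          (\<forall>j<m. L (\<tau> (Suc (m - Suc j))) \<omega> - L (\<tau> (m - Suc j)) \<omega> \<in> A (m - Suc j))"
        (is "?l \<longleftrightarrow> ?r1 \<and> ?r2")
      proof (intro iffI conjI)
        assume r: "?r1 \<and> ?r2"
        show ?l
        proof (intro allI impI)
          fix i assume i: "i < n"
          show "L (\<tau> (Suc i)) \<omega> - L (\<tau> i) \<omega> \<in> A i"
          proof (cases "i < m")
            case True
            then have "m - Suc (m - Suc i) = i" "m - Suc i < m" by auto
            with r show ?thesis by metis
          next
            case False
            then have "m + (i - m) = i" "i - m < n - m" using i by auto
            with r show ?thesis by metis
          qed
        qed
      qed (use m in auto)
      then show "\<omega> \<in> ?E \<longleftrightarrow> \<omega> \<in> ?F"
        using w sp e1 e2 by (simp add: B1_def B2_def)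
    qed
    then have "prob ?E = prob ?F" by (rule finite_measure_eq_AE[OF _ E_sets F_sets])
    also have "\<dots> = prob (sample_path L1 -` B1 \<inter> space M) * prob (sample_path L2 -` B2 \<inter> space M)"
      by (rule indep_varD[OF ind B1_sets B2_sets])
    also have "sample_path L1 -` B1 \<inter> space M = {\<omega> \<in> space M. \<forall>i<n - m. L1 (\<tau>1 (Suc i)) \<omega> - L1 (\<tau>1 i) \<omega> \<in> A (m + i)}"
      using measurable_space[OF pm(1)] \<tau>1 by (auto simp: B1_def sample_path_def)
    also have "prob \<dots> = (\<Prod>i<n - m. measure (distr M borel (L1 (\<tau>1 (Suc i) - \<tau>1 i))) (A (m + i)))"
      by (rule L1.levy_prob) (use \<tau>1[of 0] \<tau> m A in \<open>auto simp: \<tau>1_def\<close>)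
    also have "\<dots> = (\<Prod>i<n - m. measure (?P (m + i)) (A (m + i)))"
      using d1 \<tau> m by (intro prod.cong) (auto simp: \<tau>1_def)
    also have "sample_path L2 -` B2 \<inter> space M = {\<omega> \<in> space M. \<forall>j<m. L2 (\<tau>2 (Suc j)) \<omega> - L2 (\<tau>2 j) \<omega> \<in> A (m - Suc j)}"
      using measurable_space[OF pm(2)] \<tau>2 by (auto simp: B2_def sample_path_def)
    also have "prob \<dots> = (\<Prod>j<m. measure (distr M borel (L2 (\<tau>2 (Suc j) - \<tau>2 j))) (A (m - Suc j)))"
      by (rule L2.levy_prob) (use \<tau>2[of 0] m A mono in \<open>auto simp: \<tau>2_def\<close>)
    also have "\<dots> = (\<Prod>j<m. measure (?P (m - Suc j)) (A (m - Suc j)))"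
      using d2 \<tau> m by (intro prod.cong) (auto simp: \<tau>2_def Suc_diff_Suc mono)
    also have "\<dots> = (\<Prod>j<m. measure (?P j) (A j))" by (rule prod.nat_diff_reindex)
    also have "(\<Prod>i<n - m. measure (?P (m + i)) (A (m + i))) * (\<Prod>j<m. measure (?P j) (A j)) = (\<Prod>i<n. measure (?P i) (A i))"
    proof -
      have split: "(\<Prod>i<m + k. f i) = (\<Prod>i<k. f (m + i)) * (\<Prod>j<m. f j)" for k and f :: "nat \<Rightarrow> real"
        by (induction k) (auto simp: mult_ac)
      show ?thesis using split[of _ "n - m"] m by simp
    qed
    finally have prob: "prob ?E = (\<Prod>i<n. measure (?P i) (A i))" .
    have V: "(\<lambda>\<omega>. \<lambda>i\<in>{..<n}. L (\<tau> (Suc i)) \<omega> - L (\<tau> i) \<omega>) \<in> M \<rightarrow>\<^sub>M (\<Pi>\<^sub>M i\<in>{..<n}. borel)"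
      by (rule measurable_restrict) measurable
    have S: "Pi\<^sub>E {..<n} A \<in> sets (\<Pi>\<^sub>M i\<in>{..<n}. borel)"
      by (rule sets_PiM_I_finite) (use A in auto)
    have vim: "(\<lambda>\<omega>. \<lambda>i\<in>{..<n}. L (\<tau> (Suc i)) \<omega> - L (\<tau> i) \<omega>) -` Pi\<^sub>E {..<n} A \<inter> space M = ?E"
      by (rule set_eqI) (simp add: PiE_iff conj_commute Ball_def)
    have P: "emeasure (?P i) (A i) = ennreal (measure (?P i) (A i))" for i
      by (rule finite_measure.emeasure_eq_measure[OF prob_space.finite_measure[OF prob_space_distr[OF measurable_L]]])
    have "emeasure (distr M (\<Pi>\<^sub>M i\<in>{..<n}. borel) (\<lambda>\<omega>. \<lambda>i\<in>{..<n}. L (\<tau> (Suc i)) \<omega> - L (\<tau> i) \<omega>)) (Pi\<^sub>E {..<n} A) = emeasure M ?E"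
      unfolding emeasure_distr[OF V S] vim ..
    also have "\<dots> = (\<Prod>i<n. emeasure (?P i) (A i))"
      unfolding emeasure_eq_measure prob P by (rule prod_ennreal[symmetric]) simp
    finally show "emeasure (distr M (\<Pi>\<^sub>M i\<in>{..<n}. borel) (\<lambda>\<omega>. \<lambda>i\<in>{..<n}. L (\<tau> (Suc i)) \<omega> - L (\<tau> i) \<omega>)) (Pi\<^sub>E {..<n} A)
        = (\<Prod>i\<in>{..<n}. emeasure (?P i) (A i))" .
  qed (auto intro!: sets_PiM_cong)
qed

declare measurable_path_component [measurable del]

end

section \<open>Integrals with respect to a Levy process\<close>

lemma lborel_integral_affine_unit:
  fixes f :: "real \<Rightarrow> 'b :: {banach, second_countable_topology}"
  shows lborel_integral_shift: "(LINT x|lborel. f (t + x)) = (LINT x|lborel. f x)"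
    and lborel_integral_reflect: "(LINT x|lborel. f (t - x)) = (LINT x|lborel. f x)"
  using lborel_integral_real_affine[of 1 f t] lborel_integral_real_affine[of "-1" f t] by simp_all

lemma lborel_integrable_affine_unit:
  fixes f :: "real \<Rightarrow> 'b :: {banach, second_countable_topology}"
  shows lborel_integrable_shift: "integrable lborel (\<lambda>x. f (t + x)) \<longleftrightarrow> integrable lborel f"
    and lborel_integrable_reflect: "integrable lborel (\<lambda>x. f (t - x)) \<longleftrightarrow> integrable lborel f"
  using lborel_integrable_real_affine_iff[of 1 f t] lborel_integrable_real_affine_iff[of "-1" f t] by simp_all

lemma square_integrable_shift:
  fixes f :: "real \<Rightarrow> real"
  assumes "square_integrable lborel f"
  shows "square_integrable lborel (\<lambda>x. f (t + x))"
proof -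
  have [measurable]: "f \<in> borel_measurable borel" using assms by (simp add: square_integrable_real)
  show ?thesis using assms lborel_integrable_shift[of "\<lambda>x. (f x)\<^sup>2" t] by (simp add: square_integrable_real)
qed

lemma square_integrable_reflect:
  fixes f :: "real \<Rightarrow> real"
  assumes "square_integrable lborel f"
  shows "square_integrable lborel (\<lambda>x. f (t - x))"
proof -
  have [measurable]: "f \<in> borel_measurable borel" using assms by (simp add: square_integrable_real)
  show ?thesis using assms lborel_integrable_reflect[of "\<lambda>x. (f x)\<^sup>2" t] by (simp add: square_integrable_real)
qed

lemma L2_tendsto_cmult:
  fixes F :: "nat \<Rightarrow> 'a \<Rightarrow> real"
  assumes F: "L2_tendsto M F f"
  shows "L2_tendsto M (\<lambda>n x. c * F n x) (\<lambda>x. c * f x)"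
proof -
  note F' = F[unfolded L2_tendsto_real]
  have "(LINT x|M. (c * F n x - c * f x)\<^sup>2) = c\<^sup>2 * (LINT x|M. (F n x - f x)\<^sup>2)" for n
    by (subst integral_mult_right_zero[symmetric]) (simp add: right_diff_distrib[symmetric] power_mult_distrib)
  moreover have "(\<lambda>n. c\<^sup>2 * (LINT x|M. (F n x - f x)\<^sup>2)) \<longlonglongrightarrow> 0"
    using F' tendsto_mult_right_zero by blast
  ultimately show ?thesis using F' by (simp add: L2_tendsto_real square_integrable_cmult)
qed

lemma L2_tendsto_add:
  fixes F G :: "nat \<Rightarrow> 'a \<Rightarrow> real"
  assumes F: "L2_tendsto M F f" and G: "L2_tendsto M G g"
  shows "L2_tendsto M (\<lambda>n x. F n x + G n x) (\<lambda>x. f x + g x)"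
  using L2_tendsto_diff[OF F L2_tendsto_cmult[OF G, of "-1"]] by simp

lemma L2_dominated_convergence:
  fixes F :: "nat \<Rightarrow> 'a \<Rightarrow> real"
  assumes F: "\<And>n. F n \<in> borel_measurable M" and f: "f \<in> borel_measurable M"
    and w: "square_integrable M w"
    and lim: "AE x in M. (\<lambda>n. F n x) \<longlonglongrightarrow> f x"
    and le: "\<And>n x. \<bar>F n x\<bar> \<le> \<bar>w x\<bar>" "\<And>x. \<bar>f x\<bar> \<le> \<bar>w x\<bar>"
  shows "L2_tendsto M F f"
proof -
  note F[measurable] f[measurable]
  have "(\<lambda>n. LINT x|M. (F n x - f x)\<^sup>2) \<longlonglongrightarrow> (LINT x|M. 0)"
  proof (rule integral_dominated_convergence)
    show "integrable M (\<lambda>x. (2 * w x)\<^sup>2)"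
      using square_integrable_cmult[OF w, of 2] by (simp add: square_integrable_real)
    show "AE x in M. (\<lambda>n. (F n x - f x)\<^sup>2) \<longlonglongrightarrow> 0"
      using lim
    proof eventually_elim
      case (elim x)
      then have "(\<lambda>n. (F n x - f x)\<^sup>2) \<longlonglongrightarrow> (f x - f x)\<^sup>2" by (intro tendsto_intros)
      then show ?case by simp
    qed
    show "AE x in M. norm ((F n x - f x)\<^sup>2) \<le> (2 * w x)\<^sup>2" for n
    proof (rule AE_I2)
      fix x
      have "\<bar>F n x - f x\<bar> \<le> \<bar>2 * w x\<bar>" using le(1)[of n x] le(2)[of x] by linarith
      then show "norm ((F n x - f x)\<^sup>2) \<le> (2 * w x)\<^sup>2" by (simp add: abs_le_square_iff)
    qed
  qed measurable
  moreover have "square_integrable M (F n)" for n by (rule square_integrable_bound[OF w F le(1)])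
  moreover have "square_integrable M f" by (rule square_integrable_bound[OF w f le(2)])
  ultimately show ?thesis by (simp add: L2_tendsto_real)
qed

lemma square_integrable_indicator_interval:
  fixes a b :: real
  shows "square_integrable lborel (\<lambda>x. indicator {a<..b} x :: real)"
proof -
  have "(\<lambda>x :: real. (indicator {a<..b} x :: real)\<^sup>2) = indicator {a<..b}" by (auto simp: indicator_def)
  moreover have "integrable lborel (indicator {a<..b} :: real \<Rightarrow> real)"
    by (cases "a \<le> b") (simp_all add: integrable_real_indicator)
  ultimately show ?thesis by (simp add: square_integrable_real)
qed

section \<open>Step functions and their density in L^2\<close>

definition proper_steps :: "(real \<times> real \<times> real) list \<Rightarrow> bool" where
  "proper_steps S \<longleftrightarrow> (\<forall>(c, a, b)\<in>set S. a < b)"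

lemma proper_steps_simps [simp]:
  "proper_steps []" "proper_steps ((c, a, b) # S) \<longleftrightarrow> a < b \<and> proper_steps S"
  "proper_steps (S @ T) \<longleftrightarrow> proper_steps S \<and> proper_steps T"
  unfolding proper_steps_def by (simp_all add: ball_Un)

lemma has_levy_integral_iff:
  "has_levy_integral M L f Y \<longleftrightarrow> (\<exists>S. (\<forall>n. proper_steps (S n)) \<and>
     L2_tendsto lborel (\<lambda>n. step_fun (S n)) f \<and> L2_tendsto M (\<lambda>n. step_integral L (S n)) Y)"
  by (simp add: has_levy_integral_def proper_steps_def)

lemma step_fun_Cons: "step_fun ((c, a, b) # S) u = c * indicator {a<..b} u + step_fun S u"
  by (simp add: step_fun_def)

lemma step_fun_Nil [simp]: "step_fun [] u = 0"
  by (simp add: step_fun_def)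

lemma step_fun_append: "step_fun (S @ S') u = step_fun S u + step_fun S' u"
  by (simp add: step_fun_def)

definition scale_steps :: "real \<Rightarrow> (real \<times> real \<times> real) list \<Rightarrow> (real \<times> real \<times> real) list" where
  "scale_steps r S = map (\<lambda>(c, a, b). (r * c, a, b)) S"

definition shift_steps :: "real \<Rightarrow> (real \<times> real \<times> real) list \<Rightarrow> (real \<times> real \<times> real) list" where
  "shift_steps h S = map (\<lambda>(c, a, b). (c, a + h, b + h)) S"

lemma step_fun_scale: "step_fun (scale_steps r S) u = r * step_fun S u"
  by (induction S) (auto simp: scale_steps_def step_fun_def algebra_simps split: prod.splits)

lemma step_fun_shift: "step_fun (shift_steps h S) u = step_fun S (u - h)"
  by (induction S) (auto simp: shift_steps_def step_fun_def indicator_def algebra_simps split: prod.splits)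

lemma proper_steps_scale [simp]: "proper_steps (scale_steps r S) \<longleftrightarrow> proper_steps S"
  and proper_steps_shift [simp]: "proper_steps (shift_steps h S) \<longleftrightarrow> proper_steps S"
  by (auto simp: scale_steps_def shift_steps_def proper_steps_def split_beta)

lemma square_integrable_step_fun: "square_integrable lborel (step_fun S)"
proof (induction S)
  case Nil
  then show ?case by simp
next
  case (Cons s S)
  obtain c a b where s: "s = (c, a, b)" by (cases s)
  have "square_integrable lborel (\<lambda>u. c * indicator {a<..b} u + step_fun S u)"
    by (rule square_integrable_add[OF square_integrable_cmult[OF square_integrable_indicator_interval] Cons])
  then show ?case unfolding s by (simp add: step_fun_Cons[abs_def])
qed

definition step_approximable :: "(real \<Rightarrow> real) \<Rightarrow> bool" where
  "step_approximable f \<longleftrightarrow> (\<exists>S. (\<forall>n. proper_steps (S n)) \<and> L2_tendsto lborel (\<lambda>n. step_fun (S n)) f)"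

lemma step_approximableI:
  assumes f: "square_integrable lborel f"
    and e: "\<And>e. 0 < e \<Longrightarrow> \<exists>S. proper_steps S \<and> (LINT x|lborel. (step_fun S x - f x)\<^sup>2) < e"
  shows "step_approximable f"
proof -
  have "\<forall>n. \<exists>S. proper_steps S \<and> (LINT x|lborel. (step_fun S x - f x)\<^sup>2) < inverse (real (Suc n))"
    using e by simp
  then obtain S where S: "\<And>n. proper_steps (S n)"
    "\<And>n. (LINT x|lborel. (step_fun (S n) x - f x)\<^sup>2) < inverse (real (Suc n))" by metis
  have "(\<lambda>n. LINT x|lborel. (step_fun (S n) x - f x)\<^sup>2) \<longlonglongrightarrow> 0"
    by (rule tendsto_sandwich[OF _ _ tendsto_const LIMSEQ_inverse_real_of_nat])
       (auto intro!: always_eventually less_imp_le S(2) simp del: of_nat_Suc)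
  with f S(1) show ?thesis
    unfolding step_approximable_def by (auto simp: L2_tendsto_real square_integrable_step_fun)
qed

lemma step_approximableD:
  assumes "step_approximable f" "0 < e"
  obtains S where "proper_steps S" "(LINT x|lborel. (step_fun S x - f x)\<^sup>2) < e"
proof -
  obtain S where S: "\<And>n. proper_steps (S n)" "L2_tendsto lborel (\<lambda>n. step_fun (S n)) f"
    using assms(1) by (auto simp: step_approximable_def)
  then have "eventually (\<lambda>n. (LINT x|lborel. (step_fun (S n) x - f x)\<^sup>2) < e) sequentially"
    using assms(2) by (intro order_tendstoD(2)[of _ 0]) (auto simp: L2_tendsto_real)
  then show ?thesis using S(1) that by (auto simp: eventually_sequentially)
qed

lemma step_approximable_add:
  assumes "step_approximable f" "step_approximable g"
  shows "step_approximable (\<lambda>x. f x + g x)"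
proof -
  obtain S where S: "\<And>n. proper_steps (S n)" "L2_tendsto lborel (\<lambda>n. step_fun (S n)) f"
    using assms(1) by (auto simp: step_approximable_def)
  obtain T where T: "\<And>n. proper_steps (T n)" "L2_tendsto lborel (\<lambda>n. step_fun (T n)) g"
    using assms(2) by (auto simp: step_approximable_def)
  have "step_fun (S n @ T n) = (\<lambda>x. step_fun (S n) x + step_fun (T n) x)" for n
    by (simp add: step_fun_append[abs_def])
  with L2_tendsto_add[OF S(2) T(2)] have "L2_tendsto lborel (\<lambda>n. step_fun (S n @ T n)) (\<lambda>x. f x + g x)" by simp
  moreover have "proper_steps (S n @ T n)" for n using S(1)[of n] T(1)[of n] by simp
  ultimately show ?thesis unfolding step_approximable_def by (intro exI[of _ "\<lambda>n. S n @ T n"]) blast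
qed

lemma step_approximable_cmult:
  assumes "step_approximable f"
  shows "step_approximable (\<lambda>x. r * f x)"
proof -
  obtain S where S: "\<And>n. proper_steps (S n)" "L2_tendsto lborel (\<lambda>n. step_fun (S n)) f"
    using assms(1) by (auto simp: step_approximable_def)
  have "step_fun (scale_steps r (S n)) = (\<lambda>x. r * step_fun (S n) x)" for n
    by (simp add: step_fun_scale[abs_def])
  with L2_tendsto_cmult[OF S(2)] have "L2_tendsto lborel (\<lambda>n. step_fun (scale_steps r (S n))) (\<lambda>x. r * f x)" by simp
  moreover have "proper_steps (scale_steps r (S n))" for n using S(1)[of n] by simp
  ultimately show ?thesis unfolding step_approximable_def by (intro exI[of _ "\<lambda>n. scale_steps r (S n)"]) blast
qed

lemma step_approximable_zero: "step_approximable (\<lambda>x. 0)"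
  unfolding step_approximable_def
  by (intro exI[of _ "\<lambda>_. []"]) (auto simp: L2_tendsto_real step_fun_def[abs_def])

lemma step_approximable_sum:
  assumes "\<And>i. i \<in> I \<Longrightarrow> step_approximable (f i)"
  shows "step_approximable (\<lambda>x. \<Sum>i\<in>I. f i x)"
  using assms
proof (induction I rule: infinite_finite_induct)
  case (insert i I)
  then have "step_approximable (f i)" "step_approximable (\<lambda>x. \<Sum>i\<in>I. f i x)" by simp_all
  from step_approximable_add[OF this] show ?case using insert(1,2) by simp
qed (simp_all add: step_approximable_zero)

lemma step_approximable_limit:
  assumes F: "\<And>n. step_approximable (F n)" and lim: "L2_tendsto lborel F f"
  shows "step_approximable f"
proof (rule step_approximableI)
  note L = lim[unfolded L2_tendsto_real]
  show f: "square_integrable lborel f" using L by simp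
  fix e :: real assume e: "0 < e"
  then have "eventually (\<lambda>n. (LINT x|lborel. (F n x - f x)\<^sup>2) < e / 4) sequentially"
    using L by (intro order_tendstoD(2)[of _ 0]) auto
  then obtain n where n: "(LINT x|lborel. (F n x - f x)\<^sup>2) < e / 4" by (auto simp: eventually_sequentially)
  obtain S where S: "proper_steps S" "(LINT x|lborel. (step_fun S x - F n x)\<^sup>2) < e / 4"
    using step_approximableD[OF F[of n], of "e / 4"] e by auto
  have "(LINT x|lborel. (step_fun S x - f x)\<^sup>2)
      \<le> 2 * (LINT x|lborel. (step_fun S x - F n x)\<^sup>2) + 2 * (LINT x|lborel. (F n x - f x)\<^sup>2)"
    by (rule integral_power2_diff_triangle) (use L f square_integrable_step_fun in auto)
  then have "(LINT x|lborel. (step_fun S x - f x)\<^sup>2) < e" using S n by linarith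
  with S show "\<exists>S. proper_steps S \<and> (LINT x|lborel. (step_fun S x - f x)\<^sup>2) < e" by blast
qed

lemma step_approximable_interval: "step_approximable (indicator {a<..b})"
proof (cases "a < b")
  case True
  have "step_fun [(1, a, b)] = indicator {a<..b}" by (auto simp: step_fun_def)
  then show ?thesis
    unfolding step_approximable_def using True square_integrable_step_fun[of "[(1, a, b)]"]
    by (intro exI[of _ "\<lambda>_. [(1, a, b)]"]) (auto intro: L2_tendsto_const)
next
  case False
  then have "indicator {a<..b} = (\<lambda>x. 0 :: real)" by (auto simp: indicator_def)
  then show ?thesis using step_approximable_zero by simp
qed

text \<open>Dynkin's lemma on half-open intervals. Intersecting with a fixed bounded interval keeps
  complements and countable unions square integrable.\<close>

lemma step_approximable_indicator:
  fixes A :: "real set"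
  assumes "A \<in> sets borel"
  shows "step_approximable (indicator (A \<inter> {a<..b}))"
proof -
  let ?G = "range (\<lambda>(a, b). {a<..b::real})"
  have sets: "sets borel = sigma_sets UNIV ?G" by (subst borel_sigma_sets_Ioc) simp
  have "Int_stable ?G"
  proof (rule Int_stableI)
    fix A B assume "A \<in> ?G" "B \<in> ?G"
    then obtain a b c d where "A = {a<..b}" "B = {c<..d}" by auto
    then have "A \<inter> B = (\<lambda>(a, b). {a<..b}) (max a c, min b d)" by auto
    then show "A \<inter> B \<in> ?G" by (simp only: rangeI)
  qed
  moreover have "?G \<subseteq> Pow UNIV" by simp
  moreover have "A \<in> sigma_sets UNIV ?G" using assms by (simp add: sets)
  ultimately show ?thesis
  proof (induction rule: sigma_sets_induct_disjoint)
    case (basic A)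
    then obtain c d where "A = {c<..d}" by auto
    then have "A \<inter> {a<..b} = {max c a<..min d b}" by auto
    then show ?case using step_approximable_interval by simp
  next
    case empty
    have "indicator ({} \<inter> {a<..b}) = (\<lambda>x. 0 :: real)" by auto
    then show ?case using step_approximable_zero by simp
  next
    case (compl A)
    have eq: "indicator ((UNIV - A) \<inter> {a<..b}) = (\<lambda>x. indicator {a<..b} x + (- 1) * indicator (A \<inter> {a<..b}) x :: real)"
      by (auto simp: indicator_def)
    show ?case unfolding eq
      by (rule step_approximable_add[OF step_approximable_interval step_approximable_cmult[OF compl.IH]])
  next
    case (union A)
    then have A: "A i \<in> sets borel" for i using sets by auto
    show ?case
    proof (rule step_approximable_limit)
      show "step_approximable (\<lambda>x. \<Sum>i<n. indicator (A i \<inter> {a<..b}) x)" for n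
        using union(3) by (intro step_approximable_sum) simp
      have eq: "(\<Sum>i<n. indicator (A i \<inter> {a<..b}) x) = (indicator ((\<Union>i<n. A i) \<inter> {a<..b}) x :: real)" for n x
      proof -
        have d: "disjoint_family_on (\<lambda>i. A i \<inter> {a<..b}) {..<n}"
          using union(1) by (auto simp: disjoint_family_on_def)
        have "(\<Sum>i<n. indicator (A i \<inter> {a<..b}) x) = (indicator (\<Union>i<n. A i \<inter> {a<..b}) x :: real)"
          by (rule indicator_UN_disjoint[symmetric, OF _ d]) simp
        also have "(\<Union>i<n. A i \<inter> {a<..b}) = (\<Union>i<n. A i) \<inter> {a<..b}" by auto
        finally show ?thesis .
      qed
      show "L2_tendsto lborel (\<lambda>n x. \<Sum>i<n. indicator (A i \<inter> {a<..b}) x :: real) (indicator ((\<Union>i. A i) \<inter> {a<..b}))"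
        unfolding eq
      proof (rule L2_dominated_convergence[OF _ _ square_integrable_indicator_interval[of a b]])
        show "AE x in lborel. (\<lambda>n. indicator ((\<Union>i<n. A i) \<inter> {a<..b}) x :: real) \<longlonglongrightarrow> indicator ((\<Union>i. A i) \<inter> {a<..b}) x"
        proof (rule AE_I2)
          fix x :: real
          show "(\<lambda>n. indicator ((\<Union>i<n. A i) \<inter> {a<..b}) x :: real) \<longlonglongrightarrow> indicator ((\<Union>i. A i) \<inter> {a<..b}) x"
          proof (cases "\<exists>i. x \<in> A i \<inter> {a<..b}")
            case True
            then obtain i where i: "x \<in> A i \<inter> {a<..b}" by auto
            have "eventually (\<lambda>n. indicator ((\<Union>i<n. A i) \<inter> {a<..b}) x = (1 :: real)) sequentially"
              using eventually_gt_at_top[of i] by eventually_elim (use i in \<open>auto simp: indicator_def\<close>)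
            moreover have "indicator ((\<Union>i. A i) \<inter> {a<..b}) x = (1 :: real)" using i by (auto simp: indicator_def)
            ultimately show ?thesis by (simp add: tendsto_eventually)
          next
            case False
            then have "indicator ((\<Union>i<n. A i) \<inter> {a<..b}) x = (0 :: real)"
              "indicator ((\<Union>i. A i) \<inter> {a<..b}) x = (0 :: real)" for n by (auto simp: indicator_def)
            then show ?thesis by simp
          qed
        qed
      qed (use A in \<open>auto simp: indicator_def\<close>)
    qed
  qed
qed

text \<open>Simple functions bounded by 2 |f| and cut off to (-n, n] are finite combinations of the
  indicators just treated, and they converge to \<open>f\<close> by domination.\<close>

lemma step_approximable_square_integrable:
  assumes f: "square_integrable lborel f"
  shows "step_approximable f"
proof -
  have [measurable]: "f \<in> borel_measurable lborel" using f by measurable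
  obtain F where F: "\<And>i. simple_function lborel (F i)" "\<And>x. (\<lambda>i. F i x) \<longlonglongrightarrow> f x"
    "\<And>i x. \<bar>F i x\<bar> \<le> 2 * \<bar>f x\<bar>"
    using borel_measurable_implies_sequence_metric[of f lborel 0] by auto
  have Fm[measurable]: "F i \<in> borel_measurable lborel" for i using F(1) by (rule borel_measurable_simple_function)
  show ?thesis
  proof (rule step_approximable_limit)
    fix n :: nat
    let ?I = "{- real n<..real n}"
    have eq: "F n x * indicator ?I x = (\<Sum>y\<in>range (F n). y * indicator ((F n -` {y}) \<inter> ?I) x)" for x
    proof -
      have fin: "finite (range (F n))" using F(1)[of n] by (auto simp: simple_function_def)
      have "(\<Sum>y\<in>range (F n). y * indicator ((F n -` {y}) \<inter> ?I) x)
          = (\<Sum>y\<in>range (F n). if y = F n x then F n x * indicator ?I x else 0)"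
        by (intro sum.cong) (auto simp: indicator_def)
      also have "\<dots> = F n x * indicator ?I x" using fin by simp
      finally show ?thesis by simp
    qed
    have "step_approximable (\<lambda>x. \<Sum>y\<in>range (F n). y * indicator ((F n -` {y}) \<inter> ?I) x)"
    proof (intro step_approximable_sum step_approximable_cmult step_approximable_indicator)
      fix y
      have "F n -` {y} \<inter> space lborel \<in> sets lborel" by (rule measurable_sets[OF Fm]) simp
      then show "F n -` {y} \<in> sets borel" by simp
    qed
    then show "step_approximable (\<lambda>x. F n x * indicator ?I x)" unfolding eq .
  next
    show "L2_tendsto lborel (\<lambda>n x. F n x * indicator {- real n<..real n} x) f"
    proof (rule L2_dominated_convergence[OF _ _ square_integrable_cmult[OF f, of 2]])
      show "AE x in lborel. (\<lambda>n. F n x * indicator {- real n<..real n} x) \<longlonglongrightarrow> f x"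
      proof (rule AE_I2)
        fix x :: real
        obtain N where N: "\<bar>x\<bar> < real N" using reals_Archimedean2 by blast
        have "eventually (\<lambda>n. F n x * indicator {- real n<..real n} x = F n x) sequentially"
        proof (rule eventually_mono[OF eventually_ge_at_top[of N]])
          fix n assume "N \<le> n"
          then have "real N \<le> real n" by simp
          with N have "- real n < x" "x \<le> real n" by linarith+
          then show "F n x * indicator {- real n<..real n} x = F n x" by simp
        qed
        then show "(\<lambda>n. F n x * indicator {- real n<..real n} x) \<longlonglongrightarrow> f x"
          by (subst tendsto_cong) (auto intro: F(2))
      qed
      show "\<bar>F n x * indicator {- real n<..real n} x\<bar> \<le> \<bar>2 * f x\<bar>" for n x
        using F(3)[of n x] by (auto simp: indicator_def abs_mult)
    qed (auto simp: abs_mult)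
  qed
qed

text \<open>Domination settles intervals, linearity settles steps, and density the rest: by
  translation invariance the approximation error is the same before and after the shift.\<close>

lemma L2_translation_continuous:
  fixes f :: "real \<Rightarrow> real" and h :: "nat \<Rightarrow> real"
  assumes f: "square_integrable lborel f" and h: "h \<longlonglongrightarrow> 0"
  shows "L2_tendsto lborel (\<lambda>n x. f (h n + x)) f"
proof -
  have interval: "L2_tendsto lborel (\<lambda>n x. indicator {a<..b} (h n + x) :: real) (indicator {a<..b})" for a b :: real
  proof -
    \<comment> \<open>A bound on all shifts keeps the translated intervals inside one fixed
      interval, whose indicator dominates them.\<close>
    obtain K where K: "\<And>n. \<bar>h n\<bar> \<le> K" using convergent_imp_Bseq[OF convergentI[OF h]] by (auto simp: Bseq_def)
    show ?thesis
    proof (rule L2_dominated_convergence[OF _ _ square_integrable_indicator_interval[of "a - K" "b + K"]])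
      have "AE x in lborel. x \<noteq> a \<and> x \<noteq> b"
        using AE_lborel_singleton[of a] AE_lborel_singleton[of b] by eventually_elim simp
      then show "AE x in lborel. (\<lambda>n. indicator {a<..b} (h n + x) :: real) \<longlonglongrightarrow> indicator {a<..b} x"
      proof eventually_elim
        case (elim x)
        have t: "(\<lambda>n. h n + x) \<longlonglongrightarrow> x" using tendsto_add[OF h tendsto_const[of x]] by simp
        have "eventually (\<lambda>n. indicator {a<..b} (h n + x) = (indicator {a<..b} x :: real)) sequentially"
        proof (cases "a < x \<and> x < b")
          case True
          then have "eventually (\<lambda>n. a < h n + x) sequentially" "eventually (\<lambda>n. h n + x < b) sequentially"
            using order_tendstoD(1)[OF t, of a] order_tendstoD(2)[OF t, of b] by auto
          then show ?thesis by eventually_elim (use True in auto)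
        next
          case False
          then have "x < a \<or> b < x" using elim by auto
          then show ?thesis
          proof
            assume "x < a"
            then show ?thesis using order_tendstoD(2)[OF t, of a] by (auto elim!: eventually_mono)
          next
            assume "b < x"
            then show ?thesis using order_tendstoD(1)[OF t, of b] by (auto elim!: eventually_mono)
          qed
        qed
        then show ?case by (rule tendsto_eventually)
      qed
      show "\<bar>indicator {a<..b} (h n + x) :: real\<bar> \<le> \<bar>indicator {a - K<..b + K} x\<bar>" for n x
        using K[of n] by (auto simp: indicator_def)
      have "0 \<le> K" using K[of 0] by linarith
      then show "\<bar>indicator {a<..b} x :: real\<bar> \<le> \<bar>indicator {a - K<..b + K} x\<bar>" for x
        by (auto simp: indicator_def)
    qed measurable
  qed
  have step: "L2_tendsto lborel (\<lambda>n x. step_fun S (h n + x)) (step_fun S)" for S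
  proof (induction S)
    case Nil
    then show ?case by (simp add: L2_tendsto_real)
  next
    case (Cons s S)
    obtain c a b where s: "s = (c, a, b)" by (cases s)
    show ?case
      using L2_tendsto_add[OF L2_tendsto_cmult[OF interval[of a b], of c] Cons] unfolding s
      by (simp add: step_fun_Cons[abs_def])
  qed
  show ?thesis
    unfolding L2_tendsto_real
  proof (intro conjI allI square_integrable_shift f LIMSEQ_I)
    fix e :: real assume e: "0 < e"
    obtain S where S: "(LINT x|lborel. (step_fun S x - f x)\<^sup>2) < e / 16"
      using step_approximableD[OF step_approximable_square_integrable[OF f], of "e / 16"] e by auto
    note sS = square_integrable_step_fun[of S]
    have "eventually (\<lambda>n. (LINT x|lborel. (step_fun S (h n + x) - step_fun S x)\<^sup>2) < e / 16) sequentially"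
      using step[of S] e by (intro order_tendstoD(2)[of _ 0]) (auto simp: L2_tendsto_real)
    then obtain N where N: "\<And>n. n \<ge> N \<Longrightarrow> (LINT x|lborel. (step_fun S (h n + x) - step_fun S x)\<^sup>2) < e / 16"
      by (auto simp: eventually_sequentially)
    have "norm ((LINT x|lborel. (f (h n + x) - f x)\<^sup>2) - 0) < e" if "n \<ge> N" for n
    proof -
      have "(LINT x|lborel. (f (h n + x) - f x)\<^sup>2)
          \<le> 2 * (LINT x|lborel. (f (h n + x) - step_fun S (h n + x))\<^sup>2) + 2 * (LINT x|lborel. (step_fun S (h n + x) - f x)\<^sup>2)"
        by (intro integral_power2_diff_triangle square_integrable_shift f sS)
      moreover have "(LINT x|lborel. (step_fun S (h n + x) - f x)\<^sup>2)
          \<le> 2 * (LINT x|lborel. (step_fun S (h n + x) - step_fun S x)\<^sup>2) + 2 * (LINT x|lborel. (step_fun S x - f x)\<^sup>2)"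
        by (intro integral_power2_diff_triangle square_integrable_shift f sS)
      moreover have "(LINT x|lborel. (f (h n + x) - step_fun S (h n + x))\<^sup>2) = (LINT x|lborel. (step_fun S x - f x)\<^sup>2)"
        using lborel_integral_shift[of "\<lambda>x. (f x - step_fun S x)\<^sup>2" "h n"] by (simp add: power2_commute)
      ultimately have "(LINT x|lborel. (f (h n + x) - f x)\<^sup>2) < e" using N[OF that] S e by linarith
      then show ?thesis by simp
    qed
    then show "\<exists>N. \<forall>n\<ge>N. norm ((LINT x|lborel. (f (h n + x) - f x)\<^sup>2) - 0) < e" by blast
  qed
qed

section \<open>The isometry and its consequences\<close>

context standard_two_sided_levy
begin

lemma step_integral_Cons: "step_integral L ((c, a, b) # S) \<omega> = c * (L b \<omega> - L a \<omega>) + step_integral L S \<omega>"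
  by (simp add: step_integral_def)

lemma step_integral_Nil [simp]: "step_integral L [] \<omega> = 0"
  by (simp add: step_integral_def)

lemma step_integral_append: "step_integral L (S @ S') \<omega> = step_integral L S \<omega> + step_integral L S' \<omega>"
  by (simp add: step_integral_def)

lemma step_integral_scale: "step_integral L (scale_steps r S) \<omega> = r * step_integral L S \<omega>"
  by (induction S) (auto simp: scale_steps_def step_integral_def algebra_simps split: prod.splits)

lemma square_integrable_increment: "square_integrable M (\<lambda>\<omega>. L b \<omega> - L a \<omega>)"
  by (intro square_integrable_diff sq_L)

lemma square_integrable_step_integral: "square_integrable M (step_integral L S)"
proof (induction S)
  case Nil
  then show ?case by simp
next
  case (Cons s S)
  obtain c a b where s: "s = (c, a, b)" by (cases s)
  have "square_integrable M (\<lambda>\<omega>. c * (L b \<omega> - L a \<omega>) + step_integral L S \<omega>)"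
    by (rule square_integrable_add[OF square_integrable_cmult[OF square_integrable_increment] Cons])
  then show ?case unfolding s by (simp add: step_integral_Cons[abs_def])
qed

lemma mean_step_integral: "(LINT \<omega>|M. step_integral L S \<omega>) = 0"
proof (induction S)
  case (Cons s S)
  obtain c a b where s: "s = (c, a, b)" by (cases s)
  show ?case
    using Cons square_integrable_integrable[OF square_integrable_step_integral[of S]]
      square_integrable_integrable[OF sq_L] mean_L unfolding s
    by (simp add: step_integral_Cons)
qed simp

lemma square_integrable_oriented_indicator: "square_integrable lborel (oriented_indicator t)"
  unfolding oriented_indicator_def[abs_def]
  by (intro square_integrable_diff square_integrable_indicator_interval)

lemma increment_inner:
  assumes "a < b" "c < d"
  shows "(LINT \<omega>|M. (L b \<omega> - L a \<omega>) * (L d \<omega> - L c \<omega>)) = (LINT u|lborel. indicator {a<..b} u * indicator {c<..d} u)"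
proof -
  have i: "integrable M (\<lambda>\<omega>. L s \<omega> * L t \<omega>)" for s t by (intro square_integrable_mult sq_L)
  have j: "integrable lborel (\<lambda>u. oriented_indicator s u * oriented_indicator t u)" for s t
    by (intro square_integrable_mult square_integrable_oriented_indicator)
  have "(LINT \<omega>|M. (L b \<omega> - L a \<omega>) * (L d \<omega> - L c \<omega>))
     = (LINT \<omega>|M. L b \<omega> * L d \<omega> - L b \<omega> * L c \<omega> - L a \<omega> * L d \<omega> + L a \<omega> * L c \<omega>)"
    by (simp add: algebra_simps)
  also have "\<dots> = (LINT u|lborel. oriented_indicator b u * oriented_indicator d u - oriented_indicator b u * oriented_indicator c u
      - oriented_indicator a u * oriented_indicator d u + oriented_indicator a u * oriented_indicator c u)"
    using i j by (simp add: cov_L)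
  also have "\<dots> = (LINT u|lborel. (oriented_indicator b u - oriented_indicator a u) * (oriented_indicator d u - oriented_indicator c u))"
    by (simp add: algebra_simps)
  finally show ?thesis using assms by (simp add: indicator_eq_oriented_diff)
qed

text \<open>The isometry on steps. It is expanded bilinearly over both lists, so overlapping
  intervals are handled without passing to a common partition.\<close>

lemma step_integral_inner:
  assumes "proper_steps S" "proper_steps T"
  shows "(LINT \<omega>|M. step_integral L S \<omega> * step_integral L T \<omega>) = (LINT u|lborel. step_fun S u * step_fun T u)"
  using assms(1)
proof (induction S)
  case Nil
  then show ?case by simp
next
  case (Cons s S)
  obtain c a b where s: "s = (c, a, b)" by (cases s)
  have ab: "a < b" and S: "proper_steps S" using Cons.prems by (simp_all add: s)
  note ii = square_integrable_indicator_interval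
  have single: "(LINT \<omega>|M. (L b \<omega> - L a \<omega>) * step_integral L T \<omega>) = (LINT u|lborel. indicator {a<..b} u * step_fun T u)"
    using assms(2)
  proof (induction T)
    case Nil
    then show ?case by simp
  next
    case (Cons t T)
    obtain c' a' b' where t: "t = (c', a', b')" by (cases t)
    have "(LINT \<omega>|M. (L b \<omega> - L a \<omega>) * step_integral L (t # T) \<omega>)
        = (LINT \<omega>|M. c' * ((L b \<omega> - L a \<omega>) * (L b' \<omega> - L a' \<omega>)) + (L b \<omega> - L a \<omega>) * step_integral L T \<omega>)"
      unfolding t step_integral_Cons by (intro Bochner_Integration.integral_cong) (auto simp: algebra_simps)
    also have "\<dots> = c' * (LINT \<omega>|M. (L b \<omega> - L a \<omega>) * (L b' \<omega> - L a' \<omega>)) + (LINT \<omega>|M. (L b \<omega> - L a \<omega>) * step_integral L T \<omega>)"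
      using square_integrable_mult[OF square_integrable_increment[of b a] square_integrable_increment[of b' a']]
        square_integrable_mult[OF square_integrable_increment[of b a] square_integrable_step_integral[of T]] by simp
    also have "\<dots> = c' * (LINT u|lborel. indicator {a<..b} u * indicator {a'<..b'} u) + (LINT u|lborel. indicator {a<..b} u * step_fun T u)"
      using Cons ab by (simp add: t increment_inner)
    also have "\<dots> = (LINT u|lborel. c' * (indicator {a<..b} u * indicator {a'<..b'} u) + indicator {a<..b} u * step_fun T u)"
      using square_integrable_mult[OF ii[of a b] ii[of a' b']]
        square_integrable_mult[OF ii[of a b] square_integrable_step_fun[of T]] by simp
    also have "\<dots> = (LINT u|lborel. indicator {a<..b} u * step_fun (t # T) u)"
      unfolding t step_fun_Cons by (intro Bochner_Integration.integral_cong) (auto simp: algebra_simps)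
    finally show ?case .
  qed
  have "(LINT \<omega>|M. step_integral L (s # S) \<omega> * step_integral L T \<omega>)
      = (LINT \<omega>|M. c * ((L b \<omega> - L a \<omega>) * step_integral L T \<omega>) + step_integral L S \<omega> * step_integral L T \<omega>)"
    unfolding s step_integral_Cons by (intro Bochner_Integration.integral_cong) (auto simp: algebra_simps)
  also have "\<dots> = c * (LINT \<omega>|M. (L b \<omega> - L a \<omega>) * step_integral L T \<omega>) + (LINT \<omega>|M. step_integral L S \<omega> * step_integral L T \<omega>)"
    using square_integrable_mult[OF square_integrable_increment[of b a] square_integrable_step_integral[of T]]
      square_integrable_mult[OF square_integrable_step_integral[of S] square_integrable_step_integral[of T]] by simp
  also have "\<dots> = c * (LINT u|lborel. indicator {a<..b} u * step_fun T u) + (LINT u|lborel. step_fun S u * step_fun T u)"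
    using Cons.IH[OF S] single by simp
  also have "\<dots> = (LINT u|lborel. c * (indicator {a<..b} u * step_fun T u) + step_fun S u * step_fun T u)"
    using square_integrable_mult[OF ii[of a b] square_integrable_step_fun[of T]]
      square_integrable_mult[OF square_integrable_step_fun[of S] square_integrable_step_fun[of T]] by simp
  also have "\<dots> = (LINT u|lborel. step_fun (s # S) u * step_fun T u)"
    unfolding s step_fun_Cons by (intro Bochner_Integration.integral_cong) (auto simp: algebra_simps)
  finally show ?case .
qed

lemma has_levy_integralE:
  assumes "has_levy_integral M L f Y"
  obtains S where "\<And>n. proper_steps (S n)" "L2_tendsto lborel (\<lambda>n. step_fun (S n)) f"
    "L2_tendsto M (\<lambda>n. step_integral L (S n)) Y"
  using assms unfolding has_levy_integral_iff by blast

lemma has_levy_integral_sq: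
  assumes "has_levy_integral M L f Y"
  shows "square_integrable lborel f" "square_integrable M Y"
  using assms by (auto elim!: has_levy_integralE simp: L2_tendsto_real)

lemma has_levy_integral_inner:
  assumes "has_levy_integral M L f Y" "has_levy_integral M L f' Y'"
  shows "(LINT \<omega>|M. Y \<omega> * Y' \<omega>) = (LINT u|lborel. f u * f' u)"
proof -
  obtain S where S: "\<And>n. proper_steps (S n)" "L2_tendsto lborel (\<lambda>n. step_fun (S n)) f"
    "L2_tendsto M (\<lambda>n. step_integral L (S n)) Y" using assms(1) unfolding has_levy_integral_iff by blast
  obtain T where T: "\<And>n. proper_steps (T n)" "L2_tendsto lborel (\<lambda>n. step_fun (T n)) f'"
    "L2_tendsto M (\<lambda>n. step_integral L (T n)) Y'" using assms(2) unfolding has_levy_integral_iff by blast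
  have "(LINT \<omega>|M. step_integral L (S n) \<omega> * step_integral L (T n) \<omega>) = (LINT u|lborel. step_fun (S n) u * step_fun (T n) u)" for n
    by (rule step_integral_inner[OF S(1) T(1)])
  with L2_tendsto_integral_mult[OF S(3) T(3)] L2_tendsto_integral_mult[OF S(2) T(2)]
  show ?thesis by (simp add: LIMSEQ_unique)
qed

lemma has_levy_integral_mean:
  assumes "has_levy_integral M L f Y"
  shows "(LINT \<omega>|M. Y \<omega>) = 0"
proof -
  obtain S where S: "L2_tendsto M (\<lambda>n. step_integral L (S n)) Y" using assms unfolding has_levy_integral_iff by blast
  from L2_tendsto_integral_mult[OF this L2_tendsto_const[OF square_integrable_const[of 1]]]
  show ?thesis by (simp add: mean_step_integral LIMSEQ_const_iff)
qed

lemma has_levy_integral_steps: "proper_steps S \<Longrightarrow> has_levy_integral M L (step_fun S) (step_integral L S)"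
  unfolding has_levy_integral_iff
  by (intro exI[of _ "\<lambda>_. S"] conjI allI L2_tendsto_const square_integrable_step_fun square_integrable_step_integral)

lemma has_levy_integral_interval:
  assumes "a < b" shows "has_levy_integral M L (indicator {a<..b}) (\<lambda>\<omega>. L b \<omega> - L a \<omega>)"
proof -
  have "step_fun [(1, a, b)] = indicator {a<..b}" "step_integral L [(1, a, b)] = (\<lambda>\<omega>. L b \<omega> - L a \<omega>)"
    by (auto simp: step_fun_def step_integral_def)
  then show ?thesis using has_levy_integral_steps[of "[(1, a, b)]"] assms by simp
qed

lemma has_levy_integral_lincomb:
  assumes "has_levy_integral M L f Y" "has_levy_integral M L g Z"
  shows "has_levy_integral M L (\<lambda>u. p * f u + q * g u) (\<lambda>\<omega>. p * Y \<omega> + q * Z \<omega>)"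
proof -
  obtain S where S: "\<And>n. proper_steps (S n)" "L2_tendsto lborel (\<lambda>n. step_fun (S n)) f"
    "L2_tendsto M (\<lambda>n. step_integral L (S n)) Y" using assms(1) unfolding has_levy_integral_iff by blast
  obtain T where T: "\<And>n. proper_steps (T n)" "L2_tendsto lborel (\<lambda>n. step_fun (T n)) g"
    "L2_tendsto M (\<lambda>n. step_integral L (T n)) Z" using assms(2) unfolding has_levy_integral_iff by blast
  let ?U = "\<lambda>n. scale_steps p (S n) @ scale_steps q (T n)"
  have 1: "step_fun (?U n) = (\<lambda>u. p * step_fun (S n) u + q * step_fun (T n) u)" for n
    by (rule ext) (simp add: step_fun_append step_fun_scale)
  have 2: "step_integral L (?U n) = (\<lambda>\<omega>. p * step_integral L (S n) \<omega> + q * step_integral L (T n) \<omega>)" for n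
    by (rule ext) (simp add: step_integral_append step_integral_scale)
  show ?thesis
    unfolding has_levy_integral_iff
  proof (intro exI[of _ ?U] conjI allI)
    show "proper_steps (?U n)" for n using S(1)[of n] T(1)[of n] by simp
    show "L2_tendsto lborel (\<lambda>n. step_fun (?U n)) (\<lambda>u. p * f u + q * g u)"
      unfolding 1 by (intro L2_tendsto_add L2_tendsto_cmult S T)
    show "L2_tendsto M (\<lambda>n. step_integral L (?U n)) (\<lambda>\<omega>. p * Y \<omega> + q * Z \<omega>)"
      unfolding 2 by (intro L2_tendsto_add L2_tendsto_cmult S T)
  qed
qed

lemma has_levy_integral_diff:
  assumes "has_levy_integral M L f Y" "has_levy_integral M L g Z"
  shows "has_levy_integral M L (\<lambda>u. f u - g u) (\<lambda>\<omega>. Y \<omega> - Z \<omega>)"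
  using has_levy_integral_lincomb[OF assms, of 1 "-1"] by simp

lemma has_levy_integral_zero: "has_levy_integral M L (\<lambda>u. 0) (\<lambda>\<omega>. 0)"
  using has_levy_integral_steps[of "[]"] by (simp add: step_fun_def[abs_def] step_integral_def[abs_def])

lemma has_levy_integral_sum:
  assumes "\<And>i. i \<in> I \<Longrightarrow> has_levy_integral M L (f i) (Y i)"
  shows "has_levy_integral M L (\<lambda>u. \<Sum>i\<in>I. c i * f i u) (\<lambda>\<omega>. \<Sum>i\<in>I. c i * Y i \<omega>)"
  using assms
proof (induction I rule: infinite_finite_induct)
  case (insert i I)
  then have "has_levy_integral M L (f i) (Y i)"
    "has_levy_integral M L (\<lambda>u. \<Sum>i\<in>I. c i * f i u) (\<lambda>\<omega>. \<Sum>i\<in>I. c i * Y i \<omega>)" by simp_all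
  from has_levy_integral_lincomb[OF this, of "c i" 1] show ?case using insert(1,2) by simp
qed (simp_all add: has_levy_integral_zero)

lemma has_levy_integral_dist:
  assumes "has_levy_integral M L f Y" "has_levy_integral M L g Z"
  shows "(LINT \<omega>|M. (Y \<omega> - Z \<omega>)\<^sup>2) = (LINT u|lborel. (f u - g u)\<^sup>2)"
  using has_levy_integral_inner[OF has_levy_integral_diff[OF assms] has_levy_integral_diff[OF assms]]
  by (simp add: power2_eq_square)

lemma has_levy_integral_unique:
  assumes "has_levy_integral M L f Y" "has_levy_integral M L f Z"
  shows "AE \<omega> in M. Y \<omega> = Z \<omega>"
proof -
  have "AE \<omega> in M. Y \<omega> - Z \<omega> = 0"
    by (rule integral_power2_eq_0_AE)
       (use has_levy_integral_dist[OF assms] has_levy_integral_sq[OF has_levy_integral_diff[OF assms]] in auto)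
  then show ?thesis by auto
qed

lemma has_levy_integral_cong_AE:
  assumes "has_levy_integral M L f Y" "g \<in> borel_measurable lborel" "AE u in lborel. f u = g u"
    "Z \<in> borel_measurable M" "AE \<omega> in M. Y \<omega> = Z \<omega>"
  shows "has_levy_integral M L g Z"
proof -
  note sq = has_levy_integral_sq[OF assms(1)]
  have g: "square_integrable lborel g" by (rule square_integrable_cong_AE[OF sq(1) assms(2,3)])
  have Z: "square_integrable M Z" by (rule square_integrable_cong_AE[OF sq(2) assms(4,5)])
  obtain S where S: "\<And>n. proper_steps (S n)" "L2_tendsto lborel (\<lambda>n. step_fun (S n)) f"
    "L2_tendsto M (\<lambda>n. step_integral L (S n)) Y" using assms(1) unfolding has_levy_integral_iff by blast
  have [measurable]: "f \<in> borel_measurable lborel" "g \<in> borel_measurable lborel" "Y \<in> borel_measurable M" "Z \<in> borel_measurable M"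
    using square_integrable_measurable[OF sq(1)] square_integrable_measurable[OF sq(2)] assms by auto
  have [measurable]: "step_fun (S n) \<in> borel_measurable lborel" "step_integral L (S n) \<in> borel_measurable M" for n
    using square_integrable_step_fun square_integrable_step_integral by measurable
  have 1: "(LINT u|lborel. (step_fun (S n) u - g u)\<^sup>2) = (LINT u|lborel. (step_fun (S n) u - f u)\<^sup>2)" for n
    using assms(3) by (intro integral_cong_AE) auto
  have 2: "(LINT \<omega>|M. (step_integral L (S n) \<omega> - Z \<omega>)\<^sup>2) = (LINT \<omega>|M. (step_integral L (S n) \<omega> - Y \<omega>)\<^sup>2)" for n
    using assms(5) by (intro integral_cong_AE) auto
  show ?thesis
    unfolding has_levy_integral_iff
  proof (intro exI[of _ S] conjI allI S(1))
    show "L2_tendsto lborel (\<lambda>n. step_fun (S n)) g" "L2_tendsto M (\<lambda>n. step_integral L (S n)) Z"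
      using S(2,3) g Z unfolding L2_tendsto_real 1 2 by simp_all
  qed
qed

lemma has_levy_integral_exists:
  assumes f: "square_integrable lborel f"
  obtains Y where "has_levy_integral M L f Y"
proof -
  obtain S where S: "\<And>n. proper_steps (S n)" "L2_tendsto lborel (\<lambda>n. step_fun (S n)) f"
    using step_approximable_square_integrable[OF f] by (auto simp: step_approximable_def)
  have eq: "(LINT \<omega>|M. (step_integral L (S m) \<omega> - step_integral L (S n) \<omega>)\<^sup>2)
      = (LINT u|lborel. (step_fun (S m) u - step_fun (S n) u)\<^sup>2)" for m n
    by (rule has_levy_integral_dist) (use S in \<open>auto intro!: has_levy_integral_steps\<close>)
  have "\<exists>Y. L2_tendsto M (\<lambda>n. step_integral L (S n)) Y"
  proof (rule L2_complete[of M "\<lambda>n. step_integral L (S n)"])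
    fix e :: real assume e: "0 < e"
    have "eventually (\<lambda>n. (LINT u|lborel. (step_fun (S n) u - f u)\<^sup>2) < e / 4) sequentially"
      using S(2) e by (intro order_tendstoD(2)[of _ 0]) (auto simp: L2_tendsto_real)
    then obtain N where N: "\<And>n. n \<ge> N \<Longrightarrow> (LINT u|lborel. (step_fun (S n) u - f u)\<^sup>2) < e / 4"
      by (auto simp: eventually_sequentially)
    have "(LINT u|lborel. (step_fun (S m) u - step_fun (S n) u)\<^sup>2) < e" if "m \<ge> N" "n \<ge> N" for m n
      using integral_power2_diff_triangle[OF square_integrable_step_fun[of "S m"] f square_integrable_step_fun[of "S n"]]
        N[OF that(1)] N[OF that(2)] by (simp add: power2_commute[of "f _"])
    then show "\<exists>N. \<forall>m\<ge>N. \<forall>n\<ge>N. (LINT \<omega>|M. (step_integral L (S m) \<omega> - step_integral L (S n) \<omega>)\<^sup>2) < e"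
      unfolding eq by blast
  next
    show "square_integrable M (step_integral L (S n))" for n by (rule square_integrable_step_integral)
  qed (rule exI)
  then obtain Y where Y: "L2_tendsto M (\<lambda>n. step_integral L (S n)) Y" ..
  have "has_levy_integral M L f Y"
    unfolding has_levy_integral_iff by (intro exI[of _ S] conjI allI S Y)
  then show ?thesis by (rule that)
qed

text \<open>An isometry on a complete space has closed range. This is how elements of the past of a
  moving average are recognised as integrals.\<close>

lemma has_levy_integral_limit:
  assumes f: "\<And>n. has_levy_integral M L (f n) (Y n)" and Z: "L2_tendsto M Y Z"
  obtains F where "has_levy_integral M L F Z" "L2_tendsto lborel f F"
proof -
  note Z' = Z[unfolded L2_tendsto_real]
  have "\<exists>F. L2_tendsto lborel f F"
  proof (rule L2_complete[of lborel f])
    fix e :: real assume e: "0 < e"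
    have "eventually (\<lambda>n. (LINT \<omega>|M. (Y n \<omega> - Z \<omega>)\<^sup>2) < e / 4) sequentially"
      using Z' e by (intro order_tendstoD(2)[of _ 0]) auto
    then obtain N where N: "\<And>n. n \<ge> N \<Longrightarrow> (LINT \<omega>|M. (Y n \<omega> - Z \<omega>)\<^sup>2) < e / 4"
      by (auto simp: eventually_sequentially)
    have "(LINT \<omega>|M. (Y m \<omega> - Y n \<omega>)\<^sup>2) < e" if "m \<ge> N" "n \<ge> N" for m n
      using integral_power2_diff_triangle[of M "Y m" Z "Y n"] Z'
        N[OF that(1)] N[OF that(2)] by (simp add: power2_commute[of "Z _"])
    then show "\<exists>N. \<forall>m\<ge>N. \<forall>n\<ge>N. (LINT u|lborel. (f m u - f n u)\<^sup>2) < e"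
      unfolding has_levy_integral_dist[OF f f, symmetric] by blast
  next
    show "square_integrable lborel (f n)" for n by (rule has_levy_integral_sq(1)[OF f])
  qed (rule exI)
  then obtain F where F: "L2_tendsto lborel f F" ..
  then have "square_integrable lborel F" by (simp add: L2_tendsto_real)
  then obtain Y' where Y': "has_levy_integral M L F Y'" by (rule has_levy_integral_exists)
  have "L2_tendsto M Y Y'"
    unfolding L2_tendsto_real has_levy_integral_dist[OF f Y']
    using F Z' has_levy_integral_sq[OF Y'] by (auto simp: L2_tendsto_real)
  from L2_tendsto_unique[OF this Z] have "AE \<omega> in M. Y' \<omega> = Z \<omega>" .
  then have "has_levy_integral M L F Z"
    using Z' has_levy_integral_sq[OF Y'] square_integrable_measurable[of lborel F]
      square_integrable_measurable[of M Z]
    by (intro has_levy_integral_cong_AE[OF Y']) auto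
  with F show ?thesis using that by blast
qed

end

section \<open>Moving averages\<close>

text \<open>Serves to reach distribution functions from expectations of bounded continuous
  functions, which behave well under almost sure limits.\<close>

lemma tendsto_clamp_indicator:
  fixes x a :: real
  shows "(\<lambda>k. max 0 (min 1 (1 - real k * (x - a)))) \<longlonglongrightarrow> indicator {..a} x"
proof (cases "x \<le> a")
  case True
  have "real k * (x - a) \<le> 0" for k using True by (simp add: mult_nonneg_nonpos)
  then have "max 0 (min 1 (1 - real k * (x - a))) = 1" for k by (simp add: min_def max_def)
  then show ?thesis using True by simp
next
  case False
  then obtain N where N: "1 < real N * (x - a)" using reals_Archimedean3[of "x - a"] by auto
  have "eventually (\<lambda>k. max 0 (min 1 (1 - real k * (x - a))) = 0) sequentially"
    using eventually_ge_at_top[of N]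
  proof eventually_elim
    case (elim k)
    then have "real N * (x - a) \<le> real k * (x - a)" using False by (intro mult_right_mono) auto
    with N show ?case by simp
  qed
  then have "(\<lambda>k. max 0 (min 1 (1 - real k * (x - a)))) \<longlonglongrightarrow> 0" by (rule tendsto_eventually)
  then show ?thesis using False by simp
qed

section \<open>Joint laws and their limits\<close>

context prob_space
begin

text \<open>A finite measure on the line is determined by its distribution function; here it is the
  law of \<open>X\<close> on the event \<open>E\<close>. In \<open>joint_law_eqI\<close> the events
  carry the constraints on the other coordinates.\<close>

lemma prob_Int_vimage_eqI:
  fixes X Y :: "'a \<Rightarrow> real"
  assumes X[measurable]: "X \<in> borel_measurable M" and Y[measurable]: "Y \<in> borel_measurable M"
    and E[measurable]: "E \<in> events" and F[measurable]: "F \<in> events"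
    and eq: "\<And>c. prob (E \<inter> {\<omega> \<in> space M. X \<omega> \<le> c}) = prob (F \<inter> {\<omega> \<in> space M. Y \<omega> \<le> c})"
    and B: "B \<in> sets borel"
  shows "prob (E \<inter> {\<omega> \<in> space M. X \<omega> \<in> B}) = prob (F \<inter> {\<omega> \<in> space M. Y \<omega> \<in> B})"
proof -
  have em: "emeasure (distr (density M (indicator E)) borel X) B = emeasure M (E \<inter> {\<omega> \<in> space M. X \<omega> \<in> B})"
    if [measurable]: "X \<in> borel_measurable M" "E \<in> events" "B \<in> sets borel" for X :: "'a \<Rightarrow> real" and E B
  proof -
    have "emeasure (distr (density M (indicator E)) borel X) B = emeasure (density M (indicator E)) (X -` B \<inter> space M)"
      by (subst emeasure_distr) auto
    also have "\<dots> = (\<integral>\<^sup>+\<omega>. indicator E \<omega> * indicator (X -` B \<inter> space M) \<omega> \<partial>M)"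
      by (rule emeasure_density) (auto intro: measurable_sets)
    also have "\<dots> = (\<integral>\<^sup>+\<omega>. indicator (E \<inter> {\<omega> \<in> space M. X \<omega> \<in> B}) \<omega> \<partial>M)"
      by (intro nn_integral_cong) (auto simp: indicator_def)
    also have "\<dots> = emeasure M (E \<inter> {\<omega> \<in> space M. X \<omega> \<in> B})"
      by (rule nn_integral_indicator) measurable
    finally show ?thesis .
  qed
  have fb: "finite_borel_measure (distr (density M (indicator E)) borel X)"
    if [measurable]: "X \<in> borel_measurable M" "E \<in> events" for X :: "'a \<Rightarrow> real" and E
  proof -
    have "emeasure (distr (density M (indicator E)) borel X) UNIV \<noteq> \<infinity>"
      by (subst em) (auto simp: emeasure_eq_measure)
    then show ?thesis
      by (auto simp: finite_borel_measure_def finite_borel_measure_axioms_def intro!: finite_measureI)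
  qed
  have "distr (density M (indicator E)) borel X = distr (density M (indicator F)) borel Y"
  proof (rule cdf_unique'[OF fb fb])
    show "cdf (distr (density M (indicator E)) borel X) = cdf (distr (density M (indicator F)) borel Y)"
    proof
      fix c
      show "cdf (distr (density M (indicator E)) borel X) c = cdf (distr (density M (indicator F)) borel Y) c"
        using eq[of c] unfolding cdf_def measure_def by (subst (1 2) em) auto
    qed
  qed measurable
  then have "emeasure M (E \<inter> {\<omega> \<in> space M. X \<omega> \<in> B}) = emeasure M (F \<inter> {\<omega> \<in> space M. Y \<omega> \<in> B})"
    using em[OF X E B] em[OF Y F B] by simp
  then show ?thesis by (simp add: measure_def)
qed

text \<open>Half-lines are exchanged for Borel sets one coordinate at a time: \<open>S\<close>
  collects the coordinates already exchanged, while the rest keep their upper bounds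
  \<open>a\<close>.\<close>

lemma joint_law_eqI:
  fixes X Y :: "'i \<Rightarrow> 'a \<Rightarrow> real"
  assumes J: "finite J" and X: "\<And>j. j \<in> J \<Longrightarrow> X j \<in> borel_measurable M"
    and Y: "\<And>j. j \<in> J \<Longrightarrow> Y j \<in> borel_measurable M"
    and eq: "\<And>a. prob {\<omega> \<in> space M. \<forall>j\<in>J. X j \<omega> \<le> a j} = prob {\<omega> \<in> space M. \<forall>j\<in>J. Y j \<omega> \<le> a j}"
  shows "distr M (\<Pi>\<^sub>M j\<in>J. borel) (\<lambda>\<omega>. \<lambda>j\<in>J. X j \<omega>) = distr M (\<Pi>\<^sub>M j\<in>J. borel) (\<lambda>\<omega>. \<lambda>j\<in>J. Y j \<omega>)"
proof -
  let ?E = "\<lambda>X S A a. {\<omega> \<in> space M. (\<forall>j\<in>S. X j \<omega> \<in> A j) \<and> (\<forall>j\<in>J - S. X j \<omega> \<le> a j)}"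
  have ev: "{\<omega> \<in> space M. (\<forall>j\<in>S. X j \<omega> \<in> A j) \<and> (\<forall>j\<in>T. X j \<omega> \<le> (a j :: real))} \<in> events"
    if "finite S" "finite T" "\<And>j. j \<in> S \<union> T \<Longrightarrow> X j \<in> borel_measurable M" "\<And>j. j \<in> S \<Longrightarrow> A j \<in> sets borel"
    for S T :: "'i set" and A a and X :: "'i \<Rightarrow> 'a \<Rightarrow> real"
  proof -
    have "{\<omega> \<in> space M. \<forall>j\<in>S. X j \<omega> \<in> A j} \<in> events"
    proof (rule sets.sets_Collect_finite_All[OF _ that(1)])
      fix j assume "j \<in> S"
      then have [measurable]: "X j \<in> borel_measurable M" "A j \<in> sets borel" using that by auto
      show "{\<omega> \<in> space M. X j \<omega> \<in> A j} \<in> events" by measurable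
    qed
    moreover have "{\<omega> \<in> space M. \<forall>j\<in>T. X j \<omega> \<le> a j} \<in> events"
    proof (rule sets.sets_Collect_finite_All[OF _ that(2)])
      fix j assume "j \<in> T"
      then have [measurable]: "X j \<in> borel_measurable M" using that by auto
      show "{\<omega> \<in> space M. X j \<omega> \<le> a j} \<in> events" by measurable
    qed
    ultimately have "{\<omega> \<in> space M. \<forall>j\<in>S. X j \<omega> \<in> A j} \<inter> {\<omega> \<in> space M. \<forall>j\<in>T. X j \<omega> \<le> a j} \<in> events" by auto
    then show ?thesis by (simp add: Int_def conj_ac cong: conj_cong)
  qed
  have main: "\<forall>A a. (\<forall>j\<in>S. A j \<in> sets borel) \<longrightarrow> prob (?E X S A a) = prob (?E Y S A a)" if "S \<subseteq> J" for S
    using finite_subset[OF that J] that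
  proof (induction S rule: finite_induct)
    case empty
    then show ?case using eq by simp
  next
    case (insert k S)
    then have k: "k \<in> J" and S: "S \<subseteq> J" "finite S" by auto
    show ?case
    proof (intro allI impI)
      fix A :: "'i \<Rightarrow> real set" and a
      assume A: "\<forall>j\<in>insert k S. A j \<in> sets borel"
      let ?T = "J - insert k S"
      let ?D = "\<lambda>X. {\<omega> \<in> space M. (\<forall>j\<in>S. X j \<omega> \<in> A j) \<and> (\<forall>j\<in>?T. X j \<omega> \<le> a j)}"
      have D: "?D X \<in> events" "?D Y \<in> events"
        by (rule ev; use A S J X Y in auto)+
      have 1: "?D Z \<inter> {\<omega> \<in> space M. Z k \<omega> \<le> c} = ?E Z S A (a(k := c))" for Z :: "'i \<Rightarrow> 'a \<Rightarrow> real" and c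
        using k insert.hyps by auto
      have "prob (?D X \<inter> {\<omega> \<in> space M. X k \<omega> \<in> A k}) = prob (?D Y \<inter> {\<omega> \<in> space M. Y k \<omega> \<in> A k})"
      proof (rule prob_Int_vimage_eqI)
        show "prob (?D X \<inter> {\<omega> \<in> space M. X k \<omega> \<le> c}) = prob (?D Y \<inter> {\<omega> \<in> space M. Y k \<omega> \<le> c})" for c
          unfolding 1 using insert.IH S A by auto
      qed (use D X Y k A in auto)
      moreover have "?D Z \<inter> {\<omega> \<in> space M. Z k \<omega> \<in> A k} = ?E Z (insert k S) A a" for Z :: "'i \<Rightarrow> 'a \<Rightarrow> real"
        by auto
      ultimately show "prob (?E X (insert k S) A a) = prob (?E Y (insert k S) A a)" by simp
    qed
  qed
  have VX: "(\<lambda>\<omega>. \<lambda>j\<in>J. Z j \<omega>) \<in> M \<rightarrow>\<^sub>M (\<Pi>\<^sub>M j\<in>J. borel)" if "\<And>j. j \<in> J \<Longrightarrow> Z j \<in> borel_measurable M" for Z :: "'i \<Rightarrow> 'a \<Rightarrow> real"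
    by (rule measurable_restrict) (rule that)
  have vim: "(\<lambda>\<omega>. \<lambda>j\<in>J. Z j \<omega>) -` Pi\<^sub>E J A \<inter> space M = ?E Z J A (\<lambda>_. 0)" for A and Z :: "'i \<Rightarrow> 'a \<Rightarrow> real"
    by (rule set_eqI) (simp add: PiE_iff conj_commute)
  show ?thesis
  proof (rule measure_eqI_PiM_finite[where I = J and M = "\<lambda>_. borel" and A = "\<lambda>_. Pi\<^sub>E J (\<lambda>_. UNIV)"])
    fix A :: "'i \<Rightarrow> real set" assume A: "\<And>i. i \<in> J \<Longrightarrow> A i \<in> sets borel"
    have S: "Pi\<^sub>E J A \<in> sets (\<Pi>\<^sub>M j\<in>J. borel)" by (rule sets_PiM_I_finite[OF J A])
    show "emeasure (distr M (\<Pi>\<^sub>M j\<in>J. borel) (\<lambda>\<omega>. \<lambda>j\<in>J. X j \<omega>)) (Pi\<^sub>E J A) = emeasure (distr M (\<Pi>\<^sub>M j\<in>J. borel) (\<lambda>\<omega>. \<lambda>j\<in>J. Y j \<omega>)) (Pi\<^sub>E J A)"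
    proof -
      have "(\<lambda>\<omega>. \<lambda>j\<in>J. X j \<omega>) \<in> M \<rightarrow>\<^sub>M (\<Pi>\<^sub>M j\<in>J. borel)" "(\<lambda>\<omega>. \<lambda>j\<in>J. Y j \<omega>) \<in> M \<rightarrow>\<^sub>M (\<Pi>\<^sub>M j\<in>J. borel)"
        by (rule VX, erule X) (rule VX, erule Y)
      from this[THEN emeasure_distr, OF S] show ?thesis
        using main[of J] A by (simp add: vim emeasure_eq_measure)
    qed
  next
    show "range (\<lambda>_. Pi\<^sub>E J (\<lambda>_. UNIV)) \<subseteq> prod_algebra J (\<lambda>_. borel :: real measure)"
      using prod_algebraI_finite[OF J, of "\<lambda>_. UNIV" "\<lambda>_. borel :: real measure"] by auto
    show "(\<Union>i::nat. Pi\<^sub>E J (\<lambda>_. UNIV)) = space (\<Pi>\<^sub>M j\<in>J. borel :: real measure)"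
      by (simp add: space_PiM)
    interpret D: prob_space "distr M (\<Pi>\<^sub>M j\<in>J. borel) (\<lambda>\<omega>. \<lambda>j\<in>J. X j \<omega>)" by (rule prob_space_distr[OF VX[OF X]])
    show "emeasure (distr M (\<Pi>\<^sub>M j\<in>J. borel) (\<lambda>\<omega>. \<lambda>j\<in>J. X j \<omega>)) (Pi\<^sub>E J (\<lambda>_. UNIV)) \<noteq> \<infinity>" by simp
  qed (use J in auto)
qed

text \<open>For fixed k the bounded continuous product \<open>f k\<close> passes to the almost sure
  limit; only afterwards does k tend to infinity, where \<open>f k\<close> becomes the indicator of
  the box of half-lines. In this order atoms on the boundary of the box do no harm.\<close>

lemma joint_law_limit:
  fixes X Y :: "'i \<Rightarrow> 'a \<Rightarrow> real" and V W :: "nat \<Rightarrow> 'i \<Rightarrow> 'a \<Rightarrow> real"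
  assumes J: "finite J"
    and meas: "\<And>j. j \<in> J \<Longrightarrow> X j \<in> borel_measurable M" "\<And>j. j \<in> J \<Longrightarrow> Y j \<in> borel_measurable M"
      "\<And>n j. j \<in> J \<Longrightarrow> V n j \<in> borel_measurable M" "\<And>n j. j \<in> J \<Longrightarrow> W n j \<in> borel_measurable M"
    and V: "\<And>j. j \<in> J \<Longrightarrow> AE \<omega> in M. (\<lambda>n. V n j \<omega>) \<longlonglongrightarrow> X j \<omega>"
    and W: "\<And>j. j \<in> J \<Longrightarrow> AE \<omega> in M. (\<lambda>n. W n j \<omega>) \<longlonglongrightarrow> Y j \<omega>"
    and eq: "\<And>n. distr M (\<Pi>\<^sub>M j\<in>J. borel) (\<lambda>\<omega>. \<lambda>j\<in>J. V n j \<omega>) = distr M (\<Pi>\<^sub>M j\<in>J. borel) (\<lambda>\<omega>. \<lambda>j\<in>J. W n j \<omega>)"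
  shows "distr M (\<Pi>\<^sub>M j\<in>J. borel) (\<lambda>\<omega>. \<lambda>j\<in>J. X j \<omega>) = distr M (\<Pi>\<^sub>M j\<in>J. borel) (\<lambda>\<omega>. \<lambda>j\<in>J. Y j \<omega>)"
proof (rule joint_law_eqI[OF J meas(1,2)])
  fix a :: "'i \<Rightarrow> real"
  define f where "f k z = (\<Prod>j\<in>J. max 0 (min 1 (1 - real k * (z j - a j))))" for k :: nat and z :: "'i \<Rightarrow> real"
  have bound: "\<bar>f k z\<bar> \<le> 1" for k z
    unfolding f_def abs_prod by (intro prod_le_1) auto
  have fm: "f k \<in> borel_measurable (\<Pi>\<^sub>M j\<in>J. borel)" for k
    unfolding f_def[abs_def] by (intro borel_measurable_prod) measurable
  have fZ[measurable]: "(\<lambda>\<omega>. f k (\<lambda>j. Z j \<omega>)) \<in> borel_measurable M"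
    if "\<And>j. j \<in> J \<Longrightarrow> Z j \<in> borel_measurable M" for k and Z :: "'i \<Rightarrow> 'a \<Rightarrow> real"
    unfolding f_def[abs_def]
  proof (rule borel_measurable_prod)
    fix j assume "j \<in> J"
    note that[OF this, measurable]
    show "(\<lambda>\<omega>. max 0 (min 1 (1 - real k * (Z j \<omega> - a j)))) \<in> borel_measurable M" by measurable
  qed
  have conv1: "(\<lambda>n. LINT \<omega>|M. f k (\<lambda>j. V n j \<omega>)) \<longlonglongrightarrow> (LINT \<omega>|M. f k (\<lambda>j. X j \<omega>))"
    if m: "\<And>j. j \<in> J \<Longrightarrow> X j \<in> borel_measurable M" "\<And>n j. j \<in> J \<Longrightarrow> V n j \<in> borel_measurable M"
      and c: "\<And>j. j \<in> J \<Longrightarrow> AE \<omega> in M. (\<lambda>n. V n j \<omega>) \<longlonglongrightarrow> X j \<omega>"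
    for k and X :: "'i \<Rightarrow> 'a \<Rightarrow> real" and V :: "nat \<Rightarrow> 'i \<Rightarrow> 'a \<Rightarrow> real"
  proof (rule integral_dominated_convergence[where w = "\<lambda>_. 1"])
    have "AE \<omega> in M. \<forall>j\<in>J. (\<lambda>n. V n j \<omega>) \<longlonglongrightarrow> X j \<omega>" using c J by (subst AE_finite_all) auto
    then show "AE \<omega> in M. (\<lambda>n. f k (\<lambda>j. V n j \<omega>)) \<longlonglongrightarrow> f k (\<lambda>j. X j \<omega>)"
      unfolding f_def by eventually_elim (auto intro!: tendsto_intros)
  qed (use bound m in \<open>auto intro!: fZ\<close>)
  have conv2: "(\<lambda>k. LINT \<omega>|M. f k (\<lambda>j. X j \<omega>)) \<longlonglongrightarrow> prob {\<omega> \<in> space M. \<forall>j\<in>J. X j \<omega> \<le> a j}"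
    if m: "\<And>j. j \<in> J \<Longrightarrow> X j \<in> borel_measurable M" for X :: "'i \<Rightarrow> 'a \<Rightarrow> real"
  proof -
    let ?A = "{\<omega> \<in> space M. \<forall>j\<in>J. X j \<omega> \<le> a j}"
    have A[measurable]: "?A \<in> events"
    proof (rule sets.sets_Collect_finite_All[OF _ J])
      fix j assume "j \<in> J"
      note m[OF this, measurable]
      show "{\<omega> \<in> space M. X j \<omega> \<le> a j} \<in> events" by measurable
    qed
    have "(\<lambda>k. LINT \<omega>|M. f k (\<lambda>j. X j \<omega>)) \<longlonglongrightarrow> (LINT \<omega>|M. indicator ?A \<omega>)"
    proof (rule integral_dominated_convergence[where w = "\<lambda>_. 1"])
      show "AE \<omega> in M. (\<lambda>k. f k (\<lambda>j. X j \<omega>)) \<longlonglongrightarrow> indicator ?A \<omega>"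
      proof (rule AE_I2)
        fix \<omega> assume w: "\<omega> \<in> space M"
        have "(\<lambda>k. f k (\<lambda>j. X j \<omega>)) \<longlonglongrightarrow> (\<Prod>j\<in>J. indicator {..a j} (X j \<omega>))"
          unfolding f_def by (intro tendsto_prod tendsto_clamp_indicator)
        moreover have "(\<Prod>j\<in>J. indicator {..a j} (X j \<omega>)) = (indicator ?A \<omega> :: real)"
          using w J by (auto simp: indicator_def prod_zero_iff split: if_splits)
        ultimately show "(\<lambda>k. f k (\<lambda>j. X j \<omega>)) \<longlonglongrightarrow> indicator ?A \<omega>" by simp
      qed
    qed (use bound m A in \<open>auto intro!: fZ\<close>)
    then show ?thesis by simp
  qed
  have "(LINT \<omega>|M. f k (\<lambda>j. V n j \<omega>)) = (LINT \<omega>|M. f k (\<lambda>j. W n j \<omega>))" for k n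
  proof -
    have r: "f k (\<lambda>j. Z j) = f k (\<lambda>j\<in>J. Z j)" for Z :: "'i \<Rightarrow> real" unfolding f_def by (intro prod.cong) auto
    have e: "(LINT \<omega>|M. f k (\<lambda>j. Z j \<omega>)) = integral\<^sup>L (distr M (\<Pi>\<^sub>M j\<in>J. borel) (\<lambda>\<omega>. \<lambda>j\<in>J. Z j \<omega>)) (f k)"
      if "\<And>j. j \<in> J \<Longrightarrow> Z j \<in> borel_measurable M" for Z :: "'i \<Rightarrow> 'a \<Rightarrow> real"
      by (subst integral_distr[OF measurable_restrict fm]) (use that r in auto)
    show ?thesis using e[of "V n"] e[of "W n"] meas eq[of n] by simp
  qed
  then have "(LINT \<omega>|M. f k (\<lambda>j. X j \<omega>)) = (LINT \<omega>|M. f k (\<lambda>j. Y j \<omega>))" for k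
    using conv1[of X V k, OF meas(1) meas(3) V]
      conv1[of Y W k, OF meas(2) meas(4) W] LIMSEQ_unique by simp
  then show "prob {\<omega> \<in> space M. \<forall>j\<in>J. X j \<omega> \<le> a j} = prob {\<omega> \<in> space M. \<forall>j\<in>J. Y j \<omega> \<le> a j}"
    using conv2[of X, OF meas(1)] conv2[of Y, OF meas(2)] LIMSEQ_unique by simp
qed auto

end

section \<open>Stationarity, pure non-determinism and measurable versions of moving averages\<close>

context standard_two_sided_levy
begin

text \<open>All the step integrals are one fixed function \<open>\<Phi>\<close> of the increments
  over a common grid. A shift moves the grid but not its mesh lengths, and by
  \<open>distr_increments\<close> only these matter.\<close>

lemma step_integral_law_shift:
  fixes S :: "'i \<Rightarrow> (real \<times> real \<times> real) list"
  assumes J: "finite J"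
  shows "distr M (\<Pi>\<^sub>M j\<in>J. borel) (\<lambda>\<omega>. \<lambda>j\<in>J. step_integral L (S j) \<omega>)
       = distr M (\<Pi>\<^sub>M j\<in>J. borel) (\<lambda>\<omega>. \<lambda>j\<in>J. step_integral L (shift_steps h (S j)) \<omega>)"
proof -
  define ends where "ends T = (\<lambda>(c, a, b). a) ` set T \<union> (\<lambda>(c, a, b). b) ` set T" for T :: "(real \<times> real \<times> real) list"
  \<comment> \<open>\<open>distr_increments\<close> asks for 0 as a node: the point 0 serves the
    unshifted grid, and \<open>- h\<close> the grid shifted by \<open>h\<close>.\<close>
  define E where "E = {0, - h} \<union> (\<Union>j\<in>J. ends (S j))"
  have finE: "finite E" using J by (auto simp: E_def ends_def)
  define es where "es = sorted_list_of_set E"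
  have es: "set es = E" "sorted es" using finE by (auto simp: es_def)
  define \<tau> where "\<tau> i = es ! i" for i
  define n where "n = length es - 1"
  have len: "length es = Suc n" using es(1) unfolding n_def E_def by (cases es) auto
  have mono: "\<tau> i \<le> \<tau> (Suc i)" if "i < n" for i
    unfolding \<tau>_def using es(2) len that by (intro sorted_nth_mono) auto
  have "\<exists>i. i \<le> n \<and> \<tau> i = e" if "e \<in> E" for e
    using that es(1) len unfolding \<tau>_def by (metis in_set_conv_nth less_Suc_eq_le)
  then obtain idx where idx: "\<And>e. e \<in> E \<Longrightarrow> idx e \<le> n" "\<And>e. e \<in> E \<Longrightarrow> \<tau> (idx e) = e" by metis
  define \<Phi> where "\<Phi> T x = (\<Sum>(c, a, b)\<leftarrow>T. c * ((\<Sum>i<idx b. x i) - (\<Sum>i<idx a. x i)))"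
    for T :: "(real \<times> real \<times> real) list" and x :: "nat \<Rightarrow> real"
  define \<Delta> where "\<Delta> r \<omega> = (\<lambda>i\<in>{..<n}. L (\<tau> (Suc i) + r) \<omega> - L (\<tau> i + r) \<omega>)" for r \<omega>
  have \<Delta>m: "\<Delta> r \<in> M \<rightarrow>\<^sub>M (\<Pi>\<^sub>M i\<in>{..<n}. borel)" for r
    unfolding \<Delta>_def[abs_def] by (rule measurable_restrict) measurable
  have tele: "L (e + r) \<omega> = L (\<tau> 0 + r) \<omega> + (\<Sum>i<idx e. \<Delta> r \<omega> i)" if "e \<in> E" for e r \<omega>
  proof -
    have "(\<Sum>i<idx e. \<Delta> r \<omega> i) = (\<Sum>i<idx e. L (\<tau> (Suc i) + r) \<omega> - L (\<tau> i + r) \<omega>)"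
      unfolding \<Delta>_def using idx(1)[OF that] by (intro sum.cong) auto
    also have "\<dots> = L (\<tau> (idx e) + r) \<omega> - L (\<tau> 0 + r) \<omega>" by (rule sum_lessThan_telescope)
    finally show ?thesis using idx(2)[OF that] by simp
  qed
  have SI: "step_integral L (shift_steps r T) \<omega> = \<Phi> T (\<Delta> r \<omega>)" if "ends T \<subseteq> E" for T r \<omega>
    using that
  proof (induction T)
    case (Cons s T)
    obtain c a b where s: "s = (c, a, b)" by (cases s)
    have "a \<in> E" "b \<in> E" "ends T \<subseteq> E" using Cons.prems by (auto simp: ends_def s)
    with Cons.IH show ?case
      by (simp add: s shift_steps_def step_integral_def \<Phi>_def tele)
  qed (simp add: shift_steps_def step_integral_def \<Phi>_def)
  have \<Phi>m: "\<Phi> T \<in> borel_measurable (\<Pi>\<^sub>M i\<in>{..<n}. borel)" if "ends T \<subseteq> E" for T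
    using that
  proof (induction T)
    case Nil
    then show ?case by (simp add: \<Phi>_def[abs_def])
  next
    case (Cons s T)
    obtain c a b where s: "s = (c, a, b)" by (cases s)
    have e: "a \<in> E" "b \<in> E" "ends T \<subseteq> E" using Cons.prems by (auto simp: ends_def s)
    have sm: "(\<lambda>x. \<Sum>i<idx e. x i) \<in> borel_measurable (\<Pi>\<^sub>M i\<in>{..<n}. borel :: real measure)" if "e \<in> E" for e
      using idx(1)[OF that] by (intro borel_measurable_sum measurable_component_singleton) auto
    have "\<Phi> (s # T) = (\<lambda>x. c * ((\<Sum>i<idx b. x i) - (\<Sum>i<idx a. x i)) + \<Phi> T x)"
      by (simp add: \<Phi>_def[abs_def] s)
    then show ?case using Cons.IH[OF e(3)] sm[OF e(1)] sm[OF e(2)] by simp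
  qed
  have sub: "ends (S j) \<subseteq> E" if "j \<in> J" for j using that by (auto simp: E_def)
  have law: "distr M (\<Pi>\<^sub>M j\<in>J. borel) (\<lambda>\<omega>. \<lambda>j\<in>J. step_integral L (shift_steps r (S j)) \<omega>)
      = distr (distr M (\<Pi>\<^sub>M i\<in>{..<n}. borel) (\<Delta> r)) (\<Pi>\<^sub>M j\<in>J. borel) (\<lambda>x. \<lambda>j\<in>J. \<Phi> (S j) x)" for r
  proof -
    have "(\<lambda>x. \<lambda>j\<in>J. \<Phi> (S j) x) \<in> (\<Pi>\<^sub>M i\<in>{..<n}. borel) \<rightarrow>\<^sub>M (\<Pi>\<^sub>M j\<in>J. borel)"
      by (intro measurable_restrict \<Phi>m sub)
    moreover have "(\<lambda>\<omega>. \<lambda>j\<in>J. step_integral L (shift_steps r (S j)) \<omega>) = (\<lambda>x. \<lambda>j\<in>J. \<Phi> (S j) x) \<circ> \<Delta> r"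
      by (auto simp: fun_eq_iff SI[OF sub] restrict_def)
    ultimately show ?thesis using \<Delta>m by (simp add: distr_distr)
  qed
  have inc: "distr M (\<Pi>\<^sub>M i\<in>{..<n}. borel) (\<Delta> r) = (\<Pi>\<^sub>M i\<in>{..<n}. distr M borel (L (\<tau> (Suc i) - \<tau> i)))"
    if "- r \<in> E" for r
    unfolding \<Delta>_def[abs_def]
    using distr_increments[of n "\<lambda>i. \<tau> i + r" "idx (- r)"] mono idx[OF that] by simp
  have "0 \<in> E" "- h \<in> E" by (auto simp: E_def)
  with inc[of 0] inc[of h] have "distr M (\<Pi>\<^sub>M i\<in>{..<n}. borel) (\<Delta> 0) = distr M (\<Pi>\<^sub>M i\<in>{..<n}. borel) (\<Delta> h)" by simp
  then have "distr M (\<Pi>\<^sub>M j\<in>J. borel) (\<lambda>\<omega>. \<lambda>j\<in>J. step_integral L (shift_steps 0 (S j)) \<omega>)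
    = distr M (\<Pi>\<^sub>M j\<in>J. borel) (\<lambda>\<omega>. \<lambda>j\<in>J. step_integral L (shift_steps h (S j)) \<omega>)"
    unfolding law by simp
  moreover have "shift_steps 0 T = T" for T by (auto simp: shift_steps_def map_idI)
  ultimately show ?thesis by simp
qed

text \<open>Shifting the steps that approximate \<open>X t\<close> gives steps for
  \<open>X (t + h)\<close> with exactly the same error, so one fast subsequence makes both families
  converge almost surely, for all times of \<open>J\<close> at once.\<close>

lemma moving_average_stationary:
  assumes X: "\<And>t. has_levy_integral M L (\<lambda>u. g (t - u)) (X t)"
  shows "stationary_process M X"
  unfolding stationary_process_def
proof (intro conjI allI impI)
  have Xsq: "square_integrable M (X t)" for t using has_levy_integral_sq[OF X] by simp
  have Xm: "X t \<in> borel_measurable M" for t using Xsq[of t] by measurable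
  then show "X t \<in> borel_measurable M" for t .
  fix h :: real and J :: "real set" assume J: "finite J"
  have "\<forall>t. \<exists>S. (\<forall>n. proper_steps (S n)) \<and> L2_tendsto lborel (\<lambda>n. step_fun (S n)) (\<lambda>u. g (t - u)) \<and>
      L2_tendsto M (\<lambda>n. step_integral L (S n)) (X t)"
    by (rule allI, rule X[unfolded has_levy_integral_iff])
  from choice[OF this] obtain S where S': "\<forall>t. (\<forall>n. proper_steps (S t n)) \<and>
      L2_tendsto lborel (\<lambda>n. step_fun (S t n)) (\<lambda>u. g (t - u)) \<and>
      L2_tendsto M (\<lambda>n. step_integral L (S t n)) (X t)" ..
  then have S: "\<And>t n. proper_steps (S t n)"
    "\<And>t. L2_tendsto M (\<lambda>n. step_integral L (S t n)) (X t)" by blast+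
  have SX: "(\<lambda>n. LINT \<omega>|M. (step_integral L (S t n) \<omega> - X t \<omega>)\<^sup>2) \<longlonglongrightarrow> 0" for t
    using S(2)[of t] by (simp add: L2_tendsto_real)
  have eq: "(LINT \<omega>|M. (step_integral L (shift_steps h (S t n)) \<omega> - X (t + h) \<omega>)\<^sup>2)
      = (LINT \<omega>|M. (step_integral L (S t n) \<omega> - X t \<omega>)\<^sup>2)" for t n
  proof -
    have "(LINT \<omega>|M. (step_integral L (shift_steps h (S t n)) \<omega> - X (t + h) \<omega>)\<^sup>2)
        = (LINT u|lborel. (step_fun (shift_steps h (S t n)) u - g (t + h - u))\<^sup>2)"
      by (rule has_levy_integral_dist[OF has_levy_integral_steps X]) (simp add: S(1))
    also have "\<dots> = (LINT u|lborel. (step_fun (S t n) (- h + u) - g (t - (- h + u)))\<^sup>2)"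
      by (simp add: step_fun_shift algebra_simps)
    also have "\<dots> = (LINT u|lborel. (step_fun (S t n) u - g (t - u))\<^sup>2)"
      by (rule lborel_integral_shift[where f = "\<lambda>u. (step_fun (S t n) u - g (t - u))\<^sup>2"])
    also have "\<dots> = (LINT \<omega>|M. (step_integral L (S t n) \<omega> - X t \<omega>)\<^sup>2)"
      by (rule has_levy_integral_dist[OF has_levy_integral_steps X, symmetric]) (simp add: S(1))
    finally show ?thesis .
  qed
  have "(\<lambda>n. \<Sum>t\<in>J. LINT \<omega>|M. (step_integral L (S t n) \<omega> - X t \<omega>)\<^sup>2) \<longlonglongrightarrow> (\<Sum>t\<in>J. 0)"
    by (intro tendsto_sum SX)
  then have lim: "(\<lambda>n. \<Sum>t\<in>J. LINT \<omega>|M. (step_integral L (S t n) \<omega> - X t \<omega>)\<^sup>2) \<longlonglongrightarrow> 0" by simp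
  obtain r where "strict_mono r" and r: "\<And>k. (\<Sum>t\<in>J. LINT \<omega>|M. (step_integral L (S t (r k)) \<omega> - X t \<omega>)\<^sup>2) \<le> (1/8) ^ k"
    by (rule fast_subseq[OF lim]) blast
  have le: "(LINT \<omega>|M. (step_integral L (S t (r k)) \<omega> - X t \<omega>)\<^sup>2) \<le> (1/8) ^ k" if "t \<in> J" for t k
  proof -
    have "(LINT \<omega>|M. (step_integral L (S t (r k)) \<omega> - X t \<omega>)\<^sup>2)
        \<le> (\<Sum>t\<in>J. LINT \<omega>|M. (step_integral L (S t (r k)) \<omega> - X t \<omega>)\<^sup>2)"
      by (rule member_le_sum[OF that _ J]) simp
    then show ?thesis using r[of k] by linarith
  qed
  note mS = square_integrable_measurable[OF square_integrable_step_integral]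
  show "distr M (\<Pi>\<^sub>M t\<in>J. borel) (\<lambda>\<omega>. \<lambda>t\<in>J. X (t + h) \<omega>) = distr M (\<Pi>\<^sub>M t\<in>J. borel) (\<lambda>\<omega>. \<lambda>t\<in>J. X t \<omega>)"
  proof (rule joint_law_limit[where V = "\<lambda>k t. step_integral L (shift_steps h (S t (r k)))"
        and W = "\<lambda>k t. step_integral L (S t (r k))"])
    fix t assume t: "t \<in> J"
    show "AE \<omega> in M. (\<lambda>k. step_integral L (shift_steps h (S t (r k))) \<omega>) \<longlonglongrightarrow> X (t + h) \<omega>"
      by (rule AE_tendsto_of_summable_L2[OF square_integrable_step_integral Xsq]) (simp add: eq le t)
    show "AE \<omega> in M. (\<lambda>k. step_integral L (S t (r k)) \<omega>) \<longlonglongrightarrow> X t \<omega>"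
      by (rule AE_tendsto_of_summable_L2[OF square_integrable_step_integral Xsq]) (simp add: le t)
  next
    fix k
    show "distr M (\<Pi>\<^sub>M j\<in>J. borel) (\<lambda>\<omega>. \<lambda>j\<in>J. step_integral L (shift_steps h (S j (r k))) \<omega>)
        = distr M (\<Pi>\<^sub>M j\<in>J. borel) (\<lambda>\<omega>. \<lambda>j\<in>J. step_integral L (S j (r k)) \<omega>)"
      by (rule step_integral_law_shift[OF J, symmetric])
  qed (use J Xm mS in auto)
qed

text \<open>Causality confines the integrands of the span up to \<open>t\<close> to u <= t, and the
  isometry carries this over to the closure. An element of every past has an integrand that vanishes
  beyond each t, hence almost everywhere.\<close>

lemma moving_average_purely_nondeterministic:
  assumes X: "\<And>t. has_levy_integral M L (\<lambda>u. g (t - u)) (X t)" and g: "\<And>u. u < 0 \<Longrightarrow> g u = 0"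
  shows "purely_nondeterministic M X"
  unfolding purely_nondeterministic_def
proof (intro conjI ballI)
  show "stationary_process M X" by (rule moving_average_stationary[OF X])
  show "square_integrable M (X 0)" "(LINT \<omega>|M. X 0 \<omega>) = 0"
    using has_levy_integral_sq[OF X[of 0]] has_levy_integral_mean[OF X[of 0]] by auto
  fix Z assume Z: "Z \<in> (\<Inter>t. past_closed_span M X t)"
  have rep: "\<exists>f. has_levy_integral M L f Z \<and> (LINT u|lborel. (indicator {t<..} u * f u)\<^sup>2) = 0" for t
  proof -
    have "Z \<in> past_closed_span M X t" using Z by (rule INT_D) simp
    then obtain J c where J': "\<forall>n. finite (J n) \<and> J n \<subseteq> {..t}"
      and lim: "L2_tendsto M (\<lambda>n \<omega>. \<Sum>s\<in>J n. c n s * X s \<omega>) Z"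
      unfolding past_closed_span_def mem_Collect_eq by (elim exE conjE)
    have J: "\<And>n. finite (J n)" "\<And>n. J n \<subseteq> {..t}" using J' by auto
    have h: "has_levy_integral M L (\<lambda>u. \<Sum>s\<in>J n. c n s * g (s - u)) (\<lambda>\<omega>. \<Sum>s\<in>J n. c n s * X s \<omega>)" for n
      by (rule has_levy_integral_sum[where f = "\<lambda>s u. g (s - u)"]) (rule X)
    obtain f where f: "has_levy_integral M L f Z" "L2_tendsto lborel (\<lambda>n u. \<Sum>s\<in>J n. c n s * g (s - u)) f"
      by (rule has_levy_integral_limit[OF h lim]) blast
    note fsq = has_levy_integral_sq(1)[OF f(1)]
    have [measurable]: "f \<in> borel_measurable borel" using square_integrable_measurable[OF fsq] by simp
    have isq: "square_integrable lborel (\<lambda>u. indicator {t<..} u * f u)"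
      by (rule square_integrable_bound[OF fsq]) (auto simp: indicator_def)
    have "(LINT u|lborel. (indicator {t<..} u * f u)\<^sup>2) \<le> (LINT u|lborel. ((\<Sum>s\<in>J n. c n s * g (s - u)) - f u)\<^sup>2)" for n
    proof (rule integral_mono)
      show "integrable lborel (\<lambda>u. (indicator {t<..} u * f u)\<^sup>2)" using isq by (simp add: square_integrable_real)
      show "integrable lborel (\<lambda>u. ((\<Sum>s\<in>J n. c n s * g (s - u)) - f u)\<^sup>2)"
        using square_integrable_diff[OF has_levy_integral_sq(1)[OF h[of n]] fsq] by (simp add: square_integrable_real)
      fix u
      show "(indicator {t<..} u * f u)\<^sup>2 \<le> ((\<Sum>s\<in>J n. c n s * g (s - u)) - f u)\<^sup>2"
      proof (cases "t < u")
        case True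
        have "(\<Sum>s\<in>J n. c n s * g (s - u)) = 0"
        proof (rule sum.neutral, intro ballI)
          fix s assume "s \<in> J n"
          then have "s \<le> t" using J(2)[of n] by auto
          with True show "c n s * g (s - u) = 0" using g[of "s - u"] by simp
        qed
        then show ?thesis using True by simp
      qed simp
    qed
    moreover have "(\<lambda>n. LINT u|lborel. ((\<Sum>s\<in>J n. c n s * g (s - u)) - f u)\<^sup>2) \<longlonglongrightarrow> 0"
      using f(2) by (simp add: L2_tendsto_real)
    ultimately have "(LINT u|lborel. (indicator {t<..} u * f u)\<^sup>2) \<le> 0"
      by (intro LIMSEQ_le_const) auto
    moreover have "0 \<le> (LINT u|lborel. (indicator {t<..} u * f u)\<^sup>2)" by simp
    ultimately show ?thesis using f(1) by (intro exI[of _ f]) linarith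
  qed
  obtain f where f: "has_levy_integral M L f Z" using rep by blast
  note fsq = has_levy_integral_sq(1)[OF f]
  have fm[measurable]: "f \<in> borel_measurable borel" using square_integrable_measurable[OF fsq] by simp
  \<comment> \<open>The integrand supplied by \<open>rep\<close> may change with \<open>t\<close>;
    by the isometry any two integrands of \<open>Z\<close> agree almost everywhere.\<close>
  have "AE u in lborel. t < u \<longrightarrow> f u = 0" for t
  proof -
    obtain f' where f': "has_levy_integral M L f' Z" "(LINT u|lborel. (indicator {t<..} u * f' u)\<^sup>2) = 0" using rep by blast
    note fsq' = has_levy_integral_sq(1)[OF f'(1)]
    have [measurable]: "f' \<in> borel_measurable borel" using square_integrable_measurable[OF fsq'] by simp
    have "AE u in lborel. f u - f' u = 0"
      by (rule integral_power2_eq_0_AE[OF square_integrable_diff[OF fsq fsq']])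
         (use has_levy_integral_dist[OF f f'(1)] in simp)
    moreover have "square_integrable lborel (\<lambda>u. indicator {t<..} u * f' u)"
      by (rule square_integrable_bound[OF fsq']) (auto simp: indicator_def)
    from integral_power2_eq_0_AE[OF this f'(2)] have "AE u in lborel. indicator {t<..} u * f' u = 0" .
    ultimately show ?thesis by eventually_elim (auto simp: indicator_def split: if_splits)
  qed
  then have "AE u in lborel. \<forall>n::nat. - real n < u \<longrightarrow> f u = 0" by (subst AE_all_countable) simp
  then have f0: "AE u in lborel. f u = 0"
  proof eventually_elim
    case (elim u)
    obtain n where "- u < real n" using reals_Archimedean2 by blast
    then show ?case using elim[rule_format, of n] by simp
  qed
  have "(LINT \<omega>|M. (Z \<omega>)\<^sup>2) = (LINT u|lborel. (f u)\<^sup>2)"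
    using has_levy_integral_inner[OF f f] by (simp add: power2_eq_square)
  also have "\<dots> = 0" by (rule integral_eq_zero_AE) (use f0 in auto)
  finally show "AE \<omega> in M. Z \<omega> = 0"
    using integral_power2_eq_0_AE[OF has_levy_integral_sq(2)[OF f]] by simp
qed

text \<open>Sampling an arbitrary version on sufficiently fine grids gives jointly measurable approximations that
  converge almost surely at each time.\<close>

lemma moving_average_measurable_version:
  assumes g: "square_integrable lborel g"
  obtains X where "measurable_process M X" "\<And>t. has_levy_integral M L (\<lambda>u. g (t - u)) (X t)"
proof -
  have "\<exists>Y. has_levy_integral M L (\<lambda>u. g (t - u)) Y" for t
    using has_levy_integral_exists[OF square_integrable_reflect[OF g]] by blast
  then obtain Y where Y: "\<And>t. has_levy_integral M L (\<lambda>u. g (t - u)) (Y t)" by metis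
  have Ysq: "square_integrable M (Y t)" for t using has_levy_integral_sq[OF Y] by simp
  have Ym[measurable]: "Y t \<in> borel_measurable M" for t using Ysq[of t] by measurable
  \<comment> \<open>By the isometry the squared L^2 distance of \<open>Y s\<close> and
    \<open>Y t\<close> depends on s - t only, so one grid width is good for all times.\<close>
  define w where "w h = (LINT x|lborel. (g (h + x) - g x)\<^sup>2)" for h
  have Yw: "(LINT \<omega>|M. (Y s \<omega> - Y t \<omega>)\<^sup>2) = w (s - t)" for s t
  proof -
    have "(LINT \<omega>|M. (Y s \<omega> - Y t \<omega>)\<^sup>2) = (LINT u|lborel. (g (s - u) - g (t - u))\<^sup>2)"
      by (rule has_levy_integral_dist[OF Y Y])
    also have "\<dots> = (LINT u|lborel. (g (s - t + (t - u)) - g (t - u))\<^sup>2)" by simp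
    also have "\<dots> = w (s - t)"
      unfolding w_def by (rule lborel_integral_reflect[where f = "\<lambda>x. (g (s - t + x) - g x)\<^sup>2"])
    finally show ?thesis .
  qed
  have "\<exists>n. \<forall>h. \<bar>h\<bar> \<le> inverse (real (Suc n)) \<longrightarrow> w h \<le> e" if "0 < e" for e
  proof (rule ccontr)
    assume "\<not> ?thesis"
    then have "\<forall>n. \<exists>h. \<bar>h\<bar> \<le> inverse (real (Suc n)) \<and> e < w h" by (auto simp: not_le)
    then obtain h where h: "\<And>n. \<bar>h n\<bar> \<le> inverse (real (Suc n))" "\<And>n. e < w (h n)" by metis
    have "h \<longlonglongrightarrow> 0"
      by (rule Lim_null_comparison[OF _ LIMSEQ_inverse_real_of_nat]) (use h(1) in \<open>auto simp del: of_nat_Suc\<close>)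
    from L2_translation_continuous[OF g this] have "(\<lambda>n. w (h n)) \<longlonglongrightarrow> 0"
      by (simp add: L2_tendsto_real w_def)
    then have "e \<le> 0" using h(2) by (intro LIMSEQ_le_const) (auto intro: less_imp_le)
    with that show False by simp
  qed
  then have "\<forall>k. \<exists>n. \<forall>h. \<bar>h\<bar> \<le> inverse (real (Suc n)) \<longrightarrow> w h \<le> (1/8) ^ k" by simp
  then obtain n where n: "\<And>k h. \<bar>h\<bar> \<le> inverse (real (Suc (n k))) \<Longrightarrow> w h \<le> (1/8) ^ k" by metis
  define V where "V k t = Y (real_of_int \<lfloor>t * real (Suc (n k))\<rfloor> / real (Suc (n k)))" for k t
  have Vm[measurable]: "(\<lambda>z. V k (fst z) (snd z)) \<in> borel_measurable (borel \<Otimes>\<^sub>M M)" for k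
    unfolding V_def
    by (rule measurable_compose_countable[where f = "\<lambda>i z. Y (real_of_int i / real (Suc (n k))) (snd z)"
          and g = "\<lambda>z. \<lfloor>fst z * real (Suc (n k))\<rfloor>"]) measurable
  have Vsq: "square_integrable M (V k t)" for k t unfolding V_def by (rule Ysq)
  have V: "AE \<omega> in M. (\<lambda>k. V k t \<omega>) \<longlonglongrightarrow> Y t \<omega>" for t
  proof (rule AE_tendsto_of_summable_L2[OF Vsq Ysq])
    fix k
    let ?N = "real (Suc (n k))"
    have "0 < ?N" by simp
    have "\<bar>real_of_int \<lfloor>t * ?N\<rfloor> - t * ?N\<bar> \<le> 1" by linarith
    then have "\<bar>real_of_int \<lfloor>t * ?N\<rfloor> - t * ?N\<bar> / ?N \<le> 1 / ?N" by (rule divide_right_mono) simp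
    moreover have "real_of_int \<lfloor>t * ?N\<rfloor> / ?N - t = (real_of_int \<lfloor>t * ?N\<rfloor> - t * ?N) / ?N"
      using \<open>0 < ?N\<close> by (simp add: diff_divide_distrib del: of_nat_Suc)
    ultimately have "\<bar>real_of_int \<lfloor>t * ?N\<rfloor> / ?N - t\<bar> \<le> inverse ?N"
      by (simp add: inverse_eq_divide del: of_nat_Suc)
    then show "(LINT \<omega>|M. (V k t \<omega> - Y t \<omega>)\<^sup>2) \<le> (1/8) ^ k"
      unfolding V_def Yw by (rule n)
  qed
  \<comment> \<open>Where the sequence diverges, \<open>lim\<close> returns some default. For each
    fixed time this happens on a null set, so \<open>X t\<close> is a version of \<open>Y t\<close>,
    while the limit as a whole is jointly measurable.\<close>
  define X where "X t \<omega> = lim (\<lambda>k. V k t \<omega>)" for t \<omega>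
  have XY: "AE \<omega> in M. X t \<omega> = Y t \<omega>" for t
    using V[of t] by eventually_elim (simp add: X_def limI)
  have Xm: "(\<lambda>z. X (fst z) (snd z)) \<in> borel_measurable (borel \<Otimes>\<^sub>M M)"
    unfolding X_def by measurable
  have [measurable]: "X t \<in> borel_measurable M" for t
  proof -
    have "(\<lambda>\<omega>. (t, \<omega>)) \<in> M \<rightarrow>\<^sub>M borel \<Otimes>\<^sub>M M" by measurable
    from measurable_compose[OF this Xm] show ?thesis by simp
  qed
  show ?thesis
  proof (rule that)
    show "measurable_process M X" using Xm by (simp add: measurable_process_def split_beta')
    fix t
    have "square_integrable lborel (\<lambda>u. g (t - u))" by (rule square_integrable_reflect[OF g])
    from square_integrable_measurable[OF this]
    show "has_levy_integral M L (\<lambda>u. g (t - u)) (X t)"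
      using XY[of t] by (intro has_levy_integral_cong_AE[OF Y]) auto
  qed
qed

end

section \<open>Fourier analysis\<close>

lemma einterval_halfline: "einterval (ereal a) \<infinity> = {a<..}" "einterval (- \<infinity>) (ereal a) = {..<a}"
  by (auto simp: einterval_def)

lemma FTC_Ioi:
  fixes F f :: "real \<Rightarrow> complex"
  assumes F: "\<And>x. a < x \<Longrightarrow> (F has_vector_derivative f x) (at x)" and f: "\<And>x. a < x \<Longrightarrow> isCont f x"
    and int: "set_integrable lborel {a<..} f" and A: "(F \<longlongrightarrow> A) (at_right a)" and B: "(F \<longlongrightarrow> B) at_top"
  shows "(LINT x:{a<..}|lborel. f x) = B - A"
proof -
  have "(LBINT x=ereal a..\<infinity>. f x) = B - A"
    by (rule interval_integral_FTC_integrable) (use assms in \<open>auto simp: einterval_halfline ereal_tendsto_simps\<close>)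
  then show ?thesis by (simp add: interval_lebesgue_integral_def einterval_halfline)
qed

lemma FTC_Iio:
  fixes F f :: "real \<Rightarrow> complex"
  assumes F: "\<And>x. x < a \<Longrightarrow> (F has_vector_derivative f x) (at x)" and f: "\<And>x. x < a \<Longrightarrow> isCont f x"
    and int: "set_integrable lborel {..<a} f" and A: "(F \<longlongrightarrow> A) at_bot" and B: "(F \<longlongrightarrow> B) (at_left a)"
  shows "(LINT x:{..<a}|lborel. f x) = B - A"
proof -
  have "(LBINT x=-\<infinity>..ereal a. f x) = B - A"
    by (rule interval_integral_FTC_integrable) (use assms in \<open>auto simp: einterval_halfline ereal_tendsto_simps\<close>)
  then show ?thesis by (simp add: interval_lebesgue_integral_def einterval_halfline)
qed

lemma norm_iexp [simp]: "norm (iexp x) = 1"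
  by simp

lemma iexp_add: "iexp (x + y) = iexp x * iexp y"
  by (simp add: exp_add[symmetric] algebra_simps)

lemma fourier_parameter_derivative:
  fixes f :: "'c \<Rightarrow> complex" and u :: "'c \<Rightarrow> real"
  assumes f: "integrable N f" and uf: "integrable N (\<lambda>c. complex_of_real (u c) * f c)"
    and u[measurable]: "u \<in> borel_measurable N"
  shows "((\<lambda>y. LINT c|N. f c * iexp (y * u c)) has_vector_derivative
     (LINT c|N. f c * (\<i> * complex_of_real (u c)) * iexp (y * u c))) (at y)"
proof -
  have fm[measurable]: "f \<in> borel_measurable N" using f by auto
  have i1: "integrable N (\<lambda>c. f c * iexp (y * u c))" for y
    by (rule Bochner_Integration.integrable_bound[OF f]) (auto simp: norm_mult)
  have i2: "integrable N (\<lambda>c. f c * (\<i> * complex_of_real (u c)) * iexp (y * u c))" for y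
    by (rule Bochner_Integration.integrable_bound[OF uf]) (auto simp: norm_mult)
  let ?F = "\<lambda>y. LINT c|N. f c * iexp (y * u c)" and ?F' = "LINT c|N. f c * (\<i> * complex_of_real (u c)) * iexp (y * u c)"
  \<comment> \<open>The Taylor remainder of the exponential has two bounds: the quadratic one gives
    pointwise convergence of the difference quotients, the linear one dominates them by a multiple
    of the integrable |u f|.\<close>
  define R where "R x = iexp x - 1 - \<i> * complex_of_real x" for x
  have R1: "norm (R x) \<le> x\<^sup>2 / 2" for x
    using iexp_approx1[of x 1] by (simp add: R_def fact_numeral diff_diff_add power2_eq_square abs_mult[symmetric] numeral_2_eq_2[symmetric])
  have R2: "norm (R x) \<le> 2 * \<bar>x\<bar>" for x
    using iexp_approx2[of x 1] by (simp add: R_def diff_diff_add)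
  have Rm[measurable]: "R \<in> borel_measurable borel" unfolding R_def[abs_def] by measurable
  let ?r = "\<lambda>h c. f c * iexp (y * u c) * R (h * u c)"
  have r: "norm (?F (y + h) - ?F y - h *\<^sub>R ?F') / norm h = norm (LINT c|N. ?r h c / of_real h)" if "h \<noteq> 0" for h
  proof -
    have "?F (y + h) - ?F y - h *\<^sub>R ?F' = (LINT c|N. ?r h c)"
    proof -
      have "?r h c = f c * iexp ((y + h) * u c) - f c * iexp (y * u c)
          - of_real h * (f c * (\<i> * complex_of_real (u c)) * iexp (y * u c))" for c
      proof -
        have "iexp ((y + h) * u c) = iexp (y * u c) * iexp (h * u c)" by (simp only: distrib_right iexp_add)
        then show ?thesis by (simp add: R_def algebra_simps)
      qed
      then have "(LINT c|N. ?r h c) = (LINT c|N. f c * iexp ((y + h) * u c) - f c * iexp (y * u c)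
          - of_real h * (f c * (\<i> * complex_of_real (u c)) * iexp (y * u c)))"
        by (simp only:)
      also have "\<dots> = ?F (y + h) - ?F y - of_real h * ?F'"
        using i1[of "y + h"] i1[of y] i2[of y]
        by (simp only: Bochner_Integration.integral_diff Bochner_Integration.integrable_diff
            integrable_mult_right integral_mult_right_zero)
      finally show ?thesis by (simp only: scaleR_conv_of_real)
    qed
    then show ?thesis using that by (simp add: norm_divide)
  qed
  have nr: "norm (?r h c / of_real h) = norm (f c) * norm (R (h * u c)) / \<bar>h\<bar>" for h c
    by (simp only: norm_mult norm_divide norm_iexp mult_1_right norm_of_real)
  have "(\<lambda>h. norm (LINT c|N. ?r h c / of_real h)) \<midarrow>0\<rightarrow> 0"
  proof (rule iffD1[OF LIMSEQ_SEQ_conv], intro allI impI)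
    fix S :: "nat \<Rightarrow> real" assume S: "(\<forall>n. S n \<noteq> 0) \<and> S \<longlonglongrightarrow> 0"
    have "(\<lambda>n. LINT c|N. ?r (S n) c / of_real (S n)) \<longlonglongrightarrow> (LINT c|N. 0)"
    proof (rule integral_dominated_convergence)
      show "integrable N (\<lambda>c. 2 * norm (complex_of_real (u c) * f c))" using uf by auto
      show "AE c in N. (\<lambda>n. ?r (S n) c / of_real (S n)) \<longlonglongrightarrow> 0"
      proof (rule AE_I2)
        fix c
        show "(\<lambda>n. ?r (S n) c / of_real (S n)) \<longlonglongrightarrow> 0"
        proof (rule Lim_null_comparison)
          show "\<forall>\<^sub>F n in sequentially. norm (?r (S n) c / of_real (S n)) \<le> norm (f c) * ((u c)\<^sup>2 / 2) * \<bar>S n\<bar>"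
          proof (intro always_eventually allI)
            fix n
            have "norm (f c) * norm (R (S n * u c)) / \<bar>S n\<bar> \<le> norm (f c) * ((S n * u c)\<^sup>2 / 2) / \<bar>S n\<bar>"
              by (intro divide_right_mono mult_left_mono R1) auto
            also have "\<dots> = norm (f c) * ((u c)\<^sup>2 / 2) * \<bar>S n\<bar>"
              using S by (simp add: power2_eq_square field_simps)
            finally show "norm (?r (S n) c / of_real (S n)) \<le> norm (f c) * ((u c)\<^sup>2 / 2) * \<bar>S n\<bar>"
              unfolding nr .
          qed
          show "(\<lambda>n. norm (f c) * ((u c)\<^sup>2 / 2) * \<bar>S n\<bar>) \<longlonglongrightarrow> 0"
            using S by (intro tendsto_mult_right_zero tendsto_rabs_zero) auto
        qed
      qed
      fix n
      show "AE c in N. norm (?r (S n) c / of_real (S n)) \<le> 2 * norm (complex_of_real (u c) * f c)"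
      proof (rule AE_I2)
        fix c
        have "norm (f c) * norm (R (S n * u c)) / \<bar>S n\<bar> \<le> norm (f c) * (2 * \<bar>S n * u c\<bar>) / \<bar>S n\<bar>"
          by (intro divide_right_mono mult_left_mono R2) auto
        also have "\<dots> = 2 * norm (complex_of_real (u c) * f c)"
          using S by (simp add: abs_mult norm_mult)
        finally show "norm (?r (S n) c / of_real (S n)) \<le> 2 * norm (complex_of_real (u c) * f c)" unfolding nr .
      qed
    qed measurable
    then show "(\<lambda>n. norm (LINT c|N. ?r (S n) c / of_real (S n))) \<longlonglongrightarrow> 0"
      by (intro tendsto_norm_zero) simp
  qed
  then have "(\<lambda>h. norm (?F (y + h) - ?F y - h *\<^sub>R ?F') / norm h) \<midarrow>0\<rightarrow> 0"
    by (rule Lim_transform_eventually)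
       (unfold eventually_at_filter, intro always_eventually allI impI, rule r[symmetric])
  then show ?thesis
    unfolding has_vector_derivative_def has_derivative_at by (auto intro: bounded_linear_scaleR_left)
qed

text \<open>The unnormalised Gamma density. The rate \<delta> damps the power kernel of the
  fractional derivative and is later sent to 0.\<close>

definition gamma_kernel :: "real \<Rightarrow> real \<Rightarrow> real \<Rightarrow> real" where
  "gamma_kernel a \<delta> x = indicator {0<..} x * (x powr (a - 1) * exp (- (\<delta> * x)))"

lemma gamma_kernel_measurable [measurable]: "gamma_kernel a \<delta> \<in> borel_measurable borel"
  unfolding gamma_kernel_def[abs_def] by measurable

lemma gamma_kernel_Suc: "x * gamma_kernel a \<delta> x = gamma_kernel (a + 1) \<delta> x"
  by (auto simp: gamma_kernel_def indicator_def powr_mult_base)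

lemma gamma_kernel_integral:
  assumes a: "0 < a" and \<delta>: "0 < \<delta>"
  shows gamma_kernel_integrable: "integrable lborel (gamma_kernel a \<delta>)"
    and "(LINT x|lborel. gamma_kernel a \<delta> x) = Gamma a * \<delta> powr (- a)"
proof -
  have nn: "0 \<le> gamma_kernel a d x" for d x by (simp add: gamma_kernel_def)
  have "(\<integral>\<^sup>+x. ennreal (gamma_kernel a 1 x) \<partial>lborel) = (\<integral>\<^sup>+x. ennreal (indicator {0..} x * x powr (a - 1) / exp x) \<partial>lborel)"
  proof (rule nn_integral_cong_AE)
    show "AE x in lborel. ennreal (gamma_kernel a 1 x) = ennreal (indicator {0..} x * x powr (a - 1) / exp x)"
      using AE_lborel_singleton[of "0 :: real"]
      by eventually_elim (auto simp: gamma_kernel_def indicator_def exp_minus field_simps)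
  qed
  also have "\<dots> = ennreal (Gamma a)" using Gamma_conv_nn_integral_real[OF a] by simp
  finally have nn1: "(\<integral>\<^sup>+x. ennreal (gamma_kernel a 1 x) \<partial>lborel) = ennreal (Gamma a)" .
  have i1: "integrable lborel (gamma_kernel a 1)"
    by (rule integrableI_nn_integral_finite[OF _ _ nn1]) (use nn in auto)
  have v1: "(LINT x|lborel. gamma_kernel a 1 x) = Gamma a"
    using nn1 a by (subst integral_eq_nn_integral) (use nn in \<open>auto simp: Gamma_real_pos less_imp_le\<close>)
  have sc: "gamma_kernel a \<delta> x = \<delta> powr (1 - a) * gamma_kernel a 1 (0 + \<delta> * x)" for x
    using \<delta> by (auto simp: gamma_kernel_def indicator_def powr_mult zero_less_mult_iff powr_add[symmetric] mult.assoc[symmetric])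
  show "integrable lborel (gamma_kernel a \<delta>)"
    unfolding sc[abs_def] using lborel_integrable_real_affine[OF i1, of \<delta> 0] \<delta> by simp
  have "(LINT x|lborel. gamma_kernel a \<delta> x) = \<delta> powr (1 - a) * (LINT x|lborel. gamma_kernel a 1 (0 + \<delta> * x))"
    unfolding sc by simp
  also have "\<delta> * (LINT x|lborel. gamma_kernel a 1 (0 + \<delta> * x)) = Gamma a"
    using lborel_integral_real_affine[of \<delta> "gamma_kernel a 1" 0] \<delta> v1 by simp
  then have "(LINT x|lborel. gamma_kernel a 1 (0 + \<delta> * x)) = Gamma a / \<delta>" using \<delta> by (simp add: field_simps)
  also have "\<delta> powr (1 - a) * (Gamma a / \<delta>) = Gamma a * \<delta> powr (- a)"
    using \<delta> by (simp add: powr_diff powr_minus field_simps)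
  finally show "(LINT x|lborel. gamma_kernel a \<delta> x) = Gamma a * \<delta> powr (- a)" .
qed

text \<open>Integration by parts gives the differential equation (\<delta> - iy) G' = i a G for the
  transform G, so G times the a-th power of \<delta> - iy is constant in y; at y = 0 it is the Gamma
  integral. The base stays in the right half-plane, away from the branch cut.\<close>

lemma fourier_gamma_kernel:
  assumes a: "0 < a" and \<delta>: "0 < \<delta>"
  shows "(LINT x|lborel. of_real (gamma_kernel a \<delta> x) * iexp (y * x))
     = of_real (Gamma a) * (of_real \<delta> - \<i> * of_real y) powr (- of_real a)"
proof -
  define G where "G y = (LINT x|lborel. complex_of_real (gamma_kernel a \<delta> x) * iexp (y * x))" for y
  define H where "H y = (LINT x|lborel. complex_of_real (gamma_kernel (a + 1) \<delta> x) * iexp (y * x))" for y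
  define z where "z y = complex_of_real \<delta> - \<i> * complex_of_real y" for y
  have z0: "z y \<noteq> 0" "z y \<notin> \<real>\<^sub>\<le>\<^sub>0" for y
    using \<delta> by (auto simp: z_def complex_eq_iff complex_nonpos_Reals_iff)
  have ia: "integrable lborel (\<lambda>x. complex_of_real (gamma_kernel a \<delta> x))" if "0 < a" for a
    using gamma_kernel_integrable[OF that \<delta>] by simp
  have ie: "integrable lborel (\<lambda>x. complex_of_real (gamma_kernel a \<delta> x) * iexp (y * x))" if "0 < a" for a y
    by (rule Bochner_Integration.integrable_bound[OF ia[OF that]]) (auto simp: norm_mult)
  have "(G has_vector_derivative (LINT x|lborel. complex_of_real (gamma_kernel a \<delta> x) * (\<i> * complex_of_real x) * iexp (y * x))) (at y)" for y
    unfolding G_def[abs_def]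
  proof (rule fourier_parameter_derivative[OF ia[OF a]])
    show "integrable lborel (\<lambda>x. complex_of_real x * complex_of_real (gamma_kernel a \<delta> x))"
      using ia[of "a + 1"] a by (simp add: of_real_mult[symmetric] gamma_kernel_Suc del: of_real_mult)
  qed measurable
  moreover have "complex_of_real (gamma_kernel a \<delta> x) * (\<i> * complex_of_real x) * iexp (y * x)
      = \<i> * (complex_of_real (gamma_kernel (a + 1) \<delta> x) * iexp (y * x))" for x y
    unfolding gamma_kernel_Suc[symmetric] by simp
  then have "(LINT x|lborel. complex_of_real (gamma_kernel a \<delta> x) * (\<i> * complex_of_real x) * iexp (y * x)) = \<i> * H y" for y
    by (simp only: H_def integral_mult_right_zero)
  ultimately have G': "(G has_vector_derivative \<i> * H y) (at y)" for y
    by (simp only:)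
  have parts: "z y * H y = of_real a * G y" for y
  proof -
    let ?F = "\<lambda>x. complex_of_real (x powr a) * exp (- z y * of_real x)"
    let ?f = "\<lambda>x. of_real (a * x powr (a - 1)) * exp (- z y * of_real x) - z y * (of_real (x powr a) * exp (- z y * of_real x))"
    have e: "exp (- z y * of_real x) = of_real (exp (- (\<delta> * x))) * iexp (y * x)" for x
      by (simp add: z_def exp_of_real[symmetric] exp_add[symmetric] algebra_simps)
    have eq: "indicator {0<..} x *\<^sub>R ?f x = of_real a * (of_real (gamma_kernel a \<delta> x) * iexp (y * x))
        - z y * (of_real (gamma_kernel (a + 1) \<delta> x) * iexp (y * x))" for x
      unfolding e by (auto simp: gamma_kernel_def indicator_def algebra_simps)
    have "(LINT x:{0<..}|lborel. ?f x) = 0 - 0"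
    proof (rule FTC_Ioi[where F = ?F])
      fix x :: real assume x: "0 < x"
      have "((\<lambda>x. x powr a) has_real_derivative a * x powr (a - 1)) (at x)"
        using x by (auto intro!: derivative_eq_intros)
      then have 1: "((\<lambda>x. complex_of_real (x powr a)) has_vector_derivative of_real (a * x powr (a - 1))) (at x)"
        by (rule has_vector_derivative_of_real)
      have 2: "((\<lambda>x. exp (- z y * of_real x)) has_vector_derivative - z y * exp (- z y * of_real x)) (at x)"
        by (auto intro!: derivative_eq_intros has_vector_derivative_real_field)
      show "(?F has_vector_derivative ?f x) (at x)"
        using has_vector_derivative_mult[OF 1 2] by (simp add: algebra_simps)
      show "isCont ?f x"
        using x by (intro continuous_intros) auto
    next
      show "set_integrable lborel {0<..} ?f"
        unfolding set_integrable_def eq using ie[OF a] ie[of "a + 1"] a by auto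
      have n: "norm (?F x) = x powr a * exp (- (\<delta> * x))" for x
        by (simp add: norm_mult z_def)
      show "(?F \<longlongrightarrow> 0) (at_right 0)"
      proof (rule tendsto_norm_zero_cancel)
        have "((\<lambda>x. x powr a * exp (- (\<delta> * x))) \<longlongrightarrow> 0 powr a * exp (- (\<delta> * 0))) (at_right 0)"
          using a by (intro tendsto_intros) (auto simp: eventually_at_filter)
        then show "((\<lambda>x. norm (?F x)) \<longlongrightarrow> 0) (at_right 0)" unfolding n using a by simp
      qed
      show "(?F \<longlongrightarrow> 0) at_top"
      proof (rule tendsto_norm_zero_cancel)
        have "((\<lambda>x. x powr a * exp (- (\<delta> * x))) \<longlongrightarrow> 0) at_top"
          using \<delta> by real_asymp
        then show "((\<lambda>x. norm (?F x)) \<longlongrightarrow> 0) at_top" unfolding n .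
      qed
    qed
    then have "0 = (LINT x|lborel. of_real a * (of_real (gamma_kernel a \<delta> x) * iexp (y * x))
        - z y * (of_real (gamma_kernel (a + 1) \<delta> x) * iexp (y * x)))"
      unfolding set_lebesgue_integral_def eq by simp
    also have "\<dots> = of_real a * G y - z y * H y"
      using ie[OF a] ie[of "a + 1"] a by (simp add: G_def H_def)
    finally show ?thesis by simp
  qed
  have "((\<lambda>y. G y * z y powr of_real a) has_vector_derivative 0) (at y)" for y
  proof -
    have "(z has_vector_derivative - \<i>) (at y)"
      unfolding z_def[abs_def] by (auto intro!: derivative_eq_intros)
    from field_vector_diff_chain_at[OF this has_field_derivative_powr[OF z0(2)]]
    have "((\<lambda>y. z y powr of_real a) has_vector_derivative - \<i> * (of_real a * z y powr (of_real a - 1))) (at y)"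
      by (simp add: o_def)
    from has_vector_derivative_mult[OF G' this]
    have "((\<lambda>y. G y * z y powr of_real a) has_vector_derivative
       G y * (- \<i> * (of_real a * z y powr (of_real a - 1))) + \<i> * H y * z y powr of_real a) (at y)" .
    moreover have "G y * (- \<i> * (of_real a * z y powr (of_real a - 1))) + \<i> * H y * z y powr of_real a = 0"
    proof -
      have "z y powr of_real a = z y powr (of_real a - 1) * z y"
        using z0(1)[of y] powr_add[of "z y" "of_real a - 1" 1] by simp
      then have "\<i> * H y * z y powr of_real a = \<i> * z y powr (of_real a - 1) * (z y * H y)" by simp
      then show ?thesis by (simp add: parts)
    qed
    ultimately show ?thesis by (simp only:)
  qed
  then obtain c where c: "\<And>y. G y * z y powr of_real a = c"
    using has_vector_derivative_zero_constant[of UNIV "\<lambda>y. G y * z y powr of_real a"] by auto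
  have "G 0 = of_real (Gamma a * \<delta> powr (- a))"
    using gamma_kernel_integral(2)[OF a \<delta>] by (simp add: G_def del: of_real_mult)
  moreover have "z 0 powr of_real a = of_real (\<delta> powr a)" using \<delta> by (simp add: z_def powr_of_real)
  ultimately have "c = of_real (Gamma a * \<delta> powr (- a) * \<delta> powr a)" using c[of 0] by (simp only: of_real_mult)
  also have "Gamma a * \<delta> powr (- a) * \<delta> powr a = Gamma a" using \<delta> by (simp add: mult.assoc powr_add[symmetric])
  finally have "c = of_real (Gamma a)" .
  then have "G y * z y powr of_real a = of_real (Gamma a)" using c[of y] by simp
  then have "G y = of_real (Gamma a) * z y powr (- of_real a)"
    using z0(1)[of y] by (simp add: powr_minus field_simps)
  then show ?thesis by (simp add: G_def z_def)
qed

text \<open>The parameter is a width in time: the Gaussian factor in frequency corresponds to the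
  normal density of deviation \<sigma>, so a small \<sigma> means little smoothing.\<close>

lemma gaussian_fourier:
  fixes \<sigma> x :: real
  assumes \<sigma>: "0 < \<sigma>"
  shows "(LINT y|lborel. of_real (exp (- (\<sigma> * y)\<^sup>2 / 2)) * iexp (y * x)) = of_real (2 * pi * normal_density 0 \<sigma> x)"
    and gaussian_integrable: "integrable lborel (\<lambda>y. exp (- (\<sigma> * y)\<^sup>2 / 2))"
proof -
  have e1: "exp (- y\<^sup>2 / 2) = sqrt (2 * pi) * std_normal_density y" for y :: real
    by (simp add: std_normal_density_def)
  have "integrable lborel (\<lambda>y. sqrt (2 * pi) * std_normal_density y)"
    using integrable_normal_density[of 1 0] by simp
  then have "integrable lborel (\<lambda>y :: real. exp (- y\<^sup>2 / 2))" unfolding e1 .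
  from lborel_integrable_real_affine[OF this, of \<sigma> 0] \<sigma>
  show "integrable lborel (\<lambda>y. exp (- (\<sigma> * y)\<^sup>2 / 2))" by simp
  have std: "(LINT y|lborel. of_real (exp (- y\<^sup>2 / 2)) * iexp (y * t)) = of_real (sqrt (2 * pi) * exp (- t\<^sup>2 / 2))" for t
  proof -
    have "char std_normal_distribution t = (LINT y|lborel. std_normal_density y *\<^sub>R iexp (t * y))"
      unfolding char_def by (subst integral_density) auto
    then have "(LINT y|lborel. std_normal_density y *\<^sub>R iexp (t * y)) = of_real (exp (- t\<^sup>2 / 2))"
      by (simp add: char_std_normal_distribution)
    then have "of_real (sqrt (2 * pi)) * (LINT y|lborel. std_normal_density y *\<^sub>R iexp (t * y)) = of_real (sqrt (2 * pi) * exp (- t\<^sup>2 / 2))"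
      by simp
    also have "of_real (sqrt (2 * pi)) * (LINT y|lborel. std_normal_density y *\<^sub>R iexp (t * y))
        = (LINT y|lborel. of_real (exp (- y\<^sup>2 / 2)) * iexp (y * t))"
      unfolding e1 by (subst integral_mult_right_zero[symmetric])
        (simp add: scaleR_conv_of_real mult.commute[of t] mult.assoc)
    finally show ?thesis .
  qed
  have "(LINT y|lborel. of_real (exp (- y\<^sup>2 / 2)) * iexp (y * (x / \<sigma>)))
      = \<bar>\<sigma>\<bar> *\<^sub>R (LINT y|lborel. of_real (exp (- (0 + \<sigma> * y)\<^sup>2 / 2)) * iexp ((0 + \<sigma> * y) * (x / \<sigma>)))"
    by (rule lborel_integral_real_affine) (use \<sigma> in simp)
  then have "(LINT y|lborel. of_real (exp (- (\<sigma> * y)\<^sup>2 / 2)) * iexp (y * x)) = of_real (sqrt (2 * pi) * exp (- (x / \<sigma>)\<^sup>2 / 2)) / of_real \<sigma>"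
    using \<sigma> unfolding std by (simp add: field_simps scaleR_conv_of_real)
  also have "\<dots> = of_real (2 * pi * normal_density 0 \<sigma> x)"
    using \<sigma> by (simp add: normal_density_def real_sqrt_mult power_divide field_simps
        of_real_mult[symmetric] of_real_divide[symmetric] del: of_real_mult of_real_divide)
  finally show "(LINT y|lborel. of_real (exp (- (\<sigma> * y)\<^sup>2 / 2)) * iexp (y * x)) = of_real (2 * pi * normal_density 0 \<sigma> x)" .
qed

section \<open>Smoothed Fourier inversion in L^2\<close>

lemma square_integrable_norm:
  fixes f :: "'a \<Rightarrow> complex"
  shows "square_integrable M f \<Longrightarrow> square_integrable M (\<lambda>x. norm (f x))"
  by (auto simp: square_integrable_def)

lemma square_integrable_mult_complex:
  fixes f g :: "'a \<Rightarrow> complex"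
  assumes f: "square_integrable M f" and g: "square_integrable M g"
  shows "integrable M (\<lambda>x. f x * g x)"
    and "norm (LINT x|M. f x * g x) \<le> sqrt (LINT x|M. (norm (f x))\<^sup>2) * sqrt (LINT x|M. (norm (g x))\<^sup>2)"
proof -
  have i: "integrable M (\<lambda>x. norm (f x) * norm (g x))"
    by (rule square_integrable_mult[OF f[THEN square_integrable_norm] g[THEN square_integrable_norm]])
  show "integrable M (\<lambda>x. f x * g x)"
    by (rule Bochner_Integration.integrable_bound[OF i]) (use f g in \<open>auto simp: norm_mult square_integrable_def\<close>)
  have "norm (LINT x|M. f x * g x) \<le> (LINT x|M. norm (f x * g x))" by (rule integral_norm_bound)
  also have "\<dots> = (LINT x|M. norm (f x) * norm (g x))" by (simp add: norm_mult)
  also have "\<dots> \<le> sqrt (LINT x|M. (norm (f x))\<^sup>2) * sqrt (LINT x|M. (norm (g x))\<^sup>2)"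
    using Cauchy_Schwarz_abs[OF f[THEN square_integrable_norm] g[THEN square_integrable_norm]] by simp
  finally show "norm (LINT x|M. f x * g x) \<le> sqrt (LINT x|M. (norm (f x))\<^sup>2) * sqrt (LINT x|M. (norm (g x))\<^sup>2)" .
qed

lemma square_integrable_diff_complex:
  fixes f g :: "'a \<Rightarrow> complex"
  assumes f: "square_integrable M f" and g: "square_integrable M g"
  shows "square_integrable M (\<lambda>x. f x - g x)"
proof -
  have [measurable]: "f \<in> borel_measurable M" "g \<in> borel_measurable M" using f g by (auto simp: square_integrable_def)
  have "square_integrable M (\<lambda>x. norm (f x - g x))"
    by (rule square_integrable_bound[OF square_integrable_add[OF f[THEN square_integrable_norm] g[THEN square_integrable_norm]]])
       (auto intro: norm_triangle_ineq4)
  then show ?thesis by (auto simp: square_integrable_def)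
qed

lemma L2_tendsto_integral_mult_complex:
  fixes F :: "nat \<Rightarrow> 'a \<Rightarrow> complex"
  assumes F: "L2_tendsto M F f" and g: "square_integrable M g"
  shows "(\<lambda>n. LINT x|M. F n x * g x) \<longlonglongrightarrow> (LINT x|M. f x * g x)"
proof -
  note F' = F[unfolded L2_tendsto_def]
  have s: "square_integrable M (F n)" "square_integrable M f" for n using F' by auto
  have d: "square_integrable M (\<lambda>x. F n x - f x)" for n by (rule square_integrable_diff_complex[OF s])
  have "(\<lambda>n. (LINT x|M. F n x * g x) - (LINT x|M. f x * g x)) \<longlonglongrightarrow> 0"
  proof (rule Lim_null_comparison)
    have "(\<lambda>n. sqrt (LINT x|M. (norm (F n x - f x))\<^sup>2)) \<longlonglongrightarrow> sqrt 0"
      using F' by (intro tendsto_real_sqrt) auto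
    then show "(\<lambda>n. sqrt (LINT x|M. (norm (F n x - f x))\<^sup>2) * sqrt (LINT x|M. (norm (g x))\<^sup>2)) \<longlonglongrightarrow> 0"
      by (intro tendsto_mult_left_zero) simp
    show "\<forall>\<^sub>F n in sequentially. norm ((LINT x|M. F n x * g x) - (LINT x|M. f x * g x))
        \<le> sqrt (LINT x|M. (norm (F n x - f x))\<^sup>2) * sqrt (LINT x|M. (norm (g x))\<^sup>2)"
    proof (intro always_eventually allI)
      fix n
      have "(LINT x|M. F n x * g x) - (LINT x|M. f x * g x) = (LINT x|M. (F n x - f x) * g x)"
        using square_integrable_mult_complex(1)[OF s(1) g, of n] square_integrable_mult_complex(1)[OF s(2) g]
        by (simp add: left_diff_distrib)
      then show "norm ((LINT x|M. F n x * g x) - (LINT x|M. f x * g x))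
        \<le> sqrt (LINT x|M. (norm (F n x - f x))\<^sup>2) * sqrt (LINT x|M. (norm (g x))\<^sup>2)"
        using square_integrable_mult_complex(2)[OF d g] by simp
    qed
  qed
  then show ?thesis by (simp add: LIM_zero_iff)
qed

lemma square_integrable_gaussian:
  fixes \<sigma> :: real
  assumes \<sigma>: "0 < \<sigma>"
  shows "square_integrable lborel (\<lambda>y. exp (- (\<sigma> * y)\<^sup>2 / 2))"
proof -
  have "(exp (- (\<sigma> * y)\<^sup>2 / 2))\<^sup>2 = exp (- ((sqrt 2 * \<sigma>) * y)\<^sup>2 / 2)" for y
    by (simp add: power2_eq_square exp_add[symmetric] algebra_simps)
  then show ?thesis using gaussian_integrable[of "sqrt 2 * \<sigma>"] \<sigma> by (simp add: square_integrable_real)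
qed

lemma square_integrable_normal_density:
  assumes \<sigma>: "0 < \<sigma>" shows "square_integrable lborel (normal_density 0 \<sigma>)"
proof -
  have "normal_density 0 \<sigma> = (\<lambda>y. 1 / sqrt (2 * pi * \<sigma>\<^sup>2) * exp (- (inverse \<sigma> * y)\<^sup>2 / 2))"
    using \<sigma> by (intro ext) (simp add: normal_density_def power_mult_distrib power_inverse field_simps)
  moreover have "square_integrable lborel (\<lambda>y. 1 / sqrt (2 * pi * \<sigma>\<^sup>2) * exp (- (inverse \<sigma> * y)\<^sup>2 / 2))"
    by (rule square_integrable_cmult[OF square_integrable_gaussian]) (use \<sigma> in simp)
  ultimately show ?thesis by (simp only:)
qed

lemma normal_density_minus: "normal_density 0 \<sigma> (x - y) = normal_density 0 \<sigma> (y - x)"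
  by (simp add: normal_density_def power2_commute)

text \<open>Inversion up to a Gaussian. For the integrable approximants provided by
  \<open>has_fourier_L2\<close> it is Fubini's theorem; both sides are continuous in L^2, being
  pairings with a normal density and with a Gaussian.\<close>

lemma has_fourier_L2_gaussian:
  assumes G: "has_fourier_L2 g G" and \<sigma>: "0 < \<sigma>"
  shows "of_real (2 * pi) * (LINT r|lborel. g r * of_real (normal_density 0 \<sigma> (x - r)))
       = (LINT y|lborel. G y * of_real (exp (- (\<sigma> * y)\<^sup>2 / 2)) * iexp (- (y * x)))"
proof -
  obtain F where F: "\<And>n. integrable lborel (F n)" "L2_tendsto lborel F g" "L2_tendsto lborel (\<lambda>n. fourier_L1 (F n)) G"
    using G unfolding has_fourier_L2_def by blast
  define \<phi> where "\<phi> y = complex_of_real (exp (- (\<sigma> * y)\<^sup>2 / 2)) * iexp (- (y * x))" for y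
  define \<psi> where "\<psi> r = complex_of_real (2 * pi * normal_density 0 \<sigma> (x - r))" for r
  have \<phi>m[measurable]: "\<phi> \<in> borel_measurable borel" unfolding \<phi>_def[abs_def] by measurable
  have \<phi>i: "integrable lborel \<phi>"
    by (rule Bochner_Integration.integrable_bound[OF gaussian_integrable[OF \<sigma>]]) (auto simp: \<phi>_def norm_mult)
  have \<phi>s: "square_integrable lborel \<phi>"
    using square_integrable_gaussian[OF \<sigma>] by (auto simp: square_integrable_def \<phi>_def[abs_def] norm_mult)
  have "square_integrable lborel (\<lambda>r. 2 * pi * normal_density 0 \<sigma> (x - r))"
    by (intro square_integrable_cmult square_integrable_reflect square_integrable_normal_density \<sigma>)
  moreover have "(norm (\<psi> r))\<^sup>2 = (2 * pi * normal_density 0 \<sigma> (x - r))\<^sup>2" for r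
    unfolding \<psi>_def norm_of_real by (rule power2_abs)
  moreover have "\<psi> \<in> borel_measurable borel" unfolding \<psi>_def[abs_def] by measurable
  ultimately have \<psi>s: "square_integrable lborel \<psi>"
    unfolding square_integrable_def by simp
  have eq: "(LINT r|lborel. F n r * \<psi> r) = (LINT y|lborel. fourier_L1 (F n) y * \<phi> y)" for n
  proof -
    have inner: "(LINT y|lborel. \<phi> y * iexp (y * r)) = \<psi> r" for r
    proof -
      have "(LINT y|lborel. \<phi> y * iexp (y * r)) = (LINT y|lborel. of_real (exp (- (\<sigma> * y)\<^sup>2 / 2)) * iexp (y * (r - x)))"
      proof (rule Bochner_Integration.integral_cong[OF refl])
        fix y
        have "iexp (y * (r - x)) = iexp (- (y * x)) * iexp (y * r)"
          by (simp only: iexp_add[symmetric]) (simp add: algebra_simps)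
        then show "\<phi> y * iexp (y * r) = of_real (exp (- (\<sigma> * y)\<^sup>2 / 2)) * iexp (y * (r - x))"
          by (simp only: \<phi>_def mult.assoc)
      qed
      then show ?thesis unfolding gaussian_fourier(1)[OF \<sigma>] by (simp add: \<psi>_def normal_density_minus[of _ x])
    qed
    have "(LINT r|lborel. F n r * (LINT y|lborel. \<phi> y * iexp (y * r))) = (LINT y|lborel. \<phi> y * (LINT r|lborel. F n r * iexp (y * r)))"
      by (rule Fubini_bounded_kernel[where B = 1]) (auto simp: F(1) \<phi>i sigma_finite_lborel)
    then show ?thesis unfolding inner fourier_L1_def by (simp add: mult.commute)
  qed
  have "(\<lambda>n. LINT r|lborel. F n r * \<psi> r) \<longlonglongrightarrow> (LINT r|lborel. g r * \<psi> r)"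
    by (rule L2_tendsto_integral_mult_complex[OF F(2) \<psi>s])
  moreover have "(\<lambda>n. LINT r|lborel. F n r * \<psi> r) \<longlonglongrightarrow> (LINT y|lborel. G y * \<phi> y)"
    unfolding eq by (rule L2_tendsto_integral_mult_complex[OF F(3) \<phi>s])
  ultimately have "(LINT r|lborel. g r * \<psi> r) = (LINT y|lborel. G y * \<phi> y)" by (rule LIMSEQ_unique)
  moreover have "(LINT r|lborel. g r * \<psi> r) = of_real (2 * pi) * (LINT r|lborel. g r * of_real (normal_density 0 \<sigma> (x - r)))"
    by (subst integral_mult_right_zero[symmetric]) (simp add: \<psi>_def mult_ac)
  ultimately show ?thesis by (simp add: \<phi>_def mult.assoc)
qed

text \<open>The substitution v = w / (n + 1) moves the shrinking width from the density into the
  argument of \<open>A\<close>, where domination by \<open>K\<close> applies.\<close>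

lemma gaussian_smoothing_tendsto:
  fixes A :: "real \<Rightarrow> real"
  assumes [measurable]: "A \<in> borel_measurable borel" and K: "\<And>v. \<bar>A v\<bar> \<le> K"
    and cont: "\<And>h. h \<longlonglongrightarrow> 0 \<Longrightarrow> (\<lambda>n. A (h n)) \<longlonglongrightarrow> A 0"
  shows "(\<lambda>n. LINT v|lborel. normal_density 0 (inverse (real (Suc n))) v * A v) \<longlonglongrightarrow> A 0"
proof -
  have "(LINT v|lborel. normal_density 0 (inverse (real (Suc n))) v * A v)
      = (LINT w|lborel. std_normal_density w * A (inverse (real (Suc n)) * w))" for n
  proof -
    define \<sigma> where "\<sigma> = inverse (real (Suc n))"
    have \<sigma>: "0 < \<sigma>" by (simp add: \<sigma>_def)
    have e: "\<sigma> * normal_density 0 \<sigma> (0 + \<sigma> * w) = std_normal_density w" for w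
      using \<sigma> by (simp add: normal_density_def real_sqrt_mult power_mult_distrib)
    have "(LINT v|lborel. normal_density 0 \<sigma> v * A v) = \<bar>\<sigma>\<bar> *\<^sub>R (LINT w|lborel. normal_density 0 \<sigma> (0 + \<sigma> * w) * A (0 + \<sigma> * w))"
      by (rule lborel_integral_real_affine) (use \<sigma> in simp)
    also have "\<dots> = (LINT w|lborel. std_normal_density w * A (\<sigma> * w))"
      unfolding e[symmetric] using \<sigma> by (simp add: mult.assoc)
    finally show ?thesis by (simp add: \<sigma>_def)
  qed
  moreover have "(\<lambda>n. LINT w|lborel. std_normal_density w * A (inverse (real (Suc n)) * w)) \<longlonglongrightarrow> (LINT w|lborel. std_normal_density w * A 0)"
  proof (rule integral_dominated_convergence)
    show "integrable lborel (\<lambda>w. std_normal_density w * K)" using integrable_normal_density[of 1 0] by simp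
    show "AE w in lborel. (\<lambda>n. std_normal_density w * A (inverse (real (Suc n)) * w)) \<longlonglongrightarrow> std_normal_density w * A 0"
      by (intro AE_I2 tendsto_mult tendsto_const cont tendsto_mult_left_zero LIMSEQ_inverse_real_of_nat)
    show "AE w in lborel. norm (std_normal_density w * A (inverse (real (Suc n)) * w)) \<le> std_normal_density w * K" for n
      by (intro AE_I2) (auto simp: abs_mult normal_density_nonneg intro!: mult_left_mono K)
  qed measurable
  moreover have "(LINT w|lborel. std_normal_density w * A 0) = A 0"
    using integral_normal_density[of 1 0] by simp
  ultimately show ?thesis by simp
qed

text \<open>The autocorrelation of a merely square integrable function is bounded and continuous at
  0, so Gaussian averages of it can be evaluated there in the limit, although \<open>f\<close>
  itself has no point values.\<close>

lemma translation_correlation: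
  fixes f :: "real \<Rightarrow> real"
  assumes f: "square_integrable lborel f" and \<sigma>: "0 < \<sigma>"
  defines "A \<equiv> \<lambda>v. LINT x|lborel. f x * f (v + x)"
  shows "A \<in> borel_measurable borel" "\<And>v. \<bar>A v\<bar> \<le> (LINT x|lborel. (f x)\<^sup>2)"
    and "h \<longlonglongrightarrow> 0 \<Longrightarrow> (\<lambda>n. A (h n)) \<longlonglongrightarrow> A 0"
    and "(LINT x|lborel. f x * (LINT v|lborel. normal_density 0 \<sigma> v * f (v + x))) = (LINT v|lborel. normal_density 0 \<sigma> v * A v)"
proof -
  have fm[measurable]: "f \<in> borel_measurable borel" using square_integrable_measurable[OF f] by simp
  show "A \<in> borel_measurable borel" unfolding A_def by measurable
  have sh: "square_integrable lborel (\<lambda>x. f (v + x))" for v by (rule square_integrable_shift[OF f])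
  have nn: "0 \<le> (LINT x|lborel. (f x)\<^sup>2)" by simp
  have v: "(LINT x|lborel. (f (v + x))\<^sup>2) = (LINT x|lborel. (f x)\<^sup>2)" for v
    by (rule lborel_integral_shift[where f = "\<lambda>x. (f x)\<^sup>2"])
  show "\<bar>A v\<bar> \<le> (LINT x|lborel. (f x)\<^sup>2)" for v
    using Cauchy_Schwarz_abs[OF f sh[of v]] nn by (simp add: A_def v)
  show "(\<lambda>n. A (h n)) \<longlonglongrightarrow> A 0" if "h \<longlonglongrightarrow> 0"
    using L2_tendsto_integral_mult[OF L2_tendsto_const[OF f] L2_translation_continuous[OF f that]] by (simp add: A_def)
  show "(LINT x|lborel. f x * (LINT v|lborel. normal_density 0 \<sigma> v * f (v + x))) = (LINT v|lborel. normal_density 0 \<sigma> v * A v)"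
    unfolding A_def
    by (rule weighted_superposition(3)[OF sigma_finite_lborel sigma_finite_lborel integrable_normal_density[OF \<sigma>] _ _ sh _ f])
       (auto simp: v)
qed

text \<open>Pairing \<open>f\<close> with its vanishing smoothings gives 0 for every Gaussian
  average of its autocorrelation; as the width shrinks these averages tend to the value at 0, the
  squared norm of \<open>f\<close>.\<close>

lemma gaussian_smoothing_zero:
  fixes f :: "real \<Rightarrow> real"
  assumes f: "square_integrable lborel f"
    and zero: "\<And>\<sigma> x. 0 < \<sigma> \<Longrightarrow> (LINT r|lborel. normal_density 0 \<sigma> (x - r) * f r) = 0"
  shows "AE x in lborel. f x = 0"
proof -
  let ?A = "\<lambda>v. LINT x|lborel. f x * f (v + x)"
  note tc = translation_correlation[OF f]
  have z: "(LINT v|lborel. normal_density 0 \<sigma> v * f (v + x)) = 0" if "0 < \<sigma>" for \<sigma> x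
  proof -
    have "normal_density 0 \<sigma> (x - (x + v)) * f (x + v) = normal_density 0 \<sigma> v * f (v + x)" for v
      by (simp add: normal_density_def add.commute)
    with lborel_integral_shift[of "\<lambda>r. normal_density 0 \<sigma> (x - r) * f r" x] zero[OF that, of x]
    show ?thesis by (simp only:)
  qed
  have "(\<lambda>n. LINT v|lborel. normal_density 0 (inverse (real (Suc n))) v * ?A v) \<longlonglongrightarrow> ?A 0"
    by (rule gaussian_smoothing_tendsto[OF tc(1)[of 1] tc(2)[of 1] tc(3)[of 1]]) simp_all
  moreover have "(LINT v|lborel. normal_density 0 (inverse (real (Suc n))) v * ?A v) = 0" for n
    using z[of "inverse (real (Suc n))"] by (subst tc(4)[symmetric]) simp_all
  ultimately have "?A 0 = 0" by (simp add: LIMSEQ_const_iff)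
  then have "(LINT x|lborel. (f x)\<^sup>2) = 0" by (simp add: power2_eq_square)
  from integral_power2_eq_0_AE[OF f this] show ?thesis .
qed

section \<open>The fractional derivative kernel\<close>

lemma integrable_product_mult:
  fixes f :: "'a \<Rightarrow> 'c :: {banach, second_countable_topology, real_normed_field}" and g :: "'b \<Rightarrow> 'c"
  assumes M: "sigma_finite_measure M" and N: "sigma_finite_measure N"
    and f: "integrable M f" and g: "integrable N g"
  shows "integrable (M \<Otimes>\<^sub>M N) (\<lambda>z. f (fst z) * g (snd z))"
    and "(LINT z|(M \<Otimes>\<^sub>M N). f (fst z) * g (snd z)) = (LINT x|M. f x) * (LINT y|N. g y)"
proof -
  interpret M: sigma_finite_measure M by fact
  interpret N: sigma_finite_measure N by fact
  interpret pair_sigma_finite M N ..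
  have [measurable]: "f \<in> borel_measurable M" "g \<in> borel_measurable N" using f g by auto
  show i: "integrable (M \<Otimes>\<^sub>M N) (\<lambda>z. f (fst z) * g (snd z))"
    by (intro Fubini_integrable) (use f g in \<open>auto simp: norm_mult\<close>)
  from integral_fst'[OF i] show "(LINT z|(M \<Otimes>\<^sub>M N). f (fst z) * g (snd z)) = (LINT x|M. f x) * (LINT y|N. g y)"
    by simp
qed

text \<open>The fractional derivative of the indicator of an interval of length \<open>c\<close>,
  without the Gamma factor and as a function of the distance x = t - u to the right end.\<close>

definition frac_kernel :: "real \<Rightarrow> real \<Rightarrow> real \<Rightarrow> real" where
  "frac_kernel \<beta> c x = (max x 0) powr (- \<beta>) - (max (x - c) 0) powr (- \<beta>)"

lemma frac_deriv_indicator_eq: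
  "frac_deriv_indicator \<beta> s t u = 1 / Gamma (1 - \<beta>) * frac_kernel \<beta> (t - s) (t - u)"
proof -
  have "t - u - (t - s) = s - u" by simp
  then show ?thesis by (simp add: frac_deriv_indicator_def frac_kernel_def)
qed

lemma frac_kernel_measurable [measurable]: "frac_kernel \<beta> c \<in> borel_measurable borel"
  unfolding frac_kernel_def[abs_def] by measurable

lemma frac_deriv_indicator_measurable [measurable]: "frac_deriv_indicator \<beta> s t \<in> borel_measurable borel"
  unfolding frac_deriv_indicator_def[abs_def] by measurable

text \<open>Neither power is integrable, only their difference. It is positive up to
  \<open>c\<close> and negative beyond, and both parts have mass c^(1 - \<beta>) / (1 - \<beta>),
  whence the factor 2. Beyond \<open>c\<close> the mass is found from an antiderivative that
  vanishes at infinity.\<close>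

lemma frac_kernel_integrable:
  assumes \<beta>: "0 < \<beta>" "\<beta> < 1" and c: "0 < c"
  shows "integrable lborel (frac_kernel \<beta> c)"
    and "(LINT x|lborel. \<bar>frac_kernel \<beta> c x\<bar>) = 2 * (c powr (1 - \<beta>) / (1 - \<beta>))"
proof -
  have d: "((\<lambda>x. (x - b) powr (1 - \<beta>) / (1 - \<beta>)) has_real_derivative (x - b) powr (- \<beta>)) (at x)" if "b < x" for x b
    using that \<beta> by (auto intro!: derivative_eq_intros)
  have t0: "((\<lambda>x. (x - b) powr (1 - \<beta>) / (1 - \<beta>)) \<longlongrightarrow> (a - b) powr (1 - \<beta>) / (1 - \<beta>)) (at a within S)"
    if "a \<noteq> b \<or> (\<forall>x\<in>S. b \<le> x)" for b a S
    using \<beta> that by (intro tendsto_divide tendsto_powr' tendsto_diff tendsto_ident_at tendsto_const)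
      (auto simp: eventually_at_filter intro!: always_eventually)
  let ?F0 = "\<lambda>x. x powr (1 - \<beta>) / (1 - \<beta>)"
  have 1: "set_integrable lborel (einterval (ereal 0) (ereal c)) (\<lambda>x. x powr (- \<beta>))
    \<and> (LBINT x=ereal 0..ereal c. x powr (- \<beta>)) = c powr (1 - \<beta>) / (1 - \<beta>) - 0"
  proof -
    have A: "((?F0 \<circ> real_of_ereal) \<longlongrightarrow> 0) (at_right (ereal 0))"
      using t0[of 0 0 "{0<..}"] \<beta> by (auto simp: ereal_tendsto_simps)
    have B: "((?F0 \<circ> real_of_ereal) \<longlongrightarrow> c powr (1 - \<beta>) / (1 - \<beta>)) (at_left (ereal c))"
      using t0[of c 0 "{..<c}"] c by (simp add: ereal_tendsto_simps)
    have C: "DERIV ?F0 x :> x powr (- \<beta>)" if "ereal 0 < ereal x" "ereal x < ereal c" for x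
      using d[of 0 x] that by simp
    have E: "isCont (\<lambda>x. x powr (- \<beta>)) x" if "ereal 0 < ereal x" "ereal x < ereal c" for x
      using that by (intro continuous_intros) auto
    have N: "AE x in lborel. ereal 0 < ereal x \<longrightarrow> ereal x < ereal c \<longrightarrow> 0 \<le> x powr (- \<beta>)" by simp
    show ?thesis
      using interval_integral_FTC_nonneg[of "ereal 0" "ereal c" ?F0 "\<lambda>x. x powr (- \<beta>)", OF _ C E N A B] c by simp
  qed
  let ?F = "\<lambda>x. (x - c) powr (1 - \<beta>) / (1 - \<beta>) - x powr (1 - \<beta>) / (1 - \<beta>)"
  have lim: "(?F \<longlongrightarrow> 0) at_top"
  proof -
    have "eventually (\<lambda>x. norm (?F x) \<le> (c * (x - c) powr (- \<beta>)) / (1 - \<beta>)) at_top"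
      using eventually_gt_at_top[of c]
    proof eventually_elim
      case (elim x)
      define w where "w = x - c"
      have w: "0 < w" using elim by (simp add: w_def)
      \<comment> \<open>As 1 + c / w >= 1, its power 1 - \<beta> is at most its first power; this
        bounds the difference of the two powers by c w^(-\<beta>).\<close>
      have "x powr (1 - \<beta>) = w powr (1 - \<beta>) * (1 + c / w) powr (1 - \<beta>)"
      proof -
        have "w * (1 + c / w) = w + c" using w by (simp add: distrib_left)
        then have "w * (1 + c / w) = x" by (simp add: w_def)
        with powr_mult[of w "1 + c / w" "1 - \<beta>"] w c show ?thesis by simp
      qed
      also have "\<dots> \<le> w powr (1 - \<beta>) * (1 + c / w) powr 1"
        using \<beta> w c by (intro mult_left_mono powr_mono) auto
      also have "\<dots> = w powr (1 - \<beta>) + c * w powr (- \<beta>)"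
        using w c by (simp add: algebra_simps powr_diff powr_minus field_simps)
      finally have "x powr (1 - \<beta>) - w powr (1 - \<beta>) \<le> c * w powr (- \<beta>)" by simp
      moreover have "w powr (1 - \<beta>) \<le> x powr (1 - \<beta>)"
        using w c \<beta> by (intro powr_mono2) (auto simp: w_def)
      ultimately have "\<bar>w powr (1 - \<beta>) - x powr (1 - \<beta>)\<bar> \<le> c * w powr (- \<beta>)" by linarith
      then have "\<bar>w powr (1 - \<beta>) - x powr (1 - \<beta>)\<bar> / (1 - \<beta>) \<le> c * w powr (- \<beta>) / (1 - \<beta>)"
        using \<beta> by (intro divide_right_mono) auto
      moreover have "norm (?F x) = \<bar>w powr (1 - \<beta>) - x powr (1 - \<beta>)\<bar> / (1 - \<beta>)"
        using \<beta> by (simp add: w_def[symmetric] diff_divide_distrib[symmetric] abs_divide)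
      ultimately show ?case by (simp only: w_def)
    qed
    moreover have "((\<lambda>x. (c * (x - c) powr (- \<beta>)) / (1 - \<beta>)) \<longlongrightarrow> (c * 0) / (1 - \<beta>)) at_top"
    proof (intro tendsto_divide tendsto_mult tendsto_const)
      have "filterlim (\<lambda>x. - c + x) at_top at_top"
        by (rule filterlim_tendsto_add_at_top[OF tendsto_const filterlim_ident])
      then have "filterlim (\<lambda>x. x - c) at_top at_top" by simp
      then show "((\<lambda>x. (x - c) powr - \<beta>) \<longlongrightarrow> 0) at_top"
        using \<beta> by (intro tendsto_neg_powr) auto
    qed (use \<beta> in simp)
    ultimately show ?thesis by (intro Lim_null_comparison[where f = ?F]) simp_all
  qed
  let ?f2 = "\<lambda>x. (x - c) powr (- \<beta>) - x powr (- \<beta>)"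
  have 2: "set_integrable lborel (einterval (ereal c) \<infinity>) ?f2
    \<and> (LBINT x=ereal c..\<infinity>. ?f2 x) = 0 - (- (c powr (1 - \<beta>) / (1 - \<beta>)))"
  proof -
    have A: "((?F \<circ> real_of_ereal) \<longlongrightarrow> - (c powr (1 - \<beta>) / (1 - \<beta>))) (at_right (ereal c))"
      using tendsto_diff[OF t0[of c c "{c<..}"] t0[of c 0 "{c<..}"]] \<beta> c by (auto simp: ereal_tendsto_simps)
    have B: "((?F \<circ> real_of_ereal) \<longlongrightarrow> 0) (at_left \<infinity>)" using lim by (simp add: ereal_tendsto_simps)
    have N: "AE x in lborel. ereal c < ereal x \<longrightarrow> ereal x < \<infinity> \<longrightarrow> 0 \<le> ?f2 x"
      using c \<beta> by (intro AE_I2) (auto intro!: powr_mono2')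
    have C: "DERIV ?F x :> ?f2 x" if "ereal c < ereal x" "ereal x < \<infinity>" for x
      using DERIV_diff[OF d[of c x] d[of 0 x]] that c by simp
    have E: "isCont ?f2 x" if "ereal c < ereal x" "ereal x < \<infinity>" for x
      using that c by (intro continuous_intros) auto
    show ?thesis
      using interval_integral_FTC_nonneg[of "ereal c" "\<infinity>" ?F ?f2, OF _ C E N A B] by simp
  qed
  let ?e1 = "\<lambda>x. indicator {0<..<c} x *\<^sub>R (x powr (- \<beta>))"
  let ?e2 = "\<lambda>x. indicator {c<..} x *\<^sub>R ((x - c) powr (- \<beta>) - x powr (- \<beta>))"
  have ei: "einterval (ereal 0) (ereal c) = {0<..<c}" by (auto simp: einterval_def)
  have i: "integrable lborel ?e1" "integrable lborel ?e2"
    using 1 2 by (simp_all only: set_integrable_def ei einterval_halfline)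
  have v: "(LINT x|lborel. ?e1 x) = c powr (1 - \<beta>) / (1 - \<beta>)" "(LINT x|lborel. ?e2 x) = c powr (1 - \<beta>) / (1 - \<beta>)"
    using 1 2 c by (simp_all add: interval_lebesgue_integral_def set_lebesgue_integral_def ei einterval_halfline)
  have ae: "AE x in lborel. frac_kernel \<beta> c x = ?e1 x - ?e2 x \<and> \<bar>frac_kernel \<beta> c x\<bar> = ?e1 x + ?e2 x"
    using AE_lborel_singleton[of c]
  proof eventually_elim
    case (elim x)
    consider "x \<le> 0" | "0 < x" "x < c" | "c < x" using elim by linarith
    then show ?case
    proof cases
      case 3
      then have "x powr (- \<beta>) \<le> (x - c) powr (- \<beta>)" using c \<beta> by (intro powr_mono2') auto
      then show ?thesis using 3 c by (simp add: frac_kernel_def)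
    qed (use c in \<open>auto simp: frac_kernel_def\<close>)
  qed
  have "integrable lborel (\<lambda>x. ?e1 x - ?e2 x)" using i by (rule Bochner_Integration.integrable_diff)
  then show "integrable lborel (frac_kernel \<beta> c)"
    by (rule integrable_cong_AE_imp) (use ae in \<open>auto elim: eventually_mono\<close>)
  have "(LINT x|lborel. \<bar>frac_kernel \<beta> c x\<bar>) = (LINT x|lborel. ?e1 x + ?e2 x)"
    by (rule integral_cong_AE) (use ae in \<open>auto elim: eventually_mono\<close>)
  also have "\<dots> = 2 * (c powr (1 - \<beta>) / (1 - \<beta>))"
    using i v by (subst Bochner_Integration.integral_add) simp_all
  finally show "(LINT x|lborel. \<bar>frac_kernel \<beta> c x\<bar>) = 2 * (c powr (1 - \<beta>) / (1 - \<beta>))" .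
qed

lemma frac_deriv_indicator_integrable:
  assumes \<beta>: "0 < \<beta>" "\<beta> < 1" and st: "s < t"
  shows "integrable lborel (frac_deriv_indicator \<beta> s t)"
    and "(LINT u|lborel. \<bar>frac_deriv_indicator \<beta> s t u\<bar>) = 2 * ((t - s) powr (1 - \<beta>) / (1 - \<beta>)) / Gamma (1 - \<beta>)"
proof -
  note k = frac_kernel_integrable[OF \<beta>, of "t - s"]
  have G: "0 < Gamma (1 - \<beta>)" using \<beta> by (intro Gamma_real_pos) simp
  show "integrable lborel (frac_deriv_indicator \<beta> s t)"
    unfolding frac_deriv_indicator_eq[abs_def]
    using k(1) st lborel_integrable_reflect[of "frac_kernel \<beta> (t - s)" t] by (intro integrable_mult_right) simp
  have "(LINT u|lborel. \<bar>frac_deriv_indicator \<beta> s t u\<bar>) = (LINT u|lborel. 1 / Gamma (1 - \<beta>) * \<bar>frac_kernel \<beta> (t - s) (t - u)\<bar>)"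
    using G by (simp add: frac_deriv_indicator_eq abs_mult)
  also have "\<dots> = 1 / Gamma (1 - \<beta>) * (LINT x|lborel. \<bar>frac_kernel \<beta> (t - s) x\<bar>)"
    using lborel_integral_reflect[of "\<lambda>x. \<bar>frac_kernel \<beta> (t - s) x\<bar>" t] by simp
  finally show "(LINT u|lborel. \<bar>frac_deriv_indicator \<beta> s t u\<bar>) = 2 * ((t - s) powr (1 - \<beta>) / (1 - \<beta>)) / Gamma (1 - \<beta>)"
    using k(2) st by simp
qed

text \<open>An exponential damping with rate \<delta> splits the kernel into a Gamma kernel minus a
  multiple of its translate by \<open>c\<close>, each integrable. As \<delta> tends to 0 the left
  side converges by domination with the undamped kernel, the right side because for nonzero y the
  base of the power stays off the branch cut.\<close>

lemma fourier_frac_kernel: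
  assumes \<beta>: "0 < \<beta>" "\<beta> < 1" and c: "0 < c" and y: "y \<noteq> 0"
  shows "(LINT x|lborel. of_real (frac_kernel \<beta> c x) * iexp (y * x))
     = of_real (Gamma (1 - \<beta>)) * ((1 - iexp (y * c)) * (- \<i> * of_real y) powr of_real (\<beta> - 1))"
proof -
  define \<delta> where "\<delta> n = inverse (real (Suc n))" for n
  have \<delta>: "0 < \<delta> n" for n by (simp add: \<delta>_def)
  have \<delta>0: "\<delta> \<longlonglongrightarrow> 0" unfolding \<delta>_def[abs_def] by (rule LIMSEQ_inverse_real_of_nat)
  let ?k = "frac_kernel \<beta> c"
  have ki: "integrable lborel (\<lambda>x. complex_of_real (?k x))" using frac_kernel_integrable(1)[OF \<beta> c] by simp
  have eq: "(LINT x|lborel. of_real (?k x * exp (- (\<delta> n * max x 0))) * iexp (y * x))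
     = (1 - of_real (exp (- (\<delta> n * c))) * iexp (y * c)) * (of_real (Gamma (1 - \<beta>)) * (of_real (\<delta> n) - \<i> * of_real y) powr (of_real (\<beta> - 1)))" for n
  proof -
    let ?g = "\<lambda>x. complex_of_real (gamma_kernel (1 - \<beta>) (\<delta> n) x)"
    have gi: "integrable lborel (\<lambda>x. ?g x * iexp (y * x))"
      by (rule Bochner_Integration.integrable_bound[OF gamma_kernel_integrable[of "1 - \<beta>" "\<delta> n"]])
         (use \<beta> \<delta> in \<open>auto simp: norm_mult\<close>)
    have gi': "integrable lborel (\<lambda>x. ?g (- c + x) * iexp (y * (- c + x)))"
      using lborel_integrable_shift[of "\<lambda>x. ?g x * iexp (y * x)" "- c"] gi by simp
    have pw: "of_real (?k x * exp (- (\<delta> n * max x 0))) * iexp (y * x) = ?g x * iexp (y * x)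
        - of_real (exp (- (\<delta> n * c))) * iexp (y * c) * (?g (- c + x) * iexp (y * (- c + x)))" for x
    proof -
      have "iexp (y * x) = iexp (y * c) * iexp (y * (- c + x))"
        by (simp only: iexp_add[symmetric]) (simp add: algebra_simps)
      moreover have "?k x * exp (- (\<delta> n * max x 0)) = gamma_kernel (1 - \<beta>) (\<delta> n) x
          - exp (- (\<delta> n * c)) * gamma_kernel (1 - \<beta>) (\<delta> n) (- c + x)"
        using c by (auto simp: frac_kernel_def gamma_kernel_def indicator_def algebra_simps exp_add[symmetric] max_def not_le not_less)
      moreover have "(P - E * R) * (C * I) = P * (C * I) - E * C * (R * I)" for P E R C I :: complex
        by (simp add: algebra_simps)
      ultimately show ?thesis by (simp only: of_real_diff of_real_mult)
    qed
    have "(LINT x|lborel. of_real (?k x * exp (- (\<delta> n * max x 0))) * iexp (y * x))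
      = (LINT x|lborel. ?g x * iexp (y * x)) - of_real (exp (- (\<delta> n * c))) * iexp (y * c) * (LINT x|lborel. ?g (- c + x) * iexp (y * (- c + x)))"
      unfolding pw using gi gi' by (subst Bochner_Integration.integral_diff) (simp_all only: integrable_mult_right integral_mult_right_zero)
    also have "(LINT x|lborel. ?g (- c + x) * iexp (y * (- c + x))) = (LINT x|lborel. ?g x * iexp (y * x))"
      by (rule lborel_integral_shift[where f = "\<lambda>x. ?g x * iexp (y * x)"])
    finally have "(LINT x|lborel. of_real (?k x * exp (- (\<delta> n * max x 0))) * iexp (y * x))
      = (1 - of_real (exp (- (\<delta> n * c))) * iexp (y * c)) * (LINT x|lborel. ?g x * iexp (y * x))"
      by (simp only: left_diff_distrib mult_1)
    also have "(LINT x|lborel. ?g x * iexp (y * x)) = of_real (Gamma (1 - \<beta>)) * (of_real (\<delta> n) - \<i> * of_real y) powr (- of_real (1 - \<beta>))"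
      by (rule fourier_gamma_kernel) (use \<beta> \<delta> in auto)
    also have "- complex_of_real (1 - \<beta>) = of_real (\<beta> - 1)" by simp
    finally show ?thesis .
  qed
  have "(\<lambda>n. LINT x|lborel. of_real (?k x * exp (- (\<delta> n * max x 0))) * iexp (y * x)) \<longlonglongrightarrow> (LINT x|lborel. of_real (?k x) * iexp (y * x))"
  proof (rule integral_dominated_convergence)
    show "integrable lborel (\<lambda>x. norm (complex_of_real (?k x)))" using ki by (rule integrable_norm)
    show "AE x in lborel. (\<lambda>n. of_real (?k x * exp (- (\<delta> n * max x 0))) * iexp (y * x)) \<longlonglongrightarrow> of_real (?k x) * iexp (y * x)"
    proof (rule AE_I2)
      fix x
      have "(\<lambda>n. of_real (?k x * exp (- (\<delta> n * max x 0))) * iexp (y * x)) \<longlonglongrightarrow> of_real (?k x * exp (- (0 * max x 0))) * iexp (y * x)"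
        by (intro tendsto_intros \<delta>0)
      then show "(\<lambda>n. of_real (?k x * exp (- (\<delta> n * max x 0))) * iexp (y * x)) \<longlonglongrightarrow> of_real (?k x) * iexp (y * x)" by simp
    qed
    show "AE x in lborel. norm (of_real (?k x * exp (- (\<delta> n * max x 0))) * iexp (y * x)) \<le> norm (complex_of_real (?k x))" for n
    proof (rule AE_I2)
      fix x
      have "\<bar>?k x\<bar> * exp (- (\<delta> n * max x 0)) \<le> \<bar>?k x\<bar> * 1" using \<delta>[of n] by (intro mult_left_mono) auto
      then show "norm (of_real (?k x * exp (- (\<delta> n * max x 0))) * iexp (y * x)) \<le> norm (complex_of_real (?k x))"
        by (simp add: norm_mult abs_mult)
    qed
  qed measurable
  moreover have "(\<lambda>n. (1 - of_real (exp (- (\<delta> n * c))) * iexp (y * c)) * (of_real (Gamma (1 - \<beta>)) * (of_real (\<delta> n) - \<i> * of_real y) powr (of_real (\<beta> - 1))))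
      \<longlonglongrightarrow> (1 - of_real (exp (- (0 * c))) * iexp (y * c)) * (of_real (Gamma (1 - \<beta>)) * (of_real 0 - \<i> * of_real y) powr (of_real (\<beta> - 1)))"
    by (intro tendsto_intros tendsto_powr_complex \<delta>0) (use y in \<open>auto simp: complex_nonpos_Reals_iff\<close>)
  ultimately have "(LINT x|lborel. of_real (?k x) * iexp (y * x))
      = (1 - of_real (exp (- (0 * c))) * iexp (y * c)) * (of_real (Gamma (1 - \<beta>)) * (of_real 0 - \<i> * of_real y) powr (of_real (\<beta> - 1)))"
    unfolding eq by (rule LIMSEQ_unique)
  then show ?thesis by (simp add: mult_ac)
qed

lemma fourier_frac_deriv_indicator:
  assumes \<beta>: "0 < \<beta>" "\<beta> < 1" and st: "s < t" and y: "y \<noteq> 0"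
  shows "(LINT u|lborel. of_real (frac_deriv_indicator \<beta> s t u) * iexp (- (y * u)))
     = (iexp (- (y * t)) - iexp (- (y * s))) * (- \<i> * of_real y) powr of_real (\<beta> - 1)"
proof -
  let ?k = "frac_kernel \<beta> (t - s)"
  have "0 < Gamma (1 - \<beta>)" using \<beta> by (intro Gamma_real_pos) simp
  then have G: "Gamma (1 - \<beta>) \<noteq> 0" by linarith
  have "(LINT u|lborel. of_real (frac_deriv_indicator \<beta> s t u) * iexp (- (y * u)))
      = (LINT x|lborel. of_real (frac_deriv_indicator \<beta> s t (t - x)) * iexp (- (y * (t - x))))"
    by (rule lborel_integral_reflect[symmetric])
  also have "\<dots> = (LINT x|lborel. (of_real (1 / Gamma (1 - \<beta>)) * iexp (- (y * t))) * (of_real (?k x) * iexp (y * x)))"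
  proof (rule Bochner_Integration.integral_cong[OF refl])
    fix x
    have "iexp (- (y * (t - x))) = iexp (- (y * t)) * iexp (y * x)"
      by (simp only: iexp_add[symmetric]) (simp add: algebra_simps)
    then show "of_real (frac_deriv_indicator \<beta> s t (t - x)) * iexp (- (y * (t - x)))
        = (of_real (1 / Gamma (1 - \<beta>)) * iexp (- (y * t))) * (of_real (?k x) * iexp (y * x))"
      by (simp add: frac_deriv_indicator_eq)
  qed
  also have "\<dots> = (of_real (1 / Gamma (1 - \<beta>)) * iexp (- (y * t))) * (LINT x|lborel. of_real (?k x) * iexp (y * x))"
    by (rule integral_mult_right_zero)
  also have "(LINT x|lborel. of_real (?k x) * iexp (y * x)) = of_real (Gamma (1 - \<beta>)) * ((1 - iexp (y * (t - s))) * (- \<i> * of_real y) powr of_real (\<beta> - 1))"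
    by (rule fourier_frac_kernel[OF \<beta> _ y]) (use st in simp)
  also have "(of_real (1 / Gamma (1 - \<beta>)) * iexp (- (y * t))) * (of_real (Gamma (1 - \<beta>)) * ((1 - iexp (y * (t - s))) * (- \<i> * of_real y) powr of_real (\<beta> - 1)))
      = (iexp (- (y * t)) - iexp (- (y * t)) * iexp (y * (t - s))) * (- \<i> * of_real y) powr of_real (\<beta> - 1)"
    using G by (simp add: field_simps)
  also have "iexp (- (y * t)) * iexp (y * (t - s)) = iexp (- (y * s))"
    by (simp only: iexp_add[symmetric]) (simp add: algebra_simps)
  finally show ?thesis .
qed

section \<open>The kernel of the equation as a Fourier multiplier\<close>

locale fractional_delay =
  fixes \<beta> :: real and Q :: "real measure" and \<sigma> :: "real \<Rightarrow> real"
  assumes \<beta>: "0 < \<beta>" "\<beta> < 1 / 2"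
    and Q: "finite_measure Q" "sets Q = sets (restrict_space borel {0..})"
    and \<sigma>: "integrable Q \<sigma>" and \<sigma>_moment: "integrable Q (\<lambda>v. v * \<sigma> v)"
begin

lemma sigma_finite_Q: "sigma_finite_measure Q"
  using Q(1) by (rule finite_measure.axioms(1))

lemma measurable_id_Q [measurable]: "(\<lambda>v. v) \<in> borel_measurable Q"
proof -
  have "(\<lambda>v. v) \<in> borel_measurable (restrict_space borel {0..} :: real measure)"
    by (rule measurable_restrict_space1) simp
  then show ?thesis by (simp cong: measurable_cong_sets add: Q(2))
qed

lemma measurable_\<sigma> [measurable]: "\<sigma> \<in> borel_measurable Q"
  using \<sigma> by auto

definition eta_hat :: "real \<Rightarrow> complex" where
  "eta_hat y = (LINT v|Q. of_real (\<sigma> v) * iexp (y * v))"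

text \<open>The function h of the statement on the imaginary axis, at the point iy, with the signed
  measure expressed by the density \<open>\<sigma>\<close> on \<open>Q\<close>.\<close>

definition h :: "real \<Rightarrow> complex" where
  "h y = (- \<i> * of_real y) powr of_real (1 - \<beta>) - eta_hat y"

text \<open>Lives on pairs of an integration time u and a delay v. With the weight \<open>D\<close>
  and the evaluation point \<open>lag\<close>, the nested integrals of the equation become one
  integral.\<close>

definition \<nu> :: "(real \<times> real) measure" where
  "\<nu> = lborel \<Otimes>\<^sub>M Q"

definition D :: "real \<Rightarrow> real \<Rightarrow> real \<times> real \<Rightarrow> real" where
  "D s t c = frac_deriv_indicator \<beta> s t (fst c) * \<sigma> (snd c)"

definition lag :: "real \<times> real \<Rightarrow> real" where
  "lag c = fst c - snd c"

lemma sigma_finite_\<nu>: "sigma_finite_measure \<nu>"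
proof -
  interpret Q: sigma_finite_measure Q by (rule sigma_finite_Q)
  interpret pair_sigma_finite lborel Q ..
  show ?thesis unfolding \<nu>_def by (rule sigma_finite_measure_axioms)
qed

lemma lag_measurable [measurable]: "lag \<in> borel_measurable \<nu>"
  unfolding lag_def[abs_def] \<nu>_def by measurable

lemma D_integrable: "s < t \<Longrightarrow> integrable \<nu> (D s t)"
  unfolding D_def[abs_def] \<nu>_def
  using \<beta> by (intro integrable_product_mult sigma_finite_Q sigma_finite_lborel \<sigma> frac_deriv_indicator_integrable) auto

text \<open>The time variable contributes the fractional power; the delay enters \<open>lag\<close>
  with a minus sign and contributes \<open>eta_hat\<close> at +y.\<close>

lemma fourier_D:
  assumes st: "s < t" and y: "y \<noteq> 0"
  shows "(LINT c|\<nu>. of_real (D s t c) * iexp (- (y * lag c)))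
    = (iexp (- (y * t)) - iexp (- (y * s))) * (- \<i> * of_real y) powr of_real (\<beta> - 1) * eta_hat y"
proof -
  have "(LINT c|\<nu>. of_real (D s t c) * iexp (- (y * lag c)))
     = (LINT c|(lborel \<Otimes>\<^sub>M Q). (of_real (frac_deriv_indicator \<beta> s t (fst c)) * iexp (- (y * fst c))) * (of_real (\<sigma> (snd c)) * iexp (y * snd c)))"
    unfolding \<nu>_def
  proof (rule Bochner_Integration.integral_cong[OF refl])
    fix c
    have "iexp (- (y * lag c)) = iexp (- (y * fst c)) * iexp (y * snd c)"
      by (simp only: iexp_add[symmetric] lag_def) (simp add: algebra_simps)
    then show "of_real (D s t c) * iexp (- (y * lag c))
      = (of_real (frac_deriv_indicator \<beta> s t (fst c)) * iexp (- (y * fst c))) * (of_real (\<sigma> (snd c)) * iexp (y * snd c))"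
      by (simp add: D_def)
  qed
  also have "\<dots> = (LINT u|lborel. of_real (frac_deriv_indicator \<beta> s t u) * iexp (- (y * u))) * eta_hat y"
    unfolding eta_hat_def
  proof (rule integrable_product_mult(2)[OF sigma_finite_lborel sigma_finite_Q])
    have "integrable lborel (\<lambda>u. complex_of_real (frac_deriv_indicator \<beta> s t u))"
      using frac_deriv_indicator_integrable(1)[OF _ _ st, of \<beta>] \<beta> by simp
    then show "integrable lborel (\<lambda>u. complex_of_real (frac_deriv_indicator \<beta> s t u) * iexp (- (y * u)))"
      by (rule Bochner_Integration.integrable_bound) (auto simp: norm_mult)
    show "integrable Q (\<lambda>v. complex_of_real (\<sigma> v) * iexp (y * v))"
      by (rule Bochner_Integration.integrable_bound[OF \<sigma>]) (auto simp: norm_mult)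
  qed
  also have "(LINT u|lborel. of_real (frac_deriv_indicator \<beta> s t u) * iexp (- (y * u)))
     = (iexp (- (y * t)) - iexp (- (y * s))) * (- \<i> * of_real y) powr of_real (\<beta> - 1)"
    by (rule fourier_frac_deriv_indicator) (use \<beta> st y in auto)
  finally show ?thesis .
qed

text \<open>Applied in time to a function given by a frequency integral, the kernel acts as a
  multiplier: its own transform moves inside. The exponential has modulus 1, so
  \<open>Fubini_bounded_kernel\<close> applies.\<close>

lemma fourier_kernel_Fubini:
  assumes st: "s < t" and \<Psi>: "integrable lborel \<Psi>"
  shows "(LINT c|\<nu>. of_real (D s t c) * (LINT y|lborel. \<Psi> y * iexp (- (y * (lag c - w)))))
     = (LINT y|lborel. \<Psi> y * iexp (y * w) * (LINT c|\<nu>. of_real (D s t c) * iexp (- (y * lag c))))"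
proof -
  have "(LINT c|\<nu>. of_real (D s t c) * (LINT y|lborel. \<Psi> y * iexp (- (y * (lag c - w)))))
     = (LINT y|lborel. \<Psi> y * (LINT c|\<nu>. of_real (D s t c) * iexp (- (y * (lag c - w)))))"
    by (rule Fubini_bounded_kernel[OF sigma_finite_\<nu> sigma_finite_lborel _ \<Psi>, where B = 1])
       (use D_integrable[OF st] in auto)
  also have "\<dots> = (LINT y|lborel. \<Psi> y * iexp (y * w) * (LINT c|\<nu>. of_real (D s t c) * iexp (- (y * lag c))))"
  proof (rule Bochner_Integration.integral_cong[OF refl])
    fix y
    have e: "iexp (- (y * (lag c - w))) = iexp (y * w) * iexp (- (y * lag c))" for c
      by (simp only: iexp_add[symmetric]) (simp add: algebra_simps)
    have "(LINT c|\<nu>. of_real (D s t c) * iexp (- (y * (lag c - w)))) = (LINT c|\<nu>. iexp (y * w) * (of_real (D s t c) * iexp (- (y * lag c))))"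
      unfolding e by (simp only: mult_ac)
    also have "\<dots> = iexp (y * w) * (LINT c|\<nu>. of_real (D s t c) * iexp (- (y * lag c)))"
      by (rule integral_mult_right_zero)
    finally show "\<Psi> y * (LINT c|\<nu>. of_real (D s t c) * iexp (- (y * (lag c - w))))
        = \<Psi> y * iexp (y * w) * (LINT c|\<nu>. of_real (D s t c) * iexp (- (y * lag c)))"
      by (simp only: mult.assoc)
  qed
  finally show ?thesis .
qed

text \<open>Comes from solving the definition of \<open>h\<close> for \<open>eta_hat\<close>. The
  multiplier of the kernel becomes 1 minus a multiple of \<open>h\<close>, so a function with
  \<open>h\<close> in the denominator of its transform leaves an explicit remainder.\<close>

lemma h_identity:
  assumes y: "y \<noteq> 0"
  shows "(- \<i> * of_real y) powr of_real (\<beta> - 1) * eta_hat y = 1 - (- \<i> * of_real y) powr of_real (\<beta> - 1) * h y"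
proof -
  have "(- \<i> * of_real y) powr of_real (\<beta> - 1) * (- \<i> * of_real y) powr of_real (1 - \<beta>) = 1"
    using y by (subst powr_add[symmetric]) simp
  then show ?thesis by (simp add: h_def algebra_simps)
qed

declare measurable_id_Q [measurable del]

end

section \<open>The moving average solves the equation\<close>

declare standard_two_sided_levy.measurable_path_component [measurable del]

locale delay_kernel = fractional_delay +
  fixes g :: "real \<Rightarrow> real"
  assumes g_sq: "square_integrable lborel g" and g_causal: "\<And>u. u < 0 \<Longrightarrow> g u = 0"
    and h_nonzero: "\<And>y. h y \<noteq> 0"
    and g_fourier: "has_fourier_L2 (\<lambda>u. complex_of_real (g u)) (\<lambda>y. (- \<i> * of_real y) powr of_real (- \<beta>) / h y)"
begin

lemma g_measurable [measurable]: "g \<in> borel_measurable borel"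
  using square_integrable_measurable[OF g_sq] by simp

text \<open>By \<open>h_identity\<close> the kernel maps the smoothed \<open>g\<close> to its
  increment minus the inverse transform of the difference of two exponentials over -iy, damped by
  the Gaussian; that is the smoothed indicator of [s, t].\<close>

lemma kernel_identity_smoothed:
  assumes e: "0 < e" and st: "s < t"
  shows "(LINT c|\<nu>. D s t c * (LINT r|lborel. g r * normal_density 0 e (lag c - w - r)))
    = (LINT r|lborel. g r * normal_density 0 e (t - w - r)) - (LINT r|lborel. g r * normal_density 0 e (s - w - r))
      - (LINT u|lborel. indicator {s..t} u * normal_density 0 e (w - u))"
proof -
  define G where "G y = (- \<i> * of_real y) powr of_real (- \<beta>) / h y" for y
  define N where "N y = complex_of_real (exp (- (e * y)\<^sup>2 / 2))" for y
  define gs where "gs x = (LINT r|lborel. g r * normal_density 0 e (x - r))" for x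
  define \<Psi> where "\<Psi> y = G y * N y" for y
  define E where "E x y = iexp (- (y * x))" for x y
  have Ni: "integrable lborel N" using gaussian_integrable[OF e] unfolding N_def[abs_def] by (rule integrable_of_real)
  have Ns: "square_integrable lborel N"
    using square_integrable_gaussian[OF e] by (simp add: square_integrable_def N_def[abs_def])
  have Gs: "square_integrable lborel G"
    using g_fourier unfolding has_fourier_L2_def L2_tendsto_def G_def[abs_def] by blast
  have \<Psi>i: "integrable lborel \<Psi>" unfolding \<Psi>_def[abs_def] by (rule square_integrable_mult_complex(1)[OF Gs Ns])
  have \<Psi>E: "integrable lborel (\<lambda>y. \<Psi> y * E x y)" for x
    by (rule Bochner_Integration.integrable_bound[OF \<Psi>i]) (use \<Psi>i in \<open>auto simp: E_def norm_mult\<close>)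
  have gs: "complex_of_real (2 * pi * gs x) = (LINT y|lborel. \<Psi> y * E x y)" for x
  proof -
    have "complex_of_real (2 * pi * gs x) = of_real (2 * pi) * (LINT r|lborel. of_real (g r) * of_real (normal_density 0 e (x - r)))"
      unfolding gs_def of_real_mult by (simp only: of_real_mult[symmetric] integral_complex_of_real)
    also have "\<dots> = (LINT y|lborel. \<Psi> y * E x y)"
      using has_fourier_L2_gaussian[OF g_fourier e, of x] by (simp only: \<Psi>_def N_def G_def E_def)
    finally show ?thesis .
  qed
  define m where "m y = (LINT c|\<nu>. of_real (D s t c) * E (lag c) y)" for y
  have lhs: "complex_of_real (2 * pi * (LINT c|\<nu>. D s t c * gs (lag c - w))) = (LINT y|lborel. \<Psi> y * iexp (y * w) * m y)"
  proof -
    have "complex_of_real (2 * pi * (LINT c|\<nu>. D s t c * gs (lag c - w)))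
        = of_real (2 * pi) * (LINT c|\<nu>. of_real (D s t c * gs (lag c - w)))"
      by (simp only: of_real_mult[of "2 * pi"] integral_complex_of_real)
    also have "\<dots> = (LINT c|\<nu>. of_real (2 * pi) * of_real (D s t c * gs (lag c - w)))"
      by (rule integral_mult_right_zero[symmetric])
    also have "\<dots> = (LINT c|\<nu>. of_real (D s t c) * (LINT y|lborel. \<Psi> y * E (lag c - w) y))"
      unfolding gs[symmetric] by (rule Bochner_Integration.integral_cong[OF refl]) simp
    also have "\<dots> = (LINT y|lborel. \<Psi> y * iexp (y * w) * m y)"
      unfolding E_def m_def by (rule fourier_kernel_Fubini[OF st \<Psi>i])
    finally show ?thesis .
  qed
  \<comment> \<open>The transform of the indicator; away from 0 it is the difference of exponentials
    over -iy, and everywhere it is bounded by t - s.\<close>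
  define U where "U y = (LINT u|lborel. of_real (indicator {s..t} u) * E u y)" for y
  have U: "U y = (E t y - E s y) * (- \<i> * of_real y) powr (- 1)" if y: "y \<noteq> 0" for y
  proof -
    have "((\<lambda>u. E u y / (- \<i> * of_real y)) has_vector_derivative E u y) (at u within {s..t})" for u
      unfolding E_def using y by (auto intro!: derivative_eq_intros has_vector_derivative_real_field simp: field_simps)
    moreover have "continuous_on {s..t} (\<lambda>u. E u y)" unfolding E_def by (intro continuous_intros)
    ultimately have "(LINT u|lborel. indicator {s..t} u *\<^sub>R E u y) = E t y / (- \<i> * of_real y) - E s y / (- \<i> * of_real y)"
      using st by (intro integral_FTC_Icc) auto
    then show ?thesis using y by (simp add: U_def scaleR_conv_of_real powr_minus diff_divide_distrib divide_inverse algebra_simps)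
  qed
  have Ubound: "norm (U y) \<le> t - s" for y
  proof -
    have "norm (U y) \<le> (LINT u|lborel. norm (of_real (indicator {s..t} u) * E u y))"
      unfolding U_def by (rule integral_norm_bound)
    also have "\<dots> = (LINT u|lborel. indicator {s..t} u)" by (simp add: norm_mult E_def)
    also have "\<dots> = t - s" using st by simp
    finally show ?thesis .
  qed
  have Um: "U \<in> borel_measurable borel" unfolding U_def[abs_def] E_def by measurable
  have NU: "integrable lborel (\<lambda>y. N y * iexp (y * w) * U y)"
  proof (rule Bochner_Integration.integrable_bound)
    show "integrable lborel (\<lambda>y. N y * of_real (t - s))" using Ni by simp
    show "(\<lambda>y. N y * iexp (y * w) * U y) \<in> borel_measurable lborel"
      using Ni Um by measurable
    show "AE y in lborel. norm (N y * iexp (y * w) * U y) \<le> norm (N y * of_real (t - s))"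
    proof (rule AE_I2)
      fix y
      have "norm (complex_of_real (t - s)) = t - s" using st by (simp only: norm_of_real)
      then show "norm (N y * iexp (y * w) * U y) \<le> norm (N y * of_real (t - s))"
        using Ubound[of y] by (simp add: norm_mult mult_left_mono del: of_real_diff)
    qed
  qed
  \<comment> \<open>The frequency 0 is left out: there complex \<open>powr\<close> takes the default
    value 0 and the law of exponents fails.\<close>
  have "AE y in lborel. \<Psi> y * iexp (y * w) * m y = \<Psi> y * E (t - w) y - \<Psi> y * E (s - w) y - N y * iexp (y * w) * U y"
    using AE_lborel_singleton[of "0 :: real"]
  proof eventually_elim
    case (elim y)
    let ?z = "- \<i> * complex_of_real y"
    have E: "E (x - w) y = iexp (y * w) * E x y" for x
      unfolding E_def by (simp only: iexp_add[symmetric]) (simp add: algebra_simps)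
    have m: "m y = (E t y - E s y) * (1 - ?z powr of_real (\<beta> - 1) * h y)"
      unfolding m_def E_def fourier_D[OF st elim] h_identity[OF elim, symmetric] by (simp only: mult.assoc)
    \<comment> \<open>The factor \<open>h\<close> cancels the denominator of \<open>G\<close>, and
      the exponents - \<beta> and \<beta> - 1 add up to -1.\<close>
    have "G y * (?z powr of_real (\<beta> - 1) * h y) = ?z powr of_real (- \<beta>) * ?z powr of_real (\<beta> - 1)"
      using h_nonzero[of y] by (simp add: G_def)
    also have "\<dots> = ?z powr (- 1)" using elim by (subst powr_add[symmetric]) simp
    finally have GU: "G y * (?z powr of_real (\<beta> - 1) * h y) = ?z powr (- 1)" .
    have "\<Psi> y * iexp (y * w) * m y = \<Psi> y * (iexp (y * w) * E t y) - \<Psi> y * (iexp (y * w) * E s y)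
        - N y * iexp (y * w) * ((E t y - E s y) * (G y * (?z powr of_real (\<beta> - 1) * h y)))"
    proof -
      have "P * K * W * ((A - B) * (1 - Z)) = P * K * (W * A) - P * K * (W * B) - K * W * ((A - B) * (P * Z))"
        for P K W A B Z :: complex by (simp add: algebra_simps)
      then show ?thesis unfolding m \<Psi>_def .
    qed
    then show ?case unfolding GU E U[OF elim] .
  qed
  then have "(LINT y|lborel. \<Psi> y * iexp (y * w) * m y)
      = (LINT y|lborel. \<Psi> y * E (t - w) y - \<Psi> y * E (s - w) y - N y * iexp (y * w) * U y)"
  proof (rule integral_cong_AE[rotated 2])
    have "m \<in> borel_measurable borel"
    proof -
      interpret N: sigma_finite_measure \<nu> by (rule sigma_finite_\<nu>)
      have [measurable]: "D s t \<in> borel_measurable \<nu>" using D_integrable[OF st] by auto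
      show ?thesis unfolding m_def[abs_def] E_def by measurable
    qed
    then show "(\<lambda>y. \<Psi> y * iexp (y * w) * m y) \<in> borel_measurable lborel" using \<Psi>i by measurable
    show "(\<lambda>y. \<Psi> y * E (t - w) y - \<Psi> y * E (s - w) y - N y * iexp (y * w) * U y) \<in> borel_measurable lborel"
      using \<Psi>E NU by (intro borel_measurable_integrable Bochner_Integration.integrable_diff)
  qed
  also have "\<dots> = of_real (2 * pi * gs (t - w)) - of_real (2 * pi * gs (s - w)) - (LINT y|lborel. N y * iexp (y * w) * U y)"
    using \<Psi>E NU by (simp only: gs Bochner_Integration.integral_diff Bochner_Integration.integrable_diff)
  also have "(LINT y|lborel. N y * iexp (y * w) * U y) = of_real (2 * pi * (LINT u|lborel. indicator {s..t} u * normal_density 0 e (w - u)))"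
  proof -
    have "integrable lborel (\<lambda>y. N y * iexp (y * w))"
      by (rule Bochner_Integration.integrable_bound[OF Ni]) (use Ni in \<open>auto simp: norm_mult\<close>)
    then have "(LINT y|lborel. (N y * iexp (y * w)) * U y)
        = (LINT u|lborel. of_real (indicator {s..t} u) * (LINT y|lborel. (N y * iexp (y * w)) * E u y))"
      unfolding U_def by (rule Fubini_bounded_kernel[OF sigma_finite_lborel sigma_finite_lborel, where B = 1])
        (use st in \<open>auto simp: E_def integrable_of_real\<close>)
    also have "\<dots> = (LINT u|lborel. of_real (2 * pi * (indicator {s..t} u * normal_density 0 e (w - u))))"
    proof (rule Bochner_Integration.integral_cong[OF refl])
      fix u
      have "(N y * iexp (y * w)) * E u y = of_real (exp (- (e * y)\<^sup>2 / 2)) * iexp (y * (w - u))" for y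
      proof -
        have "iexp (y * (w - u)) = iexp (y * w) * E u y"
          unfolding E_def by (simp only: iexp_add[symmetric]) (simp add: algebra_simps)
        then show ?thesis by (simp only: N_def mult.assoc)
      qed
      then have "(LINT y|lborel. (N y * iexp (y * w)) * E u y) = of_real (2 * pi * normal_density 0 e (w - u))"
        using gaussian_fourier(1)[OF e, of "w - u"] by (simp only:)
      then show "of_real (indicator {s..t} u) * (LINT y|lborel. (N y * iexp (y * w)) * E u y)
          = complex_of_real (2 * pi * (indicator {s..t} u * normal_density 0 e (w - u)))"
        by simp
    qed
    also have "\<dots> = of_real (2 * pi * (LINT u|lborel. indicator {s..t} u * normal_density 0 e (w - u)))"
      by (simp only: integral_complex_of_real integral_mult_right_zero)
    finally show ?thesis .
  qed
  finally have "complex_of_real (2 * pi * (LINT c|\<nu>. D s t c * gs (lag c - w)))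
      = of_real (2 * pi * gs (t - w) - 2 * pi * gs (s - w) - 2 * pi * (LINT u|lborel. indicator {s..t} u * normal_density 0 e (w - u)))"
    unfolding lhs[symmetric] by (simp only: of_real_diff)
  then have "2 * pi * (LINT c|\<nu>. D s t c * gs (lag c - w))
      = 2 * pi * gs (t - w) - 2 * pi * gs (s - w) - 2 * pi * (LINT u|lborel. indicator {s..t} u * normal_density 0 e (w - u))"
    by (simp only: of_real_eq_iff)
  also have "\<dots> = 2 * pi * (gs (t - w) - gs (s - w) - (LINT u|lborel. indicator {s..t} u * normal_density 0 e (w - u)))"
    by (simp only: right_diff_distrib)
  finally show ?thesis by (simp add: gs_def)
qed

lemma g_past_sq: "square_integrable lborel (\<lambda>x. g (t - x))"
  by (rule square_integrable_reflect[OF g_sq])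

lemma g_past_norm: "(LINT x|lborel. (g (t - x))\<^sup>2) = (LINT x|lborel. (g x)\<^sup>2)"
  by (rule lborel_integral_reflect[where f = "\<lambda>x. (g x)\<^sup>2"])

text \<open>Lebesgue measure takes the place of the probability space, and the translates of
  \<open>g\<close> that of the process.\<close>

lemmas kernel_superposition = weighted_superposition[OF sigma_finite_lborel sigma_finite_\<nu> D_integrable lag_measurable,
  where X = "\<lambda>t x. g (t - x)" and C = "LINT x|lborel. (g x)\<^sup>2", OF _ _ g_past_sq eq_refl[OF g_past_norm]]

theorem kernel_identity:
  assumes st: "s < t"
  shows "AE x in lborel. g (t - x) - g (s - x) - indicator {s<..t} x = (LINT c|\<nu>. D s t c * g (lag c - x))"
proof -
  define k1 where "k1 x = (LINT c|\<nu>. D s t c * g (lag c - x))" for x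
  have sup: "square_integrable lborel k1"
    "\<And>W. square_integrable lborel W \<Longrightarrow> (LINT x|lborel. W x * k1 x) = (LINT c|\<nu>. D s t c * (LINT x|lborel. W x * g (lag c - x)))"
    unfolding k1_def using kernel_superposition(2,3)[OF st] by auto
  let ?k0 = "\<lambda>x. g (t - x) - g (s - x) - indicator {s<..t} x"
  have k0: "square_integrable lborel ?k0"
    by (intro square_integrable_diff g_past_sq square_integrable_indicator_interval)
  have "AE x in lborel. ?k0 x - k1 x = 0"
  proof (rule gaussian_smoothing_zero[OF square_integrable_diff[OF k0 sup(1)]])
    fix e w :: real assume e: "0 < e"
    let ?n = "normal_density 0 e"
    have ns: "square_integrable lborel (\<lambda>x. ?n (w - x))"
      by (rule square_integrable_reflect[OF square_integrable_normal_density[OF e]])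
    \<comment> \<open>The reflection r = a - x turns the pairing at w into a smoothing of
      \<open>g\<close> at a - w, the form in which the smoothed identity is available.\<close>
    have conv: "(LINT x|lborel. ?n (w - x) * g (a - x)) = (LINT r|lborel. g r * ?n (a - w - r))" for a
    proof -
      have "(LINT x|lborel. ?n (w - x) * g (a - x)) = (LINT x|lborel. g (a - x) * ?n (a - w - (a - x)))"
        by (rule Bochner_Integration.integral_cong[OF refl]) (simp add: normal_density_minus[of e w] mult.commute)
      also have "\<dots> = (LINT r|lborel. g r * ?n (a - w - r))"
        by (rule lborel_integral_reflect[where f = "\<lambda>r. g r * ?n (a - w - r)"])
      finally show ?thesis .
    qed
    have ind: "(LINT x|lborel. ?n (w - x) * indicator {s<..t} x) = (LINT u|lborel. indicator {s..t} u * ?n (w - u))"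
    proof (rule integral_cong_AE)
      show "AE x in lborel. ?n (w - x) * indicator {s<..t} x = indicator {s..t} x * ?n (w - x)"
        using AE_lborel_singleton[of s] by eventually_elim (auto simp: indicator_def)
    qed measurable
    note i = square_integrable_mult[OF ns g_past_sq] square_integrable_mult[OF ns square_integrable_indicator_interval]
      square_integrable_mult[OF ns sup(1)]
    have "(LINT x|lborel. ?n (w - x) * (?k0 x - k1 x)) = (LINT x|lborel. ?n (w - x) * g (t - x) - ?n (w - x) * g (s - x)
        - ?n (w - x) * indicator {s<..t} x - ?n (w - x) * k1 x)"
      by (simp only: right_diff_distrib)
    also have "\<dots> = (LINT x|lborel. ?n (w - x) * g (t - x)) - (LINT x|lborel. ?n (w - x) * g (s - x))
        - (LINT x|lborel. ?n (w - x) * indicator {s<..t} x) - (LINT x|lborel. ?n (w - x) * k1 x)"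
      using i by (simp only: Bochner_Integration.integral_diff Bochner_Integration.integrable_diff)
    also have "\<dots> = 0"
      unfolding sup(2)[OF ns] conv ind kernel_identity_smoothed[OF e st] by simp
    finally show "(LINT x|lborel. ?n (w - x) * (?k0 x - k1 x)) = 0" .
  qed
  then show ?thesis by (simp add: k1_def)
qed

end

section \<open>Path integrals against the signed measure\<close>

locale signed_delay = fractional_delay +
  fixes \<eta> :: "real set \<Rightarrow> real"
  assumes \<eta>: "finite_signed_measure halfline \<eta>" and Q_eq: "Q = total_variation halfline \<eta>"
    and signed: "\<And>f :: real \<Rightarrow> real. integrable Q f \<Longrightarrow> signed_integral halfline \<eta> f = (LINT v|Q. \<sigma> v * f v)"
begin

text \<open>Lets the kernel be divided out: integrability in v of its product with x (u - v) passes
  to x (u - v) itself.\<close>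

lemma frac_deriv_indicator_nonzero:
  assumes "u < t" "s < t" shows "frac_deriv_indicator \<beta> s t u \<noteq> 0"
proof -
  have G: "0 < Gamma (1 - \<beta>)" using \<beta> by (intro Gamma_real_pos) simp
  have "(max (t - u) 0) powr (- \<beta>) \<noteq> (max (s - u) 0) powr (- \<beta>)"
  proof (cases "s \<le> u")
    case True
    then show ?thesis using assms by simp
  next
    case False
    then have "(t - u) powr (- \<beta>) < (s - u) powr (- \<beta>)"
      using assms \<beta> by (intro powr_less_mono2_neg) auto
    then show ?thesis using False assms by simp
  qed
  with G show ?thesis by (simp add: frac_deriv_indicator_def)
qed

text \<open>Fubini for a single path. \<open>i1\<close>, with the density, yields the value of the
  nested integral; \<open>i2\<close>, without it, yields integrability of almost every section under
  the total variation itself, as \<open>signed_integrable\<close> demands. After t the kernel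
  vanishes, so restricting to u <= t changes nothing.\<close>

lemma path_integral:
  assumes st: "s < t" and x[measurable]: "x \<in> borel_measurable borel"
    and i1: "integrable \<nu> (\<lambda>c. D s t c * x (lag c))"
    and i2: "integrable \<nu> (\<lambda>c. frac_deriv_indicator \<beta> s t (fst c) * x (lag c))"
  shows "AE u in lborel. u \<le> t \<longrightarrow> signed_integrable halfline \<eta> (\<lambda>v. x (u - v))"
    and "set_integrable lborel {..t} (\<lambda>u. frac_deriv_indicator \<beta> s t u * signed_integral halfline \<eta> (\<lambda>v. x (u - v)))"
    and "(LINT u:{..t}|lborel. frac_deriv_indicator \<beta> s t u * signed_integral halfline \<eta> (\<lambda>v. x (u - v)))
       = (LINT c|\<nu>. D s t c * x (lag c))"
proof -
  interpret Q: sigma_finite_measure Q by (rule sigma_finite_Q)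
  interpret pair_sigma_finite lborel Q ..
  let ?f = "frac_deriv_indicator \<beta> s t" and ?s = "\<lambda>u. signed_integral halfline \<eta> (\<lambda>v. x (u - v))"
  have f0: "?f u = 0" if "t < u" for u using that st by (simp add: frac_deriv_indicator_def)
  have "AE u in lborel. integrable Q (\<lambda>v. ?f u * x (u - v))"
    using AE_integrable_fst'[OF i2[unfolded \<nu>_def]] by (simp add: lag_def)
  then have ae: "AE u in lborel. u \<noteq> t \<and> (u < t \<longrightarrow> integrable Q (\<lambda>v. x (u - v)))"
    using AE_lborel_singleton[of t]
  proof eventually_elim
    case (elim u)
    then show ?case using frac_deriv_indicator_nonzero[of u t s] st by (auto simp: integrable_mult_right_iff)
  qed
  then show "AE u in lborel. u \<le> t \<longrightarrow> signed_integrable halfline \<eta> (\<lambda>v. x (u - v))"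
    by eventually_elim (auto simp: signed_integrable_def Q_eq)
  \<comment> \<open>The representation by \<open>\<sigma>\<close> covers only those u whose section
    is integrable, so measurability of the signed integral in u is taken from its two
    variations.\<close>
  have sm: "(\<lambda>u. LINT v|P. x (u - v)) \<in> borel_measurable borel" if P: "finite_measure P" "sets P = sets halfline" for P
  proof -
    interpret P: finite_measure P by fact
    have "(\<lambda>v. v) \<in> borel_measurable (restrict_space borel {0..} :: real measure)"
      by (rule measurable_restrict_space1) simp
    then have [measurable]: "(\<lambda>v. v) \<in> borel_measurable P" by (simp cong: measurable_cong_sets add: P(2))
    show ?thesis by (rule P.borel_measurable_lebesgue_integral) measurable
  qed
  have [measurable]: "?s \<in> borel_measurable borel"
    unfolding signed_integral_def
    by (intro borel_measurable_diff sm finite_measure_upper_variation finite_measure_lower_variation \<eta>) simp_all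
  have eq: "AE u in lborel. (LINT v|Q. D s t (u, v) * x (lag (u, v))) = indicator {..t} u *\<^sub>R (?f u * ?s u)"
    using ae
  proof eventually_elim
    case (elim u)
    have e: "(LINT v|Q. D s t (u, v) * x (lag (u, v))) = ?f u * (LINT v|Q. \<sigma> v * x (u - v))"
      by (subst integral_mult_right_zero[symmetric]) (simp add: D_def lag_def mult.assoc)
    show ?case
    proof (cases "u < t")
      case True
      then show ?thesis using elim signed by (simp add: e)
    next
      case False
      then have "t < u" using elim by simp
      then show ?thesis by (simp add: e f0)
    qed
  qed
  have i1': "integrable lborel (\<lambda>u. LINT v|Q. D s t (u, v) * x (lag (u, v)))"
    by (rule integrable_fst'[OF i1[unfolded \<nu>_def]])
  then show "set_integrable lborel {..t} (\<lambda>u. ?f u * ?s u)"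
    unfolding set_integrable_def by (rule integrable_cong_AE_imp) (use eq in \<open>auto elim: eventually_mono\<close>)
  have "(LINT u:{..t}|lborel. ?f u * ?s u) = (LINT u|lborel. LINT v|Q. D s t (u, v) * x (lag (u, v)))"
    unfolding set_lebesgue_integral_def
    by (rule integral_cong_AE) (use eq i1' in \<open>auto elim: eventually_mono\<close>)
  also have "\<dots> = (LINT c|\<nu>. D s t c * x (lag c))"
    unfolding \<nu>_def by (rule integral_fst'[OF i1[unfolded \<nu>_def]])
  finally show "(LINT u:{..t}|lborel. ?f u * ?s u) = (LINT c|\<nu>. D s t c * x (lag c))" .
qed

text \<open>\<open>weighted_superposition\<close> is used with two weights, the kernel with and
  without the density, because \<open>path_integral\<close> asks for both integrabilities on almost
  every path.\<close>

lemma process_integral: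
  fixes X :: "real \<Rightarrow> 'w \<Rightarrow> real"
  assumes M: "sigma_finite_measure M" and st: "s < t"
    and X: "measurable_process M X" and sq: "\<And>t. square_integrable M (X t)"
    and C: "\<And>t. (LINT \<omega>|M. (X t \<omega>)\<^sup>2) \<le> C"
  shows "AE \<omega> in M.
        (AE u in lborel. u \<le> t \<longrightarrow> signed_integrable halfline \<eta> (\<lambda>v. X (u - v) \<omega>)) \<and>
        set_integrable lborel {..t} (\<lambda>u. frac_deriv_indicator \<beta> s t u * signed_integral halfline \<eta> (\<lambda>v. X (u - v) \<omega>)) \<and>
        (LINT u:{..t}|lborel. frac_deriv_indicator \<beta> s t u * signed_integral halfline \<eta> (\<lambda>v. X (u - v) \<omega>))
          = (LINT c|\<nu>. D s t c * X (lag c) \<omega>)"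
proof -
  note Xm = X[unfolded measurable_process_def]
  have d2: "integrable \<nu> (\<lambda>c. frac_deriv_indicator \<beta> s t (fst c))"
  proof -
    interpret Q: finite_measure Q by (rule Q)
    have "integrable \<nu> (\<lambda>c. frac_deriv_indicator \<beta> s t (fst c) * (\<lambda>_. 1) (snd c))"
      unfolding \<nu>_def
      by (rule integrable_product_mult(1)[OF sigma_finite_lborel sigma_finite_Q])
         (use frac_deriv_indicator_integrable(1)[of \<beta> s t] \<beta> st in auto)
    then show ?thesis by simp
  qed
  have "AE \<omega> in M. integrable \<nu> (\<lambda>c. D s t c * X (lag c) \<omega>)"
    by (rule weighted_superposition(1)[OF M sigma_finite_\<nu> D_integrable[OF st] lag_measurable Xm sq C])
  moreover have "AE \<omega> in M. integrable \<nu> (\<lambda>c. frac_deriv_indicator \<beta> s t (fst c) * X (lag c) \<omega>)"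
    by (rule weighted_superposition(1)[OF M sigma_finite_\<nu> d2 lag_measurable Xm sq C])
  ultimately have "AE \<omega> in M. \<omega> \<in> space M \<and> integrable \<nu> (\<lambda>c. D s t c * X (lag c) \<omega>) \<and>
      integrable \<nu> (\<lambda>c. frac_deriv_indicator \<beta> s t (fst c) * X (lag c) \<omega>)"
    by (auto intro: AE_conjI)
  then show ?thesis
  proof eventually_elim
    case (elim \<omega>)
    then have "(\<lambda>t. X t \<omega>) \<in> borel_measurable borel"
      using measurable_compose[OF measurable_Pair2' Xm, of \<omega>] by simp
    from path_integral[OF st this] elim show ?case by blast
  qed
qed

end

section \<open>The equation for the moving average\<close>

locale sfdde = standard_two_sided_levy M L + signed_delay \<beta> Q \<sigma> \<eta> + delay_kernel \<beta> Q \<sigma> g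
  for M :: "'w measure" and L \<beta> Q \<sigma> \<eta> g
begin

theorem moving_average_solution:
  assumes Xm: "measurable_process M X" and X: "\<And>t. has_levy_integral M L (\<lambda>u. g (t - u)) (X t)"
  shows "sfdde_solution M L \<beta> \<eta> X"
  unfolding sfdde_solution_def
proof (intro conjI allI impI)
  show "measurable_process M X" by fact
  show "stationary_process M X" by (rule moving_average_stationary[OF X])
  have sq: "square_integrable M (X t)" for t using has_levy_integral_sq[OF X] by simp
  show "integrable M (X 0)" by (rule square_integrable_integrable[OF sq])
  fix s t :: real assume st: "s < t"
  have C: "(LINT \<omega>|M. (X t \<omega>)\<^sup>2) \<le> (LINT x|lborel. (g x)\<^sup>2)" for t
    using has_levy_integral_inner[OF X X, of t t] g_past_norm[of t] by (simp add: power2_eq_square)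
  define I where "I \<omega> = (LINT c|\<nu>. D s t c * X (lag c) \<omega>)" for \<omega>
  note ws = weighted_superposition[OF sigma_finite_measure_axioms sigma_finite_\<nu> D_integrable[OF st] lag_measurable
      Xm[unfolded measurable_process_def] sq C]
  have Isq: "square_integrable M I" unfolding I_def using ws(2) .
  have EI: "(LINT \<omega>|M. W \<omega> * I \<omega>) = (LINT c|\<nu>. D s t c * (LINT \<omega>|M. W \<omega> * X (lag c) \<omega>))" if "square_integrable M W" for W
    unfolding I_def by (rule ws(3)[OF that])
  define T where "T \<omega> = X t \<omega> - X s \<omega> - (L t \<omega> - L s \<omega>)" for \<omega>
  let ?k0 = "\<lambda>x. g (t - x) - g (s - x) - indicator {s<..t} x"
  have T: "has_levy_integral M L ?k0 T"
    unfolding T_def[abs_def] by (intro has_levy_integral_diff X has_levy_integral_interval st)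
  have Tsq: "square_integrable M T" using has_levy_integral_sq[OF T] by simp
  \<comment> \<open>Tested against an integral with integrand \<open>\<phi>\<close>, both
    \<open>I\<close> and \<open>T\<close> turn into integrals of \<open>\<phi>\<close> by the
    isometry, and \<open>kernel_identity\<close> compares the two.\<close>
  have orth: "(LINT \<omega>|M. Z \<omega> * (I \<omega> - T \<omega>)) = 0" if Z: "has_levy_integral M L \<phi> Z" for Z \<phi>
  proof -
    note Zsq = has_levy_integral_sq[OF Z]
    have "(LINT \<omega>|M. Z \<omega> * I \<omega>) = (LINT c|\<nu>. D s t c * (LINT x|lborel. \<phi> x * g (lag c - x)))"
      unfolding EI[OF Zsq(2)] has_levy_integral_inner[OF Z X] ..
    also have "\<dots> = (LINT x|lborel. \<phi> x * (LINT c|\<nu>. D s t c * g (lag c - x)))"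
      by (rule kernel_superposition(3)[OF st _ Zsq(1), symmetric]) measurable
    also have "\<dots> = (LINT x|lborel. \<phi> x * ?k0 x)"
    proof (rule integral_cong_AE)
      have k1: "square_integrable lborel (\<lambda>x. LINT c|\<nu>. D s t c * g (lag c - x))"
        by (rule kernel_superposition(2)[OF st]) measurable
      have [measurable]: "\<phi> \<in> borel_measurable borel" "(\<lambda>x. LINT c|\<nu>. D s t c * g (lag c - x)) \<in> borel_measurable borel"
        using square_integrable_measurable[OF Zsq(1)] square_integrable_measurable[OF k1] by simp_all
      show "(\<lambda>x. \<phi> x * (LINT c|\<nu>. D s t c * g (lag c - x))) \<in> borel_measurable lborel"
        "(\<lambda>x. \<phi> x * ?k0 x) \<in> borel_measurable lborel" by measurable
      show "AE x in lborel. \<phi> x * (LINT c|\<nu>. D s t c * g (lag c - x)) = \<phi> x * ?k0 x"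
        using kernel_identity[OF st] by eventually_elim simp
    qed
    also have "\<dots> = (LINT \<omega>|M. Z \<omega> * T \<omega>)" by (rule has_levy_integral_inner[OF Z T, symmetric])
    finally have "(LINT \<omega>|M. Z \<omega> * I \<omega>) - (LINT \<omega>|M. Z \<omega> * T \<omega>) = 0" by simp
    then show ?thesis
      using square_integrable_mult[OF Zsq(2) Isq] square_integrable_mult[OF Zsq(2) Tsq]
      by (simp add: right_diff_distrib)
  qed
  have dsq: "square_integrable M (\<lambda>\<omega>. I \<omega> - T \<omega>)" by (rule square_integrable_diff[OF Isq Tsq])
  \<comment> \<open>As a superposition of the \<open>X a\<close>, \<open>I\<close> inherits from
    them the orthogonality to the residual, and \<open>T\<close> is itself an integral against
    \<open>L\<close>. So the residual is orthogonal to itself.\<close>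
  have "(LINT \<omega>|M. (I \<omega> - T \<omega>) * X a \<omega>) = 0" for a
    using orth[OF X[of a]] by (simp add: mult.commute)
  then have "(LINT \<omega>|M. (I \<omega> - T \<omega>) * I \<omega>) = 0" unfolding EI[OF dsq] by simp
  moreover have "(LINT \<omega>|M. (I \<omega> - T \<omega>) * T \<omega>) = 0" using orth[OF T] by (simp add: mult.commute)
  ultimately have "(LINT \<omega>|M. (I \<omega> - T \<omega>)\<^sup>2) = 0"
    using square_integrable_mult[OF dsq Isq] square_integrable_mult[OF dsq Tsq]
    by (simp add: power2_eq_square right_diff_distrib)
  from integral_power2_eq_0_AE[OF dsq this] have IT: "AE \<omega> in M. I \<omega> = T \<omega>" by simp
  from IT process_integral[OF sigma_finite_measure_axioms st Xm sq C]
  show "AE \<omega> in M.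
        (AE u in lborel. u \<le> t \<longrightarrow> signed_integrable halfline \<eta> (\<lambda>v. X (u - v) \<omega>)) \<and>
        set_integrable lborel {..t}
          (\<lambda>u. frac_deriv_indicator \<beta> s t u * signed_integral halfline \<eta> (\<lambda>v. X (u - v) \<omega>)) \<and>
        X t \<omega> - X s \<omega> =
          (LINT u:{..t}|lborel.
             frac_deriv_indicator \<beta> s t u * signed_integral halfline \<eta> (\<lambda>v. X (u - v) \<omega>)) +
          L t \<omega> - L s \<omega>"
    by eventually_elim (simp add: I_def T_def)
qed

end

section \<open>Bounded solutions of the homogeneous equation\<close>

text \<open>One half of Plancherel. With Gaussian damping in x, Fubini bounds the squared norm by a
  Gaussian average of correlations of |\<Psi>| with its translates, each at most the squared norm of
  \<Psi> by Cauchy-Schwarz. Fatou's lemma removes the damping.\<close>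

lemma bessel_inequality:
  fixes \<Psi> :: "real \<Rightarrow> complex"
  assumes i: "integrable lborel \<Psi>" and s: "square_integrable lborel \<Psi>"
  shows "(\<integral>\<^sup>+x. ennreal ((norm (LINT y|lborel. \<Psi> y * iexp (- (y * x))))\<^sup>2) \<partial>lborel)
     \<le> ennreal (2 * pi * (LINT y|lborel. (norm (\<Psi> y))\<^sup>2))"
proof -
  define \<psi> where "\<psi> x = (LINT y|lborel. \<Psi> y * iexp (- (y * x)))" for x
  define B where "B = (LINT y|lborel. (norm (\<Psi> y))\<^sup>2)"
  define K where "K = (LINT y|lborel. norm (\<Psi> y))"
  have \<Psi>m[measurable]: "\<Psi> \<in> borel_measurable borel" using i by auto
  have \<psi>m[measurable]: "\<psi> \<in> borel_measurable borel" unfolding \<psi>_def[abs_def] by measurable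
  have [measurable]: "(\<lambda>x. cnj (\<psi> x)) \<in> borel_measurable borel"
    by (rule borel_measurable_continuous_on[where f = cnj, OF _ \<psi>m]) (intro continuous_intros)
  have \<psi>K: "norm (\<psi> x) \<le> K" for x
  proof -
    have "norm (\<psi> x) \<le> (LINT y|lborel. norm (\<Psi> y * iexp (- (y * x))))" unfolding \<psi>_def by (rule integral_norm_bound)
    also have "\<dots> = K" by (simp add: K_def norm_mult)
    finally show ?thesis .
  qed
  have bound: "(\<integral>\<^sup>+x. ennreal ((norm (\<psi> x))\<^sup>2 * exp (- (e * x)\<^sup>2 / 2)) \<partial>lborel) \<le> ennreal (2 * pi * B)" if e: "0 < e" for e
  proof -
    let ?N = "\<lambda>x. exp (- (e * x)\<^sup>2 / 2)" and ?n = "normal_density 0 e"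
    have Nint: "integrable lborel (\<lambda>x. complex_of_real (?N x))" using gaussian_integrable[OF e] by (rule integrable_of_real)
    have cnj: "cnj (\<psi> x) = (LINT y|lborel. cnj (\<Psi> y) * iexp (y * x))" for x
    proof -
      have "cnj (\<psi> x) = (LINT y|lborel. cnj (\<Psi> y * iexp (- (y * x))))"
        unfolding \<psi>_def by (rule Bochner_Integration.integral_cnj[symmetric])
      also have "\<dots> = (LINT y|lborel. cnj (\<Psi> y) * iexp (y * x))"
        by (rule Bochner_Integration.integral_cong[OF refl]) (simp add: exp_cnj)
      finally show ?thesis .
    qed
    have fi: "integrable lborel (\<lambda>x. of_real (?N x) * cnj (\<psi> x))"
    proof (rule Bochner_Integration.integrable_bound)
      show "integrable lborel (\<lambda>x. of_real (?N x) * complex_of_real K)" using Nint by simp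
      show "AE x in lborel. norm (of_real (?N x) * cnj (\<psi> x)) \<le> norm (of_real (?N x) * complex_of_real K)"
      proof (rule AE_I2)
        fix x
        have "norm (\<psi> x) \<le> \<bar>K\<bar>" using \<psi>K[of x] by linarith
        then show "norm (of_real (?N x) * cnj (\<psi> x)) \<le> norm (of_real (?N x) * complex_of_real K)"
          by (simp add: norm_mult mult_left_mono)
      qed
    qed measurable
    \<comment> \<open>The transform of the damped conjugate of \<psi>: up to 2 pi, the conjugate of
      \<Psi> smoothed by a normal density.\<close>
    define q where "q y = (LINT y'|lborel. cnj (\<Psi> y') * of_real (2 * pi * ?n (y' - y)))" for y
    have inner: "(LINT x|lborel. of_real (?N x) * cnj (\<psi> x) * iexp (- (y * x))) = q y" for y
    proof -
      have "(LINT x|lborel. of_real (?N x) * cnj (\<psi> x) * iexp (- (y * x)))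
          = (LINT x|lborel. (of_real (?N x) * iexp (- (y * x))) * (LINT y'|lborel. cnj (\<Psi> y') * iexp (y' * x)))"
        unfolding cnj by (simp only: mult_ac)
      also have "\<dots> = (LINT y'|lborel. cnj (\<Psi> y') * (LINT x|lborel. (of_real (?N x) * iexp (- (y * x))) * iexp (y' * x)))"
      proof (rule Fubini_bounded_kernel[OF sigma_finite_lborel sigma_finite_lborel, where B = 1])
        show "integrable lborel (\<lambda>x. of_real (?N x) * iexp (- (y * x)))"
          by (rule Bochner_Integration.integrable_bound[OF Nint]) (auto simp: norm_mult)
        show "integrable lborel (\<lambda>y'. cnj (\<Psi> y'))" using i by simp
      qed auto
      also have "\<dots> = q y"
        unfolding q_def
      proof (rule Bochner_Integration.integral_cong[OF refl])
        fix y'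
        have "(of_real (?N x) * iexp (- (y * x))) * iexp (y' * x) = of_real (?N x) * iexp (x * (y' - y))" for x
        proof -
          have "iexp (x * (y' - y)) = iexp (- (y * x)) * iexp (y' * x)"
            by (simp only: iexp_add[symmetric]) (simp add: algebra_simps)
          then show ?thesis by (simp only: mult.assoc)
        qed
        then show "cnj (\<Psi> y') * (LINT x|lborel. (of_real (?N x) * iexp (- (y * x))) * iexp (y' * x))
            = cnj (\<Psi> y') * of_real (2 * pi * ?n (y' - y))"
          using gaussian_fourier(1)[OF e, of "y' - y"] by (simp only:)
      qed
      finally show ?thesis .
    qed
    have "(LINT x|lborel. of_real (?N x) * cnj (\<psi> x) * \<psi> x) = (LINT y|lborel. \<Psi> y * q y)"
      unfolding inner[symmetric]
      by (subst \<psi>_def, rule Fubini_bounded_kernel[OF sigma_finite_lborel sigma_finite_lborel fi i, where B = 1]) auto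
    moreover have "of_real (?N x) * cnj (\<psi> x) * \<psi> x = complex_of_real ((norm (\<psi> x))\<^sup>2 * ?N x)" for x
      using complex_norm_square[of "\<psi> x"] by (simp add: mult_ac)
    ultimately have "complex_of_real (LINT x|lborel. (norm (\<psi> x))\<^sup>2 * ?N x) = (LINT y|lborel. \<Psi> y * q y)"
      by (simp only: integral_complex_of_real[symmetric])
    then have "\<bar>LINT x|lborel. (norm (\<psi> x))\<^sup>2 * ?N x\<bar> = norm (LINT y|lborel. \<Psi> y * q y)"
      by (metis norm_of_real)
    also have "\<dots> \<le> (LINT y|lborel. norm (\<Psi> y * q y))" by (rule integral_norm_bound)
    also have "\<dots> \<le> (LINT y|lborel. 2 * pi * (norm (\<Psi> y) * (LINT v|lborel. ?n v * norm (\<Psi> (v + y)))))"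
    proof (rule integral_mono')
      have ns: "square_integrable lborel (\<lambda>y. norm (\<Psi> y))" by (rule square_integrable_norm[OF s])
      have sh: "square_integrable lborel (\<lambda>x. norm (\<Psi> (v + x)))" for v
        using square_integrable_shift[OF ns] by simp
      have "square_integrable lborel (\<lambda>y. LINT v|lborel. ?n v * norm (\<Psi> (v + y)))"
      proof (rule weighted_superposition(2)[OF sigma_finite_lborel sigma_finite_lborel integrable_normal_density[OF e], where \<theta> = "\<lambda>v. v" and C = B])
        show "(LINT x|lborel. (norm (\<Psi> (t + x)))\<^sup>2) \<le> B" for t
          using lborel_integral_shift[of "\<lambda>x. (norm (\<Psi> x))\<^sup>2" t] by (simp add: B_def)
      qed (use sh in \<open>auto simp: split_beta\<close>)
      from square_integrable_mult[OF ns this]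
      show "integrable lborel (\<lambda>y. 2 * pi * (norm (\<Psi> y) * (LINT v|lborel. ?n v * norm (\<Psi> (v + y)))))" by simp
      fix y :: real
      have "norm (q y) \<le> (LINT y'|lborel. norm (cnj (\<Psi> y') * of_real (2 * pi * ?n (y' - y))))"
        unfolding q_def by (rule integral_norm_bound)
      also have "\<dots> = (LINT v|lborel. norm (cnj (\<Psi> (y + v)) * of_real (2 * pi * ?n (y + v - y))))"
        by (rule lborel_integral_shift[symmetric])
      also have "\<dots> = (LINT v|lborel. 2 * pi * (?n v * norm (\<Psi> (v + y))))"
        by (rule Bochner_Integration.integral_cong[OF refl])
           (simp add: norm_mult normal_density_nonneg abs_mult add.commute)
      also have "\<dots> = 2 * pi * (LINT v|lborel. ?n v * norm (\<Psi> (v + y)))" by (rule integral_mult_right_zero)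
      finally have fq: "norm (q y) \<le> 2 * pi * (LINT v|lborel. ?n v * norm (\<Psi> (v + y)))" .
      from mult_left_mono[OF fq, of "norm (\<Psi> y)"]
      show "norm (\<Psi> y * q y) \<le> 2 * pi * (norm (\<Psi> y) * (LINT v|lborel. ?n v * norm (\<Psi> (v + y))))"
        by (simp add: norm_mult mult_ac)
      show "0 \<le> 2 * pi * (norm (\<Psi> y) * (LINT v|lborel. ?n v * norm (\<Psi> (v + y))))"
        by (intro mult_nonneg_nonneg Bochner_Integration.integral_nonneg) (auto simp: normal_density_nonneg)
    qed
    also have "\<dots> = 2 * pi * (LINT y|lborel. norm (\<Psi> y) * (LINT v|lborel. ?n v * norm (\<Psi> (v + y))))"
      by (rule integral_mult_right_zero)
    also have "(LINT y|lborel. norm (\<Psi> y) * (LINT v|lborel. ?n v * norm (\<Psi> (v + y)))) \<le> B"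
    proof -
      note tc = translation_correlation[OF square_integrable_norm[OF s] e]
      have "(LINT y|lborel. norm (\<Psi> y) * (LINT v|lborel. ?n v * norm (\<Psi> (v + y))))
          = (LINT v|lborel. ?n v * (LINT x|lborel. norm (\<Psi> x) * norm (\<Psi> (v + x))))" by (rule tc(4))
      also have "\<dots> \<le> (LINT v|lborel. ?n v * B)"
      proof (rule integral_mono')
        show "integrable lborel (\<lambda>v. ?n v * B)" using integrable_normal_density[OF e] by simp
        show "?n v * (LINT x|lborel. norm (\<Psi> x) * norm (\<Psi> (v + x))) \<le> ?n v * B" for v
          using tc(2)[of v] normal_density_nonneg by (intro mult_left_mono) (auto simp: B_def)
        show "0 \<le> ?n v * B" for v using normal_density_nonneg by (simp add: B_def)
      qed
      also have "\<dots> = B" using integral_normal_density[OF e] by simp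
      finally show ?thesis .
    qed
    finally have "\<bar>LINT x|lborel. (norm (\<psi> x))\<^sup>2 * ?N x\<bar> \<le> 2 * pi * B" by (simp add: mult_left_mono)
    moreover have "integrable lborel (\<lambda>x. (norm (\<psi> x))\<^sup>2 * ?N x)"
    proof (rule Bochner_Integration.integrable_bound)
      show "integrable lborel (\<lambda>x. K\<^sup>2 * ?N x)" using gaussian_integrable[OF e] by simp
      show "AE x in lborel. norm ((norm (\<psi> x))\<^sup>2 * ?N x) \<le> norm (K\<^sup>2 * ?N x)"
        using \<psi>K by (intro AE_I2) (auto simp: abs_mult intro!: mult_right_mono power_mono)
    qed measurable
    then have "(\<integral>\<^sup>+x. ennreal ((norm (\<psi> x))\<^sup>2 * ?N x) \<partial>lborel) = ennreal (LINT x|lborel. (norm (\<psi> x))\<^sup>2 * ?N x)"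
      by (rule nn_integral_eq_integral) simp
    ultimately show ?thesis by (simp add: ennreal_leI)
  qed
  define e where "e n = inverse (real (Suc n))" for n
  have e: "0 < e n" for n by (simp add: e_def)
  have "(\<integral>\<^sup>+x. ennreal ((norm (\<psi> x))\<^sup>2) \<partial>lborel)
      = (\<integral>\<^sup>+x. liminf (\<lambda>n. ennreal ((norm (\<psi> x))\<^sup>2 * exp (- (e n * x)\<^sup>2 / 2))) \<partial>lborel)"
  proof (rule nn_integral_cong)
    fix x
    have "e \<longlonglongrightarrow> 0" unfolding e_def[abs_def] by (rule LIMSEQ_inverse_real_of_nat)
    then have "(\<lambda>n. (norm (\<psi> x))\<^sup>2 * exp (- (e n * x)\<^sup>2 / 2)) \<longlonglongrightarrow> (norm (\<psi> x))\<^sup>2 * exp (- (0 * x)\<^sup>2 / 2)"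
      by (intro tendsto_intros) auto
    then have "(\<lambda>n. ennreal ((norm (\<psi> x))\<^sup>2 * exp (- (e n * x)\<^sup>2 / 2))) \<longlonglongrightarrow> ennreal ((norm (\<psi> x))\<^sup>2)"
      by (intro tendsto_ennrealI) simp
    from lim_imp_Liminf[OF trivial_limit_sequentially this]
    show "ennreal ((norm (\<psi> x))\<^sup>2) = liminf (\<lambda>n. ennreal ((norm (\<psi> x))\<^sup>2 * exp (- (e n * x)\<^sup>2 / 2)))" by (rule sym)
  qed
  also have "\<dots> \<le> liminf (\<lambda>n. \<integral>\<^sup>+x. ennreal ((norm (\<psi> x))\<^sup>2 * exp (- (e n * x)\<^sup>2 / 2)) \<partial>lborel)"
    by (rule nn_integral_liminf) measurable
  also have "\<dots> \<le> ennreal (2 * pi * B)"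
    by (intro Liminf_le always_eventually allI bound e) auto
  finally show ?thesis by (simp only: \<psi>_def B_def)
qed

lemma gaussian_dominated:
  fixes f :: "real \<Rightarrow> complex"
  assumes [measurable]: "f \<in> borel_measurable borel" and e: "0 < e"
    and le: "\<And>y. norm (f y) \<le> C * exp (- (e * y)\<^sup>2 / 2)"
  shows "integrable lborel f" "square_integrable lborel f"
proof -
  have C: "norm (f y) \<le> norm (C * exp (- (e * y)\<^sup>2 / 2))" for y using le[of y] by simp
  show "integrable lborel f"
    by (rule Bochner_Integration.integrable_bound[where f = "\<lambda>y. C * exp (- (e * y)\<^sup>2 / 2)"])
       (use gaussian_integrable[OF e] C in auto)
  have "square_integrable lborel (\<lambda>y. norm (f y))"
    by (rule square_integrable_bound[OF square_integrable_cmult[OF square_integrable_gaussian[OF e], of C]]) (use C in auto)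
  then show "square_integrable lborel f" by (auto simp: square_integrable_def)
qed

text \<open>Integration by parts turns \<open>\<Psi>'\<close> into multiplication by \<open>x\<close> on the Fourier side, so by Bessel's
  inequality \<open>(1 + \<bar>x\<bar>) \<psi>(x)\<close> is square integrable, hence \<open>\<psi>\<close> is integrable.\<close>

lemma fourier_transform_integrable:
  fixes \<Psi> \<Psi>' :: "real \<Rightarrow> complex"
  assumes [measurable]: "\<Psi> \<in> borel_measurable borel" "\<Psi>' \<in> borel_measurable borel" and e: "0 < e"
    and le: "\<And>y. norm (\<Psi> y) \<le> C * exp (- (e * y)\<^sup>2 / 2)" "\<And>y. norm (\<Psi>' y) \<le> C * exp (- (e * y)\<^sup>2 / 2)"
    and deriv: "\<And>y. y \<noteq> 0 \<Longrightarrow> (\<Psi> has_vector_derivative \<Psi>' y) (at y)"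
    and cont: "\<And>y. y \<noteq> 0 \<Longrightarrow> isCont \<Psi>' y" and zero: "(\<Psi> \<longlongrightarrow> 0) (at 0)"
  shows "integrable lborel (\<lambda>x. LINT y|lborel. \<Psi> y * iexp (- (y * x)))"
proof -
  note i = gaussian_dominated[OF _ e le(1)] and i' = gaussian_dominated[OF _ e le(2)]
  define \<psi> where "\<psi> x = (LINT y|lborel. \<Psi> y * iexp (- (y * x)))" for x
  have \<psi>m[measurable]: "\<psi> \<in> borel_measurable borel" unfolding \<psi>_def[abs_def] by measurable
  have parts: "(LINT y|lborel. \<Psi>' y * iexp (- (y * x))) = \<i> * of_real x * \<psi> x" for x
  proof -
    let ?F = "\<lambda>y. \<Psi> y * iexp (- (y * x))"
    let ?f = "\<lambda>y. \<Psi>' y * iexp (- (y * x)) - \<i> * of_real x * (\<Psi> y * iexp (- (y * x)))"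
    have ii: "integrable lborel (\<lambda>y. \<Psi> y * iexp (- (y * x)))" "integrable lborel (\<lambda>y. \<Psi>' y * iexp (- (y * x)))"
      by (rule Bochner_Integration.integrable_bound[OF i(1)], auto simp: norm_mult)
         (rule Bochner_Integration.integrable_bound[OF i'(1)], auto simp: norm_mult)
    have fint: "integrable lborel ?f" using ii by simp
    have F: "(?F has_vector_derivative ?f y) (at y)" if "y \<noteq> 0" for y
    proof -
      have "((\<lambda>y. iexp (- (y * x))) has_vector_derivative - \<i> * of_real x * iexp (- (y * x))) (at y)"
        by (auto intro!: derivative_eq_intros has_vector_derivative_real_field simp: algebra_simps)
      from has_vector_derivative_mult[OF deriv[OF that] this] show ?thesis by (simp add: algebra_simps)
    qed
    have c: "isCont ?f y" if "y \<noteq> 0" for y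
    proof -
      have "isCont \<Psi> y" using deriv[OF that] by (rule has_vector_derivative_continuous)
      with cont[OF that] show ?thesis by (intro continuous_intros)
    qed
    have nF: "norm (?F y) = norm (\<Psi> y)" for y by (simp add: norm_mult)
    have F0: "(?F \<longlongrightarrow> 0) (at 0)"
      by (rule tendsto_norm_zero_cancel) (simp only: nF tendsto_norm_zero[OF zero])
    have lim: "(?F \<longlongrightarrow> 0) F" if "((\<lambda>y. C * exp (- (e * y)\<^sup>2 / 2)) \<longlongrightarrow> 0) F" for F
      by (rule Lim_null_comparison[OF _ that]) (simp only: nF le(1) eventually_True)
    have top: "((\<lambda>y. C * exp (- (e * y)\<^sup>2 / 2)) \<longlongrightarrow> 0) at_top"
      using e by real_asymp
    have bot: "((\<lambda>y. C * exp (- (e * y)\<^sup>2 / 2)) \<longlongrightarrow> 0) at_bot"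
      using e by real_asymp
    \<comment> \<open>No derivative is assumed at 0, so the fundamental theorem is used on each
      half-line; both boundary values at 0 vanish by \<open>zero\<close>.\<close>
    have "(LINT y:{0<..}|lborel. ?f y) = 0 - 0"
      by (rule FTC_Ioi[where F = ?F])
         (use F c lim[OF top] F0 fint in \<open>auto simp: set_integrable_def filterlim_at_split intro: integrable_mult_indicator\<close>)
    moreover have "(LINT y:{..<0}|lborel. ?f y) = 0 - 0"
      by (rule FTC_Iio[where F = ?F])
         (use F c lim[OF bot] F0 fint in \<open>auto simp: set_integrable_def filterlim_at_split intro: integrable_mult_indicator\<close>)
    moreover have "(LINT y|lborel. ?f y) = (LINT y:{0<..}|lborel. ?f y) + (LINT y:{..<0}|lborel. ?f y)"
    proof -
      have "(LINT y|lborel. ?f y) = (LINT y|lborel. indicator {0<..} y *\<^sub>R ?f y + indicator {..<0} y *\<^sub>R ?f y)"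
      proof (rule integral_cong_AE)
        show "AE y in lborel. ?f y = indicator {0<..} y *\<^sub>R ?f y + indicator {..<0} y *\<^sub>R ?f y"
          using AE_lborel_singleton[of "0 :: real"] by eventually_elim (auto simp: indicator_def)
      qed measurable
      also have "\<dots> = (LINT y:{0<..}|lborel. ?f y) + (LINT y:{..<0}|lborel. ?f y)"
        unfolding set_lebesgue_integral_def
        by (intro Bochner_Integration.integral_add integrable_mult_indicator fint) auto
      finally show ?thesis .
    qed
    ultimately have "(LINT y|lborel. ?f y) = 0" by simp
    moreover have "(LINT y|lborel. ?f y) = (LINT y|lborel. \<Psi>' y * iexp (- (y * x))) - \<i> * of_real x * \<psi> x"
      unfolding \<psi>_def using ii
      by (simp only: Bochner_Integration.integral_diff integrable_mult_right integral_mult_right_zero)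
    ultimately show ?thesis by simp
  qed
  have fin: "integrable lborel (\<lambda>x. (norm (\<psi> x))\<^sup>2)" "integrable lborel (\<lambda>x. (norm (\<i> * of_real x * \<psi> x))\<^sup>2)"
  proof -
    have "(\<integral>\<^sup>+x. ennreal ((norm (\<psi> x))\<^sup>2) \<partial>lborel) < \<infinity>"
      using bessel_inequality[OF i(1) i(2)] unfolding \<psi>_def by (rule le_less_trans) auto
    then show "integrable lborel (\<lambda>x. (norm (\<psi> x))\<^sup>2)" by (intro integrableI_bounded) auto
    have "(\<integral>\<^sup>+x. ennreal ((norm (\<i> * of_real x * \<psi> x))\<^sup>2) \<partial>lborel) < \<infinity>"
      using bessel_inequality[OF i'(1) i'(2)] unfolding parts by (rule le_less_trans) auto
    then show "integrable lborel (\<lambda>x. (norm (\<i> * of_real x * \<psi> x))\<^sup>2)" by (intro integrableI_bounded) auto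
  qed
  have "integrable lborel \<psi>"
  proof (rule Bochner_Integration.integrable_bound)
    have "integrable lborel (\<lambda>x :: real. inverse (1 + x\<^sup>2))"
    proof -
      have "set_integrable lborel (einterval (-\<infinity>) \<infinity>) (\<lambda>x. inverse (1 + x\<^sup>2))"
      proof (rule interval_integral_FTC_nonneg(1)[where F = arctan and A = "- (pi / 2)" and B = "pi / 2"])
        show "DERIV arctan x :> inverse (1 + x\<^sup>2)" for x by (rule DERIV_arctan)
        show "isCont (\<lambda>x. inverse (1 + x\<^sup>2)) x" for x :: real
          by (intro continuous_intros) (simp add: add_nonneg_eq_0_iff)
        show "((arctan \<circ> real_of_ereal) \<longlongrightarrow> - (pi / 2)) (at_right (- \<infinity>))"
          by (simp add: ereal_tendsto_simps tendsto_arctan_at_bot)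
        show "((arctan \<circ> real_of_ereal) \<longlongrightarrow> pi / 2) (at_left \<infinity>)"
          by (simp add: ereal_tendsto_simps tendsto_arctan_at_top)
      qed auto
      then show ?thesis by (simp add: set_integrable_def einterval_def)
    qed
    with fin show "integrable lborel (\<lambda>x. (norm (\<psi> x))\<^sup>2 + (norm (\<i> * of_real x * \<psi> x))\<^sup>2 + inverse (1 + x\<^sup>2))" by simp
    show "AE x in lborel. norm (\<psi> x) \<le> norm ((norm (\<psi> x))\<^sup>2 + (norm (\<i> * of_real x * \<psi> x))\<^sup>2 + inverse (1 + x\<^sup>2))"
    proof (rule AE_I2)
      fix x :: real
      define p where "p = norm (\<psi> x)"
      define a where "a = sqrt (1 + x\<^sup>2)"
      have a: "0 < a" "a\<^sup>2 = 1 + x\<^sup>2" by (auto simp: a_def add_pos_nonneg)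
      \<comment> \<open>This square gives 2 p <= a^2 p^2 + a^(-2): the first term is integrable by
        Bessel's inequality, the second is 1 / (1 + x^2).\<close>
      have "0 \<le> (a * p - inverse a)\<^sup>2" by simp
      also have "(a * p - inverse a)\<^sup>2 = a\<^sup>2 * p\<^sup>2 - 2 * p + inverse (a\<^sup>2)"
        using a(1) by (simp add: power2_eq_square field_simps)
      finally have "2 * p \<le> a\<^sup>2 * p\<^sup>2 + inverse (a\<^sup>2)" by simp
      moreover have "0 \<le> p" by (simp add: p_def)
      ultimately have "p \<le> p\<^sup>2 + x\<^sup>2 * p\<^sup>2 + inverse (1 + x\<^sup>2)" unfolding a(2) by (simp add: algebra_simps)
      moreover have "(norm (\<i> * of_real x * \<psi> x))\<^sup>2 = x\<^sup>2 * p\<^sup>2" by (simp add: norm_mult power_mult_distrib p_def)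
      ultimately show "norm (\<psi> x) \<le> norm ((norm (\<psi> x))\<^sup>2 + (norm (\<i> * of_real x * \<psi> x))\<^sup>2 + inverse (1 + x\<^sup>2))"
        by (simp add: p_def[symmetric])
    qed
  qed measurable
  then show ?thesis unfolding \<psi>_def[abs_def] .
qed

lemma fourier_parameter_continuous:
  fixes f :: "'c \<Rightarrow> complex" and u :: "'c \<Rightarrow> real"
  assumes f: "integrable N f" and u[measurable]: "u \<in> borel_measurable N"
  shows "isCont (\<lambda>y. LINT c|N. f c * iexp (y * u c)) y"
proof (rule continuous_within_sequentiallyI)
  fix S :: "nat \<Rightarrow> real" assume S: "S \<longlonglongrightarrow> y"
  have fm[measurable]: "f \<in> borel_measurable N" using f by auto
  show "(\<lambda>n. LINT c|N. f c * iexp (S n * u c)) \<longlonglongrightarrow> (LINT c|N. f c * iexp (y * u c))"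
  proof (rule integral_dominated_convergence)
    show "integrable N (\<lambda>c. norm (f c))" using f by auto
    show "AE c in N. (\<lambda>n. f c * iexp (S n * u c)) \<longlonglongrightarrow> f c * iexp (y * u c)"
      by (intro AE_I2 tendsto_intros S)
    show "AE c in N. norm (f c * iexp (S n * u c)) \<le> norm (f c)" for n
      by (intro AE_I2) (simp add: norm_mult)
  qed measurable
qed

lemma norm_iexp_minus_1: "norm (iexp x - 1) \<le> \<bar>x\<bar>"
  using iexp_approx1[of x 0] by simp

lemma powr_one_minus_le:
  fixes y \<beta> :: real
  assumes "0 < \<beta>" "\<beta> < 1" shows "\<bar>y\<bar> powr (1 - \<beta>) \<le> 1 + \<bar>y\<bar>"
proof (cases "\<bar>y\<bar> \<le> 1")
  case True
  then have "\<bar>y\<bar> powr (1 - \<beta>) \<le> 1" using assms by (intro powr_le1) auto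
  then show ?thesis by simp
next
  case False
  then have "\<bar>y\<bar> powr (1 - \<beta>) \<le> \<bar>y\<bar> powr 1" using assms by (intro powr_mono) auto
  then show ?thesis by simp
qed

text \<open>The polynomial factor is paid for by halving \<open>e\<close>. The surplus in the
  exponent is e^2/2 - (e/2)^2/2 = 3 e^2/8, the constant \<open>a\<close>, and 1 + a y^2 <= exp (a
  y^2).\<close>

lemma polynomial_gaussian_bound:
  fixes e y :: real
  assumes e: "0 < e"
  shows "(1 + \<bar>y\<bar>)\<^sup>2 * exp (- (e * y)\<^sup>2 / 2) \<le> 2 * (1 + 8 / (3 * e\<^sup>2)) * exp (- ((e / 2) * y)\<^sup>2 / 2)"
proof -
  define a where "a = 3 * e\<^sup>2 / 8"
  have a: "0 < a" using e by (simp add: a_def)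
  have "(1 + \<bar>y\<bar>)\<^sup>2 \<le> 2 + 2 * y\<^sup>2"
  proof -
    have "0 \<le> (1 - \<bar>y\<bar>)\<^sup>2" by simp
    then show ?thesis by (simp add: power2_eq_square algebra_simps)
  qed
  also have "\<dots> \<le> 2 * (1 + 1 / a) * (1 + a * y\<^sup>2)" using a by (simp add: field_simps)
  also have "\<dots> \<le> 2 * (1 + 1 / a) * exp (a * y\<^sup>2)" using a exp_ge_add_one_self[of "a * y\<^sup>2"] by (intro mult_left_mono) auto
  finally have "(1 + \<bar>y\<bar>)\<^sup>2 * exp (- (e * y)\<^sup>2 / 2) \<le> 2 * (1 + 1 / a) * exp (a * y\<^sup>2) * exp (- (e * y)\<^sup>2 / 2)"
    by (rule mult_right_mono) simp
  also have "\<dots> = 2 * (1 + 1 / a) * exp (a * y\<^sup>2 + - (e * y)\<^sup>2 / 2)" by (simp only: exp_add mult.assoc)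
  also have "a * y\<^sup>2 + - (e * y)\<^sup>2 / 2 = - ((e / 2) * y)\<^sup>2 / 2"
    by (simp add: a_def power2_eq_square field_simps)
  finally show ?thesis by (simp add: a_def)
qed

section \<open>Derivatives and bounds of the symbol; translations of the kernel\<close>

context fractional_delay
begin

definition q :: "real \<Rightarrow> complex" where
  "q y = (- \<i> * of_real y) powr of_real (1 - \<beta>)"

text \<open>The derivative of \<open>q\<close> at nonzero y; near 0 it is of order
  |y|^(-\<beta>).\<close>

definition q' :: "real \<Rightarrow> complex" where
  "q' y = - \<i> * (of_real (1 - \<beta>) * (- \<i> * of_real y) powr of_real (- \<beta>))"

definition eta_hat' :: "real \<Rightarrow> complex" where
  "eta_hat' y = (LINT v|Q. of_real (\<sigma> v) * (\<i> * of_real v) * iexp (y * v))"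

lemma h_eq: "h y = q y - eta_hat y"
  by (simp add: h_def q_def)

lemma norm_q: "norm (q y) = \<bar>y\<bar> powr (1 - \<beta>)"
  unfolding q_def by (subst norm_powr_real_powr') (auto simp: norm_mult)

lemma norm_q': "norm (q' y) \<le> \<bar>y\<bar> powr (- \<beta>)"
proof -
  have "norm (q' y) = (1 - \<beta>) * \<bar>y\<bar> powr (- \<beta>)"
    unfolding q'_def norm_mult using \<beta> by (subst norm_powr_real_powr') (auto simp: norm_mult simp del: of_real_diff)
  also have "\<dots> \<le> 1 * \<bar>y\<bar> powr (- \<beta>)" using \<beta> by (intro mult_right_mono) auto
  finally show ?thesis by simp
qed

lemma not_nonpos_imaginary: "y \<noteq> 0 \<Longrightarrow> - \<i> * complex_of_real y \<notin> \<real>\<^sub>\<le>\<^sub>0"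
  by (auto simp: complex_nonpos_Reals_iff)

lemma q_derivative:
  assumes "y \<noteq> 0" shows "(q has_vector_derivative q' y) (at y)"
proof -
  have "((\<lambda>y. - \<i> * complex_of_real y) has_vector_derivative - \<i>) (at y)"
    by (auto intro!: derivative_eq_intros)
  from field_vector_diff_chain_at[OF this has_field_derivative_powr[OF not_nonpos_imaginary[OF assms], where s = "of_real (1 - \<beta>)"]]
  have "((\<lambda>y. (- \<i> * complex_of_real y) powr of_real (1 - \<beta>)) has_vector_derivative
      - \<i> * (of_real (1 - \<beta>) * (- \<i> * complex_of_real y) powr (of_real (1 - \<beta>) - 1))) (at y)"
    by (simp add: o_def)
  moreover have "complex_of_real (1 - \<beta>) - 1 = of_real (- \<beta>)" by simp
  ultimately show ?thesis by (simp only: q_def[abs_def] q'_def)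
qed

lemma q'_continuous:
  assumes "y \<noteq> 0" shows "isCont q' y"
proof -
  have "isCont (\<lambda>y. (- \<i> * complex_of_real y) powr of_real (- \<beta>)) y"
    unfolding isCont_def
    by (rule tendsto_powr_complex[OF not_nonpos_imaginary[OF assms]]) (auto intro!: tendsto_intros)
  then show ?thesis unfolding q'_def[abs_def] by (intro continuous_mult continuous_const)
qed

lemma q_continuous: "isCont q y"
proof (cases "y = 0")
  case True
  have "((\<lambda>y. norm (q y)) \<longlongrightarrow> 0) (at 0)"
  proof -
    have "((\<lambda>y. \<bar>y\<bar> powr (1 - \<beta>)) \<longlongrightarrow> \<bar>0\<bar> powr (1 - \<beta>)) (at 0)"
      using \<beta> by (intro tendsto_powr' tendsto_rabs tendsto_ident_at tendsto_const) auto
    then show ?thesis by (simp add: norm_q)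
  qed
  moreover have "q 0 = 0" by (simp add: q_def)
  ultimately show ?thesis using tendsto_norm_zero_cancel[of q "at 0"] True by (simp add: isCont_def)
next
  case False
  show ?thesis by (rule has_vector_derivative_continuous[OF q_derivative[OF False]])
qed

lemma \<sigma>_moment_complex: "integrable Q (\<lambda>v. complex_of_real v * complex_of_real (\<sigma> v))"
  using integrable_of_real[OF \<sigma>_moment, where 'a = complex] by simp

text \<open>The first moment of the delay measure is what allows differentiation under the integral;
  it also bounds the derivative.\<close>

lemma eta_hat_derivative: "(eta_hat has_vector_derivative eta_hat' y) (at y)"
  unfolding eta_hat_def[abs_def] eta_hat'_def
  by (rule fourier_parameter_derivative[OF _ \<sigma>_moment_complex measurable_id_Q]) (simp add: \<sigma>)

lemma eta_hat'_continuous: "isCont eta_hat' y"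
proof -
  have "integrable Q (\<lambda>v. \<i> * (complex_of_real v * complex_of_real (\<sigma> v)))" using \<sigma>_moment_complex by simp
  then have "integrable Q (\<lambda>v. complex_of_real (\<sigma> v) * (\<i> * complex_of_real v))" by (simp add: mult_ac)
  from fourier_parameter_continuous[OF this measurable_id_Q] show ?thesis unfolding eta_hat'_def[abs_def] .
qed

lemma eta_hat_bound: "norm (eta_hat y) \<le> (LINT v|Q. \<bar>\<sigma> v\<bar>)"
proof -
  have "norm (eta_hat y) \<le> (LINT v|Q. norm (of_real (\<sigma> v) * iexp (y * v)))"
    unfolding eta_hat_def by (rule integral_norm_bound)
  then show ?thesis by (simp add: norm_mult)
qed

lemma eta_hat'_bound: "norm (eta_hat' y) \<le> (LINT v|Q. \<bar>v * \<sigma> v\<bar>)"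
proof -
  have "norm (eta_hat' y) \<le> (LINT v|Q. norm (of_real (\<sigma> v) * (\<i> * of_real v) * iexp (y * v)))"
    unfolding eta_hat'_def by (rule integral_norm_bound)
  then show ?thesis by (simp add: norm_mult abs_mult mult.commute)
qed

lemma h_derivative: "y \<noteq> 0 \<Longrightarrow> (h has_vector_derivative q' y - eta_hat' y) (at y)"
  unfolding h_eq[abs_def] by (intro has_vector_derivative_diff q_derivative eta_hat_derivative)

lemma h_continuous: "isCont h y"
  unfolding h_eq[abs_def]
  by (intro continuous_intros q_continuous has_vector_derivative_continuous[OF eta_hat_derivative])

text \<open>The kernel depends on its arguments only through t - u and s - u, so a translate of a
  solution of the homogeneous equation is again one. The integral over pairs is unfolded because the
  translation acts on the time variable alone.\<close>

lemma D_shift: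
  fixes z :: "real \<Rightarrow> real"
  assumes st: "s < t" and [measurable]: "z \<in> borel_measurable borel" and C: "\<And>x. \<bar>z x\<bar> \<le> C"
  shows "(LINT c|\<nu>. D (s - x) (t - x) c * z (lag c)) = (LINT c|\<nu>. D s t c * z (lag c - x))"
proof -
  interpret Q: sigma_finite_measure Q by (rule sigma_finite_Q)
  interpret pair_sigma_finite lborel Q ..
  have int: "integrable \<nu> (\<lambda>c. D s t c * z (lag c - x))" if st: "s < t" for s t x
  proof (rule Bochner_Integration.integrable_bound)
    show "integrable \<nu> (\<lambda>c. D s t c * C)" using D_integrable[OF st] by simp
    have [measurable]: "D s t \<in> borel_measurable \<nu>" using D_integrable[OF st] by auto
    show "(\<lambda>c. D s t c * z (lag c - x)) \<in> borel_measurable \<nu>" by measurable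
    show "AE c in \<nu>. norm (D s t c * z (lag c - x)) \<le> norm (D s t c * C)"
    proof (rule AE_I2)
      fix c
      have "\<bar>z (lag c - x)\<bar> \<le> \<bar>C\<bar>" using C[of "lag c - x"] by linarith
      then show "norm (D s t c * z (lag c - x)) \<le> norm (D s t c * C)" by (simp add: abs_mult mult_left_mono)
    qed
  qed

  have iter: "(LINT c|\<nu>. D s t c * z (lag c - x)) = (LINT u|lborel. LINT v|Q. D s t (u, v) * z (lag (u, v) - x))"
    if st: "s < t" for s t x
    unfolding \<nu>_def by (rule integral_fst'[symmetric]) (use int[OF st] in \<open>simp add: \<nu>_def\<close>)
  have "(LINT c|\<nu>. D (s - x) (t - x) c * z (lag c)) = (LINT u|lborel. LINT v|Q. D (s - x) (t - x) (u, v) * z (lag (u, v)))"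
    using iter[of "s - x" "t - x" 0] st by simp
  also have "\<dots> = (LINT u|lborel. LINT v|Q. D s t (x + u, v) * z (lag (x + u, v) - x))"
  proof -
    have "D (s - x) (t - x) (u, v) * z (lag (u, v)) = D s t (x + u, v) * z (lag (x + u, v) - x)" for u v
      by (simp add: D_def lag_def frac_deriv_indicator_def algebra_simps)
    then show ?thesis by (simp only:)
  qed
  also have "\<dots> = (LINT u|lborel. LINT v|Q. D s t (u, v) * z (lag (u, v) - x))"
    by (rule lborel_integral_shift[where f = "\<lambda>u. LINT v|Q. D s t (u, v) * z (lag (u, v) - x)"])
  also have "\<dots> = (LINT c|\<nu>. D s t c * z (lag c - x))" by (rule iter[OF st, symmetric])
  finally show "(LINT c|\<nu>. D (s - x) (t - x) c * z (lag c)) = (LINT c|\<nu>. D s t c * z (lag c - x))" .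
qed

text \<open>The dependence on t - s is what matters: it makes bounded solutions of the homogeneous
  equation Holder continuous of order 1 - \<beta>.\<close>

lemma D_norm:
  assumes st: "s < t"
  shows "(LINT c|\<nu>. \<bar>D s t c\<bar>) = 2 * ((t - s) powr (1 - \<beta>) / (1 - \<beta>)) / Gamma (1 - \<beta>) * (LINT v|Q. \<bar>\<sigma> v\<bar>)"
proof -
  have \<beta>1: "\<beta> < 1" using \<beta> by simp
  have "(LINT c|\<nu>. \<bar>D s t c\<bar>) = (LINT c|(lborel \<Otimes>\<^sub>M Q). \<bar>frac_deriv_indicator \<beta> s t (fst c)\<bar> * \<bar>\<sigma> (snd c)\<bar>)"
    by (simp add: \<nu>_def D_def abs_mult)
  also have "\<dots> = (LINT u|lborel. \<bar>frac_deriv_indicator \<beta> s t u\<bar>) * (LINT v|Q. \<bar>\<sigma> v\<bar>)"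
    by (rule integrable_product_mult(2)[OF sigma_finite_lborel sigma_finite_Q])
       (use frac_deriv_indicator_integrable(1)[OF \<beta>(1) \<beta>1 st] \<sigma> in auto)
  finally show ?thesis using frac_deriv_indicator_integrable(2)[OF \<beta>(1) \<beta>1 st] by simp
qed

text \<open>\<open>Fubini_bounded_kernel\<close> does not fit, since \<psi> is integrable rather
  than bounded and couples both variables. Instead the norm of \<psi> times z integrates over w to
  at most \<open>C\<close> times the L^1 norm of \<psi>, uniformly in the pair c.\<close>

lemma D_Fubini_L1:
  fixes z :: "real \<Rightarrow> real" and \<psi> :: "real \<Rightarrow> complex"
  assumes st: "s < t" and [measurable]: "z \<in> borel_measurable borel" and C: "\<And>x. \<bar>z x\<bar> \<le> C"
    and \<psi>: "integrable lborel \<psi>"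
  shows "(LINT c|\<nu>. of_real (D s t c) * (LINT w|lborel. \<psi> (lag c - w) * of_real (z w)))
     = (LINT w|lborel. (LINT c|\<nu>. of_real (D s t c) * \<psi> (lag c - w)) * of_real (z w))"
proof -
  interpret N: sigma_finite_measure \<nu> by (rule sigma_finite_\<nu>)
  interpret pair_sigma_finite \<nu> lborel ..
  have [measurable]: "D s t \<in> borel_measurable \<nu>" using D_integrable[OF st] by auto
  have \<psi>m[measurable]: "\<psi> \<in> borel_measurable borel" using \<psi> by auto
  have C0: "0 \<le> C" using C[of 0] by linarith
  have \<psi>s: "integrable lborel (\<lambda>w. \<psi> (a - w))" for a using \<psi> by (simp add: lborel_integrable_reflect)
  have zb: "norm (\<psi> x * of_real (z w)) \<le> norm (\<psi> x * of_real C)" for x w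
    using C[of w] C0 by (simp add: norm_mult mult_left_mono)
  have \<psi>z: "integrable lborel (\<lambda>w. \<psi> (a - w) * of_real (z w))" for a
    by (rule Bochner_Integration.integrable_bound[where f = "\<lambda>w. \<psi> (a - w) * of_real C"]) (use \<psi>s zb in auto)
  have "integrable (\<nu> \<Otimes>\<^sub>M lborel) (\<lambda>(c, w). of_real (D s t c) * (\<psi> (lag c - w) * of_real (z w)))"
  proof (rule Fubini_integrable)
    show "integrable \<nu> (\<lambda>c. LINT w|lborel. norm (case (c, w) of (c, w) \<Rightarrow> of_real (D s t c) * (\<psi> (lag c - w) * of_real (z w))))"
    proof (rule Bochner_Integration.integrable_bound)
      show "integrable \<nu> (\<lambda>c. D s t c * (LINT x|lborel. norm (\<psi> x * of_real C)))" using D_integrable[OF st] by simp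
      show "AE c in \<nu>. norm (LINT w|lborel. norm (case (c, w) of (c, w) \<Rightarrow> of_real (D s t c) * (\<psi> (lag c - w) * of_real (z w))))
          \<le> norm (D s t c * (LINT x|lborel. norm (\<psi> x * of_real C)))"
      proof (rule AE_I2)
        fix c
        have "(LINT w|lborel. norm (case (c, w) of (c, w) \<Rightarrow> of_real (D s t c) * (\<psi> (lag c - w) * of_real (z w))))
            = \<bar>D s t c\<bar> * (LINT w|lborel. norm (\<psi> (lag c - w) * of_real (z w)))"
          by (subst integral_mult_right_zero[symmetric]) (simp add: norm_mult)
        moreover have "(LINT w|lborel. norm (\<psi> (lag c - w) * of_real (z w))) \<le> (LINT w|lborel. norm (\<psi> (lag c - w) * of_real C))"
          by (rule integral_mono) (use \<psi>z \<psi>s zb in auto)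
        moreover have "(LINT w|lborel. norm (\<psi> (lag c - w) * of_real C)) = (LINT x|lborel. norm (\<psi> x * of_real C))"
          by (rule lborel_integral_reflect[where f = "\<lambda>x. norm (\<psi> x * of_real C)"])
        moreover have "0 \<le> (LINT w|lborel. norm (\<psi> (lag c - w) * of_real (z w)))" by simp
        ultimately show "norm (LINT w|lborel. norm (case (c, w) of (c, w) \<Rightarrow> of_real (D s t c) * (\<psi> (lag c - w) * of_real (z w))))
          \<le> norm (D s t c * (LINT x|lborel. norm (\<psi> x * of_real C)))"
          by (simp only: real_norm_def abs_mult abs_abs) (intro mult_left_mono, auto)
      qed
    qed measurable
    show "AE c in \<nu>. integrable lborel (\<lambda>w. case (c, w) of (c, w) \<Rightarrow> of_real (D s t c) * (\<psi> (lag c - w) * of_real (z w)))"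
      using \<psi>z by auto
  qed measurable
  from Fubini_integral[OF this]
  have "(LINT w|lborel. LINT c|\<nu>. of_real (D s t c) * (\<psi> (lag c - w) * of_real (z w)))
      = (LINT c|\<nu>. LINT w|lborel. of_real (D s t c) * (\<psi> (lag c - w) * of_real (z w)))" .
  moreover have "(LINT c|\<nu>. of_real (D s t c) * (\<psi> (lag c - w) * of_real (z w)))
      = (LINT c|\<nu>. of_real (D s t c) * \<psi> (lag c - w)) * of_real (z w)" for w
    by (subst integral_mult_left_zero[symmetric]) (simp only: mult.assoc)
  moreover have "(LINT w|lborel. of_real (D s t c) * (\<psi> (lag c - w) * of_real (z w)))
      = of_real (D s t c) * (LINT w|lborel. \<psi> (lag c - w) * of_real (z w))" for c
    by (rule integral_mult_right_zero)
  ultimately show ?thesis by simp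
qed

end

section \<open>The resolvent, and a Liouville theorem for the homogeneous equation\<close>

context delay_kernel
begin

text \<open>\<open>eta_hat\<close> is bounded by \<open>K\<close>, and \<open>R\<close> solves R^(1
  - \<beta>) = K + 1, so outside [-R, R] the leading term exceeds \<open>K\<close> by at least 1.
  Inside, continuity on a compact interval and \<open>h_nonzero\<close> give a positive
  minimum.\<close>

lemma h_lower_bound: obtains c0 where "0 < c0" "\<And>y. c0 \<le> norm (h y)"
proof -
  define K where "K = (LINT v|Q. \<bar>\<sigma> v\<bar>)"
  have K: "0 \<le> K" by (simp add: K_def)
  define R where "R = (K + 1) powr (1 / (1 - \<beta>))"
  have R: "0 \<le> R" by (simp add: R_def)
  have far: "1 \<le> norm (h y)" if "R \<le> \<bar>y\<bar>" for y
  proof -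
    have "K + 1 = R powr (1 - \<beta>)" using \<beta> K by (simp add: R_def powr_powr)
    also have "\<dots> \<le> norm (q y)" unfolding norm_q using that R \<beta> by (intro powr_mono2) auto
    also have "\<dots> \<le> norm (h y) + norm (eta_hat y)" unfolding h_eq by (metis norm_triangle_sub add.commute)
    also have "norm (eta_hat y) \<le> K" unfolding K_def by (rule eta_hat_bound)
    finally show ?thesis by simp
  qed
  have "continuous_on {-R..R} (\<lambda>y. norm (h y))"
    by (intro continuous_at_imp_continuous_on ballI continuous_intros h_continuous)
  then have "\<exists>y0\<in>{-R..R}. \<forall>y\<in>{-R..R}. norm (h y0) \<le> norm (h y)"
    using R by (intro continuous_attains_inf) auto
  then obtain y0 where y0: "\<And>y. y \<in> {-R..R} \<Longrightarrow> norm (h y0) \<le> norm (h y)" by blast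
  show ?thesis
  proof (rule that[of "min 1 (norm (h y0))"])
    show "0 < min 1 (norm (h y0))" using h_nonzero by simp
    fix y
    show "min 1 (norm (h y0)) \<le> norm (h y)"
    proof (cases "R \<le> \<bar>y\<bar>")
      case True
      then show ?thesis using far by (simp add: min.coboundedI1)
    next
      case False
      then have "y \<in> {-R..R}" by auto
      then show ?thesis using y0 by (simp add: min.coboundedI2)
    qed
  qed
qed

text \<open>The Fourier multiplier of the homogeneous equation is \<open>(e\<^sup>-\<^sup>i\<^sup>y\<^sup>t - e\<^sup>-\<^sup>i\<^sup>y\<^sup>s) h(iy) / q(y)\<close>, so this
  \<open>\<Psi>\<close> solves it with a difference of Gaussians on the right-hand side; the factor \<open>p\<close> vanishing at \<open>0\<close>
  compensates the singularity of \<open>q'\<close>.\<close>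

lemma resolvent_integrable:
  fixes b e :: real
  assumes e: "0 < e"
  defines "p \<equiv> \<lambda>y. (iexp (- (y * b)) - 1) * of_real (exp (- (e * y)\<^sup>2 / 2))"
  shows "integrable lborel (\<lambda>x. LINT y|lborel. p y * q y / h y * iexp (- (y * x)))"
    and "integrable lborel (\<lambda>y. p y * q y / h y)"
proof -
  obtain c0 where c0: "0 < c0" "\<And>y. c0 \<le> norm (h y)" by (rule h_lower_bound) blast
  define N where "N y = exp (- (e * y)\<^sup>2 / 2)" for y
  define p' where "p' y = (- \<i> * of_real b * iexp (- (y * b))) * of_real (N y)
     + (iexp (- (y * b)) - 1) * of_real (- (e\<^sup>2 * y) * N y)" for y
  define h' where "h' y = q' y - eta_hat' y" for y
  define \<Psi> where "\<Psi> y = p y * q y * inverse (h y)" for y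
  define \<Psi>' where "\<Psi>' y = p' y * q y * inverse (h y) + p y * q' y * inverse (h y)
      - p y * q y * (h' y * inverse (h y) * inverse (h y))" for y
  define K1 where "K1 = (LINT v|Q. \<bar>v * \<sigma> v\<bar>)"
  have K1: "0 \<le> K1" by (simp add: K1_def)
  have N0: "0 \<le> N y" "0 < N y" for y by (simp_all add: N_def)
  have p_der: "(p has_vector_derivative p' y) (at y)" for y
  proof -
    have 1: "((\<lambda>y. iexp (- (y * b)) - 1) has_vector_derivative - \<i> * of_real b * iexp (- (y * b))) (at y)"
      by (auto intro!: derivative_eq_intros has_vector_derivative_real_field simp: algebra_simps)
    have "(N has_real_derivative - (e\<^sup>2 * y) * N y) (at y)"
      unfolding N_def[abs_def] by (auto intro!: derivative_eq_intros simp: power2_eq_square)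
    then have 2: "((\<lambda>y. complex_of_real (N y)) has_vector_derivative of_real (- (e\<^sup>2 * y) * N y)) (at y)"
      by (rule has_vector_derivative_of_real)
    from has_vector_derivative_mult[OF 1 2] show ?thesis
      unfolding p_def p'_def N_def[abs_def] by (simp add: add.commute)
  qed
  have deriv: "(\<Psi> has_vector_derivative \<Psi>' y) (at y)" if y: "y \<noteq> 0" for y
  proof -
    have "(h has_vector_derivative h' y) (at y)" unfolding h'_def by (rule h_derivative[OF y])
    then have "((\<lambda>y. inverse (h y)) has_vector_derivative - (inverse (h y) * h' y * inverse (h y))) (at y)"
      using field_vector_diff_chain_at[of h "h' y" y, OF _ DERIV_inverse[OF h_nonzero[of y]]]
      by (simp add: o_def power2_eq_square mult_ac)
    from has_vector_derivative_mult[OF has_vector_derivative_mult[OF p_der q_derivative[OF y]] this]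
    have "((\<lambda>y. p y * q y * inverse (h y)) has_vector_derivative
      p y * q y * - (inverse (h y) * h' y * inverse (h y)) + (p y * q' y + p' y * q y) * inverse (h y)) (at y)" .
    moreover have "p y * q y * - (inverse (h y) * h' y * inverse (h y)) + (p y * q' y + p' y * q y) * inverse (h y) = \<Psi>' y"
      by (simp add: \<Psi>'_def algebra_simps)
    ultimately show ?thesis unfolding \<Psi>_def[abs_def] by simp
  qed
  have cont: "isCont \<Psi>' y" if y: "y \<noteq> 0" for y
  proof -
    have "isCont p y" by (rule has_vector_derivative_continuous[OF p_der])
    moreover have "isCont p' y"
    proof -
      have "continuous_on UNIV p'"
        unfolding p'_def[abs_def] N_def[abs_def] by (intro continuous_intros) auto
      then show ?thesis by (simp add: continuous_on_eq_continuous_at)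
    qed
    moreover have "isCont h' y" unfolding h'_def[abs_def] by (intro continuous_intros q'_continuous eta_hat'_continuous y)
    ultimately show ?thesis
      unfolding \<Psi>'_def[abs_def] using h_nonzero
      by (intro continuous_intros q_continuous q'_continuous h_continuous y) auto
  qed
  have \<Psi>m: "\<Psi> \<in> borel_measurable borel"
  proof (rule borel_measurable_continuous_countable_exceptions[of "{0}"])
    show "continuous_on (- {0}) \<Psi>"
      using deriv by (intro continuous_at_imp_continuous_on ballI has_vector_derivative_continuous) auto
  qed simp
  have \<Psi>'m: "\<Psi>' \<in> borel_measurable borel"
  proof (rule borel_measurable_continuous_countable_exceptions[of "{0}"])
    show "continuous_on (- {0}) \<Psi>'" using cont by (intro continuous_at_imp_continuous_on ballI) auto
  qed simp
  have ib: "norm (iexp (- (y * b)) - 1) \<le> \<bar>b\<bar> * \<bar>y\<bar>" for y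
    using norm_iexp_minus_1[of "- (y * b)"] by (simp add: abs_mult mult.commute)
  have i2: "norm (iexp (- (y * b)) - 1) \<le> 2" for y
    using norm_triangle_ineq4[of "iexp (- (y * b))" 1] by simp
  \<comment> \<open>Two bounds on \<open>p\<close>: one without the factor |y|, for the size of
    \<Psi>, and one with it, to absorb the singularity of \<open>q'\<close> and to obtain the limit
    at 0.\<close>
  have p2: "norm (p y) \<le> 2 * N y" for y
    unfolding p_def norm_mult N_def[symmetric] using N0 i2 by (simp add: mult_right_mono)
  have pb: "norm (p y) \<le> \<bar>b\<bar> * \<bar>y\<bar> * N y" for y
    unfolding p_def norm_mult N_def[symmetric] using N0 ib by (simp add: mult_right_mono)
  have p'b: "norm (p' y) \<le> (\<bar>b\<bar> + 2 * e\<^sup>2) * (1 + \<bar>y\<bar>) * N y" for y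
  proof -
    have "norm (p' y) \<le> norm ((- \<i> * of_real b * iexp (- (y * b))) * of_real (N y)) + norm ((iexp (- (y * b)) - 1) * of_real (- (e\<^sup>2 * y) * N y))"
      unfolding p'_def by (rule norm_triangle_ineq)
    also have "\<dots> = \<bar>b\<bar> * N y + norm (iexp (- (y * b)) - 1) * (e\<^sup>2 * \<bar>y\<bar> * N y)"
      using N0 by (simp only: norm_mult norm_iexp norm_of_real abs_mult abs_minus_cancel) simp
    also have "\<dots> \<le> \<bar>b\<bar> * N y + 2 * (e\<^sup>2 * \<bar>y\<bar> * N y)"
      using N0 i2 by (intro add_left_mono mult_right_mono) auto
    also have "\<dots> \<le> (\<bar>b\<bar> + 2 * e\<^sup>2) * (1 + \<bar>y\<bar>) * N y"
    proof -
      have "\<bar>b\<bar> + 2 * e\<^sup>2 * \<bar>y\<bar> \<le> (\<bar>b\<bar> + 2 * e\<^sup>2) * (1 + \<bar>y\<bar>)" by (simp add: algebra_simps)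
      from mult_right_mono[OF this N0(1)[of y]] show ?thesis by (simp add: algebra_simps)
    qed
    finally show ?thesis .
  qed
  have qb: "norm (q y) \<le> 1 + \<bar>y\<bar>" for y unfolding norm_q using \<beta> by (intro powr_one_minus_le) auto
  have yq': "\<bar>y\<bar> * norm (q' y) \<le> 1 + \<bar>y\<bar>" for y
  proof -
    have "\<bar>y\<bar> * norm (q' y) \<le> \<bar>y\<bar> * \<bar>y\<bar> powr (- \<beta>)" by (intro mult_left_mono norm_q') auto
    also have "\<dots> = \<bar>y\<bar> powr (1 - \<beta>)" using powr_mult_base[of "\<bar>y\<bar>" "- \<beta>"] by simp
    also have "\<dots> \<le> 1 + \<bar>y\<bar>" using \<beta> by (intro powr_one_minus_le) auto
    finally show ?thesis .
  qed
  have yh': "\<bar>y\<bar> * norm (h' y) \<le> (1 + K1) * (1 + \<bar>y\<bar>)" for y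
  proof -
    have "norm (h' y) \<le> norm (q' y) + norm (eta_hat' y)" unfolding h'_def by (rule norm_triangle_ineq4)
    then have "norm (h' y) \<le> norm (q' y) + K1" using eta_hat'_bound[of y] by (simp add: K1_def)
    then have "\<bar>y\<bar> * norm (h' y) \<le> \<bar>y\<bar> * norm (q' y) + \<bar>y\<bar> * K1"
      using mult_left_mono[of "norm (h' y)" "norm (q' y) + K1" "\<bar>y\<bar>"] by (simp add: distrib_left)
    also have "\<dots> \<le> (1 + \<bar>y\<bar>) + (1 + \<bar>y\<bar>) * K1" using yq'[of y] K1 by (intro add_mono mult_right_mono) auto
    finally show ?thesis by (simp add: algebra_simps)
  qed
  have hi: "norm (inverse (h y)) \<le> inverse c0" for y
    using c0 by (simp add: norm_inverse le_imp_inverse_le)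
  have ic: "0 \<le> inverse c0" using c0 by simp
  \<comment> \<open>The summands collect the coefficients of the three terms of \<Psi>'; the extra 2
    in the first one pays for \<Psi> itself.\<close>
  define A where "A = (2 + \<bar>b\<bar> + 2 * e\<^sup>2) * inverse c0 + \<bar>b\<bar> * inverse c0 + \<bar>b\<bar> * (1 + K1) * (inverse c0 * inverse c0)"
  define C where "C = A * (2 * (1 + 8 / (3 * e\<^sup>2)))"
  have A0: "0 \<le> A" using ic K1 by (simp add: A_def)
  have y1: "1 \<le> 1 + \<bar>y\<bar>" "1 + \<bar>y\<bar> \<le> (1 + \<bar>y\<bar>)\<^sup>2" for y :: real
    by (simp_all add: power2_eq_square algebra_simps)
  have toC: "x \<le> C * exp (- ((e / 2) * y)\<^sup>2 / 2)" if "x \<le> A * ((1 + \<bar>y\<bar>)\<^sup>2 * N y)" for x y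
  proof -
    have "A * ((1 + \<bar>y\<bar>)\<^sup>2 * N y) \<le> A * (2 * (1 + 8 / (3 * e\<^sup>2)) * exp (- ((e / 2) * y)\<^sup>2 / 2))"
      unfolding N_def using polynomial_gaussian_bound[OF e] A0 by (rule mult_left_mono)
    with that show ?thesis by (simp add: C_def mult.assoc)
  qed
  have le1: "norm (\<Psi> y) \<le> C * exp (- ((e / 2) * y)\<^sup>2 / 2)" for y
  proof (rule toC)
    have "norm (\<Psi> y) \<le> (2 * N y) * (1 + \<bar>y\<bar>) * inverse c0"
      unfolding \<Psi>_def norm_mult using p2 qb hi N0 by (intro mult_mono) auto
    also have "\<dots> = 2 * inverse c0 * ((1 + \<bar>y\<bar>) * N y)" by (simp add: mult_ac)
    also have "\<dots> \<le> A * ((1 + \<bar>y\<bar>)\<^sup>2 * N y)"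
    proof (intro mult_mono mult_right_mono y1 N0)
      have "0 \<le> (\<bar>b\<bar> + 2 * e\<^sup>2) * inverse c0 + \<bar>b\<bar> * inverse c0 + \<bar>b\<bar> * (1 + K1) * (inverse c0 * inverse c0)"
        using ic K1 by simp
      then show "2 * inverse c0 \<le> A" by (simp add: A_def algebra_simps)
    qed (use A0 N0 in auto)
    finally show "norm (\<Psi> y) \<le> A * ((1 + \<bar>y\<bar>)\<^sup>2 * N y)" .
  qed
  have le2: "norm (\<Psi>' y) \<le> C * exp (- ((e / 2) * y)\<^sup>2 / 2)" for y
  proof (rule toC)
    have t1: "norm (p' y * q y * inverse (h y)) \<le> (\<bar>b\<bar> + 2 * e\<^sup>2) * inverse c0 * ((1 + \<bar>y\<bar>)\<^sup>2 * N y)"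
    proof -
      have "norm (p' y * q y * inverse (h y)) \<le> ((\<bar>b\<bar> + 2 * e\<^sup>2) * (1 + \<bar>y\<bar>) * N y) * (1 + \<bar>y\<bar>) * inverse c0"
        unfolding norm_mult using p'b qb hi N0 by (intro mult_mono) auto
      then show ?thesis by (simp add: power2_eq_square mult_ac)
    qed
    have t2: "norm (p y * q' y * inverse (h y)) \<le> \<bar>b\<bar> * inverse c0 * ((1 + \<bar>y\<bar>)\<^sup>2 * N y)"
    proof -
      have "norm (p y * q' y * inverse (h y)) \<le> (\<bar>b\<bar> * \<bar>y\<bar> * N y) * norm (q' y) * inverse c0"
        unfolding norm_mult using pb hi N0 by (intro mult_mono) auto
      also have "\<dots> = \<bar>b\<bar> * inverse c0 * ((\<bar>y\<bar> * norm (q' y)) * N y)" by (simp add: mult_ac)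
      also have "\<dots> \<le> \<bar>b\<bar> * inverse c0 * ((1 + \<bar>y\<bar>)\<^sup>2 * N y)"
        using yq'[of y] y1(2)[of y] N0 ic by (intro mult_left_mono mult_right_mono) auto
      finally show ?thesis .
    qed
    have t3: "norm (p y * q y * (h' y * inverse (h y) * inverse (h y))) \<le> \<bar>b\<bar> * (1 + K1) * (inverse c0 * inverse c0) * ((1 + \<bar>y\<bar>)\<^sup>2 * N y)"
    proof -
      have "norm (p y * q y * (h' y * inverse (h y) * inverse (h y)))
          \<le> (\<bar>b\<bar> * \<bar>y\<bar> * N y) * (1 + \<bar>y\<bar>) * (norm (h' y) * inverse c0 * inverse c0)"
        unfolding norm_mult using pb qb hi N0 ic by (intro mult_mono mult_nonneg_nonneg) auto
      also have "\<dots> = \<bar>b\<bar> * (inverse c0 * inverse c0) * ((\<bar>y\<bar> * norm (h' y)) * ((1 + \<bar>y\<bar>) * N y))" by (simp add: mult_ac)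
      also have "\<dots> \<le> \<bar>b\<bar> * (inverse c0 * inverse c0) * (((1 + K1) * (1 + \<bar>y\<bar>)) * ((1 + \<bar>y\<bar>) * N y))"
        using yh'[of y] N0 ic by (intro mult_left_mono mult_right_mono) auto
      finally show ?thesis by (simp add: power2_eq_square mult_ac)
    qed
    have "norm (\<Psi>' y) \<le> norm (p' y * q y * inverse (h y)) + norm (p y * q' y * inverse (h y))
        + norm (p y * q y * (h' y * inverse (h y) * inverse (h y)))"
      unfolding \<Psi>'_def by (meson norm_triangle_ineq4 norm_triangle_ineq order_trans add_right_mono)
    also have "\<dots> \<le> (\<bar>b\<bar> + 2 * e\<^sup>2) * inverse c0 * ((1 + \<bar>y\<bar>)\<^sup>2 * N y) + \<bar>b\<bar> * inverse c0 * ((1 + \<bar>y\<bar>)\<^sup>2 * N y)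
        + \<bar>b\<bar> * (1 + K1) * (inverse c0 * inverse c0) * ((1 + \<bar>y\<bar>)\<^sup>2 * N y)"
      by (intro add_mono t1 t2 t3)
    also have "\<dots> = (A - 2 * inverse c0) * ((1 + \<bar>y\<bar>)\<^sup>2 * N y)"
      by (simp only: A_def algebra_simps)
    also have "\<dots> \<le> A * ((1 + \<bar>y\<bar>)\<^sup>2 * N y)"
      using ic N0 by (intro mult_right_mono) auto
    finally show "norm (\<Psi>' y) \<le> A * ((1 + \<bar>y\<bar>)\<^sup>2 * N y)" .
  qed
  have zero: "(\<Psi> \<longlongrightarrow> 0) (at 0)"
  proof (rule Lim_null_comparison)
    show "\<forall>\<^sub>F y in at 0. norm (\<Psi> y) \<le> \<bar>b\<bar> * \<bar>y\<bar> * N y * (1 + \<bar>y\<bar>) * inverse c0"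
      unfolding \<Psi>_def norm_mult using pb qb hi N0 by (intro always_eventually allI mult_mono) auto
    have "((\<lambda>y. \<bar>b\<bar> * \<bar>y\<bar> * N y * (1 + \<bar>y\<bar>) * inverse c0) \<longlongrightarrow> \<bar>b\<bar> * \<bar>0\<bar> * N 0 * (1 + \<bar>0\<bar>) * inverse c0) (at 0)"
      unfolding N_def by (intro tendsto_intros) auto
    then show "((\<lambda>y. \<bar>b\<bar> * \<bar>y\<bar> * N y * (1 + \<bar>y\<bar>) * inverse c0) \<longlongrightarrow> 0) (at 0)" by simp
  qed
  have e2: "0 < e / 2" using e by simp
  have \<Psi>_eq: "\<Psi> = (\<lambda>y. p y * q y / h y)" by (simp add: \<Psi>_def[abs_def] divide_inverse)
  show "integrable lborel (\<lambda>y. p y * q y / h y)"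
    using gaussian_dominated(1)[OF \<Psi>m e2 le1] unfolding \<Psi>_eq .
  show "integrable lborel (\<lambda>x. LINT y|lborel. p y * q y / h y * iexp (- (y * x)))"
    using fourier_transform_integrable[OF \<Psi>m \<Psi>'m e2 le1 le2 deriv cont zero] unfolding \<Psi>_eq .
qed

text \<open>Multiplying \<Psi> by h / q gives back \<open>p\<close>, so by \<open>h_identity\<close>
  the kernel maps \<psi> to its own increment minus that of \<open>P\<close>. The latter is the
  frequency integral of \<open>p\<close>, a difference of two Gaussians at distance
  \<open>b\<close>.\<close>

lemma resolvent_identity:
  fixes b e :: real
  assumes e: "0 < e" and st: "s < t"
  defines "p \<equiv> \<lambda>y. (iexp (- (y * b)) - 1) * of_real (exp (- (e * y)\<^sup>2 / 2))"
  defines "\<psi> \<equiv> \<lambda>x. LINT y|lborel. p y * q y / h y * iexp (- (y * x))"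
  defines "P \<equiv> \<lambda>x. complex_of_real (2 * pi * (normal_density 0 e (x + b) - normal_density 0 e x))"
  shows "(LINT c|\<nu>. of_real (D s t c) * \<psi> (lag c - w)) = \<psi> (t - w) - \<psi> (s - w) - (P (t - w) - P (s - w))"
proof -
  define N where "N y = complex_of_real (exp (- (e * y)\<^sup>2 / 2))" for y
  define E where "E x y = iexp (- (y * x))" for x y
  define \<Psi> where "\<Psi> y = p y * q y / h y" for y
  have Ni: "integrable lborel N" using gaussian_integrable[OF e] unfolding N_def[abs_def] by (rule integrable_of_real)
  have NE: "integrable lborel (\<lambda>y. N y * E x y)" for x
    by (rule Bochner_Integration.integrable_bound[OF Ni]) (use Ni in \<open>auto simp: E_def norm_mult\<close>)
  have pE: "p y * E x y = N y * E (x + b) y - N y * E x y" for x y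
  proof -
    have "E (x + b) y = iexp (- (y * b)) * E x y"
      unfolding E_def by (simp only: iexp_add[symmetric]) (simp add: algebra_simps)
    then show ?thesis by (simp add: p_def N_def algebra_simps)
  qed
  have pi: "integrable lborel (\<lambda>y. p y * E x y)" for x unfolding pE using NE by simp
  have NE_int: "(LINT y|lborel. N y * E x y) = of_real (2 * pi * normal_density 0 e x)" for x
    using gaussian_fourier(1)[OF e, of "- x"] normal_density_minus[of e 0 x] by (simp add: N_def E_def)
  have P: "(LINT y|lborel. p y * E x y) = P x" for x
    unfolding pE P_def using NE by (simp add: NE_int algebra_simps)
  have \<Psi>i: "integrable lborel \<Psi>" unfolding \<Psi>_def p_def by (rule resolvent_integrable(2)[OF e])
  have \<Psi>E: "integrable lborel (\<lambda>y. \<Psi> y * E x y)" for x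
    by (rule Bochner_Integration.integrable_bound[OF \<Psi>i]) (use \<Psi>i in \<open>auto simp: E_def norm_mult\<close>)
  have \<psi>: "\<psi> x = (LINT y|lborel. \<Psi> y * E x y)" for x by (simp add: \<psi>_def \<Psi>_def E_def)
  define m where "m y = (LINT c|\<nu>. of_real (D s t c) * E (lag c) y)" for y
  have "(LINT c|\<nu>. of_real (D s t c) * \<psi> (lag c - w)) = (LINT y|lborel. \<Psi> y * iexp (y * w) * m y)"
    unfolding \<psi> E_def m_def by (rule fourier_kernel_Fubini[OF st \<Psi>i])
  also have "\<dots> = (LINT y|lborel. \<Psi> y * E (t - w) y - \<Psi> y * E (s - w) y - (p y * E (t - w) y - p y * E (s - w) y))"
  proof (rule integral_cong_AE)
    have "m \<in> borel_measurable borel"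
    proof -
      interpret N: sigma_finite_measure \<nu> by (rule sigma_finite_\<nu>)
      have [measurable]: "D s t \<in> borel_measurable \<nu>" using D_integrable[OF st] by auto
      show ?thesis unfolding m_def[abs_def] E_def by measurable
    qed
    then show "(\<lambda>y. \<Psi> y * iexp (y * w) * m y) \<in> borel_measurable lborel" using \<Psi>i by measurable
    show "(\<lambda>y. \<Psi> y * E (t - w) y - \<Psi> y * E (s - w) y - (p y * E (t - w) y - p y * E (s - w) y)) \<in> borel_measurable lborel"
      using \<Psi>E pi by (intro borel_measurable_integrable Bochner_Integration.integrable_diff)
    show "AE y in lborel. \<Psi> y * iexp (y * w) * m y = \<Psi> y * E (t - w) y - \<Psi> y * E (s - w) y - (p y * E (t - w) y - p y * E (s - w) y)"
      using AE_lborel_singleton[of "0 :: real"]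
    proof eventually_elim
      case (elim y)
      let ?z = "- \<i> * complex_of_real y"
      have E: "E (x - w) y = iexp (y * w) * E x y" for x
        unfolding E_def by (simp only: iexp_add[symmetric]) (simp add: algebra_simps)
      have m: "m y = (E t y - E s y) * (1 - ?z powr of_real (\<beta> - 1) * h y)"
        unfolding m_def E_def fourier_D[OF st elim] h_identity[OF elim, symmetric] by (simp only: mult.assoc)
      have "\<Psi> y * (?z powr of_real (\<beta> - 1) * h y) = p y * (?z powr of_real (1 - \<beta>) * ?z powr of_real (\<beta> - 1))"
        using h_nonzero[of y] by (simp add: \<Psi>_def q_def)
      also have "\<dots> = p y" using elim by (subst powr_add[symmetric]) simp
      finally have pz: "\<Psi> y * (?z powr of_real (\<beta> - 1) * h y) = p y" .
      have "\<Psi> y * iexp (y * w) * m y = \<Psi> y * (iexp (y * w) * E t y) - \<Psi> y * (iexp (y * w) * E s y)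
          - ((\<Psi> y * (?z powr of_real (\<beta> - 1) * h y)) * (iexp (y * w) * E t y)
             - (\<Psi> y * (?z powr of_real (\<beta> - 1) * h y)) * (iexp (y * w) * E s y))"
      proof -
        have "G * W * ((A - B) * (1 - Z)) = G * (W * A) - G * (W * B) - ((G * Z) * (W * A) - (G * Z) * (W * B))"
          for G W A B Z :: complex by (simp add: algebra_simps)
        then show ?thesis unfolding m .
      qed
      then show ?case unfolding pz E .
    qed
  qed
  also have "\<dots> = \<psi> (t - w) - \<psi> (s - w) - (P (t - w) - P (s - w))"
    using \<Psi>E pi by (simp only: P \<psi> Bochner_Integration.integral_diff Bochner_Integration.integrable_diff)
  finally show ?thesis .
qed

text \<open>The equation is convolved with \<psi>, and Fubini moves the kernel onto \<psi>; there
  \<open>resolvent_identity\<close> reproduces the increment of the convolution of \<psi> and z,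
  which cancels. What remains says that the convolution of \<open>P\<close> and z takes equal values
  at s and t, and this convolution is 2 pi (F (x + b) - F x).\<close>

lemma bounded_solution_smoothed_increment:
  fixes z :: "real \<Rightarrow> real"
  assumes zm[measurable]: "z \<in> borel_measurable borel" and C: "\<And>x. \<bar>z x\<bar> \<le> C"
    and eq: "\<And>s t. s < t \<Longrightarrow> z t - z s = (LINT c|\<nu>. D s t c * z (lag c))"
    and e: "0 < e" and st: "s < t"
  defines "F \<equiv> \<lambda>x. LINT w|lborel. normal_density 0 e (x - w) * z w"
  shows "F (t + b) - F t = F (s + b) - F s"
proof -
  define p where "p y = (iexp (- (y * b)) - 1) * of_real (exp (- (e * y)\<^sup>2 / 2))" for y
  define \<psi> where "\<psi> x = (LINT y|lborel. p y * q y / h y * iexp (- (y * x)))" for x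
  define P where "P x = complex_of_real (2 * pi * (normal_density 0 e (x + b) - normal_density 0 e x))" for x
  have \<psi>i: "integrable lborel \<psi>" unfolding \<psi>_def[abs_def] p_def by (rule resolvent_integrable(1)[OF e])
  have C0: "0 \<le> C" using C[of 0] by linarith
  have bounded_mult: "integrable lborel (\<lambda>w. f w * complex_of_real (z w))" if "integrable lborel f" for f
  proof (rule Bochner_Integration.integrable_bound)
    show "integrable lborel (\<lambda>w. f w * complex_of_real C)" using that by simp
    show "(\<lambda>w. f w * complex_of_real (z w)) \<in> borel_measurable lborel" using that by measurable
    show "AE w in lborel. norm (f w * complex_of_real (z w)) \<le> norm (f w * complex_of_real C)"
      using C C0 by (intro AE_I2) (simp add: norm_mult mult_left_mono)
  qed
  have \<psi>z: "integrable lborel (\<lambda>w. \<psi> (a - w) * of_real (z w))" for a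
    using \<psi>i by (intro bounded_mult) (simp add: lborel_integrable_reflect)
  have \<psi>zr: "integrable lborel (\<lambda>x. \<psi> x * of_real (z (a - x)))" for a
    using lborel_integrable_reflect[of "\<lambda>w. \<psi> (a - w) * of_real (z w)" a] \<psi>z[of a] by simp
  have nd: "integrable lborel (\<lambda>w. normal_density 0 e (a - w))" for a
    using integrable_normal_density[OF e] lborel_integrable_reflect[of "normal_density 0 e" a] by simp
  have ndz: "integrable lborel (\<lambda>w. complex_of_real (normal_density 0 e (a - w)) * of_real (z w))" for a
    by (intro bounded_mult integrable_of_real nd)
  have Pz_eq: "P (a - w) * of_real (z w) = of_real (2 * pi) *
      (of_real (normal_density 0 e (a + b - w)) * of_real (z w) - of_real (normal_density 0 e (a - w)) * of_real (z w))" for a w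
  proof -
    have "a - w + b = a + b - w" by simp
    then show ?thesis by (simp add: P_def algebra_simps)
  qed
  have Pz: "integrable lborel (\<lambda>w. P (a - w) * of_real (z w))" for a
    unfolding Pz_eq by (intro integrable_mult_right Bochner_Integration.integrable_diff ndz)
  have PF: "(LINT w|lborel. P (a - w) * of_real (z w)) = of_real (2 * pi * (F (a + b) - F a))" for a
  proof -
    have "(LINT w|lborel. complex_of_real (normal_density 0 e (a - w)) * of_real (z w)) = of_real (F a)" for a
      unfolding F_def by (simp only: of_real_mult[symmetric] integral_complex_of_real)
    then show ?thesis unfolding Pz_eq using ndz
      by (simp only: integral_mult_right_zero Bochner_Integration.integral_diff of_real_mult of_real_diff)
  qed
  have reflect: "(LINT x|lborel. \<psi> x * of_real (z (a - x))) = (LINT w|lborel. \<psi> (a - w) * of_real (z w))" for a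
    using lborel_integral_reflect[of "\<lambda>w. \<psi> (a - w) * of_real (z w)" a] by simp
  have eqx: "z (t - x) - z (s - x) = (LINT c|\<nu>. D s t c * z (lag c - x))" for x
    using eq[of "s - x" "t - x"] D_shift[OF st zm C, of x] st by simp
  have "(LINT x|lborel. \<psi> x * of_real (z (t - x))) - (LINT x|lborel. \<psi> x * of_real (z (s - x)))
      = (LINT x|lborel. \<psi> x * of_real (z (t - x)) - \<psi> x * of_real (z (s - x)))"
    using \<psi>zr by simp
  also have "\<dots> = (LINT x|lborel. \<psi> x * (LINT c|\<nu>. of_real (D s t c) * of_real (z (lag c - x))))"
  proof (rule Bochner_Integration.integral_cong[OF refl])
    fix x
    have "complex_of_real (z (t - x) - z (s - x)) = (LINT c|\<nu>. of_real (D s t c) * of_real (z (lag c - x)))"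
      unfolding eqx by (simp only: of_real_mult[symmetric] integral_complex_of_real)
    then show "\<psi> x * of_real (z (t - x)) - \<psi> x * of_real (z (s - x)) = \<psi> x * (LINT c|\<nu>. of_real (D s t c) * of_real (z (lag c - x)))"
      by (simp add: right_diff_distrib[symmetric])
  qed
  also have "\<dots> = (LINT c|\<nu>. of_real (D s t c) * (LINT x|lborel. \<psi> x * of_real (z (lag c - x))))"
    by (rule Fubini_bounded_kernel[OF sigma_finite_lborel sigma_finite_\<nu> \<psi>i, where B = C])
       (use D_integrable[OF st] C in \<open>auto intro: integrable_of_real\<close>)
  also have "\<dots> = (LINT c|\<nu>. of_real (D s t c) * (LINT w|lborel. \<psi> (lag c - w) * of_real (z w)))"
    by (simp only: reflect)
  also have "\<dots> = (LINT w|lborel. (LINT c|\<nu>. of_real (D s t c) * \<psi> (lag c - w)) * of_real (z w))"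
    by (rule D_Fubini_L1[OF st zm C \<psi>i])
  also have "\<dots> = (LINT w|lborel. \<psi> (t - w) * of_real (z w) - \<psi> (s - w) * of_real (z w)
      - (P (t - w) * of_real (z w) - P (s - w) * of_real (z w)))"
  proof (rule Bochner_Integration.integral_cong[OF refl])
    fix w
    have "(LINT c|\<nu>. of_real (D s t c) * \<psi> (lag c - w)) = \<psi> (t - w) - \<psi> (s - w) - (P (t - w) - P (s - w))"
      unfolding \<psi>_def p_def P_def by (rule resolvent_identity[OF e st])
    then show "(LINT c|\<nu>. of_real (D s t c) * \<psi> (lag c - w)) * of_real (z w) = \<psi> (t - w) * of_real (z w) - \<psi> (s - w) * of_real (z w)
      - (P (t - w) * of_real (z w) - P (s - w) * of_real (z w))" by (simp only: left_diff_distrib)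
  qed
  also have "\<dots> = (LINT w|lborel. \<psi> (t - w) * of_real (z w)) - (LINT w|lborel. \<psi> (s - w) * of_real (z w))
      - (of_real (2 * pi * (F (t + b) - F t)) - of_real (2 * pi * (F (s + b) - F s)))"
    using \<psi>z Pz by (simp only: PF Bochner_Integration.integral_diff Bochner_Integration.integrable_diff)
  finally have "complex_of_real (2 * pi * (F (t + b) - F t)) = of_real (2 * pi * (F (s + b) - F s))"
    by (simp add: reflect)
  then show ?thesis by (simp only: of_real_eq_iff) simp
qed

text \<open>A Liouville theorem. Increments of the smoothed z over any lag do not depend on time, so
  it is affine along the multiples of x, and boundedness makes the slope 0. Removing the smoothing
  takes continuity of z, which the equation itself supplies.\<close>

lemma bounded_solution_constant:
  fixes z :: "real \<Rightarrow> real"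
  assumes zm[measurable]: "z \<in> borel_measurable borel" and C: "\<And>x. \<bar>z x\<bar> \<le> C"
    and eq: "\<And>s t. s < t \<Longrightarrow> z t - z s = (LINT c|\<nu>. D s t c * z (lag c))"
  shows "z x = z y"
proof -
  have smoothed: "(LINT v|lborel. normal_density 0 e v * z (x - v)) = (LINT v|lborel. normal_density 0 e v * z (0 - v))"
    if e: "0 < e" for e x
  proof -
    define F where "F x = (LINT w|lborel. normal_density 0 e (x - w) * z w)" for x
    have F_eq: "F x = (LINT v|lborel. normal_density 0 e v * z (x - v))" for x
      unfolding F_def using lborel_integral_reflect[of "\<lambda>w. normal_density 0 e (x - w) * z w" x] by simp
    have bounded: "\<bar>F x\<bar> \<le> C" for x
    proof -
      have "\<bar>F x\<bar> \<le> (LINT v|lborel. \<bar>normal_density 0 e v * z (x - v)\<bar>)" unfolding F_eq by (rule integral_abs_bound)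
      also have "\<dots> \<le> (LINT v|lborel. normal_density 0 e v * C)"
      proof (rule integral_mono')
        show "integrable lborel (\<lambda>v. normal_density 0 e v * C)" using integrable_normal_density[OF e] by simp
        show "\<bar>normal_density 0 e v * z (x - v)\<bar> \<le> normal_density 0 e v * C" for v
          using C[of "x - v"] by (simp add: abs_mult normal_density_nonneg mult_left_mono)
        show "0 \<le> normal_density 0 e v * C" for v
          using C[of 0] by (intro mult_nonneg_nonneg normal_density_nonneg) linarith
      qed
      also have "\<dots> = C" using integral_normal_density[OF e] by simp
      finally show ?thesis .
    qed
    have step: "F (t + b) - F t = F b - F 0" for t b
    proof -
      have inc: "F (t + b) - F t = F (s + b) - F s" if "s < t" for s t
        unfolding F_def by (rule bounded_solution_smoothed_increment[OF zm C eq e that])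
      consider "0 < t" | "t = 0" | "t < 0" by linarith
      then show ?thesis using inc[of 0 t] inc[of t 0] by cases auto
    qed
    have additive: "F (real n * x) = F 0 + real n * (F x - F 0)" for n x
    proof (induction n)
      case (Suc n)
      have "F (real (Suc n) * x) = F (real n * x + x)" by (simp add: algebra_simps)
      with Suc step[of "real n * x" x] show ?case by (simp add: algebra_simps)
    qed simp
    have "F x = F 0"
    proof (rule ccontr)
      assume "F x \<noteq> F 0"
      then have pos: "0 < \<bar>F x - F 0\<bar>" by simp
      obtain n :: nat where n: "2 * C < real n * \<bar>F x - F 0\<bar>" using reals_Archimedean3[OF pos] by blast
      have "real n * \<bar>F x - F 0\<bar> = \<bar>F (real n * x) - F 0\<bar>" unfolding additive by (simp add: abs_mult)
      also have "\<dots> \<le> 2 * C" using bounded[of "real n * x"] bounded[of 0] by linarith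
      finally show False using n by simp
    qed
    then show ?thesis by (simp only: F_eq)
  qed
  obtain K where K: "\<And>s t. \<bar>z t - z s\<bar> \<le> K * \<bar>t - s\<bar> powr (1 - \<beta>)"
  proof -
    define K where "K = 2 / (1 - \<beta>) / Gamma (1 - \<beta>) * (LINT v|Q. \<bar>\<sigma> v\<bar>) * C"
    have lt: "\<bar>z t - z s\<bar> \<le> K * \<bar>t - s\<bar> powr (1 - \<beta>)" if st: "s < t" for s t
    proof -
      have "\<bar>z t - z s\<bar> \<le> (LINT c|\<nu>. \<bar>D s t c * z (lag c)\<bar>)" unfolding eq[OF st] by (rule integral_abs_bound)
      also have "\<dots> \<le> (LINT c|\<nu>. \<bar>D s t c\<bar> * C)"
      proof (rule integral_mono')
        show "integrable \<nu> (\<lambda>c. \<bar>D s t c\<bar> * C)" using D_integrable[OF st] by simp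
        show "\<bar>D s t c * z (lag c)\<bar> \<le> \<bar>D s t c\<bar> * C" for c using C by (simp add: abs_mult mult_left_mono)
        show "0 \<le> \<bar>D s t c\<bar> * C" for c using C[of 0] by (intro mult_nonneg_nonneg) linarith+
      qed
      also have "\<dots> = K * \<bar>t - s\<bar> powr (1 - \<beta>)" using st by (simp add: D_norm K_def)
      finally show ?thesis .
    qed
    have "\<bar>z t - z s\<bar> \<le> K * \<bar>t - s\<bar> powr (1 - \<beta>)" for s t
      using lt[of s t] lt[of t s] by (cases s t rule: linorder_cases) (auto simp: abs_minus_commute)
    then show ?thesis by (rule that)
  qed
  have cont: "(\<lambda>n. z (x - \<delta> n)) \<longlonglongrightarrow> z x" if \<delta>: "\<delta> \<longlonglongrightarrow> 0" for \<delta> x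
  proof -
    have "(\<lambda>n. K * \<bar>\<delta> n\<bar> powr (1 - \<beta>)) \<longlonglongrightarrow> K * \<bar>0\<bar> powr (1 - \<beta>)"
      using \<beta> by (intro tendsto_intros tendsto_powr' \<delta>) auto
    then have "(\<lambda>n. K * \<bar>\<delta> n\<bar> powr (1 - \<beta>)) \<longlonglongrightarrow> 0" by simp
    then have "(\<lambda>n. z (x - \<delta> n) - z x) \<longlonglongrightarrow> 0"
      by (rule Lim_null_comparison[rotated]) (use K[of "x - \<delta> _" x] in \<open>auto intro!: always_eventually\<close>)
    then show ?thesis by (simp add: LIM_zero_iff)
  qed
  have lim: "(\<lambda>n. LINT v|lborel. normal_density 0 (inverse (real (Suc n))) v * z (x - v)) \<longlonglongrightarrow> z x" for x
    using gaussian_smoothing_tendsto[of "\<lambda>v. z (x - v)" C] C cont[of _ x] by simp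
  have "z x = z 0" for x
  proof (rule LIMSEQ_unique[OF lim])
    show "(\<lambda>n. LINT v|lborel. normal_density 0 (inverse (real (Suc n))) v * z (x - v)) \<longlonglongrightarrow> z 0"
      using lim[of 0] smoothed[of "inverse (real (Suc _))" x] by (simp del: of_nat_Suc)
  qed
  then show ?thesis by metis
qed

end

section \<open>Uniqueness\<close>

lemma square_integrable_tail:
  fixes g :: "real \<Rightarrow> real"
  assumes g: "square_integrable lborel g" and \<delta>: "0 < \<delta>"
  obtains K where "0 < K" "(LINT v|lborel. (indicator {K..} v * g v)\<^sup>2) \<le> \<delta>"
proof -
  have [measurable]: "g \<in> borel_measurable borel" using square_integrable_measurable[OF g] by simp
  have "(\<lambda>n. LINT v|lborel. (indicator {real n..} v * g v)\<^sup>2) \<longlonglongrightarrow> (LINT v|(lborel :: real measure). 0)"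
  proof (rule integral_dominated_convergence)
    show "integrable lborel (\<lambda>v. (g v)\<^sup>2)" using g by (simp add: square_integrable_real)
    show "AE v in lborel. (\<lambda>n. (indicator {real n..} v * g v)\<^sup>2) \<longlonglongrightarrow> 0"
    proof (rule AE_I2)
      fix v :: real
      obtain N :: nat where N: "v < real N" using reals_Archimedean2 by blast
      have "\<forall>\<^sub>F n in sequentially. (indicator {real n..} v * g v)\<^sup>2 = 0"
        using eventually_ge_at_top[of N] by eventually_elim (use N in auto)
      then show "(\<lambda>n. (indicator {real n..} v * g v)\<^sup>2) \<longlonglongrightarrow> 0" by (rule tendsto_eventually)
    qed
    show "AE v in lborel. norm ((indicator {real n..} v * g v)\<^sup>2) \<le> (g v)\<^sup>2" for n
      by (intro AE_I2) (simp add: indicator_def)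
  qed measurable
  then have "\<forall>\<^sub>F n in sequentially. (LINT v|lborel. (indicator {real n..} v * g v)\<^sup>2) < \<delta>"
    using \<delta> by (intro order_tendstoD(2)) auto
  then have "\<forall>\<^sub>F n in sequentially. (LINT v|lborel. (indicator {real n..} v * g v)\<^sup>2) < \<delta> \<and> 0 < n"
    using eventually_gt_at_top[of 0] by eventually_elim auto
  then obtain n where "(LINT v|lborel. (indicator {real n..} v * g v)\<^sup>2) < \<delta>" "0 < n"
    by (auto simp: eventually_sequentially)
  then show ?thesis by (intro that[of "real n"]) auto
qed

text \<open>One-point marginals are read off from the finite-dimensional laws with index set
  {0}.\<close>

lemma stationary_process_moments:
  fixes X :: "real \<Rightarrow> 'w \<Rightarrow> real"
  assumes X: "stationary_process M X"
  shows "square_integrable M (X t) \<longleftrightarrow> square_integrable M (X 0)"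
    and "(LINT \<omega>|M. (X t \<omega>)\<^sup>2) = (LINT \<omega>|M. (X 0 \<omega>)\<^sup>2)"
proof -
  have [measurable]: "X t \<in> borel_measurable M" for t using X by (simp add: stationary_process_def)
  have marg: "distr M borel (X r) = distr (distr M (\<Pi>\<^sub>M s\<in>{0}. borel) (\<lambda>\<omega>. \<lambda>s\<in>{0}. X (s + r) \<omega>)) borel (\<lambda>x. x 0)" for r
    by (subst distr_distr) (auto simp: o_def)
  have "distr M (\<Pi>\<^sub>M s\<in>{0}. borel) (\<lambda>\<omega>. \<lambda>s\<in>{0}. X (s + t) \<omega>) = distr M (\<Pi>\<^sub>M s\<in>{0}. borel) (\<lambda>\<omega>. \<lambda>s\<in>{0}. X (s + 0) \<omega>)"
    using X by (simp add: stationary_process_def)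
  then have "distr M borel (X t) = distr M borel (X 0)" unfolding marg by simp
  from distr_eq_moments[OF _ _ this]
  show "square_integrable M (X t) \<longleftrightarrow> square_integrable M (X 0)"
    and "(LINT \<omega>|M. (X t \<omega>)\<^sup>2) = (LINT \<omega>|M. (X 0 \<omega>)\<^sup>2)" by auto
qed

section \<open>Decay of covariances, and uniqueness\<close>

context sfdde
begin

text \<open>By causality only u <= s contributes to the covariance, and there the argument t - u of
  the first factor is at least \<open>K\<close>; Cauchy-Schwarz then produces the tail of
  \<open>g\<close>.\<close>

lemma moving_average_covariance_bound:
  assumes X: "\<And>t. has_levy_integral M L (\<lambda>u. g (t - u)) (X t)" and st: "s + K \<le> t"
  shows "\<bar>LINT \<omega>|M. X t \<omega> * X s \<omega>\<bar>
    \<le> sqrt (LINT v|lborel. (indicator {K..} v * g v)\<^sup>2) * sqrt (LINT v|lborel. (g v)\<^sup>2)"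
proof -
  have gs: "square_integrable lborel (\<lambda>u. g (t - u))" for t by (rule square_integrable_reflect[OF g_sq])
  have gsi: "square_integrable lborel (\<lambda>u. indicator {..s} u * g (t - u))"
    by (rule square_integrable_bound[OF gs]) (auto simp: indicator_def)
  have "(LINT \<omega>|M. X t \<omega> * X s \<omega>) = (LINT u|lborel. g (t - u) * g (s - u))" by (rule has_levy_integral_inner[OF X X])
  also have "\<dots> = (LINT u|lborel. (indicator {..s} u * g (t - u)) * g (s - u))"
    by (rule Bochner_Integration.integral_cong[OF refl]) (auto simp: indicator_def g_causal)
  finally have "\<bar>LINT \<omega>|M. X t \<omega> * X s \<omega>\<bar>
      \<le> sqrt (LINT u|lborel. (indicator {..s} u * g (t - u))\<^sup>2) * sqrt (LINT u|lborel. (g (s - u))\<^sup>2)"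
    using Cauchy_Schwarz_abs[OF gsi gs] by simp
  also have "(LINT u|lborel. (g (s - u))\<^sup>2) = (LINT v|lborel. (g v)\<^sup>2)"
    by (rule lborel_integral_reflect[where f = "\<lambda>v. (g v)\<^sup>2"])
  also have "(LINT u|lborel. (indicator {..s} u * g (t - u))\<^sup>2) = (LINT v|lborel. (indicator {t - s..} v * g v)\<^sup>2)"
  proof -
    have "indicator {..s} u = (indicator {t - s..} (t - u) :: real)" for u by (simp add: indicator_def)
    then show ?thesis by (simp only: lborel_integral_reflect[where f = "\<lambda>v. (indicator {t - s..} v * g v)\<^sup>2"])
  qed
  also have "sqrt (LINT v|lborel. (indicator {t - s..} v * g v)\<^sup>2) * sqrt (LINT v|lborel. (g v)\<^sup>2)
      \<le> sqrt (LINT v|lborel. (indicator {K..} v * g v)\<^sup>2) * sqrt (LINT v|lborel. (g v)\<^sup>2)"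
  proof (intro mult_right_mono real_sqrt_le_mono integral_mono')
    have "square_integrable lborel (\<lambda>v. indicator {K..} v * g v)"
      by (rule square_integrable_bound[OF g_sq]) (auto simp: indicator_def)
    then show "integrable lborel (\<lambda>v. (indicator {K..} v * g v)\<^sup>2)" by (simp add: square_integrable_real)
  qed (use st in \<open>auto simp: indicator_def intro!: Bochner_Integration.integral_nonneg\<close>)
  finally show ?thesis .
qed

text \<open>A mean ergodic estimate with a spacing chosen after n: it is so wide that every
  off-diagonal covariance is at most 1/n. The diagonal contributes n B and the remaining terms at
  most n, against the normalisation n^2.\<close>

lemma moving_average_mean_ergodic:
  assumes X: "\<And>t. has_levy_integral M L (\<lambda>u. g (t - u)) (X t)" and n: "0 < n"
  obtains K where "0 < K"
    "(LINT \<omega>|M. (\<Sum>i<n. X (T - real i * K) \<omega> / real n)\<^sup>2) \<le> ((LINT v|lborel. (g v)\<^sup>2) + 1) / real n"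
proof -
  define B where "B = (LINT v|lborel. (g v)\<^sup>2)"
  have B: "0 \<le> B" by (simp add: B_def)
  have Xsq: "square_integrable M (X t)" for t using has_levy_integral_sq[OF X] by simp
  have XX: "integrable M (\<lambda>\<omega>. X t \<omega> * X s \<omega>)" for t s by (rule square_integrable_mult[OF Xsq Xsq])
  have XB: "(LINT \<omega>|M. X t \<omega> * X t \<omega>) = B" for t
    unfolding has_levy_integral_inner[OF X X] B_def
    using lborel_integral_reflect[of "\<lambda>v. (g v)\<^sup>2" t] by (simp add: power2_eq_square)
  \<comment> \<open>Chosen so that sqrt \<delta> times sqrt (B + 1) is 1/n; \<open>B + 1\<close> in
    place of \<open>B\<close> avoids division by 0.\<close>
  define \<delta> where "\<delta> = inverse ((B + 1) * (real n)\<^sup>2)"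
  have \<delta>: "0 < \<delta>" using B n by (simp add: \<delta>_def)
  obtain K where K: "0 < K" "(LINT v|lborel. (indicator {K..} v * g v)\<^sup>2) \<le> \<delta>"
    by (rule square_integrable_tail[OF g_sq \<delta>])
  define \<tau> where "\<tau> i = T - real i * K" for i
  have off: "\<bar>LINT \<omega>|M. X (\<tau> i) \<omega> * X (\<tau> j) \<omega>\<bar> \<le> 1 / real n" if "i < j" for i j
  proof -
    have "real i + 1 \<le> real j" using that by linarith
    then have "(real i + 1) * K \<le> real j * K" using K(1) by (intro mult_right_mono) auto
    then have "\<tau> j + K \<le> \<tau> i" by (simp add: \<tau>_def algebra_simps)
    from moving_average_covariance_bound[OF X this]
    have "\<bar>LINT \<omega>|M. X (\<tau> i) \<omega> * X (\<tau> j) \<omega>\<bar> \<le> sqrt (LINT v|lborel. (indicator {K..} v * g v)\<^sup>2) * sqrt B"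
      by (simp add: B_def)
    also have "\<dots> \<le> sqrt \<delta> * sqrt (B + 1)" using K(2) B \<delta> by (intro mult_mono real_sqrt_le_mono) auto
    also have "\<dots> = sqrt (1 / (real n)\<^sup>2)"
    proof -
      have "B + 1 \<noteq> 0" using B by linarith
      then have "\<delta> * (B + 1) = 1 / (real n)\<^sup>2" by (simp only: \<delta>_def inverse_mult_distrib divide_inverse) simp
      then show ?thesis by (simp only: real_sqrt_mult[symmetric])
    qed
    also have "\<dots> = 1 / real n" by (simp add: real_sqrt_divide)
    finally show ?thesis .
  qed
  have cov: "(LINT \<omega>|M. X (\<tau> i) \<omega> * X (\<tau> j) \<omega>) \<le> (if i = j then B else 0) + 1 / real n" for i j
    using off[of i j] off[of j i] XB[of "\<tau> i"] by (cases i j rule: linorder_cases) (auto simp: mult.commute)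
  have "(LINT \<omega>|M. (\<Sum>i<n. X (\<tau> i) \<omega> / real n)\<^sup>2) = (LINT \<omega>|M. (\<Sum>i<n. \<Sum>j<n. X (\<tau> i) \<omega> * X (\<tau> j) \<omega>) / (real n)\<^sup>2)"
    by (rule Bochner_Integration.integral_cong[OF refl])
       (simp add: power2_eq_square sum_divide_distrib[symmetric] sum_product)
  also have "\<dots> = (\<Sum>i<n. \<Sum>j<n. LINT \<omega>|M. X (\<tau> i) \<omega> * X (\<tau> j) \<omega>) / (real n)\<^sup>2"
    using XX by simp
  also have "\<dots> \<le> (\<Sum>i<n. \<Sum>j<n. (if i = j then B else 0) + 1 / real n) / (real n)\<^sup>2"
    by (intro divide_right_mono sum_mono cov) simp
  also have "(\<Sum>i<n. \<Sum>j<n. (if i = j then B else 0) + 1 / real n) = real n * (B + 1)"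
    using n by (simp add: sum.distrib distrib_left)
  also have "real n * (B + 1) / (real n)\<^sup>2 = (B + 1) / real n" by (simp add: power2_eq_square)
  finally show ?thesis using that[OF K(1)] by (simp add: \<tau>_def B_def)
qed

lemma solution_equation:
  assumes X: "sfdde_solution M L \<beta> \<eta> X" and sq: "\<And>t. square_integrable M (X t)"
    and C: "\<And>t. (LINT \<omega>|M. (X t \<omega>)\<^sup>2) \<le> C" and st: "s < t"
  shows "AE \<omega> in M. X t \<omega> - X s \<omega> = (LINT c|\<nu>. D s t c * X (lag c) \<omega>) + L t \<omega> - L s \<omega>"
proof -
  have Xm: "measurable_process M X" using X by (simp add: sfdde_solution_def)
  have "AE \<omega> in M. X t \<omega> - X s \<omega> =
          (LINT u:{..t}|lborel.
             frac_deriv_indicator \<beta> s t u * signed_integral halfline \<eta> (\<lambda>v. X (u - v) \<omega>)) +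
          L t \<omega> - L s \<omega>"
    using X st unfolding sfdde_solution_def by (blast intro: AE_mp)
  with process_integral[OF sigma_finite_measure_axioms st Xm sq C] show ?thesis by eventually_elim simp
qed

text \<open>For a fixed increment \<open>W = Z b - Z a\<close> of \<open>Z = Y - X\<close>, the covariance \<open>u \<mapsto> E (W * Z u)\<close> is a bounded
  solution of the homogeneous equation, hence constant, so \<open>E (W\<^sup>2) = 0\<close>.\<close>

lemma solution_difference_constant:
  assumes X: "sfdde_solution M L \<beta> \<eta> X" "\<And>t. square_integrable M (X t)" "\<And>t. (LINT \<omega>|M. (X t \<omega>)\<^sup>2) \<le> A"
    and Y: "sfdde_solution M L \<beta> \<eta> Y" "\<And>t. square_integrable M (Y t)" "\<And>t. (LINT \<omega>|M. (Y t \<omega>)\<^sup>2) \<le> B"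
  shows "AE \<omega> in M. Y b \<omega> - X b \<omega> = Y a \<omega> - X a \<omega>"
proof -
  have Xm: "(\<lambda>(t, \<omega>). X t \<omega>) \<in> borel_measurable (borel \<Otimes>\<^sub>M M)" and Ym: "(\<lambda>(t, \<omega>). Y t \<omega>) \<in> borel_measurable (borel \<Otimes>\<^sub>M M)"
    using X(1) Y(1) by (simp_all add: sfdde_solution_def measurable_process_def)
  define Z where "Z t \<omega> = Y t \<omega> - X t \<omega>" for t \<omega>
  have Zm[measurable]: "(\<lambda>(t, \<omega>). Z t \<omega>) \<in> borel_measurable (borel \<Otimes>\<^sub>M M)"
    unfolding Z_def using borel_measurable_diff[OF Ym Xm] by (simp add: split_beta)
  have Zsq: "square_integrable M (Z t)" for t unfolding Z_def[abs_def] by (rule square_integrable_diff[OF Y(2) X(2)])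
  have ZC: "(LINT \<omega>|M. (Z t \<omega>)\<^sup>2) \<le> 2 * B + 2 * A" for t
    using integral_power2_diff_triangle[OF Y(2) square_integrable_zero X(2), of t t] X(3)[of t] Y(3)[of t]
    by (simp add: Z_def)
  define W where "W \<omega> = Z b \<omega> - Z a \<omega>" for \<omega>
  have Wsq: "square_integrable M W" unfolding W_def[abs_def] by (rule square_integrable_diff[OF Zsq Zsq])
  have [measurable]: "W \<in> borel_measurable M" using Wsq by measurable
  define z where "z u = (LINT \<omega>|M. W \<omega> * Z u \<omega>)" for u
  have zm: "z \<in> borel_measurable borel" unfolding z_def[abs_def] by measurable
  have zC: "\<bar>z u\<bar> \<le> sqrt (LINT \<omega>|M. (W \<omega>)\<^sup>2) * sqrt (2 * B + 2 * A)" for u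
  proof -
    have "\<bar>z u\<bar> \<le> sqrt (LINT \<omega>|M. (W \<omega>)\<^sup>2) * sqrt (LINT \<omega>|M. (Z u \<omega>)\<^sup>2)"
      unfolding z_def by (rule Cauchy_Schwarz_abs[OF Wsq Zsq])
    also have "\<dots> \<le> sqrt (LINT \<omega>|M. (W \<omega>)\<^sup>2) * sqrt (2 * B + 2 * A)"
      using ZC by (intro mult_left_mono real_sqrt_le_mono) auto
    finally show ?thesis .
  qed
  have WZ: "integrable M (\<lambda>\<omega>. W \<omega> * Z u \<omega>)" for u by (rule square_integrable_mult[OF Wsq Zsq])
  have zeq: "z t - z s = (LINT c|\<nu>. D s t c * z (lag c))" if st: "s < t" for s t
  proof -
    note ws = weighted_superposition[OF sigma_finite_measure_axioms sigma_finite_\<nu> D_integrable[OF st] lag_measurable]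
    have [measurable]: "Z u \<in> borel_measurable M" for u using Zsq[of u] by measurable
    have [measurable]: "(\<lambda>\<omega>. LINT c|\<nu>. D s t c * Z (lag c) \<omega>) \<in> borel_measurable M"
      using ws(2)[OF Zm Zsq ZC] by measurable
    have "AE \<omega> in M. Z t \<omega> - Z s \<omega> = (LINT c|\<nu>. D s t c * Z (lag c) \<omega>)"
      using solution_equation[OF X st] solution_equation[OF Y st] ws(1)[OF Xm X(2,3)] ws(1)[OF Ym Y(2,3)]
    proof eventually_elim
      case (elim \<omega>)
      then have "(LINT c|\<nu>. D s t c * Z (lag c) \<omega>) = (LINT c|\<nu>. D s t c * Y (lag c) \<omega>) - (LINT c|\<nu>. D s t c * X (lag c) \<omega>)"
        by (simp add: Z_def right_diff_distrib)
      with elim show ?case by (simp add: Z_def)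
    qed
    then have ae: "AE \<omega> in M. W \<omega> * (Z t \<omega> - Z s \<omega>) = W \<omega> * (LINT c|\<nu>. D s t c * Z (lag c) \<omega>)"
      by eventually_elim simp
    have "z t - z s = (LINT \<omega>|M. W \<omega> * (Z t \<omega> - Z s \<omega>))"
      using WZ by (simp add: z_def right_diff_distrib)
    also have "\<dots> = (LINT \<omega>|M. W \<omega> * (LINT c|\<nu>. D s t c * Z (lag c) \<omega>))"
      by (rule integral_cong_AE[OF _ _ ae]) measurable
    also have "\<dots> = (LINT c|\<nu>. D s t c * z (lag c))"
      unfolding z_def by (rule ws(3)[OF Zm Zsq ZC Wsq])
    finally show ?thesis .
  qed
  have "(LINT \<omega>|M. (W \<omega>)\<^sup>2) = (LINT \<omega>|M. W \<omega> * Z b \<omega> - W \<omega> * Z a \<omega>)"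
    by (rule Bochner_Integration.integral_cong[OF refl]) (simp add: W_def power2_eq_square algebra_simps)
  also have "\<dots> = z b - z a" using WZ by (simp add: z_def)
  also have "\<dots> = 0" using bounded_solution_constant[OF zm zC zeq, of b a] by simp
  finally have "AE \<omega> in M. W \<omega> = 0" by (rule integral_power2_eq_0_AE[OF Wsq])
  then show ?thesis by eventually_elim (simp add: W_def Z_def)
qed

text \<open>The difference \<open>\<xi>\<close> of two solutions is constant in time, and by the mean ergodic lemma it is the limit
  of averages of \<open>Y\<close> over arbitrarily remote times; so it lies in the remote past of \<open>Y\<close>.\<close>

theorem solution_unique:
  assumes Xm: "measurable_process M X" and X: "\<And>t. has_levy_integral M L (\<lambda>u. g (t - u)) (X t)"
    and Y: "sfdde_solution M L \<beta> \<eta> Y" and Y_pnd: "purely_nondeterministic M Y"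
  shows "AE \<omega> in M. Y t \<omega> = X t \<omega>"
proof -
  have Xsq: "square_integrable M (X t)" for t using has_levy_integral_sq[OF X] by simp
  have XC: "(LINT \<omega>|M. (X t \<omega>)\<^sup>2) \<le> (LINT x|lborel. (g x)\<^sup>2)" for t
    using has_levy_integral_inner[OF X X, of t t] g_past_norm[of t] by (simp add: power2_eq_square)
  have Yst: "stationary_process M Y" and Y0: "square_integrable M (Y 0)"
    and remote: "\<And>Z. (\<And>T. Z \<in> past_closed_span M Y T) \<Longrightarrow> AE \<omega> in M. Z \<omega> = 0"
    using Y_pnd by (auto simp: purely_nondeterministic_def)
  have Ysq: "square_integrable M (Y t)" for t using stationary_process_moments(1)[OF Yst, of t] Y0 by blast
  have YC: "(LINT \<omega>|M. (Y t \<omega>)\<^sup>2) \<le> (LINT \<omega>|M. (Y 0 \<omega>)\<^sup>2)" for t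
    using stationary_process_moments(2)[OF Yst, of t] by linarith
  define \<xi> where "\<xi> \<omega> = Y 0 \<omega> - X 0 \<omega>" for \<omega>
  have \<xi>sq: "square_integrable M \<xi>" unfolding \<xi>_def[abs_def] by (rule square_integrable_diff[OF Ysq Xsq])
  have [measurable]: "X t \<in> borel_measurable M" "Y t \<in> borel_measurable M" "\<xi> \<in> borel_measurable M" for t
    using Xsq[of t] Ysq[of t] \<xi>sq by measurable
  have YX: "AE \<omega> in M. Y t \<omega> = X t \<omega> + \<xi> \<omega>" for t
    using solution_difference_constant[OF moving_average_solution[OF Xm X] Xsq XC Y Ysq YC, of t 0]
    by eventually_elim (simp add: \<xi>_def)
  define B where "B = (LINT v|lborel. (g v)\<^sup>2) + 1"
  have "\<xi> \<in> past_closed_span M Y T" for T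
  proof -
    have "\<exists>K>0. (LINT \<omega>|M. (\<Sum>i<Suc n. X (T - real i * K) \<omega> / real (Suc n))\<^sup>2) \<le> B / real (Suc n)" for n
      using moving_average_mean_ergodic[OF X, of "Suc n" T] unfolding B_def by blast
    then obtain K where K: "\<And>n. 0 < K n"
      "\<And>n. (LINT \<omega>|M. (\<Sum>i<Suc n. X (T - real i * K n) \<omega> / real (Suc n))\<^sup>2) \<le> B / real (Suc n)" by metis
    define J where "J n = (\<lambda>i. T - real i * K n) ` {..<Suc n}" for n
    \<comment> \<open>\<open>past_closed_span\<close> sums over sets of times, so the sampling times
      must be distinct; the positive spacing ensures it.\<close>
    have inj: "inj_on (\<lambda>i. T - real i * K n) {..<Suc n}" for n
      using K(1)[of n] by (auto simp: inj_on_def)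
    have sumJ: "(\<Sum>s\<in>J n. 1 / real (Suc n) * Y s \<omega>) = (\<Sum>i<Suc n. Y (T - real i * K n) \<omega> / real (Suc n))" for n \<omega>
      unfolding J_def sum.reindex[OF inj] by (simp del: of_nat_Suc)
    have JT: "finite (J n)" "J n \<subseteq> {..T}" for n
      using K(1)[of n] by (auto simp: J_def intro!: mult_nonneg_nonneg)
    have err: "(LINT \<omega>|M. ((\<Sum>s\<in>J n. 1 / real (Suc n) * Y s \<omega>) - \<xi> \<omega>)\<^sup>2) \<le> B / real (Suc n)" for n
    proof -
      have "AE \<omega> in M. \<forall>i. Y (T - real i * K n) \<omega> = X (T - real i * K n) \<omega> + \<xi> \<omega>"
        unfolding AE_all_countable using YX by blast
      then have ae: "AE \<omega> in M. ((\<Sum>s\<in>J n. 1 / real (Suc n) * Y s \<omega>) - \<xi> \<omega>)\<^sup>2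
          = (\<Sum>i<Suc n. X (T - real i * K n) \<omega> / real (Suc n))\<^sup>2"
      proof eventually_elim
        case (elim \<omega>)
        have "(\<Sum>s\<in>J n. 1 / real (Suc n) * Y s \<omega>) = (\<Sum>i<Suc n. X (T - real i * K n) \<omega> / real (Suc n)) + (\<Sum>i<Suc n. \<xi> \<omega> / real (Suc n))"
          unfolding sumJ sum.distrib[symmetric] using elim by (simp only: add_divide_distrib)
        also have "(\<Sum>i<Suc n. \<xi> \<omega> / real (Suc n)) = \<xi> \<omega>" by (simp only: sum_constant card_lessThan) simp
        finally show ?case by simp
      qed
      have "(LINT \<omega>|M. ((\<Sum>s\<in>J n. 1 / real (Suc n) * Y s \<omega>) - \<xi> \<omega>)\<^sup>2)
          = (LINT \<omega>|M. (\<Sum>i<Suc n. X (T - real i * K n) \<omega> / real (Suc n))\<^sup>2)"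
        by (rule integral_cong_AE[OF _ _ ae]) measurable
      with K(2)[of n] show ?thesis by simp
    qed
    have lim: "(\<lambda>n. B / real (Suc n)) \<longlonglongrightarrow> 0" by real_asymp
    have "L2_tendsto M (\<lambda>n \<omega>. \<Sum>s\<in>J n. 1 / real (Suc n) * Y s \<omega>) \<xi>"
      unfolding L2_tendsto_real
    proof (intro conjI allI \<xi>sq square_integrable_sum square_integrable_cmult Ysq)
      show "(\<lambda>n. LINT \<omega>|M. ((\<Sum>s\<in>J n. 1 / real (Suc n) * Y s \<omega>) - \<xi> \<omega>)\<^sup>2) \<longlonglongrightarrow> 0"
        by (rule tendsto_sandwich[OF _ _ tendsto_const lim]) (use err in \<open>auto simp del: of_nat_Suc\<close>)
    qed
    then show ?thesis
      unfolding past_closed_span_def using JT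
      by (intro CollectI exI[of _ J] exI[of _ "\<lambda>n s. 1 / real (Suc n)"]) blast
  qed
  from remote[OF this] YX[of t] show ?thesis by eventually_elim simp
qed

end

text \<open>The integral fixes \<open>X t\<close> only up to a null set for each t, while the
  equation integrates along paths. Hence the last clause speaks of every jointly measurable version,
  and a separate clause provides one.\<close>

theorem theorem3p2:
  fixes M :: "'w measure"
    and L :: "real \<Rightarrow> 'w \<Rightarrow> real"
    and \<beta> :: real
    and \<eta> :: "real set \<Rightarrow> real"
    and g :: "real \<Rightarrow> real"
  assumes "prob_space M"
    and "0 < \<beta>" and "\<beta> < 1 / 2"
    and "two_sided_levy_process M L"
    and "integrable M (L 1)" and "(LINT \<omega>|M. L 1 \<omega>) = 0"
    and "integrable M (\<lambda>\<omega>. (L 1 \<omega>)\<^sup>2)" and "(LINT \<omega>|M. (L 1 \<omega>)\<^sup>2) = 1"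
    and "finite_signed_measure halfline \<eta>"
    and "(\<integral>\<^sup>+ u. ennreal u \<partial>(total_variation halfline \<eta>)) < \<infinity>"
    and "\<And>z :: complex. Re z \<le> 0 \<Longrightarrow> sfdde_h \<beta> \<eta> z \<noteq> 0"
    and "square_integrable lborel g"
    and "\<And>u. u < 0 \<Longrightarrow> g u = 0"
    and "has_fourier_L2 (\<lambda>u. complex_of_real (g u))
           (\<lambda>y. (- \<i> * complex_of_real y) powr complex_of_real (- \<beta>) /
                 sfdde_h \<beta> \<eta> (\<i> * complex_of_real y))"
  shows
    "(\<forall>t. \<exists>Y. has_levy_integral M L (\<lambda>u. indicator {..t} u * g (t - u)) Y) \<and>
     (\<forall>t Y Y'. has_levy_integral M L (\<lambda>u. indicator {..t} u * g (t - u)) Y \<longrightarrow>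
        has_levy_integral M L (\<lambda>u. indicator {..t} u * g (t - u)) Y' \<longrightarrow>
        (AE \<omega> in M. Y \<omega> = Y' \<omega>)) \<and>
     (\<exists>X. measurable_process M X \<and>
        (\<forall>t. has_levy_integral M L (\<lambda>u. indicator {..t} u * g (t - u)) (X t))) \<and>
     (\<forall>X. measurable_process M X \<longrightarrow>
        (\<forall>t. has_levy_integral M L (\<lambda>u. indicator {..t} u * g (t - u)) (X t)) \<longrightarrow>
        (\<forall>t. square_integrable M (X t) \<and> (LINT \<omega>|M. X t \<omega>) = 0) \<and>
        sfdde_solution M L \<beta> \<eta> X \<and> purely_nondeterministic M X \<and>
        (\<forall>Y. sfdde_solution M L \<beta> \<eta> Y \<longrightarrow> purely_nondeterministic M Y \<longrightarrow>
           (\<forall>t. AE \<omega> in M. Y t \<omega> = X t \<omega>)))"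
proof -
  define Q where "Q = total_variation halfline \<eta>"
  obtain \<sigma> where "\<sigma> \<in> borel_measurable halfline" and dens: "\<And>f :: real \<Rightarrow> real. integrable Q f \<Longrightarrow>
       integrable Q (\<lambda>x. \<sigma> x * f x) \<and> signed_integral halfline \<eta> f = (LINT x|Q. \<sigma> x * f x)"
    "\<And>f :: real \<Rightarrow> complex. integrable Q f \<Longrightarrow>
       integrable Q (\<lambda>x. of_real (\<sigma> x) * f x) \<and> signed_integral halfline \<eta> f = (LINT x|Q. of_real (\<sigma> x) * f x)"
    by (rule signed_integral_density[OF assms(9), folded Q_def]) blast
  have Q: "finite_measure Q" unfolding Q_def by (rule finite_measure_total_variation[OF assms(9)])
  have Qsets: "sets Q = sets halfline" by (simp add: Q_def)
  have Qspace: "space Q = {0..}" using sets_eq_imp_space_eq[OF Qsets] by (simp add: space_restrict_space)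
  interpret Q: finite_measure Q by (rule Q)
  have id: "(\<lambda>v. v) \<in> borel_measurable Q"
  proof -
    have "(\<lambda>v. v) \<in> borel_measurable halfline" by (rule measurable_restrict_space1) simp
    then show ?thesis by (simp cong: measurable_cong_sets add: Qsets)
  qed
  have "integrable Q (\<lambda>v. v)"
  proof (rule integrableI_bounded[OF id])
    have "(\<integral>\<^sup>+v. ennreal (norm v) \<partial>Q) = (\<integral>\<^sup>+v. ennreal v \<partial>Q)" by (rule nn_integral_cong) (simp add: Qspace)
    then show "(\<integral>\<^sup>+v. ennreal (norm v) \<partial>Q) < \<infinity>" using assms(10) by (simp add: Q_def)
  qed
  then have \<sigma>_moment: "integrable Q (\<lambda>v. v * \<sigma> v)" using dens(1)[of "\<lambda>v. v"] by (simp add: mult.commute)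
  have \<sigma>_int: "integrable Q \<sigma>" using dens(1)[of "\<lambda>_. 1"] by simp
  interpret signed_delay \<beta> Q \<sigma> \<eta>
    by unfold_locales (use assms(2,3,9) Q Qsets \<sigma>_int \<sigma>_moment dens(1) Q_def in auto)
  \<comment> \<open>Exponentials on the imaginary axis are bounded, hence integrable for the finite
    measure \<open>Q\<close>, so the complex form of the density rewrites the integral in
    \<open>sfdde_h\<close>.\<close>
  have h: "h y = sfdde_h \<beta> \<eta> (\<i> * complex_of_real y)" for y
  proof -
    have "integrable Q (\<lambda>v. iexp (y * v))"
      by (rule Q.integrable_const_bound[where B = 1]) (use id in auto)
    from dens(2)[OF this] show ?thesis by (simp add: h_def sfdde_h_def eta_hat_def mult.assoc)
  qed
  interpret delay_kernel \<beta> Q \<sigma> g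
    by unfold_locales (use assms(11-14) in \<open>auto simp: h\<close>)
  interpret standard_two_sided_levy M L
    using assms(1,4-8) by (auto simp: standard_two_sided_levy_def standard_two_sided_levy_axioms_def square_integrable_real)
  interpret sfdde M L \<beta> Q \<sigma> \<eta> g ..
  \<comment> \<open>As \<open>g\<close> vanishes on the negative half-line, the truncation at t is
    already built into g (t - u).\<close>
  have causal: "(\<lambda>u. indicator {..t} u * g (t - u)) = (\<lambda>u. g (t - u))" for t
  proof (rule ext)
    show "indicator {..t} u * g (t - u) = g (t - u)" for u by (cases "u \<le> t") (simp_all add: g_causal)
  qed
  show ?thesis
    unfolding causal
  proof (intro conjI allI impI)
    show "\<exists>Y. has_levy_integral M L (\<lambda>u. g (t - u)) Y" for t
      using has_levy_integral_exists[OF square_integrable_reflect[OF g_sq]] by blast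
    show "AE \<omega> in M. Y \<omega> = Y' \<omega>"
      if "has_levy_integral M L (\<lambda>u. g (t - u)) Y" "has_levy_integral M L (\<lambda>u. g (t - u)) Y'" for t Y Y'
      by (rule has_levy_integral_unique[OF that])
    show "\<exists>X. measurable_process M X \<and> (\<forall>t. has_levy_integral M L (\<lambda>u. g (t - u)) (X t))"
      using moving_average_measurable_version[OF g_sq] by blast
    fix X assume Xm: "measurable_process M X" and "\<forall>t. has_levy_integral M L (\<lambda>u. g (t - u)) (X t)"
    then have X: "has_levy_integral M L (\<lambda>u. g (t - u)) (X t)" for t by blast
    show "square_integrable M (X t)" "(LINT \<omega>|M. X t \<omega>) = 0" for t
      using has_levy_integral_sq[OF X[of t]] has_levy_integral_mean[OF X[of t]] by auto
    show "sfdde_solution M L \<beta> \<eta> X" by (rule moving_average_solution[OF Xm X])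
    show "purely_nondeterministic M X" by (rule moving_average_purely_nondeterministic[OF X g_causal])
    show "AE \<omega> in M. Y t \<omega> = X t \<omega>"
      if "sfdde_solution M L \<beta> \<eta> Y" "purely_nondeterministic M Y" for Y t
      by (rule solution_unique[OF Xm X that])
  qed
qed

end
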